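(* Let $(u_0,u_1,r)$ be the unique solution of the two-scale limit problem (L) (see context). Then $(u_0,r)$ is the unique solution in $L^2(S;H^1(\Omega))\times W^{1,\infty}(S;L^2(\Omega))$, with $\partial_t((1-V_N(r))u_0)\in L^2(S;H^1(\Omega)')$, of $$\int_S\langle\partial_t\big((1-V_N(r))u_0\big)(t),\varphi(t)\rangle_\Omega\,dt+(D\,A_{\mathrm{hom}}(r)\nabla_xu_0,\nabla_x\varphi)_{S\times\Omega}=\big((1-V_N(r))f^{\mathrm p}-\partial_tV_N(r)\,c_s,\varphi\big)_{S\times\Omega},$$ $$\int_S\int_\Omega\partial_tr(t,x)\phi(t,x)\,dx\,dt=\int_S\int_\Omega\tfrac1{c_s}f(u_0(t,x),r(t,x))\phi(t,x)\,dx\,dt$$ for every $(\varphi,\phi)\in L^2(S;H^1(\Omega))\times L^2(S\times\Omega)$, with initial values $r(0)=r^{(0)}$ and $((1-V_N(r))u_0)(0)=(1-V_N(r^{(0)}))u^{(0)}$. Here, for $\rho\in[r_{\min},r_{\max}]$ and $i,j\in\{1,\dots,N\}$, $$(A_{\mathrm{hom}})_{ij}(\rho)=\int_{Y^*_\rho}\big(\delta_{ij}+\partial_{y_i}w_j(\rho;y)\big)\,dy,$$ and $w_j(\rho;\cdot)$ is the unique element of $H^1_\#(Y^*_\rho)/\mathbb R$ such that $$\int_{Y^*_\rho}(\nabla_yw_j(\rho;y)+e_j)\cdot\nabla_y\varphi(y)\,dy=0\quad\text{for every }\varphi\in H^1_\#(Y^*_\rho).$$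
   Context: Geometry. $N\ge2$, $Y=(0,1)^N$, $x_M=(1/2,\dots,1/2)$, $S=(0,T)$ with $0<T<\infty$. $\varepsilon$ runs through a fixed sequence in $(0,1]$ converging to $0$. $\Omega\subset\mathbb R^N$ is a bounded open set such that for every $\varepsilon$ of the sequence, with $I_\varepsilon=\{k\in\mathbb Z^N:(\varepsilon k+\varepsilon Y)\cap\Omega\ne\emptyset\}$, $\Omega=\operatorname{int}\bigcup_{k\in I_\varepsilon}(\varepsilon k+\varepsilon\overline Y)$. Fix $0<r_{\min}<r_{\max}<1/2$. $Y^*_r=Y\setminus\overline{B_r(x_M)}$. $V_N(r)$ is the volume of the $N$-ball of radius $r$. $(\cdot,\cdot)_U$ is the $L^2(U)$ scalar product, $\langle\cdot,\cdot\rangle_\Omega$ the pairing of $H^1(\Omega)'$ and $H^1(\Omega)$, $e_j$ the $j$-th unit vector, $\delta_{ij}$ the Kronecker symbol. $H^1_\#(Y^*_r)$ is the space of $H^1(Y^*_r)$ functions with equal traces on opposite faces of $Y$ ($Y$-periodic). $L^2(S\times\Omega;H^1_\#(Y^*_{r(t,x)}))$ is the space of measurable $v$ on $\{(t,x,y):y\in Y^*_{r(t,x)}\}$ with $v(t,x,\cdot)\in H^1_\#(Y^*_{r(t,x)})$ a.e. and $\int_S\int_\Omega\|v(t,x,\cdot)\|^2_{H^1(Y^*_{r(t,x)})}dx\,dt<\infty$; $L^2(S;L^2(\Omega;H^1_\#(Y^*_{r(t,x)})/\mathbb R))$ is defined analogously, modulo functions constant in $y$. The radius function $r$ takes values in $[r_{\min},r_{\max}]$.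 Data. $c_s>0$ and $D>0$ are constants. $f:\mathbb R\times\mathbb R\to\mathbb R$ satisfies $f(\cdot,r)\ge0$ for $r\le r_{\min}$, $f(\cdot,r)\le0$ for $r\ge r_{\max}$, $|f(u_2,r_2)-f(u_1,r_1)|\le C(|u_2-u_1|+|r_2-r_1|)$ for some $C$, and $|f|\le C_f$. $f^{\mathrm p}:S\times\Omega\to\mathbb R$ is Lipschitz continuous on every $\varepsilon$-scaled cell, i.e. on $S\times\varepsilon(k+Y)$ for every $k\in I_\varepsilon$ and every $\varepsilon$ of the sequence. $u^{(0)}\in L^2(\Omega)$ and $r^{(0)}\in L^2(\Omega)$ with $r^{(0)}\in[r_{\min},r_{\max}]$ a.e. (in the paper these are limits of microscopic initial data). Problem (L): find $(u_0,u_1,r)\in L^2(S;H^1(\Omega))\times L^2(S;L^2(\Omega;H^1_\#(Y^*_{r(t,x)})/\mathbb R))\times W^{1,\infty}(S;L^2(\Omega))$ with $\partial_t((1-V_N(r))u_0)\in L^2(S;H^1(\Omega)')$ such that $$\int_S\langle\partial_t\big((1-V_N(r))u_0\big)(t),\varphi(t)\rangle_\Omega\,dt+\int_S\int_\Omega\int_{Y^*_{r(t,x)}}D(\nabla_xu_0+\nabla_yu_1)\cdot(\nabla_x\varphi+\nabla_y\varphi_1)\,dy\,dx\,dt=\int_S\int_\Omega\big[(1-V_N(r))f^{\mathrm p}-\partial_tV_N(r)\,c_s\big]\varphi\,dx\,dt,$$ $$\int_S\int_\Omega\partial_tr\,\phi\,dx\,dt=\int_S\int_\Omega\tfrac1{c_s}f(u_0,r)\phi\,dx\,dt$$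 for every $(\varphi,\varphi_1,\phi)\in L^2(S;H^1(\Omega))\times L^2(S\times\Omega;H^1_\#(Y^*_{r(t,x)}))\times L^2(S\times\Omega)$, with initial values $r(0)=r^{(0)}$ and $((1-V_N(r))u_0)(0)=(1-V_N(r^{(0)}))u^{(0)}$. This problem has a unique solution. *)

theory Defs
  imports "HOL-Analysis.Analysis"
begin

section \<open>Lebesgue and Sobolev spaces\<close>

text \<open>
  Elements of Lebesgue and Sobolev spaces are represented by Lebesgue measurable functions;
  equality in these spaces is equality almost everywhere and is always written out.
\<close>

definition L2 :: "'a::euclidean_space set \<Rightarrow> ('a \<Rightarrow> 'b::euclidean_space) set" where
  "L2 A = {f. f \<in> borel_measurable (lebesgue_on A) \<and>
              integrable (lebesgue_on A) (\<lambda>x. (norm (f x))\<^sup>2)}"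

definition L2_norm :: "'a::euclidean_space set \<Rightarrow> ('a \<Rightarrow> 'b::euclidean_space) \<Rightarrow> real" where
  "L2_norm A f = sqrt (LINT x|lebesgue_on A. (norm (f x))\<^sup>2)"

definition L2_inner ::
    "'a::euclidean_space set \<Rightarrow> ('a \<Rightarrow> 'b::euclidean_space) \<Rightarrow> ('a \<Rightarrow> 'b) \<Rightarrow> real" where
  "L2_inner A f g = (LINT x|lebesgue_on A. f x \<bullet> g x)"

primrec C_k :: "nat \<Rightarrow> ('a::euclidean_space \<Rightarrow> real) \<Rightarrow> bool" where
  "C_k 0 f \<longleftrightarrow> continuous_on UNIV f"
| "C_k (Suc k) f \<longleftrightarrow> (\<exists>G. (\<forall>x. GDERIV f x :> G x) \<and> (\<forall>b\<in>Basis. C_k k (\<lambda>x. G x \<bullet> b)))"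

definition smooth :: "('a::euclidean_space \<Rightarrow> real) \<Rightarrow> bool" where
  "smooth f \<longleftrightarrow> (\<forall>k. C_k k f)"

definition test_function :: "'a::euclidean_space set \<Rightarrow> ('a \<Rightarrow> real) \<Rightarrow> bool" where
  "test_function U \<psi> \<longleftrightarrow> smooth \<psi> \<and> compact (closure {x. \<psi> x \<noteq> 0}) \<and> closure {x. \<psi> x \<noteq> 0} \<subseteq> U"

definition has_weak_gradient ::
    "'a::euclidean_space set \<Rightarrow> ('a \<Rightarrow> real) \<Rightarrow> ('a \<Rightarrow> 'a) \<Rightarrow> bool" where
  "has_weak_gradient U u G \<longleftrightarrow> u \<in> L2 U \<and> G \<in> L2 U \<and>
     (\<forall>\<psi> d\<psi>. test_function U \<psi> \<longrightarrow> (\<forall>x. GDERIV \<psi> x :> d\<psi> x) \<longrightarrow>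
        (LINT x|lebesgue_on U. u x *\<^sub>R d\<psi> x) = - (LINT x|lebesgue_on U. \<psi> x *\<^sub>R G x))"

definition H1 :: "'a::euclidean_space set \<Rightarrow> ('a \<Rightarrow> real) set" where
  "H1 U = {u. \<exists>G. has_weak_gradient U u G}"

text \<open>A representative of the weak gradient, which is unique up to null sets.\<close>

definition weak_gradient :: "'a::euclidean_space set \<Rightarrow> ('a \<Rightarrow> real) \<Rightarrow> 'a \<Rightarrow> 'a" where
  "weak_gradient U u = (SOME G. has_weak_gradient U u G)"

definition H1_norm :: "'a::euclidean_space set \<Rightarrow> ('a \<Rightarrow> real) \<Rightarrow> real" where
  "H1_norm U u = sqrt ((L2_norm U u)\<^sup>2 + (L2_norm U (weak_gradient U u))\<^sup>2)"

definition H1_dual :: "'a::euclidean_space set \<Rightarrow> (('a \<Rightarrow> real) \<Rightarrow> real) set" where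
  "H1_dual U = {l. (\<forall>u\<in>H1 U. \<forall>v\<in>H1 U. l (\<lambda>x. u x + v x) = l u + l v) \<and>
                   (\<forall>u\<in>H1 U. \<forall>c. l (\<lambda>x. c * u x) = c * l u) \<and>
                   (\<exists>C. \<forall>u\<in>H1 U. \<bar>l u\<bar> \<le> C * H1_norm U u)}"

definition H1_dual_norm :: "'a::euclidean_space set \<Rightarrow> (('a \<Rightarrow> real) \<Rightarrow> real) \<Rightarrow> real" where
  "H1_dual_norm U l = (SUP u\<in>{u \<in> H1 U. H1_norm U u \<le> 1}. \<bar>l u\<bar>)"


section \<open>The perforated cell\<close>

definition x_M :: "real ^ 'n" where
  "x_M = (\<chi> i. 1/2)"

definition cell_Y :: "(real ^ 'n) set" where
  "cell_Y = box 0 1"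

definition Y_star :: "real \<Rightarrow> (real ^ 'n) set" where
  "Y_star \<rho> = cell_Y - cball x_M \<rho>"

definition ball_volume :: "'n::finite itself \<Rightarrow> real \<Rightarrow> real" where
  "ball_volume _ \<rho> = measure lebesgue (ball (0 :: real ^ 'n) \<rho>)"

definition subst_coord :: "'n \<Rightarrow> real \<Rightarrow> real ^ 'n \<Rightarrow> real ^ 'n" where
  "subst_coord i a y = (\<chi> j. if j = i then a else y $ j)"

text \<open>
  The trace on the face \<open>y\<^sub>i = a\<close> (with \<open>a \<in> {0, 1}\<close>) of the unit cube is the limit
  of the restrictions of smooth functions converging in \<open>H\<^sup>1\<close>.
  Functions on a face are written as functions on the whole cube that do not depend on \<open>y\<^sub>i\<close>;
  as the edges have length one, integrating them over the cube gives the surface integral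
  over the face. In this encoding opposite faces are identified.
\<close>

definition has_face_trace ::
    "real \<Rightarrow> (real ^ 'n \<Rightarrow> real) \<Rightarrow> 'n \<Rightarrow> real \<Rightarrow> (real ^ 'n \<Rightarrow> real) \<Rightarrow> bool" where
  "has_face_trace \<rho> v i a g \<longleftrightarrow> v \<in> H1 (Y_star \<rho>) \<and> g \<in> L2 cell_Y \<and>
     (\<exists>\<phi> :: nat \<Rightarrow> real ^ 'n \<Rightarrow> real. (\<forall>k. smooth (\<phi> k)) \<and>
        (\<lambda>k. H1_norm (Y_star \<rho>) (\<lambda>y. \<phi> k y - v y)) \<longlonglongrightarrow> 0 \<and>
        (\<lambda>k. L2_norm cell_Y (\<lambda>y. \<phi> k (subst_coord i a y) - g y)) \<longlonglongrightarrow> 0)"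

definition H1_per :: "real \<Rightarrow> (real ^ 'n \<Rightarrow> real) set" where
  "H1_per \<rho> = {v \<in> H1 (Y_star \<rho>).
     \<forall>i. \<exists>g. has_face_trace \<rho> v i 0 g \<and> has_face_trace \<rho> v i 1 g}"

definition eq_mod_const :: "real \<Rightarrow> (real ^ 'n \<Rightarrow> real) \<Rightarrow> (real ^ 'n \<Rightarrow> real) \<Rightarrow> bool" where
  "eq_mod_const \<rho> v w \<longleftrightarrow> (\<exists>c. AE y in lebesgue_on (Y_star \<rho>). v y = w y + c)"

definition solves_cell :: "real \<Rightarrow> 'n \<Rightarrow> (real ^ 'n \<Rightarrow> real) \<Rightarrow> bool" where
  "solves_cell \<rho> j w \<longleftrightarrow> w \<in> H1_per \<rho> \<and>
     (\<forall>\<phi>\<in>H1_per \<rho>.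
        (LINT y|lebesgue_on (Y_star \<rho>).
           (weak_gradient (Y_star \<rho>) w y + axis j 1) \<bullet> weak_gradient (Y_star \<rho>) \<phi> y) = 0)"

definition cell_solution :: "real \<Rightarrow> 'n \<Rightarrow> real ^ 'n \<Rightarrow> real" where
  "cell_solution \<rho> j = (SOME w. solves_cell \<rho> j w)"

definition A_hom :: "real \<Rightarrow> real ^ 'n ^ 'n" where
  "A_hom \<rho> = (\<chi> i j. LINT y|lebesgue_on (Y_star \<rho>).
     ((if i = j then 1 else 0) + weak_gradient (Y_star \<rho>) (cell_solution \<rho> j) y $ i))"


section \<open>The macroscopic domain\<close>

definition scaled_cell :: "real \<Rightarrow> int ^ 'n \<Rightarrow> (real ^ 'n) set \<Rightarrow> (real ^ 'n) set" where
  "scaled_cell e k A = (\<lambda>y. e *\<^sub>R (\<chi> i. real_of_int (k $ i)) + e *\<^sub>R y) ` A"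

definition cell_indices :: "real \<Rightarrow> (real ^ 'n) set \<Rightarrow> (int ^ 'n) set" where
  "cell_indices e \<Omega> = {k. scaled_cell e k cell_Y \<inter> \<Omega> \<noteq> {}}"


section \<open>Time-dependent function spaces\<close>

text \<open>
  Functions on \<open>S \<times> \<Omega>\<close> are curried. An element of \<open>L\<^sup>2(S; H\<^sup>1(\<Omega>))\<close> is given together with its
  spatial gradient \<open>G\<close>: strong measurability of \<open>t \<mapsto> u(t)\<close> as an \<open>H\<^sup>1(\<Omega>)\<close>-valued map means joint
  measurability of \<open>u\<close> and of a version of its gradient.
\<close>

definition in_L2_H1 ::
    "real set \<Rightarrow> 'a::euclidean_space set \<Rightarrow> (real \<Rightarrow> 'a \<Rightarrow> real) \<Rightarrow> (real \<Rightarrow> 'a \<Rightarrow> 'a) \<Rightarrow> bool" where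
  "in_L2_H1 S \<Omega> u G \<longleftrightarrow> (\<lambda>(t, x). u t x) \<in> L2 (S \<times> \<Omega>) \<and> (\<lambda>(t, x). G t x) \<in> L2 (S \<times> \<Omega>) \<and>
     (AE t in lebesgue_on S. has_weak_gradient \<Omega> (u t) (G t))"

text \<open>The space \<open>L\<^sup>2(S \<times> \<Omega>; H\<^sup>1\<^sub>#(Y\<^sup>*\<^bsub>r(t,x)\<^esub>))\<close>, with \<open>G\<close> the gradient in \<open>y\<close>.\<close>

definition in_L2_H1_per ::
    "real set \<Rightarrow> (real ^ 'n) set \<Rightarrow> (real \<Rightarrow> real ^ 'n \<Rightarrow> real) \<Rightarrow>
     (real \<Rightarrow> real ^ 'n \<Rightarrow> real ^ 'n \<Rightarrow> real) \<Rightarrow>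
     (real \<Rightarrow> real ^ 'n \<Rightarrow> real ^ 'n \<Rightarrow> real ^ 'n) \<Rightarrow> bool" where
  "in_L2_H1_per S \<Omega> r v G \<longleftrightarrow>
     (\<lambda>(t, x, y). v t x y) \<in> L2 {(t, x, y). t \<in> S \<and> x \<in> \<Omega> \<and> y \<in> Y_star (r t x)} \<and>
     (\<lambda>(t, x, y). G t x y) \<in> L2 {(t, x, y). t \<in> S \<and> x \<in> \<Omega> \<and> y \<in> Y_star (r t x)} \<and>
     (AE p in lebesgue_on (S \<times> \<Omega>). case p of (t, x) \<Rightarrow>
        v t x \<in> H1_per (r t x) \<and> has_weak_gradient (Y_star (r t x)) (v t x) (G t x))"

definition has_weak_dt ::
    "real set \<Rightarrow> 'a::euclidean_space set \<Rightarrow> (real \<Rightarrow> 'a \<Rightarrow> real) \<Rightarrow> (real \<Rightarrow> 'a \<Rightarrow> real) \<Rightarrow> bool" where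
  "has_weak_dt S \<Omega> u du \<longleftrightarrow>
     (\<lambda>(t, x). u t x) \<in> L2 (S \<times> \<Omega>) \<and> (\<lambda>(t, x). du t x) \<in> L2 (S \<times> \<Omega>) \<and>
     (\<forall>\<psi>. test_function S \<psi> \<longrightarrow>
        (AE x in lebesgue_on \<Omega>.
           (LINT t|lebesgue_on S. u t x * deriv \<psi> t) = - (LINT t|lebesgue_on S. du t x * \<psi> t)))"

definition essentially_bounded_L2 ::
    "real set \<Rightarrow> 'a::euclidean_space set \<Rightarrow> (real \<Rightarrow> 'a \<Rightarrow> real) \<Rightarrow> bool" where
  "essentially_bounded_L2 S \<Omega> u \<longleftrightarrow>
     (\<exists>C. AE t in lebesgue_on S. u t \<in> L2 \<Omega> \<and> L2_norm \<Omega> (u t) \<le> C)"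

text \<open>The space \<open>W\<^sup>1\<^sup>,\<^sup>\<infinity>(S; L\<^sup>2(\<Omega>))\<close>, for bounded \<open>S\<close>, with \<open>dr\<close> the weak time derivative of \<open>r\<close>.\<close>

definition in_W1inf_L2 ::
    "real set \<Rightarrow> 'a::euclidean_space set \<Rightarrow> (real \<Rightarrow> 'a \<Rightarrow> real) \<Rightarrow> (real \<Rightarrow> 'a \<Rightarrow> real) \<Rightarrow> bool" where
  "in_W1inf_L2 S \<Omega> r dr \<longleftrightarrow>
     has_weak_dt S \<Omega> r dr \<and> essentially_bounded_L2 S \<Omega> r \<and> essentially_bounded_L2 S \<Omega> dr"

text \<open>
  The space \<open>L\<^sup>2(S; H\<^sup>1(\<Omega>)')\<close>; since the dual is separable, weak and strong measurability agree.
\<close>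

definition L2_H1_dual ::
    "real set \<Rightarrow> 'a::euclidean_space set \<Rightarrow> (real \<Rightarrow> ('a \<Rightarrow> real) \<Rightarrow> real) set" where
  "L2_H1_dual S \<Omega> = {l. (AE t in lebesgue_on S. l t \<in> H1_dual \<Omega>) \<and>
     (\<forall>v\<in>H1 \<Omega>. (\<lambda>t. l t v) \<in> borel_measurable (lebesgue_on S)) \<and>
     integrable (lebesgue_on S) (\<lambda>t. (H1_dual_norm \<Omega> (l t))\<^sup>2)}"

text \<open>
  The weak time derivative \<open>l\<close> of a function \<open>F \<in> L\<^sup>2(S; L\<^sup>2(\<Omega>))\<close> in \<open>L\<^sup>2(S; H\<^sup>1(\<Omega>)')\<close>, where
  \<open>L\<^sup>2(\<Omega>)\<close> is embedded into \<open>H\<^sup>1(\<Omega>)'\<close> via the \<open>L\<^sup>2\<close> scalar product.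
\<close>

definition has_weak_dt_dual ::
    "real set \<Rightarrow> 'a::euclidean_space set \<Rightarrow> (real \<Rightarrow> 'a \<Rightarrow> real) \<Rightarrow>
     (real \<Rightarrow> ('a \<Rightarrow> real) \<Rightarrow> real) \<Rightarrow> bool" where
  "has_weak_dt_dual S \<Omega> F l \<longleftrightarrow> (\<lambda>(t, x). F t x) \<in> L2 (S \<times> \<Omega>) \<and> l \<in> L2_H1_dual S \<Omega> \<and>
     (\<forall>v\<in>H1 \<Omega>. \<forall>\<psi>. test_function S \<psi> \<longrightarrow>
        (LINT t|lebesgue_on S. L2_inner \<Omega> (F t) v * deriv \<psi> t)
          = - (LINT t|lebesgue_on S. l t v * \<psi> t))"

text \<open>
  Initial values are those of the representative that is continuous on \<open>[0, T]\<close>, with values in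
  \<open>L\<^sup>2(\<Omega>)\<close> and in \<open>H\<^sup>1(\<Omega>)'\<close> respectively.
\<close>

definition has_initial_value_L2 ::
    "real \<Rightarrow> 'a::euclidean_space set \<Rightarrow> (real \<Rightarrow> 'a \<Rightarrow> real) \<Rightarrow> ('a \<Rightarrow> real) \<Rightarrow> bool" where
  "has_initial_value_L2 T \<Omega> r r0 \<longleftrightarrow> (\<exists>q.
     (\<forall>t\<in>{0..T}. q t \<in> L2 \<Omega>) \<and>
     (\<forall>s\<in>{0..T}. ((\<lambda>t. L2_norm \<Omega> (\<lambda>x. q t x - q s x)) \<longlongrightarrow> 0) (at s within {0..T})) \<and>
     (AE t in lebesgue_on {0<..<T}. AE x in lebesgue_on \<Omega>. q t x = r t x) \<and>
     (AE x in lebesgue_on \<Omega>. q 0 x = r0 x))"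

definition has_initial_value_dual ::
    "real \<Rightarrow> 'a::euclidean_space set \<Rightarrow> (real \<Rightarrow> 'a \<Rightarrow> real) \<Rightarrow> ('a \<Rightarrow> real) \<Rightarrow> bool" where
  "has_initial_value_dual T \<Omega> F F0 \<longleftrightarrow> (\<exists>q.
     (\<forall>t\<in>{0..T}. q t \<in> H1_dual \<Omega>) \<and>
     (\<forall>s\<in>{0..T}. ((\<lambda>t. H1_dual_norm \<Omega> (\<lambda>v. q t v - q s v)) \<longlongrightarrow> 0) (at s within {0..T})) \<and>
     (AE t in lebesgue_on {0<..<T}. \<forall>v\<in>H1 \<Omega>. q t v = L2_inner \<Omega> (F t) v) \<and>
     (\<forall>v\<in>H1 \<Omega>. q 0 v = L2_inner \<Omega> F0 v))"


section \<open>The two limit problems\<close>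

text \<open>
  The requirements on \<open>(u\<^sub>0, r)\<close> shared by both problems. Here \<open>Gu\<close> is the gradient of \<open>u\<^sub>0\<close>,
  \<open>dr\<close> and \<open>dV\<close> are the time derivatives of \<open>r\<close> and \<open>V\<^sub>N(r)\<close>, and \<open>l\<close> is the time derivative of
  \<open>(1 - V\<^sub>N(r)) u\<^sub>0\<close>.
\<close>

definition limit_class ::
    "real \<Rightarrow> (real ^ 'n) set \<Rightarrow> real \<Rightarrow> real \<Rightarrow> (real ^ 'n \<Rightarrow> real) \<Rightarrow> (real ^ 'n \<Rightarrow> real) \<Rightarrow>
     (real \<Rightarrow> real ^ 'n \<Rightarrow> real) \<Rightarrow> (real \<Rightarrow> real ^ 'n \<Rightarrow> real) \<Rightarrow>
     (real \<Rightarrow> real ^ 'n \<Rightarrow> real ^ 'n) \<Rightarrow>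
     (real \<Rightarrow> real ^ 'n \<Rightarrow> real) \<Rightarrow> (real \<Rightarrow> real ^ 'n \<Rightarrow> real) \<Rightarrow>
     (real \<Rightarrow> (real ^ 'n \<Rightarrow> real) \<Rightarrow> real) \<Rightarrow> bool" where
  "limit_class T \<Omega> rmin rmax uini rini u0 r Gu dr dV l \<longleftrightarrow>
     in_L2_H1 {0<..<T} \<Omega> u0 Gu \<and>
     in_W1inf_L2 {0<..<T} \<Omega> r dr \<and>
     (AE p in lebesgue_on ({0<..<T} \<times> \<Omega>). case p of (t, x) \<Rightarrow> r t x \<in> {rmin..rmax}) \<and>
     has_weak_dt {0<..<T} \<Omega> (\<lambda>t x. ball_volume TYPE('n) (r t x)) dV \<and>
     has_weak_dt_dual {0<..<T} \<Omega> (\<lambda>t x. (1 - ball_volume TYPE('n) (r t x)) * u0 t x) l \<and>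
     has_initial_value_L2 T \<Omega> r rini \<and>
     has_initial_value_dual T \<Omega>
       (\<lambda>t x. (1 - ball_volume TYPE('n) (r t x)) * u0 t x)
       (\<lambda>x. (1 - ball_volume TYPE('n) (rini x)) * uini x)"

definition solves_two_scale ::
    "real \<Rightarrow> (real ^ 'n) set \<Rightarrow> real \<Rightarrow> real \<Rightarrow> real \<Rightarrow> real \<Rightarrow>
     (real \<Rightarrow> real \<Rightarrow> real) \<Rightarrow> (real \<Rightarrow> real ^ 'n \<Rightarrow> real) \<Rightarrow>
     (real ^ 'n \<Rightarrow> real) \<Rightarrow> (real ^ 'n \<Rightarrow> real) \<Rightarrow>
     (real \<Rightarrow> real ^ 'n \<Rightarrow> real) \<Rightarrow> (real \<Rightarrow> real ^ 'n \<Rightarrow> real ^ 'n \<Rightarrow> real) \<Rightarrow>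
     (real \<Rightarrow> real ^ 'n \<Rightarrow> real) \<Rightarrow> bool" where
  "solves_two_scale T \<Omega> rmin rmax cs D f fp uini rini u0 u1 r \<longleftrightarrow> (\<exists>Gu Gu1 dr dV l.
     limit_class T \<Omega> rmin rmax uini rini u0 r Gu dr dV l \<and>
     in_L2_H1_per {0<..<T} \<Omega> r u1 Gu1 \<and>
     (\<forall>\<phi> G\<phi> \<phi>1 G\<phi>1. in_L2_H1 {0<..<T} \<Omega> \<phi> G\<phi> \<longrightarrow> in_L2_H1_per {0<..<T} \<Omega> r \<phi>1 G\<phi>1 \<longrightarrow>
        (LINT t|lebesgue_on {0<..<T}. l t (\<phi> t))
        + (LINT t|lebesgue_on {0<..<T}. LINT x|lebesgue_on \<Omega>. LINT y|lebesgue_on (Y_star (r t x)).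
             D * ((Gu t x + Gu1 t x y) \<bullet> (G\<phi> t x + G\<phi>1 t x y)))
        = (LINT t|lebesgue_on {0<..<T}. LINT x|lebesgue_on \<Omega>.
             ((1 - ball_volume TYPE('n) (r t x)) * fp t x - dV t x * cs) * \<phi> t x)) \<and>
     (\<forall>\<theta>. (\<lambda>(t, x). \<theta> t x) \<in> L2 ({0<..<T} \<times> \<Omega>) \<longrightarrow>
        (LINT t|lebesgue_on {0<..<T}. LINT x|lebesgue_on \<Omega>. dr t x * \<theta> t x)
        = (LINT t|lebesgue_on {0<..<T}. LINT x|lebesgue_on \<Omega>.
             1 / cs * f (u0 t x) (r t x) * \<theta> t x)))"

definition solves_homogenized ::
    "real \<Rightarrow> (real ^ 'n) set \<Rightarrow> real \<Rightarrow> real \<Rightarrow> real \<Rightarrow> real \<Rightarrow>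
     (real \<Rightarrow> real \<Rightarrow> real) \<Rightarrow> (real \<Rightarrow> real ^ 'n \<Rightarrow> real) \<Rightarrow>
     (real ^ 'n \<Rightarrow> real) \<Rightarrow> (real ^ 'n \<Rightarrow> real) \<Rightarrow>
     (real \<Rightarrow> real ^ 'n \<Rightarrow> real) \<Rightarrow> (real \<Rightarrow> real ^ 'n \<Rightarrow> real) \<Rightarrow> bool" where
  "solves_homogenized T \<Omega> rmin rmax cs D f fp uini rini u0 r \<longleftrightarrow> (\<exists>Gu dr dV l.
     limit_class T \<Omega> rmin rmax uini rini u0 r Gu dr dV l \<and>
     (\<forall>\<phi> G\<phi>. in_L2_H1 {0<..<T} \<Omega> \<phi> G\<phi> \<longrightarrow>
        (LINT t|lebesgue_on {0<..<T}. l t (\<phi> t))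
        + L2_inner ({0<..<T} \<times> \<Omega>)
            (\<lambda>(t, x). D *\<^sub>R (A_hom (r t x) *v Gu t x)) (\<lambda>(t, x). G\<phi> t x)
        = L2_inner ({0<..<T} \<times> \<Omega>)
            (\<lambda>(t, x). (1 - ball_volume TYPE('n) (r t x)) * fp t x - dV t x * cs)
            (\<lambda>(t, x). \<phi> t x)) \<and>
     (\<forall>\<theta>. (\<lambda>(t, x). \<theta> t x) \<in> L2 ({0<..<T} \<times> \<Omega>) \<longrightarrow>
        (LINT t|lebesgue_on {0<..<T}. LINT x|lebesgue_on \<Omega>. dr t x * \<theta> t x)
        = (LINT t|lebesgue_on {0<..<T}. LINT x|lebesgue_on \<Omega>.
             1 / cs * f (u0 t x) (r t x) * \<theta> t x)))"

definition ae_equal ::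
    "real \<Rightarrow> 'a::euclidean_space set \<Rightarrow> (real \<Rightarrow> 'a \<Rightarrow> real) \<Rightarrow> (real \<Rightarrow> 'a \<Rightarrow> real) \<Rightarrow> bool" where
  "ae_equal T \<Omega> u v \<longleftrightarrow>
     (AE p in lebesgue_on ({0<..<T} \<times> \<Omega>). case p of (t, x) \<Rightarrow> u t x = v t x)"

definition unique_solution_two_scale ::
    "real \<Rightarrow> (real ^ 'n) set \<Rightarrow> real \<Rightarrow> real \<Rightarrow> real \<Rightarrow> real \<Rightarrow>
     (real \<Rightarrow> real \<Rightarrow> real) \<Rightarrow> (real \<Rightarrow> real ^ 'n \<Rightarrow> real) \<Rightarrow>
     (real ^ 'n \<Rightarrow> real) \<Rightarrow> (real ^ 'n \<Rightarrow> real) \<Rightarrow>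
     (real \<Rightarrow> real ^ 'n \<Rightarrow> real) \<Rightarrow> (real \<Rightarrow> real ^ 'n \<Rightarrow> real ^ 'n \<Rightarrow> real) \<Rightarrow>
     (real \<Rightarrow> real ^ 'n \<Rightarrow> real) \<Rightarrow> bool" where
  "unique_solution_two_scale T \<Omega> rmin rmax cs D f fp uini rini u0 u1 r \<longleftrightarrow>
     solves_two_scale T \<Omega> rmin rmax cs D f fp uini rini u0 u1 r \<and>
     (\<forall>v0 v1 s. solves_two_scale T \<Omega> rmin rmax cs D f fp uini rini v0 v1 s \<longrightarrow>
        ae_equal T \<Omega> v0 u0 \<and> ae_equal T \<Omega> s r \<and>
        (AE p in lebesgue_on ({0<..<T} \<times> \<Omega>). case p of (t, x) \<Rightarrow>
           eq_mod_const (r t x) (v1 t x) (u1 t x)))"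

definition unique_solution_homogenized ::
    "real \<Rightarrow> (real ^ 'n) set \<Rightarrow> real \<Rightarrow> real \<Rightarrow> real \<Rightarrow> real \<Rightarrow>
     (real \<Rightarrow> real \<Rightarrow> real) \<Rightarrow> (real \<Rightarrow> real ^ 'n \<Rightarrow> real) \<Rightarrow>
     (real ^ 'n \<Rightarrow> real) \<Rightarrow> (real ^ 'n \<Rightarrow> real) \<Rightarrow>
     (real \<Rightarrow> real ^ 'n \<Rightarrow> real) \<Rightarrow> (real \<Rightarrow> real ^ 'n \<Rightarrow> real) \<Rightarrow> bool" where
  "unique_solution_homogenized T \<Omega> rmin rmax cs D f fp uini rini u0 r \<longleftrightarrow>
     solves_homogenized T \<Omega> rmin rmax cs D f fp uini rini u0 r \<and>
     (\<forall>v0 s. solves_homogenized T \<Omega> rmin rmax cs D f fp uini rini v0 s \<longrightarrow>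
        ae_equal T \<Omega> v0 u0 \<and> ae_equal T \<Omega> s r)"

end

theory Submission
  imports Defs
begin

text \<open>
  A minimisation argument gives the cell solutions \<open>w\<^sub>j(\<rho>;\<cdot>)\<close>, since a Poincare inequality holds on
  \<open>Y\<^sup>*\<^sub>\<rho>\<close> uniformly in \<open>\<rho>\<close>: every point of the perforated cell reaches a slab along a face of the cell
  by a move along a coordinate axis that avoids the hole. The cell gradients are orthogonal projections onto nested spaces, so their
  energy is monotone in \<open>\<rho>\<close> and they depend measurably on \<open>(\<rho>, y)\<close>. Hence
  \<open>\<Sum>\<^sub>j \<partial>\<^sub>j u\<^sub>0(t,x) w\<^sub>j(r(t,x);y)\<close> is an admissible corrector. Testing the two-scale equation with
  \<open>\<phi> = 0\<close> forces \<open>\<nabla>\<^sub>y u\<^sub>1\<close> to be its gradient, and \<open>\<phi>\<^sub>1 = 0\<close> then yields the homogenized equation.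
  Conversely every solution of the homogenized problem extends to a two-scale solution by this
  corrector, so uniqueness is inherited.
\<close>

section \<open>Lebesgue measure on subsets and products\<close>

text \<open>The obstacle is that the perforated cell varies with \<open>(t, x)\<close>: no single
  function space contains all correctors, so their measurable dependence on the radius cannot come
  from a continuous solution map on one space. Two devices replace it. First, all radii up to
  \<open>R\<close> share one reference slab \<open>S\<close> that misses the largest hole.
  Correctors are normalised to average zero over \<open>S\<close>, a condition that survives
  restriction to a cell with a larger hole. Second, a radius is approximated from below only,
  because a corrector for a smaller hole restricts to the cell with the larger one. A monotone
  energy has countably many jumps, so countably many radii approximate every radius. Every radius
  must be reached, not just almost every one: the function \<open>r\<close> may take an exceptional
  value on a set of positive measure.

  The radius is merely Lebesgue measurable and the integrals in both problems are iterated. Hence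
  Fubini is needed for Lebesgue measure with slices that depend on the outer variable.\<close>

lemma borel_measurable_lebesgue_on_cong_AE:
  fixes f g :: "'a::euclidean_space \<Rightarrow> 'b::euclidean_space"
  assumes A: "A \<in> sets lebesgue" and f: "f \<in> borel_measurable (lebesgue_on A)"
    and eq: "AE x in lebesgue_on A. f x = g x"
  shows "g \<in> borel_measurable (lebesgue_on A)"
proof -
  have "AE x in lebesgue. x \<in> A \<longrightarrow> f x = g x"
    using eq A by (simp add: AE_restrict_space_iff)
  then have "AE x in lebesgue. (if x \<in> A then f x else 0) = (if x \<in> A then g x else 0)"
    by eventually_elim auto
  moreover have "(\<lambda>x. if x \<in> A then f x else 0) \<in> borel_measurable lebesgue"
    using f A by (simp add: borel_measurable_if)
  ultimately have "(\<lambda>x. if x \<in> A then g x else 0) \<in> borel_measurable lebesgue"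
    by (rule borel_measurable_AE[rotated])
  then show ?thesis using A by (simp add: borel_measurable_if)
qed

text \<open>No measurability is assumed: by completeness one function is measurable exactly when the
  other is, and if neither is, both integrals have the default value 0. Iterated integrals can
  therefore be rewritten almost everywhere without side conditions.\<close>

lemma integral_lebesgue_on_cong_AE:
  fixes f g :: "'a::euclidean_space \<Rightarrow> 'b::euclidean_space"
  assumes A: "A \<in> sets lebesgue" and eq: "AE x in lebesgue_on A. f x = g x"
  shows "(LINT x|lebesgue_on A. f x) = (LINT x|lebesgue_on A. g x)"
proof (cases "f \<in> borel_measurable (lebesgue_on A)")
  case True
  with borel_measurable_lebesgue_on_cong_AE[OF A True eq] eq show ?thesis
    by (intro integral_cong_AE)
next
  case False
  moreover have "g \<notin> borel_measurable (lebesgue_on A)"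
  proof
    assume "g \<in> borel_measurable (lebesgue_on A)"
    moreover have "AE x in lebesgue_on A. g x = f x" using eq by eventually_elim simp
    ultimately show False using borel_measurable_lebesgue_on_cong_AE[OF A, of g f] False by auto
  qed
  ultimately show ?thesis
    by (metis borel_measurable_integrable not_integrable_integral_eq)
qed

lemma integrable_lebesgue_on_cong_AE:
  fixes f g :: "'a::euclidean_space \<Rightarrow> 'b::euclidean_space"
  assumes A: "A \<in> sets lebesgue" and f: "integrable (lebesgue_on A) f"
    and eq: "AE x in lebesgue_on A. f x = g x"
  shows "integrable (lebesgue_on A) g"
  using f borel_measurable_lebesgue_on_cong_AE[OF A borel_measurable_integrable[OF f] eq] eq
  by (rule integrable_cong_AE_imp)

text \<open>Fubini is applied to Borel functions on products of \<open>lborel\<close>, whereas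
  elements of the function spaces are only Lebesgue measurable; a Borel version bridges the gap.
  Coordinates are treated separately to reduce to real functions.\<close>

lemma ex_borel_version_lebesgue_on:
  fixes f :: "'a::euclidean_space \<Rightarrow> 'b::euclidean_space"
  assumes A: "A \<in> sets lebesgue" and f: "f \<in> borel_measurable (lebesgue_on A)"
  shows "\<exists>g\<in>borel_measurable borel. AE x in lebesgue_on A. f x = g x"
proof -
  define F where "F x = (if x \<in> A then f x else 0)" for x
  have F: "F \<in> borel_measurable lebesgue"
    using f A unfolding F_def by (simp add: borel_measurable_if)
  have "\<exists>g\<in>borel_measurable lborel. AE x in lborel. F x \<bullet> b = g x" for b
    using F by (intro completion_ex_borel_measurable_real) simp
  then obtain g where g: "\<And>b. g b \<in> borel_measurable lborel"
      "\<And>b. AE x in lborel. F x \<bullet> b = g b x"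
    by metis
  have "AE x in lborel. \<forall>b\<in>Basis. F x \<bullet> b = g b x"
    using g(2) by (subst AE_ball_countable) (auto intro: countable_finite)
  then have "AE x in lborel. F x = (\<Sum>b\<in>Basis. g b x *\<^sub>R b)"
    by eventually_elim (subst euclidean_representation[symmetric], simp)
  then have "AE x in lebesgue. F x = (\<Sum>b\<in>Basis. g b x *\<^sub>R b)"
    by (rule AE_completion)
  then have "AE x in lebesgue_on A. f x = (\<Sum>b\<in>Basis. g b x *\<^sub>R b)"
    using A by (auto simp: AE_restrict_space_iff F_def)
  moreover have "(\<lambda>x. \<Sum>b\<in>Basis. g b x *\<^sub>R b) \<in> borel_measurable borel"
    using g(1) by simp
  ultimately show ?thesis by (rule bexI)
qed

lemmas ex_borel_version_lebesgue =
  ex_borel_version_lebesgue_on[of UNIV, unfolded lebesgue_on_UNIV_eq, simplified]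
lemmas integral_lebesgue_cong_AE =
  integral_lebesgue_on_cong_AE[of UNIV, unfolded lebesgue_on_UNIV_eq, simplified]
lemmas integrable_lebesgue_cong_AE =
  integrable_lebesgue_on_cong_AE[of UNIV, unfolded lebesgue_on_UNIV_eq, simplified]

text \<open>\<open>lebesgue\<close> on a product is the completion of the product of the
  \<open>lborel\<close> factors. Null sets are insensitive to completion, so the slicing takes place
  in \<open>lborel\<close>.\<close>

lemma AE_lebesgue_pair:
  fixes P :: "'a::euclidean_space \<times> 'b::euclidean_space \<Rightarrow> bool"
  assumes "AE p in lebesgue. P p"
  shows "AE x in lebesgue. AE y in lebesgue. P (x, y)"
proof -
  have "AE p in lborel \<Otimes>\<^sub>M lborel. P p"
    using assms by (simp only: AE_completion_iff lborel_prod)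
  then have "AE x in lborel. AE y in lborel. P (x, y)"
    by (rule lborel_pair.AE_pair)
  then show ?thesis by (simp add: AE_completion_iff)
qed

text \<open>Measurability of the slices \<open>B x\<close> is a conclusion here. It is needed for
  time slices of the perforated domain, where the radius is only Lebesgue measurable jointly in time
  and space.\<close>

lemma AE_lebesgue_on_slices:
  fixes P :: "'a::euclidean_space \<times> 'b::euclidean_space \<Rightarrow> bool"
  assumes S: "S \<in> sets lebesgue"
    and A: "{(x, y). x \<in> S \<and> y \<in> B x} \<in> sets lebesgue"
    and P: "AE p in lebesgue_on {(x, y). x \<in> S \<and> y \<in> B x}. P p"
  shows "AE x in lebesgue_on S. B x \<in> sets lebesgue \<and> (AE y in lebesgue_on (B x). P (x, y))"
proof -
  let ?A = "{(x, y). x \<in> S \<and> y \<in> B x}"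
  \<comment> \<open>Slices of a Borel version of the indicator are Borel. For almost every
    \<open>x\<close> they agree almost everywhere with the indicator of \<open>B x\<close>, which is
    then measurable by completeness.\<close>
  obtain g :: "'a \<times> 'b \<Rightarrow> real" where g: "g \<in> borel_measurable borel" "AE p in lebesgue. indicator ?A p = g p"
    using ex_borel_version_lebesgue[of "indicator ?A :: _ \<Rightarrow> real"] A by auto
  have "AE x in lebesgue. AE y in lebesgue. indicator ?A (x, y) = g (x, y)"
    using AE_lebesgue_pair[OF g(2)] .
  moreover have "AE p in lebesgue. p \<in> ?A \<longrightarrow> P p"
    using P A by (simp add: AE_restrict_space_iff)
  then have "AE x in lebesgue. AE y in lebesgue. (x, y) \<in> ?A \<longrightarrow> P (x, y)"
    by (rule AE_lebesgue_pair)
  ultimately have "AE x in lebesgue. x \<in> S \<longrightarrow> B x \<in> sets lebesgue \<and> (AE y in lebesgue_on (B x). P (x, y))"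
  proof eventually_elim
    case (elim x)
    show ?case
    proof
      assume x: "x \<in> S"
      have ind: "indicator ?A (x, y) = (indicator (B x) y :: real)" for y
        using x by (simp add: indicator_def)
      have m: "(\<lambda>y. g (x, y)) \<in> borel_measurable lebesgue"
        using g(1) by (intro measurable_completion) simp
      have "(indicator (B x) :: _ \<Rightarrow> real) \<in> borel_measurable lebesgue"
        by (rule borel_measurable_AE[OF m]) (use elim(1) in \<open>simp add: ind eq_commute\<close>)
      then have B: "B x \<in> sets lebesgue"
        by (simp add: borel_measurable_indicator_iff)
      with elim(2) x show "B x \<in> sets lebesgue \<and> (AE y in lebesgue_on (B x). P (x, y))"
        by (simp add: AE_restrict_space_iff)
    qed
  qed
  then show ?thesis using S by (subst AE_restrict_space_iff) auto
qed

text \<open>All three claims hold for a Borel version \<open>g\<close> on \<open>lborel\<close>.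
  They pass to \<open>f\<close> because almost every slice of the null set where \<open>f\<close>
  and \<open>g\<close> differ is null.\<close>

lemma Fubini_lebesgue:
  fixes f :: "'a::euclidean_space \<times> 'b::euclidean_space \<Rightarrow> real"
  assumes f: "integrable lebesgue f"
  shows "AE x in lebesgue. integrable lebesgue (\<lambda>y. f (x, y))"
    and "integrable lebesgue (\<lambda>x. LINT y|lebesgue. f (x, y))"
    and "(LINT x|lebesgue. LINT y|lebesgue. f (x, y)) = (LINT p|lebesgue. f p)"
proof -
  obtain g where g: "g \<in> borel_measurable borel" "AE p in lebesgue. f p = g p"
    using ex_borel_version_lebesgue[OF borel_measurable_integrable[OF f]] by (elim bexE) auto
  have g': "g \<in> borel_measurable lborel" using g(1) by simp
  have "integrable lebesgue g"
    using f g(2) by (rule integrable_lebesgue_cong_AE)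
  then have "integrable lborel g" using integrable_completion[OF g'] by simp
  then have gp: "integrable (lborel \<Otimes>\<^sub>M lborel) g" by (simp only: lborel_prod)
  have gx: "(\<lambda>y. g (x, y)) \<in> borel_measurable lborel" for x using g(1) by simp
  have 1: "AE x in lebesgue. integrable lebesgue (\<lambda>y. g (x, y))"
    using lborel_pair.AE_integrable_fst'[OF gp]
    by (simp only: AE_completion_iff integrable_completion[OF gx])
  have gl: "(LINT y|lebesgue. g (x, y)) = (LINT y|lborel. g (x, y))" for x
    using gx by (rule integral_completion)
  have gi: "integrable lborel (\<lambda>x. LINT y|lborel. g (x, y))"
    by (rule lborel_pair.integrable_fst'[OF gp])
  note gm = borel_measurable_integrable[OF gi]
  have 2: "integrable lebesgue (\<lambda>x. LINT y|lebesgue. g (x, y))"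
    using gi by (simp only: gl integrable_completion[OF gm])
  have 3: "(LINT x|lebesgue. LINT y|lebesgue. g (x, y)) = (LINT p|lebesgue. g p)"
    using lborel_pair.integral_fst'[OF gp]
    by (simp only: gl integral_completion[OF gm] integral_completion[OF g'] lborel_prod)
  have eq: "AE x in lebesgue. AE y in lebesgue. g (x, y) = f (x, y)"
    using AE_lebesgue_pair[OF g(2)] by (simp only: eq_commute)
  show "AE x in lebesgue. integrable lebesgue (\<lambda>y. f (x, y))"
    using 1 eq by eventually_elim (rule integrable_lebesgue_cong_AE)
  have eq2: "AE x in lebesgue. (LINT y|lebesgue. g (x, y)) = (LINT y|lebesgue. f (x, y))"
    using eq by eventually_elim (rule integral_lebesgue_cong_AE)
  show "integrable lebesgue (\<lambda>x. LINT y|lebesgue. f (x, y))"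
    using 2 eq2 by (rule integrable_lebesgue_cong_AE)
  show "(LINT x|lebesgue. LINT y|lebesgue. f (x, y)) = (LINT p|lebesgue. f p)"
    using 3 integral_lebesgue_cong_AE[OF eq2] integral_lebesgue_cong_AE[OF g(2)] by simp
qed

lemma integral_lebesgue_on_indicator:
  fixes f :: "'a::euclidean_space \<Rightarrow> real"
  assumes "A \<in> sets lebesgue"
  shows "(LINT x|lebesgue_on A. f x) = (LINT x|lebesgue. indicator A x * f x)"
  using assms by (simp add: integral_restrict_space)

text \<open>Extension by zero reduces domains whose inner slice depends on the outer variable to the
  whole space. This is the form required by cells \<open>Y_star (r t x)\<close>.\<close>

lemma Fubini_lebesgue_on:
  fixes f :: "'a::euclidean_space \<times> 'b::euclidean_space \<Rightarrow> real"
  assumes S: "S \<in> sets lebesgue"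
    and A: "{(x, y). x \<in> S \<and> y \<in> B x} \<in> sets lebesgue"
    and f: "integrable (lebesgue_on {(x, y). x \<in> S \<and> y \<in> B x}) f"
  shows "AE x in lebesgue_on S. B x \<in> sets lebesgue \<and> integrable (lebesgue_on (B x)) (\<lambda>y. f (x, y))"
    and "integrable (lebesgue_on S) (\<lambda>x. LINT y|lebesgue_on (B x). f (x, y))"
    and "(LINT x|lebesgue_on S. LINT y|lebesgue_on (B x). f (x, y))
           = (LINT p|lebesgue_on {(x, y). x \<in> S \<and> y \<in> B x}. f p)"
proof -
  let ?A = "{(x, y). x \<in> S \<and> y \<in> B x}"
  define g where "g p = indicator ?A p * f p" for p
  have g: "integrable lebesgue g"
    using f A unfolding g_def by (simp add: integrable_restrict_space)
  note F = Fubini_lebesgue[OF g]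
  have gS: "g (x, y) = indicator S x * (indicator (B x) y * f (x, y))" for x y
    by (simp add: g_def indicator_def)
  have sl: "AE x in lebesgue. x \<in> S \<longrightarrow> B x \<in> sets lebesgue"
    using AE_lebesgue_on_slices[OF S A, of "\<lambda>_. True"] S by (simp add: AE_restrict_space_iff)
  have "AE x in lebesgue. x \<in> S \<longrightarrow> B x \<in> sets lebesgue \<and> integrable (lebesgue_on (B x)) (\<lambda>y. f (x, y))"
    using sl F(1) by eventually_elim (auto simp: gS integrable_restrict_space)
  then show "AE x in lebesgue_on S. B x \<in> sets lebesgue \<and> integrable (lebesgue_on (B x)) (\<lambda>y. f (x, y))"
    using S by (subst AE_restrict_space_iff) auto
  have eq: "AE x in lebesgue. (LINT y|lebesgue. g (x, y)) = indicator S x * (LINT y|lebesgue_on (B x). f (x, y))"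
    using sl by eventually_elim (auto simp: gS integral_lebesgue_on_indicator indicator_def)
  have "integrable lebesgue (\<lambda>x. indicator S x * (LINT y|lebesgue_on (B x). f (x, y)))"
    using integrable_lebesgue_cong_AE[OF F(2) eq] .
  then show "integrable (lebesgue_on S) (\<lambda>x. LINT y|lebesgue_on (B x). f (x, y))"
    using S by (simp add: integrable_restrict_space)
  have "(LINT x|lebesgue_on S. LINT y|lebesgue_on (B x). f (x, y))
      = (LINT x|lebesgue. LINT y|lebesgue. g (x, y))"
    using S integral_lebesgue_cong_AE[OF eq]
    by (simp add: integral_lebesgue_on_indicator)
  also have "\<dots> = (LINT p|lebesgue_on ?A. f p)"
    using F(3) A by (simp add: integral_lebesgue_on_indicator g_def)
  finally show "(LINT x|lebesgue_on S. LINT y|lebesgue_on (B x). f (x, y))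
           = (LINT p|lebesgue_on ?A. f p)" .
qed

section \<open>The space of square integrable functions\<close>

lemma L2_measurable: "f \<in> L2 A \<Longrightarrow> f \<in> borel_measurable (lebesgue_on A)"
  and L2_integrable_sq: "f \<in> L2 A \<Longrightarrow> integrable (lebesgue_on A) (\<lambda>x. (norm (f x))\<^sup>2)"
  by (auto simp: L2_def)

lemma L2_iff_nn_integral:
  "f \<in> L2 A \<longleftrightarrow> f \<in> borel_measurable (lebesgue_on A) \<and>
     (\<integral>\<^sup>+x. ennreal ((norm (f x))\<^sup>2) \<partial>lebesgue_on A) < \<infinity>"
  by (auto simp: L2_def integrable_iff_bounded)

lemma nn_integral_L2: "f \<in> L2 A \<Longrightarrow>
    (\<integral>\<^sup>+x. ennreal ((norm (f x))\<^sup>2) \<partial>lebesgue_on A) = ennreal ((L2_norm A f)\<^sup>2)"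
  unfolding L2_norm_def by (subst nn_integral_eq_integral) (auto simp: L2_def)

lemma L2_norm_nonneg [simp]: "0 \<le> L2_norm A f"
  by (simp add: L2_norm_def)

lemma L2_norm_power2: "(L2_norm A f)\<^sup>2 = (LINT x|lebesgue_on A. (norm (f x))\<^sup>2)"
  by (simp add: L2_norm_def)

lemma L2_inner_self: "L2_inner A f f = (L2_norm A f)\<^sup>2"
  by (simp add: L2_inner_def L2_norm_power2 power2_norm_eq_inner)

lemma L2_bound:
  fixes f :: "'a::euclidean_space \<Rightarrow> 'b::euclidean_space"
  assumes "f \<in> borel_measurable (lebesgue_on A)" "integrable (lebesgue_on A) g"
    "\<And>x. (norm (f x))\<^sup>2 \<le> g x"
  shows "f \<in> L2 A"
  unfolding L2_def using assms
  by (auto intro!: Bochner_Integration.integrable_bound[OF assms(2)] order_trans[OF assms(3)] abs_ge_self)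

lemma L2_scaleR [intro]: "f \<in> L2 A \<Longrightarrow> (\<lambda>x. c *\<^sub>R f x) \<in> L2 A"
  by (auto simp: L2_def power_mult_distrib)

lemma L2_cmult [intro]: "f \<in> L2 A \<Longrightarrow> (\<lambda>x. c * f x :: real) \<in> L2 A"
  using L2_scaleR[of f A c] by simp

lemma L2_zero [intro, simp]: "(\<lambda>x. 0) \<in> L2 A"
  by (auto simp: L2_def)

lemma norm_add_sq_le: "(norm (a + b :: 'a::real_inner))\<^sup>2 \<le> 2 * (norm a)\<^sup>2 + 2 * (norm b)\<^sup>2"
proof -
  have "(norm (a + b))\<^sup>2 + (norm (a - b))\<^sup>2 = 2 * (norm a)\<^sup>2 + 2 * (norm b)\<^sup>2"
    by (simp add: power2_norm_eq_inner inner_simps)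
  then show ?thesis by (smt (verit) zero_le_power2)
qed

lemma L2_add [intro]: "f \<in> L2 A \<Longrightarrow> g \<in> L2 A \<Longrightarrow> (\<lambda>x. f x + g x) \<in> L2 A"
  by (rule L2_bound[where g = "\<lambda>x. 2 * (norm (f x))\<^sup>2 + 2 * (norm (g x))\<^sup>2"])
    (auto simp: L2_def norm_add_sq_le)

lemma L2_minus [intro]: "f \<in> L2 A \<Longrightarrow> (\<lambda>x. - f x) \<in> L2 A"
  by (auto simp: L2_def)

lemma L2_diff [intro]: "f \<in> L2 A \<Longrightarrow> g \<in> L2 A \<Longrightarrow> (\<lambda>x. f x - g x) \<in> L2 A"
  using L2_add[of f A "\<lambda>x. - g x"] by auto

lemma L2_sum [intro]: "(\<And>i. i \<in> I \<Longrightarrow> f i \<in> L2 A) \<Longrightarrow> (\<lambda>x. \<Sum>i\<in>I. f i x) \<in> L2 A"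
  by (induction I rule: infinite_finite_induct) auto

lemma L2_integrable_inner:
  assumes "f \<in> L2 A" "g \<in> L2 A"
  shows "integrable (lebesgue_on A) (\<lambda>x. f x \<bullet> g x)"
proof (rule Bochner_Integration.integrable_bound)
  show "integrable (lebesgue_on A) (\<lambda>x. (norm (f x))\<^sup>2 + (norm (g x))\<^sup>2)"
    using assms by (auto simp: L2_def)
  show "(\<lambda>x. f x \<bullet> g x) \<in> borel_measurable (lebesgue_on A)"
    using assms by (auto simp: L2_def)
  have "\<bar>f x \<bullet> g x\<bar> \<le> (norm (f x))\<^sup>2 + (norm (g x))\<^sup>2" for x
  proof -
    have "\<bar>f x \<bullet> g x\<bar> \<le> norm (f x) * norm (g x)" by (rule Cauchy_Schwarz_ineq2)
    moreover have "2 * norm (f x) * norm (g x) \<le> (norm (f x))\<^sup>2 + (norm (g x))\<^sup>2"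
      by (rule sum_squares_bound)
    moreover have "0 \<le> norm (f x) * norm (g x)" by simp
    ultimately show ?thesis by linarith
  qed
  then show "AE x in lebesgue_on A. norm (f x \<bullet> g x) \<le> norm ((norm (f x))\<^sup>2 + (norm (g x))\<^sup>2)"
    by (auto intro: order_trans)
qed

lemma L2_integrable_mult: "f \<in> L2 A \<Longrightarrow> g \<in> L2 A \<Longrightarrow> integrable (lebesgue_on A) (\<lambda>x. f x * g x :: real)"
  using L2_integrable_inner[of f A g] by simp

text \<open>Expansion of the squared norm along a line. It yields Cauchy-Schwarz, the parallelogram
  identity and the first variation and Pythagoras arguments for the cell problem.\<close>

lemma L2_norm_add_sq:
  assumes "f \<in> L2 A" "g \<in> L2 A"
  shows "(L2_norm A (\<lambda>x. f x + c *\<^sub>R g x))\<^sup>2 = (L2_norm A f)\<^sup>2 + 2 * c * L2_inner A f g + c\<^sup>2 * (L2_norm A g)\<^sup>2"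
proof -
  have "(L2_norm A (\<lambda>x. f x + c *\<^sub>R g x))\<^sup>2
      = (LINT x|lebesgue_on A. f x \<bullet> f x + (2 * c) * (f x \<bullet> g x) + c\<^sup>2 * (g x \<bullet> g x))"
    unfolding L2_norm_power2 power2_norm_eq_inner
    by (intro Bochner_Integration.integral_cong) (auto simp: inner_simps inner_commute power2_eq_square algebra_simps)
  also have "\<dots> = L2_inner A f f + 2 * c * L2_inner A f g + c\<^sup>2 * L2_inner A g g"
    using L2_integrable_inner[OF assms(1,1)] L2_integrable_inner[OF assms(1,2)] L2_integrable_inner[OF assms(2,2)]
    by (simp add: L2_inner_def)
  finally show ?thesis by (simp add: L2_inner_self)
qed

lemma L2_Cauchy_Schwarz:
  assumes "f \<in> L2 A" "g \<in> L2 A"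
  shows "\<bar>L2_inner A f g\<bar> \<le> L2_norm A f * L2_norm A g"
proof -
  let ?b = "L2_inner A f g" and ?a = "(L2_norm A f)\<^sup>2" and ?d = "(L2_norm A g)\<^sup>2"
  have *: "0 \<le> ?a + 2 * c * ?b + c\<^sup>2 * ?d" for c
    using L2_norm_add_sq[OF assms, of c] by (metis zero_le_power2)
  have "?b\<^sup>2 \<le> ?a * ?d"
  proof (cases "?d = 0")
    case True
    have "?b = 0"
    proof (rule ccontr)
      assume "?b \<noteq> 0"
      \<comment> \<open>With vanishing leading coefficient the quadratic is affine in
        \<open>c\<close>, and at this \<open>c\<close> its value is -1.\<close>
      then show False using *[of "- (?a + 1) / (2 * ?b)"] True by (simp add: field_simps)
    qed
    then show ?thesis by simp
  next
    case False
    then have d: "0 < ?d" by (metis zero_le_power2 order_le_less)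
    \<comment> \<open>This \<open>c\<close> minimises the quadratic.\<close>
    have "0 \<le> ?a + 2 * (- ?b / ?d) * ?b + (- ?b / ?d)\<^sup>2 * ?d" by (rule *)
    also have "\<dots> = ?a - ?b\<^sup>2 / ?d" using d by (simp add: field_simps power2_eq_square)
    finally show ?thesis using d by (simp add: field_simps)
  qed
  then have "?b\<^sup>2 \<le> (L2_norm A f * L2_norm A g)\<^sup>2" by (simp add: power_mult_distrib)
  then show ?thesis by (metis L2_norm_nonneg abs_le_square_iff abs_of_nonneg mult_nonneg_nonneg)
qed

lemma L2_norm_triangle:
  assumes "f \<in> L2 A" "g \<in> L2 A"
  shows "L2_norm A (\<lambda>x. f x + g x) \<le> L2_norm A f + L2_norm A g"
proof (rule power2_le_imp_le)
  have "(L2_norm A (\<lambda>x. f x + g x))\<^sup>2 = (L2_norm A f)\<^sup>2 + 2 * L2_inner A f g + (L2_norm A g)\<^sup>2"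
    using L2_norm_add_sq[OF assms, of 1] by simp
  also have "\<dots> \<le> (L2_norm A f + L2_norm A g)\<^sup>2"
    using L2_Cauchy_Schwarz[OF assms] by (simp add: power2_sum)
  finally show "(L2_norm A (\<lambda>x. f x + g x))\<^sup>2 \<le> (L2_norm A f + L2_norm A g)\<^sup>2" .
qed simp

lemma L2_norm_scaleR: "L2_norm A (\<lambda>x. c *\<^sub>R f x) = \<bar>c\<bar> * L2_norm A f"
  by (simp add: L2_norm_def power_mult_distrib real_sqrt_mult)

lemma L2_norm_minus_commute: "L2_norm A (\<lambda>x. f x - g x) = L2_norm A (\<lambda>x. g x - f x)"
  by (simp add: L2_norm_def norm_minus_commute)

lemma L2_norm_triangle_diff:
  assumes "f \<in> L2 A" "g \<in> L2 A" "h \<in> L2 A"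
  shows "L2_norm A (\<lambda>x. f x - h x) \<le> L2_norm A (\<lambda>x. f x - g x) + L2_norm A (\<lambda>x. g x - h x)"
  using L2_norm_triangle[of "\<lambda>x. f x - g x" A "\<lambda>x. g x - h x"] assms by auto

lemma L2_norm_triangle_le:
  assumes "f \<in> L2 A" "g \<in> L2 A"
  shows "L2_norm A f \<le> L2_norm A g + L2_norm A (\<lambda>x. f x - g x)"
  using L2_norm_triangle[of g A "\<lambda>x. f x - g x"] assms by auto

lemma L2_norm_cong_AE:
  "A \<in> sets lebesgue \<Longrightarrow> AE x in lebesgue_on A. f x = g x \<Longrightarrow> L2_norm A f = L2_norm A g"
  unfolding L2_norm_def by (rule arg_cong[where f=sqrt], rule integral_lebesgue_on_cong_AE) auto

lemma L2_cong_AE: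
  assumes "A \<in> sets lebesgue" "f \<in> L2 A" "AE x in lebesgue_on A. f x = g x"
  shows "g \<in> L2 A"
proof -
  have "g \<in> borel_measurable (lebesgue_on A)"
    using assms by (blast intro: borel_measurable_lebesgue_on_cong_AE L2_measurable)
  moreover have "integrable (lebesgue_on A) (\<lambda>x. (norm (g x))\<^sup>2)"
    using assms(3) by (intro integrable_lebesgue_on_cong_AE[OF assms(1) L2_integrable_sq[OF assms(2)]]) auto
  ultimately show ?thesis by (simp add: L2_def)
qed

lemma L2_norm_0_imp_AE:
  assumes "f \<in> L2 A" "L2_norm A f = 0"
  shows "AE x in lebesgue_on A. f x = 0"
proof -
  have "(LINT x|lebesgue_on A. (norm (f x))\<^sup>2) = 0"
    using assms(2) by (simp flip: L2_norm_power2)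
  then have "AE x in lebesgue_on A. (norm (f x))\<^sup>2 = 0"
    using L2_integrable_sq[OF assms(1)] by (subst (asm) integral_nonneg_eq_0_iff_AE) auto
  then show ?thesis by simp
qed

lemma L2_subset:
  fixes f :: "'a::euclidean_space \<Rightarrow> 'b::euclidean_space"
  assumes "f \<in> L2 B" "A \<subseteq> B" "A \<in> sets lebesgue" "B \<in> sets lebesgue"
  shows "f \<in> L2 A" and "L2_norm A f \<le> L2_norm B f"
proof -
  have m: "f \<in> borel_measurable (lebesgue_on A)"
    using measurable_restrict_mono[OF L2_measurable[OF assms(1)] assms(2)] .
  have le: "(\<integral>\<^sup>+x. ennreal ((norm (f x))\<^sup>2) \<partial>lebesgue_on A) \<le> (\<integral>\<^sup>+x. ennreal ((norm (f x))\<^sup>2) \<partial>lebesgue_on B)"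
    using assms by (simp add: nn_integral_restrict_space) (auto intro!: nn_integral_mono simp: indicator_def)
  then show "f \<in> L2 A"
    using m assms(1) by (auto simp: L2_iff_nn_integral)
  then have "ennreal ((L2_norm A f)\<^sup>2) \<le> ennreal ((L2_norm B f)\<^sup>2)"
    using le by (simp add: nn_integral_L2 assms(1))
  then show "L2_norm A f \<le> L2_norm B f" by (simp add: power2_le_iff_abs_le)
qed

lemma L2_bounded:
  fixes f :: "'a::euclidean_space \<Rightarrow> 'b::euclidean_space"
  assumes A: "A \<in> lmeasurable" and f: "f \<in> borel_measurable (lebesgue_on A)"
    and B: "AE x in lebesgue_on A. norm (f x) \<le> B"
  shows "f \<in> L2 A"
proof -
  interpret finite_measure "lebesgue_on A" using A by (rule finite_measure_lebesgue_on)
  have "integrable (lebesgue_on A) (\<lambda>x. (norm (f x))\<^sup>2)"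
  proof (rule integrable_const_bound)
    show "AE x in lebesgue_on A. norm ((norm (f x))\<^sup>2) \<le> B\<^sup>2"
      using B by eventually_elim (auto intro: power_mono)
  qed (use f in simp)
  then show ?thesis using f by (simp add: L2_def)
qed

lemma L2_mult_bounded:
  fixes f :: "'a::euclidean_space \<Rightarrow> real" and g :: "'a \<Rightarrow> 'b::euclidean_space"
  assumes f: "f \<in> borel_measurable (lebesgue_on A)" and B: "AE x in lebesgue_on A. \<bar>f x\<bar> \<le> B"
    and g: "g \<in> L2 A"
  shows "(\<lambda>x. f x *\<^sub>R g x) \<in> L2 A"
proof -
  have "integrable (lebesgue_on A) (\<lambda>x. (norm (f x *\<^sub>R g x))\<^sup>2)"
  proof (rule Bochner_Integration.integrable_bound)
    show "integrable (lebesgue_on A) (\<lambda>x. B\<^sup>2 * (norm (g x))\<^sup>2)"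
      using L2_integrable_sq[OF g] by simp
    show "(\<lambda>x. (norm (f x *\<^sub>R g x))\<^sup>2) \<in> borel_measurable (lebesgue_on A)"
      using f L2_measurable[OF g] by measurable
    show "AE x in lebesgue_on A. norm ((norm (f x *\<^sub>R g x))\<^sup>2) \<le> norm (B\<^sup>2 * (norm (g x))\<^sup>2)"
      using B
    proof eventually_elim
      case (elim x)
      then have "(f x)\<^sup>2 \<le> B\<^sup>2" by (metis abs_ge_zero power2_abs power_mono)
      then show ?case by (auto simp: power_mult_distrib intro: mult_right_mono)
    qed
  qed
  moreover have "(\<lambda>x. f x *\<^sub>R g x) \<in> borel_measurable (lebesgue_on A)"
    using f L2_measurable[OF g] by measurable
  ultimately show ?thesis by (simp add: L2_def)
qed

lemma L2_const: "A \<in> lmeasurable \<Longrightarrow> (\<lambda>x. c) \<in> L2 A"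
  by (rule L2_bounded[where B="norm c"]) auto

lemma L2_integrable:
  assumes "f \<in> L2 A" "A \<in> lmeasurable"
  shows "integrable (lebesgue_on A) f"
proof -
  interpret finite_measure "lebesgue_on A" using assms(2) by (rule finite_measure_lebesgue_on)
  have "integrable (lebesgue_on A) (\<lambda>x. 1 + (norm (f x))\<^sup>2)"
    using L2_integrable_sq[OF assms(1)] by auto
  then show ?thesis
  proof (rule Bochner_Integration.integrable_bound)
    have "norm (f x) \<le> 1 + (norm (f x))\<^sup>2" for x
      using sum_squares_bound[of 1 "norm (f x)"] norm_ge_zero[of "f x"] by (simp, linarith)
    then show "AE x in lebesgue_on A. norm (f x) \<le> norm (1 + (norm (f x))\<^sup>2)"
      by (auto intro: order_trans)
  qed (rule L2_measurable[OF assms(1)])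
qed

lemma L2_integral_le:
  assumes "f \<in> L2 A" "A \<in> lmeasurable"
  shows "\<bar>LINT x|lebesgue_on A. f x\<bar> \<le> sqrt (measure lebesgue A) * L2_norm A f"
proof -
  have "L2_norm A (\<lambda>x. 1::real) = sqrt (measure lebesgue A)"
    using assms(2) by (simp add: L2_norm_def measure_restrict_space)
  then show ?thesis
    using L2_Cauchy_Schwarz[OF L2_const[OF assms(2), of 1] assms(1)] by (simp add: L2_inner_def)
qed

text \<open>Squared norms decaying like \<open>8^-n\<close> leave room for the weight
  \<open>4^n\<close>: the integral of the weighted sum is at most \<open>C\<close> times the sum of
  \<open>2^-n\<close>, so the sum is finite almost everywhere. The weight is what makes the
  unsquared norms summable afterwards.\<close>

lemma L2_AE_tendsto:
  fixes f :: "nat \<Rightarrow> 'a::euclidean_space \<Rightarrow> 'b::euclidean_space"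
  assumes f: "\<And>n. f n \<in> L2 A" and s: "\<And>n. (L2_norm A (f n))\<^sup>2 \<le> C * (1/8) ^ n"
  shows "AE x in lebesgue_on A. summable (\<lambda>n. 4 ^ n * (norm (f n x))\<^sup>2)"
proof -
  have C: "0 \<le> C" using s[of 0] by (metis mult.right_neutral order_trans power_0 zero_le_power2)
  have [measurable]: "f n \<in> borel_measurable (lebesgue_on A)" for n using f by (rule L2_measurable)
  have "(\<integral>\<^sup>+x. (\<Sum>n. ennreal (4 ^ n * (norm (f n x))\<^sup>2)) \<partial>lebesgue_on A)
      = (\<Sum>n. \<integral>\<^sup>+x. ennreal (4 ^ n * (norm (f n x))\<^sup>2) \<partial>lebesgue_on A)"
    by (intro nn_integral_suminf) measurable
  also have "\<dots> = (\<Sum>n. ennreal (4 ^ n * (L2_norm A (f n))\<^sup>2))"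
    by (intro suminf_cong) (simp add: ennreal_mult' nn_integral_cmult nn_integral_L2[OF f])
  also have "\<dots> \<le> (\<Sum>n. ennreal (C * (1/2) ^ n))"
  proof (intro suminf_le ennreal_leI)
    fix n
    have "4 ^ n * (L2_norm A (f n))\<^sup>2 \<le> 4 ^ n * (C * (1/8) ^ n)"
      using s by (intro mult_left_mono) auto
    also have "\<dots> = C * (4 * (1/8)) ^ n" by (simp only: power_mult_distrib mult_ac)
    finally show "4 ^ n * (L2_norm A (f n))\<^sup>2 \<le> C * (1/2) ^ n" by simp
  qed auto
  also have "\<dots> = ennreal (\<Sum>n. C * (1/2) ^ n)"
    using C by (intro suminf_ennreal2) auto
  also have "\<dots> < \<infinity>" by simp
  finally have "(\<integral>\<^sup>+x. (\<Sum>n. ennreal (4 ^ n * (norm (f n x))\<^sup>2)) \<partial>lebesgue_on A) \<noteq> \<infinity>"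
    by (rule less_imp_neq)
  then have "AE x in lebesgue_on A. (\<Sum>n. ennreal (4 ^ n * (norm (f n x))\<^sup>2)) \<noteq> \<infinity>"
    by (intro nn_integral_PInf_AE) measurable
  then show ?thesis
    by eventually_elim (auto intro!: summable_suminf_not_top)
qed

text \<open>The terms of a convergent series are eventually below 1, which gives
  \<open>a n \<le> (1/2) ^ n\<close> eventually.\<close>

lemma summable_weighted_sq_imp:
  fixes a :: "nat \<Rightarrow> real"
  assumes "summable (\<lambda>n. 4 ^ n * (a n)\<^sup>2)" "\<And>n. 0 \<le> a n"
  shows "summable a"
proof -
  have "(\<lambda>n. 4 ^ n * (a n)\<^sup>2) \<longlonglongrightarrow> 0" using assms(1) by (rule summable_LIMSEQ_zero)
  then have "eventually (\<lambda>n. 4 ^ n * (a n)\<^sup>2 < 1) sequentially" by (rule order_tendstoD) simp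
  then have "eventually (\<lambda>n. norm (a n) \<le> (1/2) ^ n) sequentially"
  proof eventually_elim
    case (elim n)
    have "(2 ^ n * a n)\<^sup>2 = 4 ^ n * (a n)\<^sup>2"
      by (simp add: power_mult_distrib power2_eq_square flip: power_mult_distrib)
    then have "(2 ^ n * a n)\<^sup>2 \<le> 1" using elim by linarith
    then have "2 ^ n * a n \<le> 1" 
      using power2_le_imp_le[of "2 ^ n * a n" 1] by (simp only: power_one zero_le_one)
    then have "a n \<le> 1 / 2 ^ n" by (simp add: pos_le_divide_eq mult.commute)
    then show ?case using assms(2)[of n] by (simp add: power_one_over)
  qed
  then show ?thesis by (rule summable_comparison_test_ev) (simp add: summable_geometric)
qed

text \<open>Riesz-Fischer: a rapidly converging subsequence converges almost everywhere, and Fatou's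
  lemma identifies its pointwise limit as the limit in norm of the whole sequence.\<close>

lemma L2_complete:
  fixes f :: "nat \<Rightarrow> 'a::euclidean_space \<Rightarrow> 'b::euclidean_space"
  assumes f: "\<And>n. f n \<in> L2 A" 
    and cau: "\<And>e. 0 < e \<Longrightarrow> \<exists>N. \<forall>m\<ge>N. \<forall>n\<ge>N. L2_norm A (\<lambda>x. f m x - f n x) < e"
  shows "\<exists>g\<in>L2 A. (\<lambda>n. L2_norm A (\<lambda>x. f n x - g x)) \<longlonglongrightarrow> 0"
proof -
  have "\<forall>k. \<exists>N. \<forall>m\<ge>N. \<forall>n\<ge>N. L2_norm A (\<lambda>x. f m x - f n x) < (1/8) ^ k"
    using cau by simp
  then obtain N where N: "\<And>k m n. m \<ge> N k \<Longrightarrow> n \<ge> N k \<Longrightarrow> L2_norm A (\<lambda>x. f m x - f n x) < (1/8) ^ k"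
    by metis
  \<comment> \<open>The sum makes \<open>M k\<close> dominate \<open>N k\<close> and increase with
    \<open>k\<close>; the summand \<open>k\<close> makes it unbounded.\<close>
  define M where "M k = k + (\<Sum>i\<le>k. N i)" for k
  have M: "N k \<le> M k" "M k \<le> M (Suc k)" "k \<le> M k" for k
    by (auto simp: M_def intro: trans_le_add2 member_le_sum)
  define d where "d k x = f (M (Suc k)) x - f (M k) x" for k x
  have dL: "d k \<in> L2 A" for k using f unfolding d_def by auto
  have "(L2_norm A (d k))\<^sup>2 \<le> 1 * (1/8) ^ k" for k
  proof -
    have *: "L2_norm A (d k) < (1/8) ^ k"
      unfolding d_def using N[of k] M[of k] by (meson le_trans)
    then have "(L2_norm A (d k))\<^sup>2 \<le> ((1/8) ^ k)\<^sup>2" by (intro power_mono) auto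
    also have "\<dots> \<le> (1/8) ^ k" by (simp add: power2_eq_square mult_le_one power_le_one mult_left_le)
    finally show ?thesis by simp
  qed
  from L2_AE_tendsto[OF dL this]
  have conv: "AE x in lebesgue_on A. convergent (\<lambda>k. f (M k) x)"
  proof eventually_elim
    case (elim x)
    have "summable (\<lambda>k. norm (d k x))" using summable_weighted_sq_imp[OF elim] by simp
    then have "summable (\<lambda>k. d k x)" by (rule summable_norm_cancel)
    then have "convergent (\<lambda>n. \<Sum>k<n. d k x)" by (simp add: summable_iff_convergent)
    moreover have "(\<Sum>k<n. d k x) = f (M n) x - f (M 0) x" for n
      unfolding d_def by (rule sum_lessThan_telescope)
    ultimately have "convergent (\<lambda>n. (f (M n) x - f (M 0) x) + f (M 0) x)"
      by (intro convergent_add convergent_const) simp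
    then show ?case by simp
  qed
  define g where "g x = lim (\<lambda>k. f (M k) x)" for x
  have [measurable]: "f n \<in> borel_measurable (lebesgue_on A)" for n using f by (rule L2_measurable)
  have gm[measurable]: "g \<in> borel_measurable (lebesgue_on A)" unfolding g_def by measurable
  have glim: "AE x in lebesgue_on A. (\<lambda>k. f (M k) x) \<longlonglongrightarrow> g x"
    using conv by eventually_elim (simp add: g_def convergent_LIMSEQ_iff)
  \<comment> \<open>Fatou's lemma along the subsequence; the shift by \<open>n0\<close> ensures that
    every index used lies in the range where the Cauchy bound holds.\<close>
  have bound: "(\<integral>\<^sup>+x. ennreal ((norm (f n x - g x))\<^sup>2) \<partial>lebesgue_on A) \<le> ennreal (e\<^sup>2)"
    if "0 < e" and n: "\<And>m. m \<ge> n0 \<Longrightarrow> L2_norm A (\<lambda>x. f n x - f m x) < e" for n n0 e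
  proof -
    have "(\<integral>\<^sup>+x. ennreal ((norm (f n x - g x))\<^sup>2) \<partial>lebesgue_on A)
        = (\<integral>\<^sup>+x. liminf (\<lambda>k. ennreal ((norm (f n x - f (M (k + n0)) x))\<^sup>2)) \<partial>lebesgue_on A)"
    proof (rule nn_integral_cong_AE)
      show "AE x in lebesgue_on A. ennreal ((norm (f n x - g x))\<^sup>2)
          = liminf (\<lambda>k. ennreal ((norm (f n x - f (M (k + n0)) x))\<^sup>2))"
        using glim
      proof eventually_elim
        case (elim x)
        have "(\<lambda>k. f (M (k + n0)) x) \<longlonglongrightarrow> g x" using elim by (rule LIMSEQ_ignore_initial_segment)
        then have "(\<lambda>k. ennreal ((norm (f n x - f (M (k + n0)) x))\<^sup>2)) \<longlonglongrightarrow> ennreal ((norm (f n x - g x))\<^sup>2)"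
          by (intro tendsto_intros)
        then show ?case by (intro lim_imp_Liminf[symmetric]) auto
      qed
    qed
    also have "\<dots> \<le> liminf (\<lambda>k. \<integral>\<^sup>+x. ennreal ((norm (f n x - f (M (k + n0)) x))\<^sup>2) \<partial>lebesgue_on A)"
      by (intro nn_integral_liminf) measurable
    also have "\<dots> \<le> liminf (\<lambda>k. ennreal (e\<^sup>2))"
    proof (intro Liminf_mono always_eventually allI)
      fix k
      have "n0 \<le> M (k + n0)" using M(3)[of "k + n0"] by simp
      then have "L2_norm A (\<lambda>x. f n x - f (M (k + n0)) x) \<le> e" using n by (auto intro: less_imp_le)
      then show "(\<integral>\<^sup>+x. ennreal ((norm (f n x - f (M (k + n0)) x))\<^sup>2) \<partial>lebesgue_on A) \<le> ennreal (e\<^sup>2)"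
        using f by (subst nn_integral_L2) (auto intro!: ennreal_leI power_mono)
    qed
    also have "\<dots> = ennreal (e\<^sup>2)" by (simp add: Liminf_const)
    finally show ?thesis .
  qed
  have diff: "(\<lambda>x. f n x - g x) \<in> L2 A \<and> L2_norm A (\<lambda>x. f n x - g x) \<le> e"
    if "0 < e" and "\<And>m. m \<ge> n0 \<Longrightarrow> L2_norm A (\<lambda>x. f n x - f m x) < e" for n n0 e
  proof -
    have le: "(\<integral>\<^sup>+x. ennreal ((norm (f n x - g x))\<^sup>2) \<partial>lebesgue_on A) \<le> ennreal (e\<^sup>2)"
      using that by (rule bound)
    then have "(\<lambda>x. f n x - g x) \<in> L2 A"
      unfolding L2_iff_nn_integral by (auto intro: le_less_trans)
    moreover from this have "ennreal ((L2_norm A (\<lambda>x. f n x - g x))\<^sup>2) \<le> ennreal (e\<^sup>2)"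
      using le by (subst (asm) nn_integral_L2)
    then have "L2_norm A (\<lambda>x. f n x - g x) \<le> e"
      using \<open>0 < e\<close> by (simp add: power2_le_iff_abs_le)
    ultimately show ?thesis by simp
  qed
  obtain n1 where "\<And>m n. m \<ge> n1 \<Longrightarrow> n \<ge> n1 \<Longrightarrow> L2_norm A (\<lambda>x. f m x - f n x) < 1"
    using cau[of 1] by auto
  \<comment> \<open>Fatou only controls differences with \<open>g\<close>. That \<open>g\<close>
    itself is square integrable follows by subtracting such a difference from
    \<open>f n1\<close>.\<close>
  then have "(\<lambda>x. f n1 x - g x) \<in> L2 A" using diff[of 1 n1 n1] by auto
  then have "(\<lambda>x. f n1 x - (f n1 x - g x)) \<in> L2 A" by (rule L2_diff[OF f])
  then have "g \<in> L2 A" by simp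
  moreover have "(\<lambda>n. L2_norm A (\<lambda>x. f n x - g x)) \<longlonglongrightarrow> 0"
  proof (rule LIMSEQ_I)
    fix e :: real assume "0 < e"
    then have e2: "0 < e / 2" by simp
    then obtain n2 where n2: "\<forall>m\<ge>n2. \<forall>n\<ge>n2. L2_norm A (\<lambda>x. f m x - f n x) < e / 2"
      using cau by meson
    have "L2_norm A (\<lambda>x. f n x - g x) < e" if "n \<ge> n2" for n
    proof -
      have "L2_norm A (\<lambda>x. f n x - g x) \<le> e / 2" using diff[OF e2, of n2 n] n2 that by blast
      then show ?thesis using \<open>0 < e\<close> by linarith
    qed
    then show "\<exists>no. \<forall>n\<ge>no. norm (L2_norm A (\<lambda>x. f n x - g x) - 0) < e"
      by simp (blast)
  qed
  ultimately show ?thesis by (intro bexI[of _ g])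
qed

section \<open>Smooth functions and weak gradients\<close>

lemma GDERIV_continuous: "(\<And>x. GDERIV f x :> G x) \<Longrightarrow> continuous_on UNIV f"
  by (auto simp: gderiv_def intro!: continuous_at_imp_continuous_on has_derivative_continuous)

lemma GDERIV_unique:
  assumes "GDERIV f x :> a" "GDERIV f x :> b"
  shows "a = (b::'a::real_inner)"
proof -
  have "(\<lambda>h. inner h a) = (\<lambda>h. inner h b)"
    using assms unfolding gderiv_def by (rule has_derivative_unique)
  then have "inner (a - b) a = inner (a - b) b" by (rule fun_cong)
  then have "inner (a - b) (a - b) = 0" by (simp add: inner_diff_right)
  then show ?thesis by simp
qed

lemma C_k_const: "C_k k (\<lambda>x. c)"
proof (induction k arbitrary: c)
  case (Suc k)
  then show ?case by (auto intro!: exI[of _ "\<lambda>x. 0"] GDERIV_const)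
qed simp

lemma C_k_add: "C_k k f \<Longrightarrow> C_k k g \<Longrightarrow> C_k k (\<lambda>x. f x + g x)"
proof (induction k arbitrary: f g)
  case (Suc k)
  then obtain F G where "\<forall>x. GDERIV f x :> F x" "\<forall>b\<in>Basis. C_k k (\<lambda>x. F x \<bullet> b)"
    "\<forall>x. GDERIV g x :> G x" "\<forall>b\<in>Basis. C_k k (\<lambda>x. G x \<bullet> b)"
    by auto
  then show ?case
    using Suc.IH by (auto intro!: exI[of _ "\<lambda>x. F x + G x"] GDERIV_add simp: inner_add_left)
qed (auto intro: continuous_intros)

lemma C_k_Suc_imp: "C_k (Suc k) f \<Longrightarrow> C_k k f"
proof (induction k arbitrary: f)
  case 0
  then show ?case by (auto intro: GDERIV_continuous)
next
  case (Suc k)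
  obtain G where "\<forall>x. GDERIV f x :> G x" "\<forall>b\<in>Basis. C_k (Suc k) (\<lambda>x. G x \<bullet> b)"
    using Suc.prems by (subst (asm) C_k.simps(2)) blast
  with Suc.IH show ?case by auto
qed

lemma C_k_mult: "C_k k f \<Longrightarrow> C_k k g \<Longrightarrow> C_k k (\<lambda>x. f x * g x)"
proof (induction k arbitrary: f g)
  case (Suc k)
  then obtain F G where FG: "\<forall>x. GDERIV f x :> F x" "\<forall>b\<in>Basis. C_k k (\<lambda>x. F x \<bullet> b)"
    "\<forall>x. GDERIV g x :> G x" "\<forall>b\<in>Basis. C_k k (\<lambda>x. G x \<bullet> b)"
    by auto
  have fg: "C_k k f" "C_k k g"
    using Suc.prems by (blast intro: C_k_Suc_imp)+
  have "C_k k (\<lambda>x. f x * (G x \<bullet> b) + g x * (F x \<bullet> b))" if "b \<in> Basis" for b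
    using FG that by (intro C_k_add Suc.IH fg) auto
  with FG show ?case
    by (auto intro!: exI[of _ "\<lambda>x. f x *\<^sub>R G x + g x *\<^sub>R F x"] GDERIV_mult simp: inner_add_left)
qed (auto intro: continuous_intros)

lemma smooth_const [simp]: "smooth (\<lambda>x. c)"
  by (simp add: smooth_def C_k_const)

lemma smooth_add: "smooth f \<Longrightarrow> smooth g \<Longrightarrow> smooth (\<lambda>x. f x + g x)"
  by (simp add: smooth_def C_k_add)

lemma smooth_mult: "smooth f \<Longrightarrow> smooth g \<Longrightarrow> smooth (\<lambda>x. f x * g x)"
  by (simp add: smooth_def C_k_mult)

lemma smooth_cmult: "smooth f \<Longrightarrow> smooth (\<lambda>x. c * f x)"
  using smooth_mult[OF smooth_const] .

lemma smooth_prod: "(\<And>i. i \<in> I \<Longrightarrow> smooth (f i)) \<Longrightarrow> smooth (\<lambda>x. \<Prod>i\<in>I. f i x)"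
  by (induction I rule: infinite_finite_induct) (auto intro: smooth_mult)

lemma smooth_gradient:
  fixes f :: "'a::euclidean_space \<Rightarrow> real"
  assumes "smooth f"
  obtains G where "\<And>x. GDERIV f x :> G x" "continuous_on UNIV G"
proof -
  have "C_k (Suc 0) f" using assms by (auto simp: smooth_def simp del: C_k.simps)
  then obtain G where "\<forall>x. GDERIV f x :> G x" "\<forall>b\<in>Basis. continuous_on UNIV (\<lambda>x. G x \<bullet> b)"
    by auto
  then show ?thesis by (intro that[of G]) (auto intro: continuous_on_componentwise[THEN iffD2])
qed

lemma smooth_continuous: "smooth f \<Longrightarrow> continuous_on A f"
  by (metis C_k.simps(1) continuous_on_subset smooth_def subset_UNIV)

section \<open>Flat functions and smooth approximation of boxes\<close>

definition flat_exp :: "nat \<Rightarrow> real \<Rightarrow> real" where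
  "flat_exp n x = (if x \<le> 0 then 0 else exp (- 1 / x) / x ^ n)"

lemma power_div_fact_le_exp: "0 \<le> y \<Longrightarrow> y ^ n / fact n \<le> exp (y::real)"
proof -
  assume "0 \<le> y"
  then have "(\<Sum>k\<in>{n}. y ^ k /\<^sub>R fact k) \<le> exp y"
    unfolding exp_def by (intro sum_le_suminf summable_exp_generic) auto
  then show ?thesis by (simp add: divide_inverse mult.commute)
qed

text \<open>One term of the exponential series, that of order \<open>n + 2\<close> at
  \<open>1 / x\<close>, beats the pole of order \<open>n\<close> with two powers to spare. A
  quadratic bound is what forces derivative 0 at the origin.\<close>

lemma flat_exp_bound: "\<bar>flat_exp n x\<bar> \<le> fact (n + 2) * x\<^sup>2"
proof (cases "x \<le> 0")
  case False
  then have x: "0 < x" by simp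
  define K :: real where "K = fact (n + 2)"
  have K: "0 < K" by (simp add: K_def)
  have "(1 / x) ^ (n + 2) / K \<le> exp (1 / x)"
    unfolding K_def using x by (intro power_div_fact_le_exp) simp
  then have "1 \<le> (K * x ^ (n + 2)) * exp (1 / x)"
    using x K by (simp add: power_one_over divide_le_eq mult_ac)
  then have "exp (- 1 / x) \<le> K * x ^ (n + 2)"
    using x by (simp add: exp_minus divide_simps)
  then have "exp (- 1 / x) / x ^ n \<le> K * x\<^sup>2"
    using x by (simp add: divide_le_eq power_add power2_eq_square mult_ac)
  then show ?thesis using x by (simp add: flat_exp_def K_def)
qed (simp add: flat_exp_def)

lemma DERIV_zero_quadratic:
  fixes g :: "real \<Rightarrow> real"
  assumes "\<And>x. \<bar>g x\<bar> \<le> C * x\<^sup>2"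
  shows "DERIV g 0 :> 0"
proof -
  have g0: "g 0 = 0" using assms[of 0] by simp
  have C: "0 \<le> C" using assms[of 1] by simp
  have "((\<lambda>h. g h / h) \<longlongrightarrow> 0) (at 0)"
  proof (rule Lim_null_comparison)
    have "norm (g h / h) \<le> C * \<bar>h\<bar>" if "h \<noteq> 0" for h
      using assms[of h] that by (simp add: divide_le_eq power2_eq_square abs_mult)
    then show "\<forall>\<^sub>F h in at 0. norm (g h / h) \<le> C * \<bar>h\<bar>"
      by (auto simp: eventually_at_filter)
    show "((\<lambda>h. C * \<bar>h\<bar>) \<longlongrightarrow> 0) (at 0)"
      by (auto intro!: tendsto_eq_intros)
  qed
  then show ?thesis by (simp add: DERIV_def g0)
qed

text \<open>The family over \<open>n\<close> is introduced because it is closed under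
  differentiation up to linear combinations. The three cases are the flat side, the gluing point,
  where the quadratic bound is used, and the explicit formula.\<close>

lemma DERIV_flat_exp: "DERIV (flat_exp n) x :> flat_exp (n + 2) x - real n * flat_exp (n + 1) x"
proof -
  consider "x < 0" | "x = 0" | "0 < x" by linarith
  then show ?thesis
  proof cases
    case 1
    have "DERIV (\<lambda>x. 0) x :> (0::real)" by simp
    then have "DERIV (flat_exp n) x :> 0"
      by (rule has_field_derivative_transform_within_open[where S = "{..<0}"])
        (use 1 in \<open>auto simp: flat_exp_def\<close>)
    then show ?thesis using 1 by (simp add: flat_exp_def)
  next
    case 2
    have "DERIV (flat_exp n) 0 :> 0"
      using flat_exp_bound by (rule DERIV_zero_quadratic)
    then show ?thesis using 2 by (simp add: flat_exp_def)
  next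
    case 3
    have "DERIV (\<lambda>x. exp (- 1 / x) / x ^ n) x :> exp (- 1 / x) / x ^ (n + 2) - real n * (exp (- 1 / x) / x ^ (n + 1))"
      using 3 by (auto intro!: derivative_eq_intros simp: power2_eq_square field_simps)
        (cases n; simp add: field_simps)
    then have "DERIV (flat_exp n) x :> exp (- 1 / x) / x ^ (n + 2) - real n * (exp (- 1 / x) / x ^ (n + 1))"
      by (rule has_field_derivative_transform_within_open[where S = "{0<..}"])
        (use 3 in \<open>auto simp: flat_exp_def\<close>)
    then show ?thesis using 3 by (simp add: flat_exp_def)
  qed
qed

lemma GDERIV_affine: "GDERIV (\<lambda>x. c * (x \<bullet> i) + d) x :> c *\<^sub>R (i::'a::euclidean_space)"
  by (auto simp: gderiv_def intro!: derivative_eq_intros)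

text \<open>The induction on the order of differentiability keeps \<open>n\<close> arbitrary, since
  the derivative of member \<open>n\<close> involves members \<open>n + 1\<close> and
  \<open>n + 2\<close>.\<close>

lemma smooth_flat_exp: "smooth (\<lambda>x::'a::euclidean_space. flat_exp n (c * (x \<bullet> i) + d))"
proof -
  have "C_k k (\<lambda>x::'a. flat_exp n (c * (x \<bullet> i) + d))" for k
  proof (induction k arbitrary: n)
    case 0
    have "isCont (flat_exp n) x" for x using DERIV_flat_exp by (rule DERIV_isCont)
    then have "continuous_on UNIV (flat_exp n)" by (simp add: continuous_at_imp_continuous_on)
    then show ?case
      by (auto intro!: continuous_on_compose2[of UNIV "flat_exp n"] continuous_intros)
  next
    case (Suc k)
    let ?G = "\<lambda>x::'a. (flat_exp (n + 2) (c * (x \<bullet> i) + d) - real n * flat_exp (n + 1) (c * (x \<bullet> i) + d)) *\<^sub>R (c *\<^sub>R i)"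
    have "GDERIV (\<lambda>x::'a. flat_exp n (c * (x \<bullet> i) + d)) x :> ?G x" for x
      by (rule GDERIV_DERIV_compose[OF GDERIV_affine DERIV_flat_exp])
    moreover have "C_k k (\<lambda>x. ?G x \<bullet> b)" for b
    proof -
      have "C_k k (\<lambda>x. (c * (i \<bullet> b)) * flat_exp (n + 2) (c * (x \<bullet> i) + d)
          + (- real n * c * (i \<bullet> b)) * flat_exp (n + 1) (c * (x \<bullet> i) + d))"
        by (intro C_k_add C_k_mult C_k_const Suc.IH)
      then show ?thesis by (simp add: algebra_simps)
    qed
    ultimately show ?case unfolding C_k.simps by (intro exI[of _ ?G] conjI allI ballI)
  qed
  then show ?thesis by (simp add: smooth_def)
qed

lemma flat_exp_0: "0 \<le> flat_exp 0 x" "flat_exp 0 x \<le> 1" "flat_exp 0 x \<noteq> 0 \<longleftrightarrow> 0 < x"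
  by (auto simp: flat_exp_def)

text \<open>Dilating the argument turns the flat function into a step function; products of such
  steps give indicators of boxes.\<close>

lemma flat_exp_tendsto: "(\<lambda>m. flat_exp 0 (real (Suc m) * x)) \<longlonglongrightarrow> (if 0 < x then 1 else 0)"
proof (cases "0 < x")
  case True
  have "(\<lambda>m. exp (- (1 / x) * inverse (real (Suc m)))) \<longlonglongrightarrow> exp (- (1 / x) * 0)"
    by (intro tendsto_intros LIMSEQ_inverse_real_of_nat)
  moreover have "exp (- (1 / x) * inverse (real (Suc m))) = flat_exp 0 (real (Suc m) * x)" for m
  proof -
    have "0 < real (Suc m) * x" using True by simp
    then show ?thesis by (simp add: flat_exp_def not_le divide_inverse mult.commute del: of_nat_Suc)
  qed
  ultimately show ?thesis using True by simp
next
  case False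
  then have "flat_exp 0 (real (Suc m) * x) = 0" for m
    by (simp add: flat_exp_def mult_le_0_iff)
  then show ?thesis using False by simp
qed

text \<open>One rising and one falling flat factor per coordinate: the product is nonzero only
  inside the open box and tends to 1 there under dilation. The closed box provides the compact
  support and the dominating function.\<close>

lemma test_functions_approximate_box:
  fixes a b :: "'a::euclidean_space"
  assumes "cbox a b \<subseteq> U"
  obtains \<psi> where "\<And>m::nat. test_function U (\<psi> m)" "\<And>m x. 0 \<le> \<psi> m x \<and> \<psi> m x \<le> indicator (cbox a b) x"
    "\<And>x. (\<lambda>m. \<psi> m x) \<longlonglongrightarrow> indicator (box a b) x"
proof -
  let ?p = "\<lambda>m x i. flat_exp 0 (real (Suc m) * (x \<bullet> i - a \<bullet> i)) * flat_exp 0 (real (Suc m) * (b \<bullet> i - x \<bullet> i))"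
  define \<psi> where "\<psi> m x = (\<Prod>i\<in>Basis. ?p m x i)" for m :: nat and x :: 'a
  have sm: "smooth (\<psi> m)" for m
  proof -
    have "smooth (\<lambda>x::'a. flat_exp 0 (real (Suc m) * (x \<bullet> i) + - (real (Suc m) * (a \<bullet> i)))
        * flat_exp 0 (- real (Suc m) * (x \<bullet> i) + real (Suc m) * (b \<bullet> i)))" for i
      by (intro smooth_mult smooth_flat_exp)
    then have "smooth (\<lambda>x::'a. ?p m x i)" for i by (simp add: algebra_simps)
    then show ?thesis unfolding \<psi>_def by (intro smooth_prod)
  qed
  have supp: "{x. \<psi> m x \<noteq> 0} \<subseteq> box a b" for m
    by (auto simp: \<psi>_def mem_box flat_exp_0(3) zero_less_mult_iff simp del: of_nat_Suc)
  have cl: "closure {x. \<psi> m x \<noteq> 0} \<subseteq> cbox a b" for m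
    using supp[of m] box_subset_cbox[of a b] by (intro closure_minimal) auto
  have "compact (closure {x. \<psi> m x \<noteq> 0})" for m
    using cl[of m] by (meson bounded_cbox bounded_subset closed_closure compact_eq_bounded_closed)
  then have 1: "test_function U (\<psi> m)" for m
    using sm cl[of m] assms by (auto simp: test_function_def)
  have 0: "0 \<le> \<psi> m x" for m x by (auto simp: \<psi>_def intro!: prod_nonneg mult_nonneg_nonneg flat_exp_0)
  have "\<psi> m x \<le> 1" for m x
    unfolding \<psi>_def by (intro prod_le_1) (auto intro!: flat_exp_0 mult_le_one mult_nonneg_nonneg)
  then have 2: "0 \<le> \<psi> m x \<and> \<psi> m x \<le> indicator (cbox a b) x" for m x
    using 0[of m x] supp[of m] box_subset_cbox[of a b] by (cases "\<psi> m x = 0") (auto simp: indicator_def)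
  have 3: "(\<lambda>m. \<psi> m x) \<longlonglongrightarrow> indicator (box a b) x" for x
  proof -
    have "(\<lambda>m. \<psi> m x) \<longlonglongrightarrow> (\<Prod>i\<in>Basis. (if 0 < x \<bullet> i - a \<bullet> i then 1 else 0) * (if 0 < b \<bullet> i - x \<bullet> i then 1 else 0))"
      unfolding \<psi>_def by (intro tendsto_intros flat_exp_tendsto)
    also have "(\<Prod>i\<in>Basis. (if 0 < x \<bullet> i - a \<bullet> i then 1 else 0) * (if 0 < b \<bullet> i - x \<bullet> i then 1 else 0))
        = (indicator (box a b) x :: real)"
    proof (cases "x \<in> box a b")
      case False
      then obtain i where "i \<in> Basis" "\<not> (a \<bullet> i < x \<bullet> i \<and> x \<bullet> i < b \<bullet> i)" by (auto simp: mem_box)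
      then show ?thesis using False by (auto intro!: prod_zero bexI[of _ i])
    qed (auto simp: mem_box)
    finally show ?thesis .
  qed
  show ?thesis using that[of \<psi>] 1 2 3 by blast
qed

section \<open>Fundamental lemma of the calculus of variations\<close>

lemma AE_zero_if_box_integrals_zero:
  fixes g :: "'a::euclidean_space \<Rightarrow> real"
  assumes g: "integrable lborel g"
    and z: "\<And>a b. (LINT x|lborel. indicator (box a b) x * g x) = 0"
  shows "AE x in lborel. g x = 0"
proof -
  let ?M = "density lborel (\<lambda>x. ennreal (g x))" and ?N = "density lborel (\<lambda>x. ennreal (- g x))"
  have [measurable]: "g \<in> borel_measurable borel" using g by (simp add: borel_measurable_integrable)
  have fin: "(\<integral>\<^sup>+x. ennreal (h x) \<partial>lborel) < \<infinity>" if "integrable lborel h" for h :: "'a \<Rightarrow> real"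
    using that by (simp add: integrableD(2) order_top_class.top.not_eq_extremum real_integrable_def)
  have i: "integrable lborel (\<lambda>x. indicator (box a b) x * g x)" for a b
    using g by (intro integrable_mult_indicator[where 'b=real, simplified]) auto
  have eM: "emeasure ?M (box a b) = (\<integral>\<^sup>+x. ennreal (indicator (box a b) x * g x) \<partial>lborel)" for a b
    by (auto simp: emeasure_density indicator_def intro!: nn_integral_cong)
  have eN: "emeasure ?N (box a b) = (\<integral>\<^sup>+x. ennreal (- (indicator (box a b) x * g x)) \<partial>lborel)" for a b
    by (auto simp: emeasure_density indicator_def intro!: nn_integral_cong)
  \<comment> \<open>Boxes form an intersection-stable generator, so the measures whose densities are
    the positive and the negative part of \<open>g\<close> coincide. By uniqueness of densities the
    two parts are equal almost everywhere, which is possible only where \<open>g\<close>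
    vanishes.\<close>
  have "?M = ?N"
  proof (rule measure_eqI_generator_eq[where E = "range (\<lambda>(a, b). box a b)" and \<Omega> = UNIV
        and A = "\<lambda>n. box (- (real n *\<^sub>R One)) (real n *\<^sub>R One)"])
    show "Int_stable (range (\<lambda>(a, b). box a b :: 'a set))"
      by (auto simp: Int_stable_def box_Int_box)
    fix X :: "'a set" assume "X \<in> range (\<lambda>(a, b). box a b)"
    then obtain a b where X: "X = box a b" by auto
    have "0 = enn2real (emeasure ?M X) - enn2real (emeasure ?N X)"
      using z[of a b] real_lebesgue_integral_def[OF i[of a b]] by (simp add: X eM eN)
    moreover have "emeasure ?M X < \<infinity>" "emeasure ?N X < \<infinity>"
      unfolding X eM eN using i by (intro fin; simp)+
    ultimately show "emeasure ?M X = emeasure ?N X"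
      by (metis add_0 diff_eq_eq ennreal_enn2real infinity_ennreal_def)
  next
    show "emeasure ?M (box (- (real n *\<^sub>R One)) (real n *\<^sub>R One)) \<noteq> \<infinity>" for n
      using fin[OF i, of "- (real n *\<^sub>R One)" "real n *\<^sub>R One"] by (simp add: eM less_top)
  qed (auto simp: borel_eq_box UN_box_eq_UNIV)
  then have "AE x in lborel. ennreal (g x) = ennreal (- g x)"
    by (intro sigma_finite_measure.density_unique[OF lborel.sigma_finite_measure_axioms]) auto
  then show ?thesis
  proof eventually_elim
    case (elim x)
    then show ?case by (cases "0 \<le> g x") (auto simp: ennreal_neg)
  qed
qed

text \<open>Test functions converge to indicators of boxes inside \<open>U\<close>, so
  \<open>G\<close> has zero integral over each such box. This gives \<open>G = 0\<close> on each
  box, and countably many boxes cover \<open>U\<close>.\<close>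

lemma fundamental_lemma:
  fixes G :: "'a::euclidean_space \<Rightarrow> 'b::euclidean_space"
  assumes U: "open U" and G: "G \<in> L2 U"
    and z: "\<And>\<psi>. test_function U \<psi> \<Longrightarrow> (LINT x|lebesgue_on U. \<psi> x *\<^sub>R G x) = 0"
  shows "AE x in lebesgue_on U. G x = 0"
proof -
  have Us: "U \<in> sets lebesgue" using U by simp
  have bs: "box c d \<in> sets lebesgue" for c d :: 'a by (intro sets_completionI_sets) simp
  \<comment> \<open>Dominated convergence along the smooth approximations of the box; on the compact
    box \<open>G\<close> is integrable because it is square integrable on a set of finite
    measure.\<close>
  have box0: "(LINT x|lebesgue. indicator (box a b) x *\<^sub>R G x) = 0"
    and boxi: "integrable lebesgue (\<lambda>x. indicator (cbox a b) x *\<^sub>R G x)" if ab: "cbox a b \<subseteq> U" for a b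
  proof -
    have L: "G \<in> L2 (cbox a b)" by (rule L2_subset(1)[OF G ab _ Us]) simp
    have "integrable (lebesgue_on (cbox a b)) G" by (rule L2_integrable[OF L]) simp
    then show i: "integrable lebesgue (\<lambda>x. indicator (cbox a b) x *\<^sub>R G x)"
      by (simp add: integrable_restrict_space)
    obtain \<psi> where \<psi>: "\<And>m::nat. test_function U (\<psi> m)" "\<And>m x. 0 \<le> \<psi> m x \<and> \<psi> m x \<le> indicator (cbox a b) x"
      "\<And>x. (\<lambda>m. \<psi> m x) \<longlonglongrightarrow> indicator (box a b) x"
      using test_functions_approximate_box[OF ab] by blast
    have eq: "indicator U x *\<^sub>R (\<psi> m x *\<^sub>R G x) = \<psi> m x *\<^sub>R (indicator (cbox a b) x *\<^sub>R G x)" for m x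
    proof (cases "x \<in> cbox a b")
      case False
      then have "\<psi> m x = 0" using \<psi>(2)[of m x] by simp
      then show ?thesis by simp
    next
      case True
      then show ?thesis using ab by auto
    qed
    have s0: "(LINT x|lebesgue. \<psi> m x *\<^sub>R (indicator (cbox a b) x *\<^sub>R G x)) = 0" for m
      using z[OF \<psi>(1)[of m]] Us by (simp add: integral_restrict_space eq del: scaleR_scaleR)
    have "(\<lambda>m. LINT x|lebesgue. \<psi> m x *\<^sub>R (indicator (cbox a b) x *\<^sub>R G x))
        \<longlonglongrightarrow> (LINT x|lebesgue. indicator (box a b) x *\<^sub>R (indicator (cbox a b) x *\<^sub>R G x))"
    proof (rule integral_dominated_convergence)
      show "integrable lebesgue (\<lambda>x. norm (indicator (cbox a b) x *\<^sub>R G x))" using i by (rule integrable_norm)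
      have m: "(\<lambda>x. indicator (cbox a b) x *\<^sub>R G x) \<in> borel_measurable lebesgue"
        using i by (rule borel_measurable_integrable)
      then show "(\<lambda>x. indicator (box a b) x *\<^sub>R (indicator (cbox a b) x *\<^sub>R G x)) \<in> borel_measurable lebesgue"
        by (rule borel_measurable_scaleR[rotated]) (rule borel_measurable_indicator[OF bs])
      fix m
      have "\<psi> m \<in> borel_measurable borel"
        using \<psi>(1)[of m] by (auto simp: test_function_def intro!: borel_measurable_continuous_onI smooth_continuous)
      then have "\<psi> m \<in> borel_measurable lebesgue" by (intro measurable_completion) simp
      with m show "(\<lambda>x. \<psi> m x *\<^sub>R (indicator (cbox a b) x *\<^sub>R G x)) \<in> borel_measurable lebesgue"
        by (rule borel_measurable_scaleR[rotated])
      have "\<bar>\<psi> m x\<bar> \<le> 1" for x using \<psi>(2)[of m x] indicator_le_1[of "cbox a b" x, where 'a = real] by linarith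
      then show "AE x in lebesgue. norm (\<psi> m x *\<^sub>R (indicator (cbox a b) x *\<^sub>R G x)) \<le> norm (indicator (cbox a b) x *\<^sub>R G x)"
        unfolding norm_scaleR[of "\<psi> m _"] by (intro AE_I2 mult_left_le_one_le) auto
    qed (use \<psi>(3) in \<open>auto intro!: tendsto_intros\<close>)
    then have "(LINT x|lebesgue. indicator (box a b) x *\<^sub>R (indicator (cbox a b) x *\<^sub>R G x)) = 0"
      unfolding s0 by (rule LIMSEQ_unique[OF tendsto_const, symmetric])
    moreover have "indicator (box a b) x *\<^sub>R (indicator (cbox a b) x *\<^sub>R G x) = indicator (box a b) x *\<^sub>R G x" for x
      using box_subset_cbox[of a b] by (auto simp: indicator_def)
    ultimately show "(LINT x|lebesgue. indicator (box a b) x *\<^sub>R G x) = 0" by (simp only:)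
  qed
  \<comment> \<open>Componentwise: cut off to the box, pass to a Borel version and apply the
    criterion for real functions on the whole space.\<close>
  have local: "AE x in lebesgue. x \<in> cbox a b \<longrightarrow> G x = 0" if ab: "cbox a b \<subseteq> U" for a b
  proof -
    have "AE x in lebesgue. indicator (box a b) x * (G x \<bullet> e) = 0" for e
    proof -
      define h where "h x = indicator (box a b) x * (G x \<bullet> e)" for x
      have "integrable lebesgue (\<lambda>x. indicator (box a b) x * (indicator (cbox a b) x *\<^sub>R G x \<bullet> e))"
        using integrable_inner_left[of e lebesgue, OF boxi[OF ab]]
        by (intro integrable_mult_indicator[where 'b=real, simplified]) auto
      moreover have "indicator (box a b) x * (indicator (cbox a b) x *\<^sub>R G x \<bullet> e) = h x" for x
        using box_subset_cbox[of a b] by (auto simp: indicator_def h_def)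
      ultimately have hi: "integrable lebesgue h" by simp
      obtain k where k: "k \<in> borel_measurable borel" "AE x in lebesgue. h x = k x"
        using ex_borel_version_lebesgue[OF borel_measurable_integrable[OF hi]] by (elim bexE) auto
      have kb: "k \<in> borel_measurable lborel" using k(1) by simp
      have ki: "integrable lborel k"
        using integrable_lebesgue_cong_AE[OF hi k(2)] integrable_completion[OF kb] by simp
      have "AE x in lborel. k x = 0"
      proof (rule AE_zero_if_box_integrals_zero[OF ki])
        fix c d :: 'a
        \<comment> \<open>An arbitrary box meets \<open>box a b\<close> in a box that still lies in
          \<open>U\<close>, so the vanishing of integrals inside \<open>U\<close> covers all
          boxes.\<close>
        obtain c' d' where cd: "box c d \<inter> box a b = box c' d'" "cbox c d \<inter> cbox a b = cbox c' d'"
          unfolding box_Int_box Int_interval by blast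
        have m: "(\<lambda>x. indicator (box c d) x * k x) \<in> borel_measurable lborel" using kb by measurable
        have "(LINT x|lborel. indicator (box c d) x * k x) = (LINT x|lebesgue. indicator (box c d) x * k x)"
          using integral_completion[OF m] by simp
        also have "\<dots> = (LINT x|lebesgue. indicator (box c d) x * h x)"
          by (rule integral_lebesgue_cong_AE) (use k(2) in \<open>eventually_elim, simp\<close>)
        also have "\<dots> = (LINT x|lebesgue. (indicator (box c' d') x *\<^sub>R G x) \<bullet> e)"
          by (intro Bochner_Integration.integral_cong) (auto simp: h_def indicator_def simp flip: cd)
        also have "\<dots> = (LINT x|lebesgue. indicator (box c' d') x *\<^sub>R G x) \<bullet> e"
        proof (rule integral_inner_left)
          assume "e \<noteq> 0"
          have "cbox c' d' \<subseteq> U" using cd(2) ab by blast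
          then have "integrable lebesgue (\<lambda>x. indicator (cbox c' d') x *\<^sub>R G x)" by (rule boxi)
          then have "integrable lebesgue (\<lambda>x. indicator (box c' d') x *\<^sub>R (indicator (cbox c' d') x *\<^sub>R G x))"
            by (rule integrable_mult_indicator[OF bs])
          moreover have "indicator (box c' d') x *\<^sub>R (indicator (cbox c' d') x *\<^sub>R G x) = indicator (box c' d') x *\<^sub>R G x" for x
            using box_subset_cbox[of c' d'] by (auto simp: indicator_def)
          ultimately show "integrable lebesgue (\<lambda>x. indicator (box c' d') x *\<^sub>R G x)" by (simp only:)
        qed
        also have "\<dots> = 0" using box0[of c' d'] cd(2) ab by fastforce
        finally show "(LINT x|lborel. indicator (box c d) x * k x) = 0" .
      qed
      then have "AE x in lebesgue. k x = 0" by (rule AE_completion)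
      with k(2) show ?thesis unfolding h_def by eventually_elim simp
    qed
    then have "AE x in lebesgue. \<forall>e\<in>Basis. indicator (box a b) x * (G x \<bullet> e) = 0"
      by (subst AE_ball_countable) (auto intro: countable_finite)
    \<comment> \<open>The cut-off only sees the open box; the frontier is negligible.\<close>
    moreover have "AE x in lebesgue. x \<notin> cbox a b - box a b"
      using negligible_frontier_interval[of a b] by (intro AE_not_in) (simp add: negligible_iff_null_sets)
    ultimately show ?thesis
      by eventually_elim (auto intro!: euclidean_eqI[where 'a='b])
  qed
  obtain D where D: "countable D" "\<And>X. X \<in> D \<Longrightarrow> X \<subseteq> U" "\<And>X. X \<in> D \<Longrightarrow> \<exists>a b. X = cbox a b" "\<Union>D = U"
    using open_countable_Union_open_cbox[OF U] by (metis PowD subset_iff)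
  have "AE x in lebesgue. \<forall>X\<in>D. x \<in> X \<longrightarrow> G x = 0"
    using D(1) local D(2,3) by (subst AE_ball_countable) metis+
  then have "AE x in lebesgue. x \<in> U \<longrightarrow> G x = 0"
    by eventually_elim (use D(4) in blast)
  then show ?thesis using Us by (simp add: AE_restrict_space_iff)
qed

lemma continuous_imp_lebesgue_on:
  fixes f :: "'a::euclidean_space \<Rightarrow> 'b::euclidean_space"
  assumes "continuous_on UNIV f" "A \<in> sets lebesgue"
  shows "f \<in> borel_measurable (lebesgue_on A)"
proof -
  have "f \<in> borel_measurable borel" using assms(1) by (rule borel_measurable_continuous_onI)
  then have "f \<in> borel_measurable lebesgue" by (intro measurable_completion) simp
  then show ?thesis by (rule measurable_restrict_space1)
qed

lemma continuous_imp_L2: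
  fixes f :: "'a::euclidean_space \<Rightarrow> 'b::euclidean_space"
  assumes f: "continuous_on UNIV f" and A: "bounded A" "A \<in> sets lebesgue"
  shows "f \<in> L2 A"
proof -
  have "compact (f ` closure A)"
    using f A by (intro compact_continuous_image) (auto simp: compact_eq_bounded_closed intro: continuous_on_subset)
  then obtain B where "\<And>y. y \<in> f ` closure A \<Longrightarrow> norm y \<le> B"
    using compact_imp_bounded bounded_iff by metis
  then have "\<And>x. x \<in> A \<Longrightarrow> norm (f x) \<le> B" using closure_subset by blast
  then show ?thesis
    using A by (intro L2_bounded[where B = B] continuous_imp_lebesgue_on f bounded_set_imp_lmeasurable AE_I2) auto
qed

lemma test_function_gradient:
  fixes \<psi> :: "'a::euclidean_space \<Rightarrow> real"
  assumes "test_function U \<psi>" "\<And>x. GDERIV \<psi> x :> d\<psi> x"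
  shows "continuous_on UNIV \<psi>" "continuous_on UNIV d\<psi>"
    "\<And>x. x \<notin> closure {x. \<psi> x \<noteq> 0} \<Longrightarrow> \<psi> x = 0 \<and> d\<psi> x = 0"
proof -
  have sm: "smooth \<psi>" using assms(1) by (simp add: test_function_def)
  then show "continuous_on UNIV \<psi>" by (rule smooth_continuous)
  \<comment> \<open>The given gradient is known only pointwise. Uniqueness of gradients identifies
    it with the continuous one supplied by smoothness.\<close>
  obtain G where G: "\<And>x. GDERIV \<psi> x :> G x" "continuous_on UNIV G" using smooth_gradient[OF sm] by blast
  have "d\<psi> x = G x" for x by (rule GDERIV_unique[OF assms(2) G(1)])
  then have "d\<psi> = G" by (rule ext)
  then show "continuous_on UNIV d\<psi>" using G(2) by simp
  fix x assume x: "x \<notin> closure {x. \<psi> x \<noteq> 0}"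
  have "x \<notin> {x. \<psi> x \<noteq> 0}" using closure_subset x by (rule contra_subsetD)
  moreover have "GDERIV \<psi> x :> 0"
    unfolding gderiv_def
  proof (rule has_derivative_transform_within_open[where f = "\<lambda>x. 0"])
    show "open (- closure {x. \<psi> x \<noteq> 0})" by (rule open_Compl[OF closed_closure])
    show "0 = \<psi> y" if "y \<in> - closure {x. \<psi> x \<noteq> 0}" for y
      using that closure_subset[of "{x. \<psi> x \<noteq> 0}"] by auto
  qed (use x in auto)
  ultimately show "\<psi> x = 0 \<and> d\<psi> x = 0" using GDERIV_unique[OF assms(2)] by auto
qed

lemma test_function_L2:
  fixes \<psi> :: "'a::euclidean_space \<Rightarrow> real"
  assumes "test_function U \<psi>" "\<And>x. GDERIV \<psi> x :> d\<psi> x" "bounded U" "U \<in> sets lebesgue"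
  shows "\<psi> \<in> L2 U" "d\<psi> \<in> L2 U"
  using continuous_imp_L2[OF test_function_gradient(1)[OF assms(1,2)] assms(3,4)]
    continuous_imp_L2[OF test_function_gradient(2)[OF assms(1,2)] assms(3,4)] by auto

lemma L2_integrable_scaleR:
  fixes f :: "'a::euclidean_space \<Rightarrow> real" and G :: "'a \<Rightarrow> 'b::euclidean_space"
  assumes "f \<in> L2 A" "G \<in> L2 A"
  shows "integrable (lebesgue_on A) (\<lambda>x. f x *\<^sub>R G x)"
proof (rule Bochner_Integration.integrable_bound)
  show "integrable (lebesgue_on A) (\<lambda>x. (norm (f x))\<^sup>2 + (norm (G x))\<^sup>2)"
    using assms by (auto simp: L2_def)
  show "(\<lambda>x. f x *\<^sub>R G x) \<in> borel_measurable (lebesgue_on A)"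
    using assms by (auto simp: L2_def)
  have "norm (f x *\<^sub>R G x) \<le> (norm (f x))\<^sup>2 + (norm (G x))\<^sup>2" for x
  proof -
    have "2 * norm (f x) * norm (G x) \<le> (norm (f x))\<^sup>2 + (norm (G x))\<^sup>2"
      by (rule sum_squares_bound)
    moreover have "0 \<le> norm (f x) * norm (G x)" by simp
    ultimately have "norm (f x) * norm (G x) \<le> (norm (f x))\<^sup>2 + (norm (G x))\<^sup>2" by linarith
    then show ?thesis by simp
  qed
  then show "AE x in lebesgue_on A. norm (f x *\<^sub>R G x) \<le> norm ((norm (f x))\<^sup>2 + (norm (G x))\<^sup>2)"
    by (auto intro: order_trans)
qed

section \<open>Calculus of weak gradients\<close>

lemma has_weak_gradient_L2:
  "has_weak_gradient U u G \<Longrightarrow> u \<in> L2 U" "has_weak_gradient U u G \<Longrightarrow> G \<in> L2 U"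
  by (auto simp: has_weak_gradient_def)

lemma has_weak_gradient_unique:
  fixes U :: "'a::euclidean_space set"
  assumes U: "open U" "bounded U" and G: "has_weak_gradient U u G" and H: "has_weak_gradient U u H"
  shows "AE x in lebesgue_on U. G x = H x"
proof -
  have "AE x in lebesgue_on U. G x - H x = 0"
  proof (rule fundamental_lemma[OF U(1)])
    show "(\<lambda>x. G x - H x) \<in> L2 U"
      using has_weak_gradient_L2[OF G] has_weak_gradient_L2[OF H] by blast
    fix \<psi> :: "'a \<Rightarrow> real" assume t: "test_function U \<psi>"
    then have sm: "smooth \<psi>" by (simp add: test_function_def)
    obtain d\<psi> where d: "\<And>x. GDERIV \<psi> x :> d\<psi> x"
      using smooth_gradient[OF sm] by metis
    have "\<psi> \<in> L2 U" using test_function_L2(1)[OF t d] U by simp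
    then have "integrable (lebesgue_on U) (\<lambda>x. \<psi> x *\<^sub>R G x)" "integrable (lebesgue_on U) (\<lambda>x. \<psi> x *\<^sub>R H x)"
      using has_weak_gradient_L2[OF G] has_weak_gradient_L2[OF H] by (auto intro: L2_integrable_scaleR)
    then have "(LINT x|lebesgue_on U. \<psi> x *\<^sub>R (G x - H x))
        = (LINT x|lebesgue_on U. \<psi> x *\<^sub>R G x) - (LINT x|lebesgue_on U. \<psi> x *\<^sub>R H x)"
      by (simp add: scaleR_diff_right)
    also have "\<dots> = 0"
    proof -
      have "(LINT x|lebesgue_on U. u x *\<^sub>R d\<psi> x) = - (LINT x|lebesgue_on U. \<psi> x *\<^sub>R G x)"
        "(LINT x|lebesgue_on U. u x *\<^sub>R d\<psi> x) = - (LINT x|lebesgue_on U. \<psi> x *\<^sub>R H x)"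
        using G H t d unfolding has_weak_gradient_def by blast+
      then show ?thesis by simp
    qed
    finally show "(LINT x|lebesgue_on U. \<psi> x *\<^sub>R (G x - H x)) = 0" .
  qed
  then show ?thesis by simp
qed

lemma weak_gradient:
  assumes "has_weak_gradient U u G"
  shows "has_weak_gradient U u (weak_gradient U u)"
  unfolding weak_gradient_def by (rule someI[where P = "has_weak_gradient U u", OF assms])

lemma weak_gradient_AE:
  assumes "open U" "bounded U" "has_weak_gradient U u G"
  shows "AE x in lebesgue_on U. weak_gradient U u x = G x"
  using has_weak_gradient_unique[OF assms(1,2) weak_gradient[OF assms(3)] assms(3)] .

lemma H1_iff: "u \<in> H1 U \<longleftrightarrow> has_weak_gradient U u (weak_gradient U u)"
  using weak_gradient by (auto simp: H1_def)

lemma has_weak_gradient_add: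
  fixes U :: "'a::euclidean_space set"
  assumes U: "open U" "bounded U" and G: "has_weak_gradient U u G" and H: "has_weak_gradient U v H"
  shows "has_weak_gradient U (\<lambda>x. u x + v x) (\<lambda>x. G x + H x)"
  unfolding has_weak_gradient_def
proof (intro conjI allI impI)
  note L = has_weak_gradient_L2[OF G] has_weak_gradient_L2[OF H]
  show "(\<lambda>x. u x + v x) \<in> L2 U" "(\<lambda>x. G x + H x) \<in> L2 U" using L by auto
  fix \<psi> d\<psi> assume t: "test_function U \<psi>" "\<forall>x. GDERIV \<psi> x :> d\<psi> x"
  then have p: "\<psi> \<in> L2 U" "d\<psi> \<in> L2 U" using test_function_L2[OF t(1), of d\<psi>] U by auto
  have e: "(LINT x|lebesgue_on U. u x *\<^sub>R d\<psi> x) = - (LINT x|lebesgue_on U. \<psi> x *\<^sub>R G x)"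
    "(LINT x|lebesgue_on U. v x *\<^sub>R d\<psi> x) = - (LINT x|lebesgue_on U. \<psi> x *\<^sub>R H x)"
    using G H t unfolding has_weak_gradient_def by blast+
  show "(LINT x|lebesgue_on U. (u x + v x) *\<^sub>R d\<psi> x) = - (LINT x|lebesgue_on U. \<psi> x *\<^sub>R (G x + H x))"
    using L2_integrable_scaleR[OF L(1) p(2)] L2_integrable_scaleR[OF L(3) p(2)]
      L2_integrable_scaleR[OF p(1) L(2)] L2_integrable_scaleR[OF p(1) L(4)]
    by (simp add: scaleR_add_left scaleR_add_right e)
qed

lemma has_weak_gradient_cmult:
  assumes "has_weak_gradient U u G"
  shows "has_weak_gradient U (\<lambda>x. c * u x) (\<lambda>x. c *\<^sub>R G x)"
  unfolding has_weak_gradient_def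
proof (intro conjI allI impI)
  note L = has_weak_gradient_L2[OF assms]
  show "(\<lambda>x. c * u x) \<in> L2 U" "(\<lambda>x. c *\<^sub>R G x) \<in> L2 U" using L by auto
  fix \<psi> d\<psi> assume t: "test_function U \<psi>" "\<forall>x. GDERIV \<psi> x :> d\<psi> x"
  have "(LINT x|lebesgue_on U. (c * u x) *\<^sub>R d\<psi> x) = c *\<^sub>R (LINT x|lebesgue_on U. u x *\<^sub>R d\<psi> x)"
    by (simp flip: scaleR_scaleR)
  also have "\<dots> = - (LINT x|lebesgue_on U. \<psi> x *\<^sub>R (c *\<^sub>R G x))"
  proof -
    have "(LINT x|lebesgue_on U. u x *\<^sub>R d\<psi> x) = - (LINT x|lebesgue_on U. \<psi> x *\<^sub>R G x)"
      using assms t unfolding has_weak_gradient_def by blast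
    moreover have "\<psi> x *\<^sub>R (c *\<^sub>R G x) = c *\<^sub>R (\<psi> x *\<^sub>R G x)" for x
      by (simp add: mult.commute)
    ultimately show ?thesis by (simp only: integral_scaleR_right scaleR_minus_right)
  qed
  finally show "(LINT x|lebesgue_on U. (c * u x) *\<^sub>R d\<psi> x) = - (LINT x|lebesgue_on U. \<psi> x *\<^sub>R c *\<^sub>R G x)" .
qed

lemma has_weak_gradient_zero: "has_weak_gradient U (\<lambda>x. 0) (\<lambda>x. 0)"
  by (auto simp: has_weak_gradient_def)

lemma has_weak_gradient_diff:
  assumes "open U" "bounded U" "has_weak_gradient U u G" "has_weak_gradient U v H"
  shows "has_weak_gradient U (\<lambda>x. u x - v x) (\<lambda>x. G x - H x)"
  using has_weak_gradient_add[OF assms(1-3) has_weak_gradient_cmult[OF assms(4), of "-1"]] by simp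

lemma has_weak_gradient_sum:
  assumes "open U" "bounded U" "\<And>i. i \<in> I \<Longrightarrow> has_weak_gradient U (u i) (G i)"
  shows "has_weak_gradient U (\<lambda>x. \<Sum>i\<in>I. u i x) (\<lambda>x. \<Sum>i\<in>I. G i x)"
  using assms(3)
  by (induction I rule: infinite_finite_induct)
    (auto intro: has_weak_gradient_zero has_weak_gradient_add[OF assms(1,2)])

lemma has_weak_gradient_cong_AE:
  assumes U: "U \<in> sets lebesgue" and G: "has_weak_gradient U u G"
    and eq: "AE x in lebesgue_on U. G x = H x"
  shows "has_weak_gradient U u H"
  unfolding has_weak_gradient_def
proof (intro conjI allI impI)
  show "u \<in> L2 U" "H \<in> L2 U" using G L2_cong_AE[OF U _ eq] by (auto simp: has_weak_gradient_def)
  fix \<psi> d\<psi> assume t: "test_function U \<psi>" "\<forall>x. GDERIV \<psi> x :> d\<psi> x"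
  have "(LINT x|lebesgue_on U. \<psi> x *\<^sub>R G x) = (LINT x|lebesgue_on U. \<psi> x *\<^sub>R H x)"
    using eq by (intro integral_lebesgue_on_cong_AE[OF U]) auto
  then show "(LINT x|lebesgue_on U. u x *\<^sub>R d\<psi> x) = - (LINT x|lebesgue_on U. \<psi> x *\<^sub>R H x)"
    using G t unfolding has_weak_gradient_def by metis
qed

lemma H1_norm_eq:
  assumes "open U" "bounded U" "has_weak_gradient U u G"
  shows "H1_norm U u = sqrt ((L2_norm U u)\<^sup>2 + (L2_norm U G)\<^sup>2)"
proof -
  have "L2_norm U (weak_gradient U u) = L2_norm U G"
    using weak_gradient_AE[OF assms] assms(1) by (intro L2_norm_cong_AE) auto
  then show ?thesis by (simp add: H1_norm_def)
qed

lemma H1_norm_bounds: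
  assumes "open U" "bounded U" "has_weak_gradient U u G"
  shows "L2_norm U u \<le> H1_norm U u" "L2_norm U G \<le> H1_norm U u"
    "H1_norm U u \<le> L2_norm U u + L2_norm U G"
  unfolding H1_norm_eq[OF assms]
  by (auto intro: real_le_rsqrt sqrt_sum_squares_le_sum)

lemma norm_LINT_scaleR_le:
  fixes f :: "'a::euclidean_space \<Rightarrow> real" and G :: "'a \<Rightarrow> 'b::euclidean_space"
  assumes "f \<in> L2 U" "G \<in> L2 U"
  shows "norm (LINT x|lebesgue_on U. f x *\<^sub>R G x) \<le> L2_norm U f * L2_norm U G"
proof -
  have nL: "(\<lambda>x. \<bar>f x\<bar>) \<in> L2 U" "(\<lambda>x. norm (G x)) \<in> L2 U"
    using assms by (auto simp: L2_def)
  have "norm (LINT x|lebesgue_on U. f x *\<^sub>R G x) \<le> (LINT x|lebesgue_on U. norm (f x *\<^sub>R G x))"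
    by (rule integral_norm_bound)
  also have "\<dots> = L2_inner U (\<lambda>x. \<bar>f x\<bar>) (\<lambda>x. norm (G x))"
    by (simp add: L2_inner_def)
  also have "\<dots> \<le> L2_norm U (\<lambda>x. \<bar>f x\<bar>) * L2_norm U (\<lambda>x. norm (G x))"
    using L2_Cauchy_Schwarz[OF nL] by linarith
  also have "\<dots> = L2_norm U f * L2_norm U G"
    by (simp add: L2_norm_def)
  finally show ?thesis .
qed

lemma tendsto_if_norm_diff_le:
  fixes a :: "nat \<Rightarrow> 'a::real_normed_vector"
  assumes "\<And>n. norm (a n - l) \<le> e n * c" "e \<longlonglongrightarrow> 0"
  shows "a \<longlonglongrightarrow> l"
proof -
  have "(\<lambda>n. e n * c) \<longlonglongrightarrow> 0" using tendsto_mult_left_zero[OF assms(2)] .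
  then have "(\<lambda>n. a n - l) \<longlonglongrightarrow> 0"
    by (rule Lim_null_comparison[rotated]) (simp add: assms(1))
  then show ?thesis by (rule LIM_zero_cancel)
qed

text \<open>The weak gradient is a closed operator: for a fixed test function both sides of the
  defining identity are continuous in the norm of \<open>L2\<close>, by Cauchy-Schwarz.\<close>

lemma has_weak_gradient_limit:
  fixes U :: "'a::euclidean_space set"
  assumes U: "open U" "bounded U" and w: "\<And>n. has_weak_gradient U (u n) (G n)"
    and v: "v \<in> L2 U" "(\<lambda>n. L2_norm U (\<lambda>x. u n x - v x)) \<longlonglongrightarrow> 0"
    and H: "H \<in> L2 U" "(\<lambda>n. L2_norm U (\<lambda>x. G n x - H x)) \<longlonglongrightarrow> 0"
  shows "has_weak_gradient U v H"
  unfolding has_weak_gradient_def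
proof (intro conjI allI impI v H)
  fix \<psi> d\<psi> assume t: "test_function U \<psi>" "\<forall>x. GDERIV \<psi> x :> d\<psi> x"
  then have p: "\<psi> \<in> L2 U" "d\<psi> \<in> L2 U" using test_function_L2[OF t(1), of d\<psi>] U by auto
  note L = has_weak_gradient_L2[OF w]
  have 1: "(\<lambda>n. LINT x|lebesgue_on U. u n x *\<^sub>R d\<psi> x) \<longlonglongrightarrow> (LINT x|lebesgue_on U. v x *\<^sub>R d\<psi> x)"
  proof (rule tendsto_if_norm_diff_le[OF _ v(2)])
    fix n
    have "(LINT x|lebesgue_on U. u n x *\<^sub>R d\<psi> x) - (LINT x|lebesgue_on U. v x *\<^sub>R d\<psi> x)
        = (LINT x|lebesgue_on U. (u n x - v x) *\<^sub>R d\<psi> x)"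
      using L2_integrable_scaleR[OF L(1) p(2), of n] L2_integrable_scaleR[OF v(1) p(2)] by (simp add: scaleR_diff_left)
    also have "norm \<dots> \<le> L2_norm U (\<lambda>x. u n x - v x) * L2_norm U d\<psi>"
      by (intro norm_LINT_scaleR_le L2_diff L v p)
    finally show "norm ((LINT x|lebesgue_on U. u n x *\<^sub>R d\<psi> x) - (LINT x|lebesgue_on U. v x *\<^sub>R d\<psi> x))
        \<le> L2_norm U (\<lambda>x. u n x - v x) * L2_norm U d\<psi>" .
  qed
  have 2: "(\<lambda>n. LINT x|lebesgue_on U. \<psi> x *\<^sub>R G n x) \<longlonglongrightarrow> (LINT x|lebesgue_on U. \<psi> x *\<^sub>R H x)"
  proof (rule tendsto_if_norm_diff_le[OF _ H(2)])
    fix n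
    have "(LINT x|lebesgue_on U. \<psi> x *\<^sub>R G n x) - (LINT x|lebesgue_on U. \<psi> x *\<^sub>R H x)
        = (LINT x|lebesgue_on U. \<psi> x *\<^sub>R (G n x - H x))"
      using L2_integrable_scaleR[OF p(1) L(2), of n] L2_integrable_scaleR[OF p(1) H(1)] by (simp add: scaleR_diff_right)
    also have "norm \<dots> \<le> L2_norm U \<psi> * L2_norm U (\<lambda>x. G n x - H x)"
      by (intro norm_LINT_scaleR_le L2_diff L H p)
    finally show "norm ((LINT x|lebesgue_on U. \<psi> x *\<^sub>R G n x) - (LINT x|lebesgue_on U. \<psi> x *\<^sub>R H x))
        \<le> L2_norm U (\<lambda>x. G n x - H x) * L2_norm U \<psi>" by (simp add: mult.commute)
  qed
  have "(LINT x|lebesgue_on U. u n x *\<^sub>R d\<psi> x) = - (LINT x|lebesgue_on U. \<psi> x *\<^sub>R G n x)" for n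
    using w[of n] t unfolding has_weak_gradient_def by blast
  then show "(LINT x|lebesgue_on U. v x *\<^sub>R d\<psi> x) = - (LINT x|lebesgue_on U. \<psi> x *\<^sub>R H x)"
    using 1 tendsto_minus[OF 2] by (simp add: LIMSEQ_unique)
qed

section \<open>Integration by parts against smooth functions\<close>

lemma integral_gradient_eq_0:
  fixes F :: "'a::euclidean_space \<Rightarrow> real"
  assumes F: "\<And>x. GDERIV F x :> dF x" "continuous_on UNIV dF"
    and K: "compact K" "\<And>x. x \<notin> K \<Longrightarrow> F x = 0 \<and> dF x = 0"
  shows "(LINT x|lborel. dF x \<bullet> b) = 0"
proof -
  have Fc: "continuous_on UNIV F" using F(1) by (rule GDERIV_continuous)
  obtain B where B: "\<And>x. norm (dF x) \<le> B"
  proof -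
    have "compact (dF ` K)" using F(2) K(1) by (auto intro: compact_continuous_image continuous_on_subset)
    then obtain B where "\<And>y. y \<in> dF ` K \<Longrightarrow> norm y \<le> B" "0 < B"
      using compact_imp_bounded bounded_pos by metis
    then have "norm (dF x) \<le> B" for x using K(2)[of x] by (cases "x \<in> K") auto
    then show ?thesis using that by blast
  qed
  have B0: "0 \<le> B" using B[of 0] norm_ge_zero order_trans by blast
  \<comment> \<open>The gradient is continuous with compact support, hence bounded; the resulting
    Lipschitz bound dominates all difference quotients.\<close>
  have lip: "\<bar>F (x + h) - F x\<bar> \<le> B * norm h" for x h
  proof -
    have "norm (F (x + h) - F x) \<le> B * norm (x + h - x)"
    proof (rule differentiable_bound[where S = UNIV and f' = "\<lambda>x h. inner h (dF x)"])
      show "(F has_derivative (\<lambda>h. h \<bullet> dF x)) (at x within UNIV)" for x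
        using F(1) by (simp add: gderiv_def)
      show "onorm (\<lambda>h. h \<bullet> dF x) \<le> B" for x
      proof (rule onorm_le)
        fix h
        have "norm (h \<bullet> dF x) \<le> norm h * norm (dF x)" using Cauchy_Schwarz_ineq2[of h "dF x"] by simp
        also have "\<dots> \<le> norm h * B" using B by (intro mult_left_mono) auto
        finally show "norm (h \<bullet> dF x) \<le> B * norm h" by (simp add: mult.commute)
      qed
    qed auto
    then show ?thesis by simp
  qed
  define t where "t n = inverse (real (Suc n))" for n
  have t: "0 < t n" "t n \<le> 1" for n by (auto simp: t_def inverse_le_1_iff)
  have t0: "t \<longlonglongrightarrow> 0" unfolding t_def by (rule LIMSEQ_inverse_real_of_nat)
  have Fint: "integrable lborel F"
  proof -
    have "integrable lborel (\<lambda>x. indicator K x *\<^sub>R F x)"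
      using K(1) Fc by (intro borel_integrable_compact) (auto intro: continuous_on_subset)
    moreover have "indicator K x *\<^sub>R F x = F x" for x using K(2)[of x] by (auto simp: indicator_def)
    ultimately show ?thesis by (simp only:)
  qed
  have shift: "integrable lborel (\<lambda>x. F (x + h))" "(LINT x|lborel. F (x + h)) = (LINT x|lborel. F x)" for h
  proof -
    have d: "distr lborel borel (\<lambda>x. h + x) = lborel" by (rule lborel_distr_plus)
    have "F \<in> borel_measurable borel" using Fc by (rule borel_measurable_continuous_onI)
    then have "integrable lborel (\<lambda>x. F (h + x)) \<longleftrightarrow> integrable (distr lborel borel (\<lambda>x. h + x)) F"
      "(LINT x|distr lborel borel (\<lambda>x. h + x). F x) = (LINT x|lborel. F (h + x))"
      by (auto intro!: integrable_distr_eq[symmetric] integral_distr)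
    then show "integrable lborel (\<lambda>x. F (x + h))" "(LINT x|lborel. F (x + h)) = (LINT x|lborel. F x)"
      using Fint unfolding d by (auto simp: add.commute)
  qed
  \<comment> \<open>By translation invariance every difference quotient has integral zero. The
    derivative inherits this in the limit.\<close>
  have z: "(LINT x|lborel. (F (x + t n *\<^sub>R b) - F x) / t n) = 0" for n
    using shift[of "t n *\<^sub>R b"] Fint by simp
  \<comment> \<open>The points that reach \<open>K\<close> by a move \<open>s *\<^sub>R b\<close>
    with \<open>s\<close> in the unit interval. Outside this compact set all difference quotients
    with step at most 1 vanish.\<close>
  define K' where "K' = (\<lambda>(x, s). x + s *\<^sub>R (- b)) ` (K \<times> {0..1})"
  have K': "compact K'" unfolding K'_def
    by (intro compact_continuous_image compact_Times K(1) compact_Icc) (auto intro!: continuous_intros simp: case_prod_beta)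
  have "(\<lambda>n. LINT x|lborel. (F (x + t n *\<^sub>R b) - F x) / t n) \<longlonglongrightarrow> (LINT x|lborel. dF x \<bullet> b)"
  proof (rule integral_dominated_convergence)
    have "integrable lborel (\<lambda>x. indicator K' x *\<^sub>R (B * norm b))"
      using K' by (intro borel_integrable_compact) auto
    then show "integrable lborel (\<lambda>x. indicator K' x * (B * norm b))" by simp
    show "(\<lambda>x. dF x \<bullet> b) \<in> borel_measurable lborel"
      using F(2) by (auto intro!: borel_measurable_continuous_onI continuous_intros)
    show "(\<lambda>x. (F (x + t n *\<^sub>R b) - F x) / t n) \<in> borel_measurable lborel" for n
      using shift(1) Fint by (auto intro!: borel_measurable_integrable)
    show "AE x in lborel. (\<lambda>n. (F (x + t n *\<^sub>R b) - F x) / t n) \<longlonglongrightarrow> dF x \<bullet> b"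
    proof (rule AE_I2)
      fix x
      have "((\<lambda>s. F (x + s *\<^sub>R b)) has_derivative (\<lambda>s. (s *\<^sub>R b) \<bullet> dF (x + 0 *\<^sub>R b))) (at 0)"
        by (rule has_derivative_compose[where g = F and f = "\<lambda>s. x + s *\<^sub>R b"])
          (use F(1) in \<open>auto intro!: derivative_eq_intros simp: gderiv_def\<close>)
      then have "DERIV (\<lambda>s. F (x + s *\<^sub>R b)) 0 :> dF x \<bullet> b"
        by (simp add: has_field_derivative_def inner_commute mult_commute_abs)
      then have "((\<lambda>s. (F (x + s *\<^sub>R b) - F x) / s) \<longlongrightarrow> dF x \<bullet> b) (at 0)"
        by (simp add: DERIV_def)
      moreover have "filterlim t (at 0) sequentially"
        using t0 t(1) by (auto simp: filterlim_at less_imp_neq[THEN not_sym])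
      ultimately show "(\<lambda>n. (F (x + t n *\<^sub>R b) - F x) / t n) \<longlonglongrightarrow> dF x \<bullet> b"
        by (rule filterlim_compose)
    qed
    show "AE x in lborel. norm ((F (x + t n *\<^sub>R b) - F x) / t n) \<le> indicator K' x * (B * norm b)" for n
    proof (rule AE_I2)
      fix x
      show "norm ((F (x + t n *\<^sub>R b) - F x) / t n) \<le> indicator K' x * (B * norm b)"
      proof (cases "x \<in> K'")
        case True
        have "\<bar>F (x + t n *\<^sub>R b) - F x\<bar> \<le> B * norm (t n *\<^sub>R b)" by (rule lip)
        then show ?thesis using t[of n] True by (simp add: divide_le_eq mult_ac)
      next
        case False
        have "x + s *\<^sub>R b \<notin> K" if "0 \<le> s" "s \<le> 1" for s
        proof
          assume "x + s *\<^sub>R b \<in> K"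
          then have "(\<lambda>(x, s). x + s *\<^sub>R (- b)) (x + s *\<^sub>R b, s) \<in> K'"
            unfolding K'_def using that by (intro imageI) auto
          then show False using False by simp
        qed
        from this[of 0] this[of "t n"] have "F x = 0" "F (x + t n *\<^sub>R b) = 0" using K(2) t[of n] by (auto intro: less_imp_le)
        then show ?thesis using False by simp
      qed
    qed
  qed
  then show ?thesis unfolding z by (rule LIMSEQ_unique[OF tendsto_const, symmetric])
qed

text \<open>The product of \<open>u\<close> with a test function is continuously differentiable with
  compact support in \<open>U\<close>, so its gradient integrates to zero; the product rule splits
  this into the two sides of the weak identity.\<close>

lemma has_weak_gradient_smooth:
  fixes U :: "'a::euclidean_space set"
  assumes U: "open U" "bounded U" and u: "smooth u" "\<And>x. GDERIV u x :> G x"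
  shows "has_weak_gradient U u G"
  unfolding has_weak_gradient_def
proof (intro conjI allI impI)
  obtain G' where G': "\<And>x. GDERIV u x :> G' x" "continuous_on UNIV G'"
    using smooth_gradient[OF u(1)] by metis
  have "G x = G' x" for x by (rule GDERIV_unique[OF u(2) G'(1)])
  then have Gc: "continuous_on UNIV G" using G'(2) by presburger
  have uc: "continuous_on UNIV u" using u(1) by (rule smooth_continuous)
  have Us: "U \<in> sets lebesgue" using U by simp
  show L: "u \<in> L2 U" "G \<in> L2 U" by (intro continuous_imp_L2 Gc uc U Us)+
  fix \<psi> d\<psi> assume t: "test_function U \<psi>" "\<forall>x. GDERIV \<psi> x :> d\<psi> x"
  then have d: "\<And>x. GDERIV \<psi> x :> d\<psi> x" by simp
  note p = test_function_L2[OF t(1) d U(2) Us] and T = test_function_gradient[OF t(1) d]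
  let ?K = "closure {x. \<psi> x \<noteq> 0}"
  have K: "compact ?K" "?K \<subseteq> U" using t(1) by (auto simp: test_function_def simp del: compact_closure)
  define dF where "dF x = u x *\<^sub>R d\<psi> x + \<psi> x *\<^sub>R G x" for x
  have dFc: "continuous_on UNIV dF" unfolding dF_def by (intro continuous_intros uc Gc T)
  have i: "integrable (lebesgue_on U) dF"
    unfolding dF_def using L2_integrable_scaleR[OF L(1) p(2)] L2_integrable_scaleR[OF p(1) L(2)] by simp
  have "(LINT x|lebesgue_on U. dF x) \<bullet> b = 0" for b
  proof -
    have "(LINT x|lebesgue_on U. dF x) \<bullet> b = (LINT x|lebesgue_on U. dF x \<bullet> b)"
      using i by (intro integral_inner_left[symmetric])
    also have "\<dots> = (LINT x|lebesgue. indicator U x *\<^sub>R (dF x \<bullet> b))"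
      using Us by (simp add: integral_restrict_space)
    also have "\<dots> = (LINT x|lebesgue. dF x \<bullet> b)"
    proof (rule Bochner_Integration.integral_cong)
      fix x
      show "indicator U x *\<^sub>R (dF x \<bullet> b) = dF x \<bullet> b"
      proof (cases "x \<in> U")
        case False
        then have "x \<notin> ?K" using K(2) by blast
        then show ?thesis using T(3)[of x] by (simp add: dF_def)
      qed simp
    qed simp
    also have "\<dots> = (LINT x|lborel. dF x \<bullet> b)"
      using dFc by (intro integral_completion) (auto intro!: borel_measurable_continuous_onI continuous_intros)
    also have "\<dots> = 0"
    proof (rule integral_gradient_eq_0[where F = "\<lambda>x. u x * \<psi> x" and K = ?K])
      show "GDERIV (\<lambda>x. u x * \<psi> x) x :> dF x" for x
        unfolding dF_def using u(2) d by (rule GDERIV_mult)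
      show "u x * \<psi> x = 0 \<and> dF x = 0" if "x \<notin> ?K" for x
        using T(3)[OF that] by (simp add: dF_def)
    qed (use dFc K in auto)
    finally show ?thesis .
  qed
  then have "(LINT x|lebesgue_on U. dF x) = 0" by (auto intro!: euclidean_eqI[where 'a='a])
  then show "(LINT x|lebesgue_on U. u x *\<^sub>R d\<psi> x) = - (LINT x|lebesgue_on U. \<psi> x *\<^sub>R G x)"
    unfolding dF_def using L2_integrable_scaleR[OF L(1) p(2)] L2_integrable_scaleR[OF p(1) L(2)]
    by (simp add: add_eq_0_iff)
qed

text \<open>A test function on \<open>V\<close> is one on \<open>U\<close>, and it vanishes together
  with its gradient outside \<open>V\<close>, so both integrals may be taken over either
  set.\<close>

lemma has_weak_gradient_subset:
  fixes U V :: "'a::euclidean_space set"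
  assumes w: "has_weak_gradient U u G" and V: "V \<subseteq> U" "open V" "open U"
  shows "has_weak_gradient V u G"
  unfolding has_weak_gradient_def
proof (intro conjI allI impI)
  have s: "U \<in> sets lebesgue" "V \<in> sets lebesgue" using V by auto
  show "u \<in> L2 V" "G \<in> L2 V"
    using L2_subset(1)[OF _ V(1) s(2,1)] has_weak_gradient_L2[OF w] by auto
  fix \<psi> d\<psi> assume t: "test_function V \<psi>" "\<forall>x. GDERIV \<psi> x :> d\<psi> x"
  have tU: "test_function U \<psi>" using t(1) V(1) by (auto simp: test_function_def)
  have z: "\<psi> x = 0 \<and> d\<psi> x = 0" if "x \<notin> V" for x
    using test_function_gradient(3)[OF t(1), of d\<psi> x] t that by (auto simp: test_function_def)
  have eq: "(LINT x|lebesgue_on V. h x) = (LINT x|lebesgue_on U. h x)" if "\<And>x. x \<notin> V \<Longrightarrow> h x = 0" for h :: "'a \<Rightarrow> 'a"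
    using s V(1) that by (simp add: integral_restrict_space) (intro Bochner_Integration.integral_cong, auto simp: indicator_def)
  show "(LINT x|lebesgue_on V. u x *\<^sub>R d\<psi> x) = - (LINT x|lebesgue_on V. \<psi> x *\<^sub>R G x)"
    using w tU t(2) z unfolding has_weak_gradient_def by (simp add: eq)
qed

section \<open>Coordinate slices of the perforated cell\<close>

lemma mem_cell_Y: "y \<in> cell_Y \<longleftrightarrow> (\<forall>i. 0 < y $ i \<and> y $ i < 1)"
  by (simp add: cell_Y_def mem_box_cart)

lemma mem_Y_star: "y \<in> Y_star \<rho> \<longleftrightarrow> y \<in> cell_Y \<and> \<rho> < norm (y - x_M)"
  by (auto simp: Y_star_def dist_norm norm_minus_commute)

lemma open_cell_Y: "open (cell_Y :: (real ^ 'n) set)"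
  by (simp add: cell_Y_def open_box)

lemma open_Y_star: "open (Y_star \<rho> :: (real ^ 'n) set)"
  unfolding Y_star_def by (intro open_Diff open_cell_Y closed_cball)

lemma bounded_cell_Y: "bounded (cell_Y :: (real ^ 'n) set)"
  by (simp add: cell_Y_def)

lemma bounded_Y_star: "bounded (Y_star \<rho> :: (real ^ 'n) set)"
  unfolding Y_star_def by (rule bounded_subset[OF bounded_cell_Y]) auto

lemma cell_Y_lmeasurable [simp, intro]: "(cell_Y :: (real ^ 'n) set) \<in> lmeasurable"
  by (simp add: cell_Y_def)

lemma Y_star_sets [simp, intro]: "(Y_star \<rho> :: (real ^ 'n) set) \<in> sets lebesgue"
  by (intro sets_completionI_sets) (simp add: borel_open[OF open_Y_star])

lemma Y_star_borel [measurable, simp, intro]: "(Y_star \<rho> :: (real ^ 'n) set) \<in> sets borel"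
  by (rule borel_open[OF open_Y_star])

lemma cell_Y_borel [measurable, simp, intro]: "(cell_Y :: (real ^ 'n) set) \<in> sets borel"
  by (rule borel_open[OF open_cell_Y])

lemma Y_star_lmeasurable [simp, intro]: "(Y_star \<rho> :: (real ^ 'n) set) \<in> lmeasurable"
  using bounded_Y_star Y_star_sets by (rule bounded_set_imp_lmeasurable)

lemma Y_star_antimono: "\<rho> \<le> \<sigma> \<Longrightarrow> Y_star \<sigma> \<subseteq> Y_star \<rho>"
  by (auto simp: mem_Y_star)

lemma prod_Basis_vec: "(\<Prod>b\<in>(Basis :: (real ^ 'n) set). f b) = (\<Prod>i\<in>UNIV. f (axis i 1))"
proof -
  have "(Basis :: (real ^ 'n) set) = range (\<lambda>i. axis i 1)" by (auto simp: Basis_vec_def)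
  moreover have "inj (\<lambda>i. axis i (1::real))" by (simp add: inj_on_def axis_eq_axis)
  ultimately show ?thesis using prod.reindex[of "\<lambda>i. axis i 1" UNIV f] by (simp only: o_def)
qed

lemma emeasure_cell_Y: "emeasure lborel (cell_Y :: (real ^ 'n) set) = 1"
  by (simp add: cell_Y_def emeasure_lborel_box_eq prod_Basis_vec inner_axis) (auto simp: Basis_vec_def inner_axis)

lemma subst_coord_nth [simp]: "subst_coord i a y $ j = (if j = i then a else y $ j)"
  by (simp add: subst_coord_def)

lemma subst_coord_eq: "subst_coord i a y = y + (a - y $ i) *\<^sub>R axis i 1"
  by (simp add: vec_eq_iff axis_def)

lemma subst_coord_self [simp]: "subst_coord i (y $ i) y = y"
  by (simp add: vec_eq_iff)

lemma continuous_subst_coord: "continuous_on UNIV (\<lambda>p. subst_coord i (fst p) (snd p))"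
  unfolding subst_coord_eq by (intro continuous_intros)

lemma measurable_subst_coord [measurable (raw)]:
  assumes "f \<in> borel_measurable M" "g \<in> borel_measurable M"
  shows "(\<lambda>x. subst_coord i (f x) (g x)) \<in> borel_measurable M"
proof -
  have "(\<lambda>p. subst_coord i (fst p) (snd p)) \<in> borel_measurable borel"
    using continuous_subst_coord by (rule borel_measurable_continuous_onI)
  from measurable_compose[OF borel_measurable_Pair[OF assms] this] show ?thesis by simp
qed

text \<open>Fubini in one coordinate without splitting the space: component \<open>i\<close> of
  \<open>y\<close> is a dummy running over an interval of length one, and \<open>s\<close> takes its
  place. The pushforward of the weighted product measure is recognised as \<open>lborel\<close> by
  its values on boxes.\<close>

lemma nn_integral_subst_coord:
  fixes g :: "real ^ 'n \<Rightarrow> ennreal"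
  assumes g [measurable]: "g \<in> borel_measurable borel"
  shows "(\<integral>\<^sup>+y. \<integral>\<^sup>+s. indicator {y. 0 < y $ i \<and> y $ i < 1} y * g (subst_coord i s y) \<partial>lborel \<partial>lborel)
    = (\<integral>\<^sup>+y. g y \<partial>lborel)"
proof -
  let ?S = "{y :: real ^ 'n. 0 < y $ i \<and> y $ i < 1}"
  let ?D = "density (lborel \<Otimes>\<^sub>M lborel) (\<lambda>p. indicator ?S (snd p))"
  define M where "M = distr ?D borel (\<lambda>p. subst_coord i (fst p) (snd p))"
  have S [measurable]: "?S \<in> sets borel" by measurable
  have T [measurable]: "(\<lambda>p. subst_coord i (fst p) (snd p)) \<in> borel_measurable (borel \<Otimes>\<^sub>M borel)"
    by measurable
  have "lborel = M"
  proof (rule lborel_eqI)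
    fix l u :: "real ^ 'n" assume lu: "\<And>b. b \<in> Basis \<Longrightarrow> l \<bullet> b \<le> u \<bullet> b"
    have lu': "l $ j \<le> u $ j" for j using lu[of "axis j 1"] by (simp add: inner_axis)
    \<comment> \<open>In the preimage of the box, side \<open>i\<close> becomes the range of
      \<open>s\<close>, while \<open>y\<close> receives the side from 0 to 1 instead.\<close>
    let ?l = "subst_coord i 0 l" and ?u = "subst_coord i 1 u"
    have "emeasure M (box l u) = (\<integral>\<^sup>+p. indicator ?S (snd p) * indicator (box l u) (subst_coord i (fst p) (snd p)) \<partial>(lborel \<Otimes>\<^sub>M lborel))"
    proof -
      have "emeasure M (box l u) = (\<integral>\<^sup>+x. indicator (box l u) x \<partial>M)" by (simp add: M_def)
      also have "\<dots> = (\<integral>\<^sup>+p. indicator (box l u) (subst_coord i (fst p) (snd p)) \<partial>?D)"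
        unfolding M_def by (rule nn_integral_distr) measurable
      also have "\<dots> = (\<integral>\<^sup>+p. indicator ?S (snd p) * indicator (box l u) (subst_coord i (fst p) (snd p)) \<partial>(lborel \<Otimes>\<^sub>M lborel))"
        by (rule nn_integral_density) measurable
      finally show ?thesis .
    qed
    also have "\<dots> = (\<integral>\<^sup>+p. indicator ({l $ i<..<u $ i} \<times> box ?l ?u) p \<partial>(lborel \<Otimes>\<^sub>M lborel))"
    proof (intro nn_integral_cong)
      fix p :: "real \<times> (real ^ 'n)"
      have "(snd p \<in> ?S \<and> subst_coord i (fst p) (snd p) \<in> box l u) \<longleftrightarrow> p \<in> {l $ i<..<u $ i} \<times> box ?l ?u"
        by (cases p) (auto simp: mem_box_cart split: if_splits)
      then show "indicator ?S (snd p) * indicator (box l u) (subst_coord i (fst p) (snd p))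
          = (indicator ({l $ i<..<u $ i} \<times> box ?l ?u) p :: ennreal)"
        by (auto simp: indicator_def split: if_splits)
    qed
    also have "\<dots> = emeasure lborel {l $ i<..<u $ i} * emeasure lborel (box ?l ?u)"
      by (simp add: lborel.emeasure_pair_measure_Times)
    also have "\<dots> = ennreal (u $ i - l $ i) * ennreal (\<Prod>b\<in>Basis. (?u - ?l) \<bullet> b)"
      using lu' by (subst emeasure_lborel_box) (auto simp: Basis_vec_def inner_axis)
    also have "\<dots> = ennreal ((u $ i - l $ i) * (\<Prod>j\<in>UNIV. (?u - ?l) $ j))"
      using lu' by (simp add: prod_Basis_vec inner_axis ennreal_mult' prod_nonneg)
    also have "(\<Prod>j\<in>UNIV. (?u - ?l) $ j) = (\<Prod>j\<in>UNIV - {i}. u $ j - l $ j)"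
      by (subst prod.remove[of _ i]) (auto intro: prod.cong)
    also have "(u $ i - l $ i) * \<dots> = (\<Prod>j\<in>UNIV. u $ j - l $ j)"
      by (subst (2) prod.remove[of _ i]) auto
    also have "\<dots> = (\<Prod>b\<in>Basis. (u - l) \<bullet> b)"
      by (simp add: prod_Basis_vec inner_axis)
    finally show "emeasure M (box l u) = ennreal (\<Prod>b\<in>Basis. (u - l) \<bullet> b)" .
  qed (simp add: M_def)
  then have "(\<integral>\<^sup>+y. g y \<partial>lborel) = (\<integral>\<^sup>+y. g y \<partial>M)" by simp
  also have "\<dots> = (\<integral>\<^sup>+p. indicator ?S (snd p) * g (subst_coord i (fst p) (snd p)) \<partial>(lborel \<Otimes>\<^sub>M lborel))"
    unfolding M_def by (simp add: nn_integral_distr nn_integral_density)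
  also have "\<dots> = (\<integral>\<^sup>+y. \<integral>\<^sup>+s. indicator ?S y * g (subst_coord i s y) \<partial>lborel \<partial>lborel)"
    by (subst lborel_pair.nn_integral_snd[symmetric]) simp_all
  finally show ?thesis by simp
qed

lemma nn_integral_cell_subst_coord:
  fixes g :: "real ^ 'n \<Rightarrow> ennreal"
  assumes g [measurable]: "g \<in> borel_measurable borel"
  shows "(\<integral>\<^sup>+y. \<integral>\<^sup>+s. indicator cell_Y y * (indicator {0<..<1} s * g (subst_coord i s y)) \<partial>lborel \<partial>lborel)
    = (\<integral>\<^sup>+y. indicator cell_Y y * g y \<partial>lborel)"
proof -
  have "(\<integral>\<^sup>+y. indicator cell_Y y * g y \<partial>lborel)
      = (\<integral>\<^sup>+y. \<integral>\<^sup>+s. indicator {y. 0 < y $ i \<and> y $ i < 1} y * (indicator cell_Y (subst_coord i s y) * g (subst_coord i s y)) \<partial>lborel \<partial>lborel)"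
    by (subst nn_integral_subst_coord) measurable
  also have "\<dots> = (\<integral>\<^sup>+y. \<integral>\<^sup>+s. indicator cell_Y y * (indicator {0<..<1} s * g (subst_coord i s y)) \<partial>lborel \<partial>lborel)"
  proof (intro nn_integral_cong)
    fix y :: "real ^ 'n" and s :: real
    have "(y \<in> {y. 0 < y $ i \<and> y $ i < 1} \<and> subst_coord i s y \<in> cell_Y) \<longleftrightarrow> y \<in> cell_Y \<and> s \<in> {0<..<1}"
      by (auto simp: mem_cell_Y split: if_splits)
    then show "indicator {y. 0 < y $ i \<and> y $ i < 1} y * (indicator cell_Y (subst_coord i s y) * g (subst_coord i s y))
        = indicator cell_Y y * (indicator {0<..<1} s * g (subst_coord i s y))"
      by (auto simp: indicator_def split: if_splits)
  qed
  finally show ?thesis by simp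
qed

text \<open>The fundamental theorem of calculus followed by Cauchy-Schwarz; the length of the
  interval appears as a factor and is at most 1. Working in \<open>ennreal\<close> keeps later
  multiple integrals free of integrability conditions.\<close>

lemma sq_diff_le_nn_integral:
  fixes g g' :: "real \<Rightarrow> real"
  assumes d: "\<And>x. (g has_real_derivative g' x) (at x)" and c: "continuous_on UNIV g'"
    and ab: "\<bar>a - b\<bar> \<le> 1"
  shows "ennreal ((g a - g b)\<^sup>2) \<le> (\<integral>\<^sup>+s. indicator {min a b<..<max a b} s * ennreal ((g' s)\<^sup>2) \<partial>lborel)"
proof -
  have *: "ennreal ((g a - g b)\<^sup>2) \<le> (\<integral>\<^sup>+s. indicator {a<..<b} s * ennreal ((g' s)\<^sup>2) \<partial>lborel)"
    if "a \<le> b" "b - a \<le> 1" for a b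
  proof -
    have [measurable]: "g' \<in> borel_measurable borel" using c by (rule borel_measurable_continuous_onI)
    have int: "(LBINT x. g' x * indicator {a..b} x) = g b - g a"
      using d c that(1) by (intro integral_FTC_Icc_real) (auto simp: continuous_on_eq_continuous_at)
    have "ennreal \<bar>g b - g a\<bar> \<le> (\<integral>\<^sup>+s. ennreal (norm (g' s * indicator {a..b} s)) \<partial>lborel)"
    proof (cases "integrable lborel (\<lambda>x. g' x * indicator {a..b} x)")
      case True
      then show ?thesis using integral_norm_bound_ennreal[OF True] by (simp add: int)
    next
      \<comment> \<open>Here the Bochner integral has its default value 0, so the increment
        \<open>g b - g a\<close> is 0 and the estimate is trivial.\<close>
      case False
      then show ?thesis using int by (simp add: not_integrable_integral_eq)
    qed
    \<comment> \<open>The indicator is written twice so that one copy becomes a separate factor in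
      Cauchy-Schwarz.\<close>
    also have "\<dots> = (\<integral>\<^sup>+s. indicator {a<..<b} s * (indicator {a<..<b} s * ennreal \<bar>g' s\<bar>) \<partial>lborel)"
    proof (intro nn_integral_cong_AE)
      show "AE s in lborel. ennreal (norm (g' s * indicator {a..b} s)) = indicator {a<..<b} s * (indicator {a<..<b} s * ennreal \<bar>g' s\<bar>)"
        using AE_lborel_singleton[of a] AE_lborel_singleton[of b]
        by eventually_elim (auto simp: indicator_def)
    qed
    finally have "(ennreal \<bar>g b - g a\<bar>)\<^sup>2 \<le> (\<integral>\<^sup>+s. indicator {a<..<b} s * (indicator {a<..<b} s * ennreal \<bar>g' s\<bar>) \<partial>lborel)\<^sup>2"
      by (intro power_mono) auto
    also have "\<dots> \<le> (\<integral>\<^sup>+s. (indicator {a<..<b} s)\<^sup>2 \<partial>lborel) * (\<integral>\<^sup>+s. (indicator {a<..<b} s * ennreal \<bar>g' s\<bar>)\<^sup>2 \<partial>lborel)"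
      by (intro Cauchy_Schwarz_nn_integral) measurable
    also have "(\<integral>\<^sup>+s. (indicator {a<..<b} s)\<^sup>2 \<partial>lborel) = (\<integral>\<^sup>+s. indicator {a<..<b} s \<partial>lborel)"
      by (intro nn_integral_cong) (auto simp: indicator_def)
    also have "\<dots> = ennreal (b - a)" using that by simp
    also have "\<dots> * (\<integral>\<^sup>+s. (indicator {a<..<b} s * ennreal \<bar>g' s\<bar>)\<^sup>2 \<partial>lborel) \<le> 1 * (\<integral>\<^sup>+s. (indicator {a<..<b} s * ennreal \<bar>g' s\<bar>)\<^sup>2 \<partial>lborel)"
      using that by (intro mult_right_mono) auto
    also have "\<dots> = (\<integral>\<^sup>+s. indicator {a<..<b} s * ennreal ((g' s)\<^sup>2) \<partial>lborel)"
      by (simp, intro nn_integral_cong) (auto simp: indicator_def ennreal_power)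
    finally show ?thesis by (simp add: ennreal_power power2_commute)
  qed
  show ?thesis
    using *[of a b] *[of b a] ab by (cases "a \<le> b") (auto simp: min_def max_def power2_commute)
qed

lemma sq_diff_subst_coord_le:
  fixes \<phi> :: "real ^ 'n \<Rightarrow> real"
  assumes d: "\<And>x. GDERIV \<phi> x :> G x" and c: "continuous_on UNIV G" and ab: "\<bar>a - b\<bar> \<le> 1"
  shows "ennreal ((\<phi> (subst_coord i a y) - \<phi> (subst_coord i b y))\<^sup>2)
    \<le> (\<integral>\<^sup>+s. indicator {min a b<..<max a b} s * ennreal ((norm (G (subst_coord i s y)))\<^sup>2) \<partial>lborel)"
proof -
  have cs: "continuous_on UNIV (\<lambda>s. subst_coord i s y)"
    unfolding subst_coord_eq by (intro continuous_intros)
  have "ennreal ((\<phi> (subst_coord i a y) - \<phi> (subst_coord i b y))\<^sup>2)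
      \<le> (\<integral>\<^sup>+s. indicator {min a b<..<max a b} s * ennreal ((G (subst_coord i s y) $ i)\<^sup>2) \<partial>lborel)"
  proof (rule sq_diff_le_nn_integral[OF _ _ ab])
    fix s
    have "((\<lambda>s. \<phi> (subst_coord i s y)) has_derivative (\<lambda>h. (h *\<^sub>R axis i 1) \<bullet> G (subst_coord i s y))) (at s)"
      by (rule has_derivative_compose[where g = \<phi>])
        (use d in \<open>auto simp: gderiv_def subst_coord_eq intro!: derivative_eq_intros\<close>)
    then show "((\<lambda>s. \<phi> (subst_coord i s y)) has_real_derivative G (subst_coord i s y) $ i) (at s)"
      by (simp add: has_field_derivative_def inner_axis' mult_commute_abs)
    show "continuous_on UNIV (\<lambda>s. G (subst_coord i s y) $ i)"
      by (intro continuous_intros continuous_on_compose2[OF c cs]) auto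
  qed
  also have "\<dots> \<le> (\<integral>\<^sup>+s. indicator {min a b<..<max a b} s * ennreal ((norm (G (subst_coord i s y)))\<^sup>2) \<partial>lborel)"
  proof (intro nn_integral_mono mult_left_mono ennreal_leI)
    show "(v $ i)\<^sup>2 \<le> (norm v)\<^sup>2" for v :: "real ^ 'n"
      using component_le_norm_cart[of v i] by (metis abs_ge_zero power2_abs power_mono)
  qed auto
  finally show ?thesis .
qed

lemma sq_diff_segment_le:
  fixes \<phi> :: "'a::euclidean_space \<Rightarrow> real"
  assumes d: "\<And>x. GDERIV \<phi> x :> G x" and c: "continuous_on UNIV G"
  shows "ennreal ((\<phi> x - \<phi> y)\<^sup>2)
    \<le> ennreal ((norm (y - x))\<^sup>2) * (\<integral>\<^sup>+s. indicator {0<..<1} s * ennreal ((norm (G (x + s *\<^sub>R (y - x))))\<^sup>2) \<partial>lborel)"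
proof -
  have [measurable]: "G \<in> borel_measurable borel" using c by (rule borel_measurable_continuous_onI)
  have cs: "continuous_on UNIV (\<lambda>s. x + s *\<^sub>R (y - x))" by (intro continuous_intros)
  have "ennreal ((\<phi> (x + 0 *\<^sub>R (y - x)) - \<phi> (x + 1 *\<^sub>R (y - x)))\<^sup>2)
      \<le> (\<integral>\<^sup>+s. indicator {min 0 1<..<max 0 1} s * ennreal (((y - x) \<bullet> G (x + s *\<^sub>R (y - x)))\<^sup>2) \<partial>lborel)"
  proof (rule sq_diff_le_nn_integral)
    fix s
    have "((\<lambda>s. \<phi> (x + s *\<^sub>R (y - x))) has_derivative (\<lambda>h. (h *\<^sub>R (y - x)) \<bullet> G (x + s *\<^sub>R (y - x)))) (at s)"
      by (rule has_derivative_compose[where g = \<phi>])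
        (use d in \<open>auto simp: gderiv_def intro!: derivative_eq_intros\<close>)
    then show "((\<lambda>s. \<phi> (x + s *\<^sub>R (y - x))) has_real_derivative (y - x) \<bullet> G (x + s *\<^sub>R (y - x))) (at s)"
      by (simp add: has_field_derivative_def mult_commute_abs)
    show "continuous_on UNIV (\<lambda>s. (y - x) \<bullet> G (x + s *\<^sub>R (y - x)))"
      by (intro continuous_intros continuous_on_compose2[OF c cs]) auto
  qed simp
  also have "\<dots> \<le> (\<integral>\<^sup>+s. ennreal ((norm (y - x))\<^sup>2) * (indicator {0<..<1} s * ennreal ((norm (G (x + s *\<^sub>R (y - x))))\<^sup>2)) \<partial>lborel)"
  proof (intro nn_integral_mono)
    fix s
    have "((y - x) \<bullet> G (x + s *\<^sub>R (y - x)))\<^sup>2 \<le> (norm (y - x) * norm (G (x + s *\<^sub>R (y - x))))\<^sup>2"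
      using Cauchy_Schwarz_ineq2 by (metis abs_ge_zero power2_abs power_mono)
    then have "ennreal (((y - x) \<bullet> G (x + s *\<^sub>R (y - x)))\<^sup>2) \<le> ennreal ((norm (y - x))\<^sup>2) * ennreal ((norm (G (x + s *\<^sub>R (y - x))))\<^sup>2)"
      by (simp add: power_mult_distrib ennreal_leI flip: ennreal_mult)
    then show "indicator {min 0 1<..<max 0 1} s * ennreal (((y - x) \<bullet> G (x + s *\<^sub>R (y - x)))\<^sup>2)
        \<le> ennreal ((norm (y - x))\<^sup>2) * (indicator {0<..<1} s * ennreal ((norm (G (x + s *\<^sub>R (y - x))))\<^sup>2))"
      by (auto simp: indicator_def)
  qed
  also have "\<dots> = ennreal ((norm (y - x))\<^sup>2) * (\<integral>\<^sup>+s. indicator {0<..<1} s * ennreal ((norm (G (x + s *\<^sub>R (y - x))))\<^sup>2) \<partial>lborel)"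
    by (intro nn_integral_cmult) measurable
  finally show ?thesis by simp
qed

text \<open>The substitution has Jacobian \<open>c ^ DIM('a)\<close>, whose inverse is at most
  \<open>2 ^ DIM('a)\<close> when \<open>c\<close> is at least 1/2. This is the case needed for
  points on a segment that are closer to the endpoint being integrated.\<close>

lemma nn_integral_affine_le:
  fixes h :: "'a::euclidean_space \<Rightarrow> ennreal"
  assumes [measurable]: "h \<in> borel_measurable borel" and c: "1 / 2 \<le> c"
  shows "(\<integral>\<^sup>+y. h (t + c *\<^sub>R y) \<partial>lborel) \<le> ennreal (2 ^ DIM('a)) * (\<integral>\<^sup>+y. h y \<partial>lborel)"
proof -
  have "(\<integral>\<^sup>+y. h y \<partial>lborel) = ennreal (\<bar>c\<bar> ^ DIM('a)) * (\<integral>\<^sup>+y. h (t + c *\<^sub>R y) \<partial>lborel)"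
    using c by (subst lborel_affine[of c t]) (auto simp: nn_integral_density nn_integral_distr nn_integral_cmult)
  moreover have "1 \<le> ennreal (2 ^ DIM('a)) * ennreal (\<bar>c\<bar> ^ DIM('a))"
  proof -
    have "1 \<le> (2 * \<bar>c\<bar>) ^ DIM('a)" using c by (intro one_le_power) auto
    then show ?thesis by (simp add: power_mult_distrib flip: ennreal_mult)
  qed
  then have "1 * (\<integral>\<^sup>+y. h (t + c *\<^sub>R y) \<partial>lborel)
      \<le> (ennreal (2 ^ DIM('a)) * ennreal (\<bar>c\<bar> ^ DIM('a))) * (\<integral>\<^sup>+y. h (t + c *\<^sub>R y) \<partial>lborel)"
    by (intro mult_right_mono) auto
  ultimately show ?thesis by (simp add: mult.assoc)
qed

section \<open>Trace and Poincare inequalities on the perforated cell\<close>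

definition slab :: "'n \<Rightarrow> real \<Rightarrow> real \<Rightarrow> (real ^ 'n) set" where
  "slab i a \<delta> = {y \<in> cell_Y. \<bar>y $ i - a\<bar> < \<delta>}"

lemma slab_borel [measurable, simp, intro]: "(slab i a \<delta> :: (real ^ 'n) set) \<in> sets borel"
proof -
  have "{y :: real ^ 'n. \<bar>y $ i - a\<bar> < \<delta>} \<in> sets borel" by measurable
  moreover have "slab i a \<delta> = cell_Y \<inter> {y :: real ^ 'n. \<bar>y $ i - a\<bar> < \<delta>}" by (auto simp: slab_def)
  ultimately show ?thesis by (metis cell_Y_borel sets.Int)
qed

lemma component_minus_half_le: "\<bar>y $ i - 1/2\<bar> \<le> norm (y - x_M)"
  using component_le_norm_cart[of "y - x_M" i] by (simp add: x_M_def)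

text \<open>A single coordinate already puts these points farther than \<rho> from the centre, since
  the distance dominates each component.\<close>

lemma slab_subset_Y_star:
  assumes "a \<in> {0, 1}" "\<rho> \<le> 1/2 - \<delta>"
  shows "slab i a \<delta> \<subseteq> (Y_star \<rho> :: (real ^ 'n) set)"
proof
  fix y :: "real ^ 'n" assume "y \<in> slab i a \<delta>"
  then have "y \<in> cell_Y" "\<bar>y $ i - a\<bar> < \<delta>" by (auto simp: slab_def)
  moreover from this assms have "\<rho> < \<bar>y $ i - 1/2\<bar>" by auto
  ultimately show "y \<in> Y_star \<rho>"
    using component_minus_half_le[of y i] by (simp add: mem_Y_star)
qed

lemma sq_add_le: "ennreal ((a - c)\<^sup>2) \<le> 2 * ennreal ((a - b)\<^sup>2) + 2 * ennreal ((b - c)\<^sup>2)"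
proof -
  have "(a - c)\<^sup>2 + (a + c - 2 * b)\<^sup>2 = 2 * (a - b)\<^sup>2 + 2 * (b - c)\<^sup>2"
    by (simp add: power2_eq_square algebra_simps)
  then have "(a - c)\<^sup>2 \<le> 2 * (a - b)\<^sup>2 + 2 * (b - c)\<^sup>2"
    by (smt (verit) zero_le_power2)
  then have "ennreal ((a - c)\<^sup>2) \<le> ennreal (2 * (a - b)\<^sup>2 + 2 * (b - c)\<^sup>2)" by (rule ennreal_leI)
  then show ?thesis by (simp add: ennreal_mult')
qed

text \<open>The face value is compared with the value at every depth in the slab: the difference
  costs gradient energy along the normal line, and averaging over the depth produces the factor
  \<delta>.\<close>

lemma nn_integral_trace_le:
  fixes \<phi> :: "real ^ 'n \<Rightarrow> real"
  assumes d: "\<And>x. GDERIV \<phi> x :> G x" and c: "continuous_on UNIV G"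
    and a: "a \<in> {0, 1}" and \<delta>: "0 < \<delta>" "\<delta> \<le> 1"
  shows "ennreal \<delta> * (\<integral>\<^sup>+y. indicator cell_Y y * ennreal ((\<phi> (subst_coord i a y))\<^sup>2) \<partial>lborel)
    \<le> 2 * (\<integral>\<^sup>+y. indicator (slab i a \<delta>) y * ennreal ((\<phi> y)\<^sup>2) \<partial>lborel)
      + 2 * (\<integral>\<^sup>+y. indicator (slab i a \<delta>) y * ennreal ((norm (G y))\<^sup>2) \<partial>lborel)"
proof -
  have [measurable]: "G \<in> borel_measurable borel" using c by (rule borel_measurable_continuous_onI)
  have [measurable]: "\<phi> \<in> borel_measurable borel"
    using GDERIV_continuous[OF d] by (rule borel_measurable_continuous_onI)
  define J where "J = {s. 0 < s \<and> s < 1 \<and> \<bar>s - a\<bar> < \<delta>}"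
  have Jeq: "J = (if a = 0 then {0<..<\<delta>} else {1 - \<delta><..<1})"
    using a \<delta> by (auto simp: J_def)
  have [measurable]: "J \<in> sets borel" unfolding J_def by measurable
  have J: "emeasure lborel J = ennreal \<delta>"
    using \<delta> by (simp add: Jeq)
  define P where "P y = (\<integral>\<^sup>+s. indicator J s * ennreal ((\<phi> (subst_coord i s y))\<^sup>2) \<partial>lborel)" for y
  define Q where "Q y = (\<integral>\<^sup>+s. indicator J s * ennreal ((norm (G (subst_coord i s y)))\<^sup>2) \<partial>lborel)" for y
  have [measurable]: "P \<in> borel_measurable borel" "Q \<in> borel_measurable borel"
    unfolding P_def Q_def by measurable
  have pw: "ennreal \<delta> * ennreal ((\<phi> (subst_coord i a y))\<^sup>2) \<le> 2 * P y + 2 * Q y" for y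
  proof -
    have "ennreal \<delta> * ennreal ((\<phi> (subst_coord i a y))\<^sup>2)
        = (\<integral>\<^sup>+s. indicator J s * ennreal ((\<phi> (subst_coord i a y))\<^sup>2) \<partial>lborel)"
      by (simp add: nn_integral_multc J)
    also have "\<dots> \<le> (\<integral>\<^sup>+s. 2 * (indicator J s * ennreal ((\<phi> (subst_coord i s y))\<^sup>2)) + 2 * (indicator J s * Q y) \<partial>lborel)"
    proof (intro nn_integral_mono)
      fix s
      show "indicator J s * ennreal ((\<phi> (subst_coord i a y))\<^sup>2)
          \<le> 2 * (indicator J s * ennreal ((\<phi> (subst_coord i s y))\<^sup>2)) + 2 * (indicator J s * Q y)"
      proof (cases "s \<in> J")
        case True
        have "ennreal ((\<phi> (subst_coord i a y) - \<phi> (subst_coord i s y))\<^sup>2)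
            \<le> (\<integral>\<^sup>+s'. indicator {min a s<..<max a s} s' * ennreal ((norm (G (subst_coord i s' y)))\<^sup>2) \<partial>lborel)"
          using True a \<delta> by (intro sq_diff_subst_coord_le[OF d c]) (auto simp: J_def)
        \<comment> \<open>\<open>J\<close> consists of the points of the unit interval within
          \<delta> of its endpoint \<open>a\<close>, so the whole interval between \<open>a\<close>
          and \<open>s\<close> lies in \<open>J\<close>.\<close>
        also have "\<dots> \<le> Q y"
          unfolding Q_def using True a \<delta>
          by (intro nn_integral_mono mult_right_mono) (auto simp: Jeq indicator_def split: if_splits)
        finally have "2 * ennreal ((\<phi> (subst_coord i a y) - \<phi> (subst_coord i s y))\<^sup>2) \<le> 2 * Q y"
          by (rule mult_left_mono) simp
        with sq_add_le[of "\<phi> (subst_coord i a y)" 0 "\<phi> (subst_coord i s y)"] True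
        show ?thesis by (auto simp: add.commute elim!: order_trans intro: add_left_mono)
      qed simp
    qed
    also have "\<dots> = 2 * P y + 2 * (ennreal \<delta> * Q y)"
      unfolding P_def by (simp add: nn_integral_add nn_integral_cmult nn_integral_multc J)
    also have "ennreal \<delta> * Q y \<le> 1 * Q y" using \<delta> by (intro mult_right_mono) auto
    finally show ?thesis by (simp add: add_left_mono mult_left_mono)
  qed
  \<comment> \<open>Integration over the dummy point \<open>y\<close> and the depth \<open>s\<close>
    is collapsed to an integral over the slab.\<close>
  have slice: "(\<integral>\<^sup>+y. indicator cell_Y y * (\<integral>\<^sup>+s. indicator J s * h (subst_coord i s y) \<partial>lborel) \<partial>lborel)
      = (\<integral>\<^sup>+y. indicator (slab i a \<delta>) y * h y \<partial>lborel)" if [measurable]: "h \<in> borel_measurable borel" for h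
  proof -
    have "(\<integral>\<^sup>+y. indicator cell_Y y * (\<integral>\<^sup>+s. indicator J s * h (subst_coord i s y) \<partial>lborel) \<partial>lborel)
        = (\<integral>\<^sup>+y. \<integral>\<^sup>+s. indicator cell_Y y * (indicator {0<..<1} s * (indicator {y. \<bar>y $ i - a\<bar> < \<delta>} (subst_coord i s y) * h (subst_coord i s y))) \<partial>lborel \<partial>lborel)"
      by (subst nn_integral_cmult[symmetric]) (auto intro!: nn_integral_cong simp: indicator_def J_def)
    also have "\<dots> = (\<integral>\<^sup>+y. indicator cell_Y y * (indicator {y. \<bar>y $ i - a\<bar> < \<delta>} y * h y) \<partial>lborel)"
      by (rule nn_integral_cell_subst_coord) measurable
    also have "\<dots> = (\<integral>\<^sup>+y. indicator (slab i a \<delta>) y * h y \<partial>lborel)"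
      by (intro nn_integral_cong) (auto simp: indicator_def slab_def)
    finally show ?thesis .
  qed
  have "ennreal \<delta> * (\<integral>\<^sup>+y. indicator cell_Y y * ennreal ((\<phi> (subst_coord i a y))\<^sup>2) \<partial>lborel)
      = (\<integral>\<^sup>+y. indicator cell_Y y * (ennreal \<delta> * ennreal ((\<phi> (subst_coord i a y))\<^sup>2)) \<partial>lborel)"
    by (subst nn_integral_cmult[symmetric]) (auto intro!: nn_integral_cong simp: mult_ac)
  also have "\<dots> \<le> (\<integral>\<^sup>+y. indicator cell_Y y * (2 * P y + 2 * Q y) \<partial>lborel)"
    using pw by (intro nn_integral_mono mult_left_mono) auto
  also have "\<dots> = 2 * (\<integral>\<^sup>+y. indicator cell_Y y * P y \<partial>lborel) + 2 * (\<integral>\<^sup>+y. indicator cell_Y y * Q y \<partial>lborel)"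
    by (simp add: nn_integral_add[symmetric] nn_integral_cmult[symmetric] distrib_left mult_ac)
  also have "(\<integral>\<^sup>+y. indicator cell_Y y * P y \<partial>lborel) = (\<integral>\<^sup>+y. indicator (slab i a \<delta>) y * ennreal ((\<phi> y)\<^sup>2) \<partial>lborel)"
    unfolding P_def by (rule slice) measurable
  also have "(\<integral>\<^sup>+y. indicator cell_Y y * Q y \<partial>lborel) = (\<integral>\<^sup>+y. indicator (slab i a \<delta>) y * ennreal ((norm (G y))\<^sup>2) \<partial>lborel)"
    unfolding Q_def by (rule slice) measurable
  finally show ?thesis .
qed

lemma nn_integral_lborel_L2:
  fixes f :: "'a::euclidean_space \<Rightarrow> 'b::euclidean_space"
  assumes f: "f \<in> borel_measurable borel" and A: "A \<in> sets borel" and L: "f \<in> L2 A"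
  shows "(\<integral>\<^sup>+y. indicator A y * ennreal ((norm (f y))\<^sup>2) \<partial>lborel) = ennreal ((L2_norm A f)\<^sup>2)"
proof -
  have "(\<integral>\<^sup>+y. indicator A y * ennreal ((norm (f y))\<^sup>2) \<partial>lborel)
      = (\<integral>\<^sup>+y. indicator A y * ennreal ((norm (f y))\<^sup>2) \<partial>lebesgue)"
    by (rule nn_integral_completion[symmetric])
  also have "\<dots> = (\<integral>\<^sup>+y. ennreal ((norm (f y))\<^sup>2) \<partial>lebesgue_on A)"
    using A by (subst nn_integral_restrict_space) (auto simp: mult.commute)
  finally show ?thesis using L by (simp add: nn_integral_L2)
qed

lemma H1_norm_nonneg [simp]: "0 \<le> H1_norm U u"
  by (simp add: H1_norm_def)

lemma trace_inequality:
  fixes i :: "'n::finite"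
  assumes \<rho>: "\<rho> < 1/2" and a: "a \<in> {0, 1}"
  shows "\<exists>C. \<forall>\<phi> :: real ^ 'n \<Rightarrow> real. smooth \<phi> \<longrightarrow>
    (\<lambda>y. \<phi> (subst_coord i a y)) \<in> L2 cell_Y \<and> L2_norm cell_Y (\<lambda>y. \<phi> (subst_coord i a y)) \<le> C * H1_norm (Y_star \<rho>) \<phi>"
proof -
  \<comment> \<open>The radius is bounded from above only and may be negative, so the width is
    capped at 1.\<close>
  define \<delta> where "\<delta> = min 1 (1/2 - \<rho>)"
  have \<delta>: "0 < \<delta>" "\<delta> \<le> 1" "\<rho> \<le> 1/2 - \<delta>" using \<rho> by (auto simp: \<delta>_def)
  show ?thesis
  proof (intro exI[of _ "sqrt (2 / \<delta>)"] allI impI)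
    fix \<phi> :: "real ^ 'n \<Rightarrow> real" assume sm: "smooth \<phi>"
    obtain G where G: "\<And>x. GDERIV \<phi> x :> G x" "continuous_on UNIV G" using smooth_gradient[OF sm] by metis
    have w: "has_weak_gradient (Y_star \<rho>) \<phi> G"
      by (rule has_weak_gradient_smooth[OF open_Y_star bounded_Y_star sm G(1)])
    have cs: "continuous_on UNIV (\<lambda>y. \<phi> (subst_coord i a y))"
      unfolding subst_coord_eq by (intro continuous_on_compose2[OF smooth_continuous[OF sm, of UNIV]] continuous_intros) auto
    have L: "(\<lambda>y. \<phi> (subst_coord i a y)) \<in> L2 cell_Y"
      by (intro continuous_imp_L2 cs bounded_cell_Y) auto
    have mG: "G \<in> borel_measurable borel" and m\<phi>: "\<phi> \<in> borel_measurable borel"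
      using G(2) smooth_continuous[OF sm] by (auto intro: borel_measurable_continuous_onI)
    have sub: "(\<integral>\<^sup>+y. indicator (slab i a \<delta>) y * h y \<partial>lborel) \<le> (\<integral>\<^sup>+y. indicator (Y_star \<rho>) y * h y \<partial>lborel)" for h :: "real ^ 'n \<Rightarrow> ennreal"
      using slab_subset_Y_star[OF a \<delta>(3), of i] by (intro nn_integral_mono mult_right_mono) (auto simp: indicator_def)
    have "ennreal (\<delta> * (L2_norm cell_Y (\<lambda>y. \<phi> (subst_coord i a y)))\<^sup>2)
        = ennreal \<delta> * (\<integral>\<^sup>+y. indicator cell_Y y * ennreal ((\<phi> (subst_coord i a y))\<^sup>2) \<partial>lborel)"
      using nn_integral_lborel_L2[OF borel_measurable_continuous_onI[OF cs] cell_Y_borel L] \<delta> by (simp add: ennreal_mult)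
    also have "\<dots> \<le> 2 * (\<integral>\<^sup>+y. indicator (slab i a \<delta>) y * ennreal ((\<phi> y)\<^sup>2) \<partial>lborel)
      + 2 * (\<integral>\<^sup>+y. indicator (slab i a \<delta>) y * ennreal ((norm (G y))\<^sup>2) \<partial>lborel)"
      by (rule nn_integral_trace_le[OF G a \<delta>(1,2)])
    also have "\<dots> \<le> 2 * (\<integral>\<^sup>+y. indicator (Y_star \<rho>) y * ennreal ((\<phi> y)\<^sup>2) \<partial>lborel)
      + 2 * (\<integral>\<^sup>+y. indicator (Y_star \<rho>) y * ennreal ((norm (G y))\<^sup>2) \<partial>lborel)"
      by (intro add_mono mult_left_mono sub) auto
    also have "\<dots> = ennreal (2 * (L2_norm (Y_star \<rho>) \<phi>)\<^sup>2 + 2 * (L2_norm (Y_star \<rho>) G)\<^sup>2)"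
      using nn_integral_lborel_L2[OF m\<phi> Y_star_borel has_weak_gradient_L2(1)[OF w]]
        nn_integral_lborel_L2[OF mG Y_star_borel has_weak_gradient_L2(2)[OF w]]
      by (simp add: ennreal_mult')
    also have "\<dots> = ennreal (2 * (H1_norm (Y_star \<rho>) \<phi>)\<^sup>2)"
      by (simp add: H1_norm_eq[OF open_Y_star bounded_Y_star w])
    finally have "\<delta> * (L2_norm cell_Y (\<lambda>y. \<phi> (subst_coord i a y)))\<^sup>2 \<le> 2 * (H1_norm (Y_star \<rho>) \<phi>)\<^sup>2"
      by (simp add: ennreal_le_iff)
    then have "(L2_norm cell_Y (\<lambda>y. \<phi> (subst_coord i a y)))\<^sup>2 \<le> (2 / \<delta>) * (H1_norm (Y_star \<rho>) \<phi>)\<^sup>2"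
      using \<delta> by (simp add: field_simps)
    then have "L2_norm cell_Y (\<lambda>y. \<phi> (subst_coord i a y)) \<le> sqrt ((2 / \<delta>) * (H1_norm (Y_star \<rho>) \<phi>)\<^sup>2)"
      by (rule real_le_rsqrt)
    also have "\<dots> = sqrt (2 / \<delta>) * H1_norm (Y_star \<rho>) \<phi>"
      by (simp only: real_sqrt_mult real_sqrt_abs abs_of_nonneg[OF H1_norm_nonneg])
    finally show "(\<lambda>y. \<phi> (subst_coord i a y)) \<in> L2 cell_Y \<and> L2_norm cell_Y (\<lambda>y. \<phi> (subst_coord i a y)) \<le> sqrt (2 / \<delta>) * H1_norm (Y_star \<rho>) \<phi>"
      using L by simp
  qed
qed

text \<open>A double integral of squared differences serves as the variance: it involves no
  averages, makes sense in \<open>ennreal\<close> without integrability, and can compare two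
  different sets.\<close>

definition oscillation :: "(real ^ 'n \<Rightarrow> real) \<Rightarrow> (real ^ 'n) set \<Rightarrow> (real ^ 'n) set \<Rightarrow> ennreal" where
  "oscillation \<phi> A B = (\<integral>\<^sup>+x. \<integral>\<^sup>+y. indicator A x * (indicator B y * ennreal ((\<phi> x - \<phi> y)\<^sup>2)) \<partial>lborel \<partial>lborel)"

definition dirichlet :: "(real ^ 'n \<Rightarrow> real ^ 'n) \<Rightarrow> (real ^ 'n) set \<Rightarrow> ennreal" where
  "dirichlet G A = (\<integral>\<^sup>+x. indicator A x * ennreal ((norm (G x))\<^sup>2) \<partial>lborel)"

text \<open>Convex parts avoiding the hole are linked to themselves and links compose through parts of positive
  measure, so the uniform Poincare inequality follows by chaining slabs along the faces of the cell.\<close>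

definition linked :: "real \<Rightarrow> (real ^ 'n) set \<Rightarrow> (real ^ 'n) set \<Rightarrow> bool" where
  "linked R A B \<longleftrightarrow> (\<exists>C\<ge>0. \<forall>\<rho>\<le>R. \<forall>\<phi> G. (\<forall>x. GDERIV \<phi> x :> G x) \<longrightarrow> continuous_on UNIV G \<longrightarrow>
     oscillation \<phi> (A \<inter> Y_star \<rho>) (B \<inter> Y_star \<rho>) \<le> ennreal C * dirichlet G (Y_star \<rho>))"

section \<open>Chaining oscillation estimates over parts of the cell\<close>

lemma oscillation_mono: "A \<subseteq> A' \<Longrightarrow> B \<subseteq> B' \<Longrightarrow> oscillation \<phi> A B \<le> oscillation \<phi> A' B'"
  unfolding oscillation_def
  by (intro nn_integral_mono mult_mono) (auto simp: indicator_def)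

lemma oscillation_commute:
  assumes [measurable]: "\<phi> \<in> borel_measurable borel" "A \<in> sets borel" "B \<in> sets borel"
  shows "oscillation \<phi> A B = oscillation \<phi> B A"
proof -
  have "oscillation \<phi> A B = (\<integral>\<^sup>+y. \<integral>\<^sup>+x. indicator A x * (indicator B y * ennreal ((\<phi> x - \<phi> y)\<^sup>2)) \<partial>lborel \<partial>lborel)"
    unfolding oscillation_def by (rule lborel_pair.Fubini') measurable
  also have "\<dots> = oscillation \<phi> B A"
    unfolding oscillation_def by (intro nn_integral_cong) (simp add: power2_commute mult_ac)
  finally show ?thesis .
qed

lemma oscillation_Un_le:
  assumes [measurable]: "\<phi> \<in> borel_measurable borel" "A \<in> sets borel" "A' \<in> sets borel" "B \<in> sets borel"
  shows "oscillation \<phi> (A \<union> A') B \<le> oscillation \<phi> A B + oscillation \<phi> A' B"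
proof -
  have "oscillation \<phi> (A \<union> A') B \<le> (\<integral>\<^sup>+x. (\<integral>\<^sup>+y. indicator A x * (indicator B y * ennreal ((\<phi> x - \<phi> y)\<^sup>2)) \<partial>lborel)
      + (\<integral>\<^sup>+y. indicator A' x * (indicator B y * ennreal ((\<phi> x - \<phi> y)\<^sup>2)) \<partial>lborel) \<partial>lborel)"
    unfolding oscillation_def by (intro nn_integral_mono) (auto simp: indicator_def)
  also have "\<dots> = oscillation \<phi> A B + oscillation \<phi> A' B"
    unfolding oscillation_def by (rule nn_integral_add) measurable
  finally show ?thesis .
qed

text \<open>Insert an intermediate point of \<open>B\<close>, use that the square of a sum is at
  most twice the sum of squares, and integrate over that point. The variable left over in each term
  costs the measure of \<open>A\<close> or \<open>E\<close>, which is at most 1.\<close>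

lemma oscillation_trans:
  fixes A B E :: "(real ^ 'n) set"
  assumes [measurable]: "\<phi> \<in> borel_measurable borel" "A \<in> sets borel" "B \<in> sets borel" "E \<in> sets borel"
    and le1: "emeasure lborel A \<le> 1" "emeasure lborel E \<le> 1"
  shows "emeasure lborel B * oscillation \<phi> A E \<le> 2 * oscillation \<phi> A B + 2 * oscillation \<phi> B E"
proof -
  let ?d = "\<lambda>x y. ennreal ((\<phi> x - \<phi> y)\<^sup>2)"
  define f where "f x = (\<integral>\<^sup>+y. indicator B y * ?d x y \<partial>lborel)" for x
  define g where "g z = (\<integral>\<^sup>+y. indicator B y * ?d y z \<partial>lborel)" for z
  have [measurable]: "f \<in> borel_measurable borel" "g \<in> borel_measurable borel"
    unfolding f_def g_def by measurable
  have pw: "emeasure lborel B * ?d x z \<le> 2 * f x + 2 * g z" for x z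
  proof -
    have "emeasure lborel B * ?d x z = (\<integral>\<^sup>+y. indicator B y * ?d x z \<partial>lborel)"
      by (simp add: nn_integral_multc)
    also have "\<dots> \<le> (\<integral>\<^sup>+y. 2 * (indicator B y * ?d x y) + 2 * (indicator B y * ?d y z) \<partial>lborel)"
      by (intro nn_integral_mono) (auto simp: indicator_def sq_add_le)
    also have "\<dots> = 2 * f x + 2 * g z"
      unfolding f_def g_def by (simp add: nn_integral_add nn_integral_cmult)
    finally show ?thesis .
  qed
  have "emeasure lborel B * oscillation \<phi> A E
      = (\<integral>\<^sup>+x. \<integral>\<^sup>+z. indicator A x * (indicator E z * (emeasure lborel B * ?d x z)) \<partial>lborel \<partial>lborel)"
    unfolding oscillation_def by (simp add: nn_integral_cmult[symmetric] mult_ac)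
  also have "\<dots> \<le> (\<integral>\<^sup>+x. \<integral>\<^sup>+z. indicator A x * (indicator E z * (2 * f x + 2 * g z)) \<partial>lborel \<partial>lborel)"
    using pw by (intro nn_integral_mono mult_left_mono) auto
  also have "\<dots> = (\<integral>\<^sup>+x. 2 * (indicator A x * f x * emeasure lborel E) + 2 * (indicator A x * (\<integral>\<^sup>+z. indicator E z * g z \<partial>lborel)) \<partial>lborel)"
  proof (intro nn_integral_cong)
    fix x
    have "(\<integral>\<^sup>+z. indicator A x * (indicator E z * (2 * f x + 2 * g z)) \<partial>lborel)
        = (\<integral>\<^sup>+z. (2 * indicator A x * f x) * indicator E z + (2 * indicator A x) * (indicator E z * g z) \<partial>lborel)"
      by (intro nn_integral_cong) (simp add: distrib_left mult_ac)
    also have "\<dots> = (2 * indicator A x * f x) * emeasure lborel E + (2 * indicator A x) * (\<integral>\<^sup>+z. indicator E z * g z \<partial>lborel)"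
      by (subst nn_integral_add) (auto simp: nn_integral_cmult)
    also have "\<dots> = 2 * (indicator A x * f x * emeasure lborel E) + 2 * (indicator A x * (\<integral>\<^sup>+z. indicator E z * g z \<partial>lborel))"
      by (simp add: mult_ac)
    finally show "(\<integral>\<^sup>+z. indicator A x * (indicator E z * (2 * f x + 2 * g z)) \<partial>lborel) = \<dots>" .
  qed
  also have "\<dots> = 2 * ((\<integral>\<^sup>+x. indicator A x * f x \<partial>lborel) * emeasure lborel E)
      + 2 * (emeasure lborel A * (\<integral>\<^sup>+z. indicator E z * g z \<partial>lborel))"
    by (simp add: nn_integral_add nn_integral_cmult nn_integral_multc)
  also have "\<dots> \<le> 2 * ((\<integral>\<^sup>+x. indicator A x * f x \<partial>lborel) * 1) + 2 * (1 * (\<integral>\<^sup>+z. indicator E z * g z \<partial>lborel))"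
    using le1 by (intro add_mono mult_left_mono mult_right_mono) auto
  also have "(\<integral>\<^sup>+x. indicator A x * f x \<partial>lborel) = oscillation \<phi> A B"
    unfolding oscillation_def f_def by (intro nn_integral_cong) (simp add: nn_integral_cmult)
  also have "(\<integral>\<^sup>+z. indicator E z * g z \<partial>lborel) = oscillation \<phi> E B"
    unfolding oscillation_def g_def by (intro nn_integral_cong) (simp add: nn_integral_cmult[symmetric] power2_commute)
  also have "oscillation \<phi> E B = oscillation \<phi> B E" by (rule oscillation_commute) measurable
  finally show ?thesis by simp
qed

lemma emeasure_Int_Y_star_le: "emeasure lborel (A \<inter> Y_star \<rho> :: (real ^ 'n) set) \<le> 1"
proof -
  have "emeasure lborel (A \<inter> Y_star \<rho>) \<le> emeasure lborel (cell_Y :: (real ^ 'n) set)"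
    by (intro emeasure_mono) (auto simp: Y_star_def)
  then show ?thesis by (simp add: emeasure_cell_Y)
qed

lemma linked_mono:
  assumes "linked R A B" "A' \<subseteq> A" "B' \<subseteq> B"
  shows "linked R A' B'"
  using assms(1) unfolding linked_def
  by (meson oscillation_mono[OF Int_mono[OF assms(2) order_refl] Int_mono[OF assms(3) order_refl]] order_trans)

lemma linked_Un:
  fixes A A' B :: "(real ^ 'n) set"
  assumes [measurable]: "A \<in> sets borel" "A' \<in> sets borel" "B \<in> sets borel"
    and l: "linked R A B" "linked R A' B"
  shows "linked R (A \<union> A') B"
proof -
  obtain C where C: "0 \<le> C" "\<And>\<rho> (\<phi> :: real ^ 'n \<Rightarrow> real) G. \<rho> \<le> R \<Longrightarrow> (\<forall>x. GDERIV \<phi> x :> G x) \<Longrightarrow> continuous_on UNIV G \<Longrightarrow>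
      oscillation \<phi> (A \<inter> Y_star \<rho>) (B \<inter> Y_star \<rho>) \<le> ennreal C * dirichlet G (Y_star \<rho>)"
    using l(1) unfolding linked_def by metis
  obtain C' where C': "0 \<le> C'" "\<And>\<rho> (\<phi> :: real ^ 'n \<Rightarrow> real) G. \<rho> \<le> R \<Longrightarrow> (\<forall>x. GDERIV \<phi> x :> G x) \<Longrightarrow> continuous_on UNIV G \<Longrightarrow>
      oscillation \<phi> (A' \<inter> Y_star \<rho>) (B \<inter> Y_star \<rho>) \<le> ennreal C' * dirichlet G (Y_star \<rho>)"
    using l(2) unfolding linked_def by metis
  show ?thesis
    unfolding linked_def
  proof (intro exI[of _ "C + C'"] conjI allI impI)
    fix \<rho> and \<phi> :: "real ^ 'n \<Rightarrow> real" and G :: "real ^ 'n \<Rightarrow> real ^ 'n"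
    assume a: "\<rho> \<le> R" "\<forall>x. GDERIV \<phi> x :> G x" "continuous_on UNIV G"
    have m: "\<phi> \<in> borel_measurable borel"
      using a(2) by (intro borel_measurable_continuous_onI GDERIV_continuous) auto
    have "oscillation \<phi> ((A \<union> A') \<inter> Y_star \<rho>) (B \<inter> Y_star \<rho>)
        \<le> oscillation \<phi> (A \<inter> Y_star \<rho>) (B \<inter> Y_star \<rho>) + oscillation \<phi> (A' \<inter> Y_star \<rho>) (B \<inter> Y_star \<rho>)"
      unfolding Int_Un_distrib2 by (intro oscillation_Un_le m) auto
    also have "\<dots> \<le> ennreal C * dirichlet G (Y_star \<rho>) + ennreal C' * dirichlet G (Y_star \<rho>)"
      by (intro add_mono C C' a)
    also have "\<dots> = ennreal (C + C') * dirichlet G (Y_star \<rho>)"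
      using C(1) C'(1) by (simp add: distrib_right)
    finally show "oscillation \<phi> ((A \<union> A') \<inter> Y_star \<rho>) (B \<inter> Y_star \<rho>) \<le> ennreal (C + C') * dirichlet G (Y_star \<rho>)" .
  qed (use C C' in auto)
qed

text \<open>The intermediate set lies in the smallest perforated cell \<open>Y_star R\<close>, so it
  is not cut by any hole of radius up to \<open>R\<close>. Its measure is then a positive number
  independent of the radius, and the composed constant is uniform.\<close>

lemma linked_trans:
  fixes A B E :: "(real ^ 'n) set"
  assumes [measurable]: "A \<in> sets borel" "B \<in> sets borel" "E \<in> sets borel"
    and l: "linked R A B" "linked R B E" and B: "B \<subseteq> Y_star R" "emeasure lborel B \<noteq> 0"
  shows "linked R A E"
proof -
  obtain C where C: "0 \<le> C" "\<And>\<rho> (\<phi> :: real ^ 'n \<Rightarrow> real) G. \<rho> \<le> R \<Longrightarrow> (\<forall>x. GDERIV \<phi> x :> G x) \<Longrightarrow> continuous_on UNIV G \<Longrightarrow>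
      oscillation \<phi> (A \<inter> Y_star \<rho>) (B \<inter> Y_star \<rho>) \<le> ennreal C * dirichlet G (Y_star \<rho>)"
    using l(1) unfolding linked_def by metis
  obtain C' where C': "0 \<le> C'" "\<And>\<rho> (\<phi> :: real ^ 'n \<Rightarrow> real) G. \<rho> \<le> R \<Longrightarrow> (\<forall>x. GDERIV \<phi> x :> G x) \<Longrightarrow> continuous_on UNIV G \<Longrightarrow>
      oscillation \<phi> (B \<inter> Y_star \<rho>) (E \<inter> Y_star \<rho>) \<le> ennreal C' * dirichlet G (Y_star \<rho>)"
    using l(2) unfolding linked_def by metis
  have "emeasure lborel B \<le> 1" using emeasure_Int_Y_star_le[of B R] B(1) by (simp add: Int_absorb2)
  then have "emeasure lborel B \<noteq> top" by (auto simp: top_unique)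
  then obtain b where b: "emeasure lborel B = ennreal b" "0 \<le> b"
    using that[of "enn2real (emeasure lborel B)"] by (simp add: ennreal_enn2real_if)
  then have b0: "0 < b" using B(2) by (cases "b = 0") auto
  show ?thesis
    unfolding linked_def
  proof (intro exI[of _ "2 * (C + C') / b"] conjI allI impI)
    fix \<rho> and \<phi> :: "real ^ 'n \<Rightarrow> real" and G :: "real ^ 'n \<Rightarrow> real ^ 'n"
    assume a: "\<rho> \<le> R" "\<forall>x. GDERIV \<phi> x :> G x" "continuous_on UNIV G"
    have m: "\<phi> \<in> borel_measurable borel"
      using a(2) by (intro borel_measurable_continuous_onI GDERIV_continuous) auto
    have BB: "B \<inter> Y_star \<rho> = B" using B(1) Y_star_antimono[OF a(1)] by blast
    have "ennreal b * oscillation \<phi> (A \<inter> Y_star \<rho>) (E \<inter> Y_star \<rho>)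
        \<le> 2 * oscillation \<phi> (A \<inter> Y_star \<rho>) (B \<inter> Y_star \<rho>) + 2 * oscillation \<phi> (B \<inter> Y_star \<rho>) (E \<inter> Y_star \<rho>)"
      using oscillation_trans[OF m, of "A \<inter> Y_star \<rho>" B "E \<inter> Y_star \<rho>"]
      by (simp add: b BB emeasure_Int_Y_star_le)
    also have "\<dots> \<le> 2 * (ennreal C * dirichlet G (Y_star \<rho>)) + 2 * (ennreal C' * dirichlet G (Y_star \<rho>))"
      by (intro add_mono mult_left_mono C C' a) auto
    also have "\<dots> = ennreal b * (ennreal (2 * (C + C') / b) * dirichlet G (Y_star \<rho>))"
    proof -
      have "ennreal b * ennreal (2 * (C + C') / b) = ennreal (2 * (C + C'))"
        using b0 C(1) C'(1) by (subst ennreal_mult[symmetric]) auto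
      also have "\<dots> = 2 * ennreal C + 2 * ennreal C'"
        using C(1) C'(1) by (simp add: distrib_left ennreal_mult')
      finally have "ennreal b * (ennreal (2 * (C + C') / b) * dirichlet G (Y_star \<rho>)) = (2 * ennreal C + 2 * ennreal C') * dirichlet G (Y_star \<rho>)"
        by (simp only: mult.assoc[symmetric])
      then show ?thesis by (simp add: distrib_right mult.assoc)
    qed
    finally show "oscillation \<phi> (A \<inter> Y_star \<rho>) (E \<inter> Y_star \<rho>) \<le> ennreal (2 * (C + C') / b) * dirichlet G (Y_star \<rho>)"
      using b0 by (subst (asm) ennreal_mult_le_mult_iff) auto
  qed (use C C' b0 in auto)
qed

lemma norm_diff_cell_Y_le:
  fixes x y :: "real ^ 'n"
  assumes "x \<in> cell_Y" "y \<in> cell_Y"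
  shows "norm (y - x) \<le> real CARD('n)"
proof -
  have "norm (y - x) \<le> (\<Sum>i\<in>UNIV. \<bar>(y - x) $ i\<bar>)" by (rule norm_le_l1_cart)
  also have "\<dots> \<le> (\<Sum>i\<in>(UNIV :: 'n set). 1)"
  proof (intro sum_mono)
    fix i
    have "0 < x $ i \<and> x $ i < 1" "0 < y $ i \<and> y $ i < 1" using assms by (auto simp: mem_cell_Y)
    then show "\<bar>(y - x) $ i\<bar> \<le> 1" by (auto simp: abs_le_iff)
  qed
  finally show ?thesis by simp
qed

text \<open>Differences are integrated along segments, which stay in \<open>K\<close>. The constant
  is the squared bound on the diameter of the cell times the inverse Jacobian bound
  \<open>2 ^ CARD('n)\<close>.\<close>

lemma linked_convex:
  fixes K :: "(real ^ 'n) set"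
  assumes K [measurable]: "K \<in> sets borel" and cv: "convex K" and sub: "K \<subseteq> Y_star R"
  shows "linked R K K"
  unfolding linked_def
proof (intro exI[of _ "(real CARD('n))\<^sup>2 * 2 ^ CARD('n)"] conjI allI impI)
  fix \<rho> and \<phi> :: "real ^ 'n \<Rightarrow> real" and G :: "real ^ 'n \<Rightarrow> real ^ 'n"
  assume a: "\<rho> \<le> R" "\<forall>x. GDERIV \<phi> x :> G x" "continuous_on UNIV G"
  have [measurable]: "G \<in> borel_measurable borel" using a(3) by (rule borel_measurable_continuous_onI)
  have [measurable]: "\<phi> \<in> borel_measurable borel"
    using a(2) by (intro borel_measurable_continuous_onI GDERIV_continuous) auto
  define h where "h x = indicator K x * ennreal ((norm (G x))\<^sup>2)" for x
  have h [measurable]: "h \<in> borel_measurable borel" unfolding h_def by measurable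
  have eK: "emeasure lborel K \<le> 1"
    using emeasure_Int_Y_star_le[of K R] sub by (simp add: Int_absorb2)
  have hD: "(\<integral>\<^sup>+x. h x \<partial>lborel) \<le> dirichlet G (Y_star \<rho>)"
    unfolding h_def dirichlet_def using sub Y_star_antimono[OF a(1)]
    by (intro nn_integral_mono mult_right_mono) (auto simp: indicator_def)
  have KK: "K \<inter> Y_star \<rho> = K" using sub Y_star_antimono[OF a(1)] by blast
  let ?N = "ennreal ((real CARD('n))\<^sup>2)"
  have pw: "indicator K x * (indicator K y * ennreal ((\<phi> x - \<phi> y)\<^sup>2))
      \<le> ?N * (\<integral>\<^sup>+s. indicator {0<..<1} s * (indicator K x * (indicator K y * h (x + s *\<^sub>R (y - x)))) \<partial>lborel)" for x y
  proof (cases "x \<in> K \<and> y \<in> K")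
    case True
    then have xy: "x \<in> cell_Y" "y \<in> cell_Y" using sub by (auto simp: mem_Y_star)
    have "ennreal ((\<phi> x - \<phi> y)\<^sup>2)
        \<le> ennreal ((norm (y - x))\<^sup>2) * (\<integral>\<^sup>+s. indicator {0<..<1} s * ennreal ((norm (G (x + s *\<^sub>R (y - x))))\<^sup>2) \<partial>lborel)"
      using a by (intro sq_diff_segment_le) auto
    also have "\<dots> \<le> ?N * (\<integral>\<^sup>+s. indicator {0<..<1} s * ennreal ((norm (G (x + s *\<^sub>R (y - x))))\<^sup>2) \<partial>lborel)"
      using norm_diff_cell_Y_le[OF xy] by (intro mult_right_mono ennreal_leI power_mono) auto
    also have "(\<integral>\<^sup>+s. indicator {0<..<1} s * ennreal ((norm (G (x + s *\<^sub>R (y - x))))\<^sup>2) \<partial>lborel)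
        = (\<integral>\<^sup>+s. indicator {0<..<1} s * h (x + s *\<^sub>R (y - x)) \<partial>lborel)"
    proof (intro nn_integral_cong)
      fix s :: real
      have "x + s *\<^sub>R (y - x) \<in> K" if "0 < s" "s < 1"
        using convexD_alt[OF cv, of x y s] True that by (simp add: algebra_simps)
      then show "indicator {0<..<1} s * ennreal ((norm (G (x + s *\<^sub>R (y - x))))\<^sup>2) = indicator {0<..<1} s * h (x + s *\<^sub>R (y - x))"
        by (auto simp: h_def indicator_def)
    qed
    finally show ?thesis using True by simp
  qed auto
  have slice: "(\<integral>\<^sup>+x. \<integral>\<^sup>+y. indicator K x * (indicator K y * h (x + s *\<^sub>R (y - x))) \<partial>lborel \<partial>lborel)
      \<le> ennreal (2 ^ CARD('n)) * dirichlet G (Y_star \<rho>)" if s: "0 < s" "s < 1" for s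
  proof -
    \<comment> \<open>When \<open>y\<close> carries at least half of the weight, the substitution in
      \<open>y\<close> is controlled; the other endpoint contributes only the measure of
      \<open>K\<close>, at most 1.\<close>
    have bound: "(\<integral>\<^sup>+x. \<integral>\<^sup>+y. indicator K x * (indicator K y * h ((1 - c) *\<^sub>R x + c *\<^sub>R y)) \<partial>lborel \<partial>lborel)
        \<le> ennreal (2 ^ CARD('n)) * dirichlet G (Y_star \<rho>)" if c: "1/2 \<le> c" for c
    proof -
      have "(\<integral>\<^sup>+x. \<integral>\<^sup>+y. indicator K x * (indicator K y * h ((1 - c) *\<^sub>R x + c *\<^sub>R y)) \<partial>lborel \<partial>lborel)
          \<le> (\<integral>\<^sup>+x. indicator K x * (\<integral>\<^sup>+y. h ((1 - c) *\<^sub>R x + c *\<^sub>R y) \<partial>lborel) \<partial>lborel)"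
        by (subst nn_integral_cmult[symmetric]) (auto intro!: nn_integral_mono simp: indicator_def)
      also have "\<dots> \<le> (\<integral>\<^sup>+x. indicator K x * (ennreal (2 ^ CARD('n)) * (\<integral>\<^sup>+y. h y \<partial>lborel)) \<partial>lborel)"
        using nn_integral_affine_le[OF h c] by (intro nn_integral_mono mult_left_mono) auto
      also have "\<dots> = emeasure lborel K * (ennreal (2 ^ CARD('n)) * (\<integral>\<^sup>+y. h y \<partial>lborel))"
        by (simp add: nn_integral_multc)
      also have "\<dots> \<le> 1 * (ennreal (2 ^ CARD('n)) * dirichlet G (Y_star \<rho>))"
        using eK hD by (intro mult_mono) auto
      finally show ?thesis by simp
    qed
    show ?thesis
    proof (cases "1/2 \<le> s")
      case True
      have "x + s *\<^sub>R (y - x) = (1 - s) *\<^sub>R x + s *\<^sub>R y" for x y :: "real ^ 'n" by (simp add: algebra_simps)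
      then show ?thesis using bound[OF True] by simp
    next
      \<comment> \<open>Now the weight of \<open>x\<close> exceeds one half, so the two endpoints
        exchange roles.\<close>
      case False
      have "(\<integral>\<^sup>+x. \<integral>\<^sup>+y. indicator K x * (indicator K y * h (x + s *\<^sub>R (y - x))) \<partial>lborel \<partial>lborel)
          = (\<integral>\<^sup>+y. \<integral>\<^sup>+x. indicator K x * (indicator K y * h (x + s *\<^sub>R (y - x))) \<partial>lborel \<partial>lborel)"
        by (rule lborel_pair.Fubini') measurable
      also have "\<dots> = (\<integral>\<^sup>+y. \<integral>\<^sup>+x. indicator K y * (indicator K x * h ((1 - (1 - s)) *\<^sub>R y + (1 - s) *\<^sub>R x)) \<partial>lborel \<partial>lborel)"
        by (intro nn_integral_cong) (simp add: algebra_simps)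
      also have "\<dots> \<le> ennreal (2 ^ CARD('n)) * dirichlet G (Y_star \<rho>)"
        using False by (intro bound) simp
      finally show ?thesis .
    qed
  qed
  have "oscillation \<phi> K K \<le> (\<integral>\<^sup>+x. \<integral>\<^sup>+y. ?N * (\<integral>\<^sup>+s. indicator {0<..<1} s * (indicator K x * (indicator K y * h (x + s *\<^sub>R (y - x)))) \<partial>lborel) \<partial>lborel \<partial>lborel)"
    unfolding oscillation_def by (intro nn_integral_mono pw)
  also have "\<dots> = ?N * (\<integral>\<^sup>+x. \<integral>\<^sup>+y. \<integral>\<^sup>+s. indicator {0<..<1} s * (indicator K x * (indicator K y * h (x + s *\<^sub>R (y - x)))) \<partial>lborel \<partial>lborel \<partial>lborel)"
    by (simp add: nn_integral_cmult)
  also have "(\<integral>\<^sup>+x. \<integral>\<^sup>+y. \<integral>\<^sup>+s. indicator {0<..<1} s * (indicator K x * (indicator K y * h (x + s *\<^sub>R (y - x)))) \<partial>lborel \<partial>lborel \<partial>lborel)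
      = (\<integral>\<^sup>+x. \<integral>\<^sup>+s. \<integral>\<^sup>+y. indicator {0<..<1} s * (indicator K x * (indicator K y * h (x + s *\<^sub>R (y - x)))) \<partial>lborel \<partial>lborel \<partial>lborel)"
    by (intro nn_integral_cong lborel_pair.Fubini') measurable
  also have "\<dots> = (\<integral>\<^sup>+s. \<integral>\<^sup>+x. \<integral>\<^sup>+y. indicator {0<..<1} s * (indicator K x * (indicator K y * h (x + s *\<^sub>R (y - x)))) \<partial>lborel \<partial>lborel \<partial>lborel)"
    by (rule lborel_pair.Fubini') measurable
  also have "\<dots> = (\<integral>\<^sup>+s. indicator {0<..<1} s * (\<integral>\<^sup>+x. \<integral>\<^sup>+y. indicator K x * (indicator K y * h (x + s *\<^sub>R (y - x))) \<partial>lborel \<partial>lborel) \<partial>lborel)"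
    by (simp add: nn_integral_cmult)
  also have "\<dots> \<le> (\<integral>\<^sup>+s. indicator {0<..<1::real} s * (ennreal (2 ^ CARD('n)) * dirichlet G (Y_star \<rho>)) \<partial>lborel)"
    using slice by (intro nn_integral_mono) (auto simp: indicator_def)
  also have "\<dots> = ennreal (2 ^ CARD('n)) * dirichlet G (Y_star \<rho>)"
    by (simp add: nn_integral_multc)
  finally show "oscillation \<phi> (K \<inter> Y_star \<rho>) (K \<inter> Y_star \<rho>)
      \<le> ennreal ((real CARD('n))\<^sup>2 * 2 ^ CARD('n)) * dirichlet G (Y_star \<rho>)"
    by (simp add: KK ennreal_mult' mult.assoc mult_left_mono)
qed simp

text \<open>Moving a point outwards along a coordinate axis never enters the hole.\<close>

lemma subst_coord_in_Y_star:
  fixes x :: "real ^ 'n"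
  assumes x: "x \<in> Y_star \<rho>" and s: "0 < s" "s < 1" and out: "\<bar>x $ i - 1/2\<bar> \<le> \<bar>s - 1/2\<bar> \<or> \<rho> < \<bar>s - 1/2\<bar>"
  shows "subst_coord i s x \<in> Y_star \<rho>"
proof -
  have c: "subst_coord i s x \<in> cell_Y" using x s by (auto simp: mem_Y_star mem_cell_Y)
  have "\<rho> < norm (subst_coord i s x - x_M)"
    using out
  proof
    assume o: "\<bar>x $ i - 1/2\<bar> \<le> \<bar>s - 1/2\<bar>"
    have "norm (x - x_M) \<le> norm (subst_coord i s x - x_M)"
    proof (rule norm_le_componentwise_cart)
      show "norm ((x - x_M) $ j) \<le> norm ((subst_coord i s x - x_M) $ j)" for j
        using o by (auto simp: x_M_def)
    qed
    then show ?thesis using x by (simp add: mem_Y_star)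
  next
    assume "\<rho> < \<bar>s - 1/2\<bar>"
    then show ?thesis using component_minus_half_le[of "subst_coord i s x" i] by simp
  qed
  with c show ?thesis by (simp add: mem_Y_star)
qed

text \<open>From any point of this half, moving in direction \<open>i\<close> towards the face leads
  away from the centre and avoids the hole. The middle plane belongs to both halves, so together
  they cover the cell.\<close>

definition half_cell :: "'n \<Rightarrow> real \<Rightarrow> (real ^ 'n) set" where
  "half_cell i a = {y \<in> cell_Y. \<bar>y $ i - a\<bar> \<le> 1/2}"

lemma half_cell_borel [measurable, simp, intro]: "(half_cell i a :: (real ^ 'n) set) \<in> sets borel"
proof -
  have "{y :: real ^ 'n. \<bar>y $ i - a\<bar> \<le> 1/2} \<in> sets borel" by measurable
  moreover have "half_cell i a = cell_Y \<inter> {y :: real ^ 'n. \<bar>y $ i - a\<bar> \<le> 1/2}" by (auto simp: half_cell_def)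
  ultimately show ?thesis by (metis cell_Y_borel sets.Int)
qed

text \<open>Every point is pushed along direction \<open>i\<close> to all positions of the slab. The
  push costs the energy on its coordinate line, and from the slab on the assumed link takes over;
  averaging over the positions gives the division by \<delta>.\<close>

lemma linked_half_cell_slab:
  fixes i :: "'n::finite"
  assumes a: "a \<in> {0, 1}" and \<delta>: "0 < \<delta>" "\<delta> \<le> 1/2" "R \<le> 1/2 - \<delta>" and l: "linked R (slab i a \<delta>) (slab i a \<delta>)"
  shows "linked R (half_cell i a) (slab i a \<delta>)"
proof -
  let ?B = "slab i a \<delta> :: (real ^ 'n) set"
  obtain C where C: "0 \<le> C" "\<And>\<rho> (\<phi> :: real ^ 'n \<Rightarrow> real) G. \<rho> \<le> R \<Longrightarrow> (\<forall>x. GDERIV \<phi> x :> G x) \<Longrightarrow> continuous_on UNIV G \<Longrightarrow>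
      oscillation \<phi> (?B \<inter> Y_star \<rho>) (?B \<inter> Y_star \<rho>) \<le> ennreal C * dirichlet G (Y_star \<rho>)"
    using l unfolding linked_def by metis
  show ?thesis
    unfolding linked_def
  proof (intro exI[of _ "2 * (\<delta> + C) / \<delta>"] conjI allI impI)
    fix \<rho> and \<phi> :: "real ^ 'n \<Rightarrow> real" and G :: "real ^ 'n \<Rightarrow> real ^ 'n"
    assume A: "\<rho> \<le> R" "\<forall>x. GDERIV \<phi> x :> G x" "continuous_on UNIV G"
    have [measurable]: "G \<in> borel_measurable borel" using A(3) by (rule borel_measurable_continuous_onI)
    have [measurable]: "\<phi> \<in> borel_measurable borel"
      using A(2) by (intro borel_measurable_continuous_onI GDERIV_continuous) auto
    have Bsub: "?B \<subseteq> Y_star \<rho>" using slab_subset_Y_star[OF a, of \<rho> \<delta> i] A(1) \<delta> by simp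
    then have BB: "?B \<inter> Y_star \<rho> = ?B" by blast
    have eB: "emeasure lborel ?B \<le> 1" using emeasure_Int_Y_star_le[of ?B \<rho>] BB by simp
    let ?H = "half_cell i a \<inter> Y_star \<rho>"
    define J where "J = {s. 0 < s \<and> s < 1 \<and> \<bar>s - a\<bar> < \<delta>}"
    have Jeq: "J = (if a = 0 then {0<..<\<delta>} else {1 - \<delta><..<1})"
      using a \<delta> by (auto simp: J_def)
    have [measurable]: "J \<in> sets borel" unfolding J_def by measurable
    have J: "emeasure lborel J = ennreal \<delta>" using \<delta> by (simp add: Jeq)
    let ?d = "\<lambda>x y. ennreal ((\<phi> x - \<phi> y)\<^sup>2)"
    define e where "e x = indicator (Y_star \<rho>) x * ennreal ((norm (G x))\<^sup>2)" for x
    have [measurable]: "e \<in> borel_measurable borel" unfolding e_def by measurable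
    \<comment> \<open>The gradient energy on the whole line through \<open>x\<close> in direction
      \<open>i\<close>, restricted to the perforated cell: it bounds every push at once.\<close>
    define E where "E x = (\<integral>\<^sup>+s. indicator {0<..<1} s * e (subst_coord i s x) \<partial>lborel)" for x
    have [measurable]: "E \<in> borel_measurable borel" unfolding E_def by measurable
    have move: "?d x (subst_coord i s x) \<le> E x" if x: "x \<in> ?H" and s: "s \<in> J" for x s
    proof -
      have xc: "0 < x $ i" "x $ i < 1" "\<bar>x $ i - a\<bar> \<le> 1/2" "x \<in> Y_star \<rho>"
        using x by (auto simp: half_cell_def mem_cell_Y)
      have "?d x (subst_coord i s x) = ennreal ((\<phi> (subst_coord i (x $ i) x) - \<phi> (subst_coord i s x))\<^sup>2)" by simp
      also have "\<dots> \<le> (\<integral>\<^sup>+t. indicator {min (x $ i) s<..<max (x $ i) s} t * ennreal ((norm (G (subst_coord i t x)))\<^sup>2) \<partial>lborel)"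
        using A xc s by (intro sq_diff_subst_coord_le) (auto simp: J_def)
      also have "\<dots> \<le> E x"
        unfolding E_def
      proof (intro nn_integral_mono)
        fix t :: real
        show "indicator {min (x $ i) s<..<max (x $ i) s} t * ennreal ((norm (G (subst_coord i t x)))\<^sup>2)
            \<le> indicator {0<..<1} t * e (subst_coord i t x)"
        proof (cases "t \<in> {min (x $ i) s<..<max (x $ i) s}")
          case True
          then have t: "0 < t" "t < 1" using xc s by (auto simp: J_def)
          \<comment> \<open>On the way to the slab position \<open>s\<close> the distance to the
            middle plane grows. If \<open>x\<close> lies deeper in the slab than \<open>s\<close>,
            the motion is inwards but stays within the slab, which no hole of radius up to
            \<open>R\<close> reaches.\<close>
          have "\<bar>x $ i - 1/2\<bar> \<le> \<bar>t - 1/2\<bar> \<or> \<rho> < \<bar>t - 1/2\<bar>"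
            using a True xc s \<delta> A(1) by (auto simp: J_def min_def max_def abs_if split: if_splits)
          then have "subst_coord i t x \<in> Y_star \<rho>" by (rule subst_coord_in_Y_star[OF xc(4) t])
          then show ?thesis using t True by (simp add: e_def)
        qed simp
      qed
      finally show ?thesis .
    qed
    \<comment> \<open>The triangle inequality through the pushed point, averaged over
      \<open>J\<close>. Indicators of the perforated half are relaxed to those of the full cell so
      that the integration formula for coordinate lines applies.\<close>
    have pw: "ennreal \<delta> * (indicator ?H x * (indicator ?B y * ?d x y))
        \<le> 2 * (ennreal \<delta> * (indicator ?B y * (indicator cell_Y x * E x)))
          + 2 * (indicator cell_Y x * (indicator ?B y * (\<integral>\<^sup>+s. indicator J s * ?d (subst_coord i s x) y \<partial>lborel)))" for x y
    proof (cases "x \<in> ?H \<and> y \<in> ?B")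
      case True
      then have xc: "x \<in> cell_Y" by (auto simp: half_cell_def)
      have "ennreal \<delta> * ?d x y = (\<integral>\<^sup>+s. indicator J s * ?d x y \<partial>lborel)"
        by (simp add: nn_integral_multc J)
      also have "\<dots> \<le> (\<integral>\<^sup>+s. 2 * (indicator J s * E x) + 2 * (indicator J s * ?d (subst_coord i s x) y) \<partial>lborel)"
      proof (intro nn_integral_mono)
        fix s
        show "indicator J s * ?d x y \<le> 2 * (indicator J s * E x) + 2 * (indicator J s * ?d (subst_coord i s x) y)"
        proof (cases "s \<in> J")
          case s: True
          have "?d x y \<le> 2 * ?d x (subst_coord i s x) + 2 * ?d (subst_coord i s x) y" by (rule sq_add_le)
          also have "\<dots> \<le> 2 * E x + 2 * ?d (subst_coord i s x) y"
            using True s by (intro add_right_mono mult_left_mono move) auto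
          finally show ?thesis using s by simp
        qed simp
      qed
      also have "\<dots> = 2 * (ennreal \<delta> * E x) + 2 * (\<integral>\<^sup>+s. indicator J s * ?d (subst_coord i s x) y \<partial>lborel)"
        by (simp add: nn_integral_add nn_integral_cmult nn_integral_multc J)
      finally show ?thesis using True xc by simp
    qed auto
    define U where "U x = (\<integral>\<^sup>+y. indicator ?B y * ?d x y \<partial>lborel)" for x
    have [measurable]: "U \<in> borel_measurable borel" unfolding U_def by measurable
    have cellE: "(\<integral>\<^sup>+x. indicator cell_Y x * E x \<partial>lborel) = dirichlet G (Y_star \<rho>)"
    proof -
      have "(\<integral>\<^sup>+x. indicator cell_Y x * E x \<partial>lborel)
          = (\<integral>\<^sup>+x. \<integral>\<^sup>+s. indicator cell_Y x * (indicator {0<..<1} s * e (subst_coord i s x)) \<partial>lborel \<partial>lborel)"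
        unfolding E_def by (simp add: nn_integral_cmult)
      also have "\<dots> = (\<integral>\<^sup>+x. indicator cell_Y x * e x \<partial>lborel)"
        by (rule nn_integral_cell_subst_coord) measurable
      also have "\<dots> = dirichlet G (Y_star \<rho>)"
        unfolding dirichlet_def e_def by (intro nn_integral_cong) (auto simp: indicator_def mem_Y_star)
      finally show ?thesis .
    qed
    \<comment> \<open>Pushed points, counted by starting point and position, sweep out the slab
      exactly, since the starting coordinate runs over an interval of length one.\<close>
    have cellU: "(\<integral>\<^sup>+x. \<integral>\<^sup>+y. indicator cell_Y x * (indicator ?B y * (\<integral>\<^sup>+s. indicator J s * ?d (subst_coord i s x) y \<partial>lborel)) \<partial>lborel \<partial>lborel)
        = oscillation \<phi> ?B ?B"
    proof -
      have "(\<integral>\<^sup>+x. \<integral>\<^sup>+y. indicator cell_Y x * (indicator ?B y * (\<integral>\<^sup>+s. indicator J s * ?d (subst_coord i s x) y \<partial>lborel)) \<partial>lborel \<partial>lborel)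
          = (\<integral>\<^sup>+x. \<integral>\<^sup>+y. \<integral>\<^sup>+s. indicator cell_Y x * (indicator ?B y * (indicator J s * ?d (subst_coord i s x) y)) \<partial>lborel \<partial>lborel \<partial>lborel)"
        by (simp add: nn_integral_cmult)
      also have "\<dots> = (\<integral>\<^sup>+x. \<integral>\<^sup>+s. \<integral>\<^sup>+y. indicator cell_Y x * (indicator ?B y * (indicator J s * ?d (subst_coord i s x) y)) \<partial>lborel \<partial>lborel \<partial>lborel)"
        by (intro nn_integral_cong lborel_pair.Fubini') measurable
      also have "\<dots> = (\<integral>\<^sup>+x. \<integral>\<^sup>+s. indicator cell_Y x * (indicator {0<..<1} s * (indicator {y. \<bar>y $ i - a\<bar> < \<delta>} (subst_coord i s x) * U (subst_coord i s x))) \<partial>lborel \<partial>lborel)"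
        unfolding U_def
        by (intro nn_integral_cong, subst nn_integral_cmult[symmetric], simp, subst nn_integral_cmult[symmetric], simp,
            subst nn_integral_cmult[symmetric], simp) (auto intro!: nn_integral_cong simp: indicator_def J_def)
      also have "\<dots> = (\<integral>\<^sup>+x. indicator cell_Y x * (indicator {y. \<bar>y $ i - a\<bar> < \<delta>} x * U x) \<partial>lborel)"
        by (rule nn_integral_cell_subst_coord) measurable
      also have "\<dots> = (\<integral>\<^sup>+x. indicator ?B x * U x \<partial>lborel)"
        by (intro nn_integral_cong) (auto simp: indicator_def slab_def)
      also have "\<dots> = oscillation \<phi> ?B ?B"
        unfolding oscillation_def U_def by (simp add: nn_integral_cmult)
      finally show ?thesis .
    qed
    have "ennreal \<delta> * oscillation \<phi> ?H ?B
        = (\<integral>\<^sup>+x. \<integral>\<^sup>+y. ennreal \<delta> * (indicator ?H x * (indicator ?B y * ?d x y)) \<partial>lborel \<partial>lborel)"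
      unfolding oscillation_def by (simp add: nn_integral_cmult)
    also have "\<dots> \<le> (\<integral>\<^sup>+x. \<integral>\<^sup>+y. 2 * (ennreal \<delta> * (indicator ?B y * (indicator cell_Y x * E x)))
          + 2 * (indicator cell_Y x * (indicator ?B y * (\<integral>\<^sup>+s. indicator J s * ?d (subst_coord i s x) y \<partial>lborel))) \<partial>lborel \<partial>lborel)"
      by (intro nn_integral_mono pw)
    also have "\<dots> = 2 * (ennreal \<delta> * (emeasure lborel ?B * (\<integral>\<^sup>+x. indicator cell_Y x * E x \<partial>lborel)))
        + 2 * (\<integral>\<^sup>+x. \<integral>\<^sup>+y. indicator cell_Y x * (indicator ?B y * (\<integral>\<^sup>+s. indicator J s * ?d (subst_coord i s x) y \<partial>lborel)) \<partial>lborel \<partial>lborel)"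
      by (simp add: nn_integral_add nn_integral_cmult nn_integral_multc)
    also have "\<dots> \<le> 2 * (ennreal \<delta> * (1 * dirichlet G (Y_star \<rho>))) + 2 * (ennreal C * dirichlet G (Y_star \<rho>))"
      unfolding cellE cellU using eB C(2)[OF A] BB by (intro add_mono mult_left_mono mult_right_mono) auto
    also have "\<dots> = ennreal \<delta> * (ennreal (2 * (\<delta> + C) / \<delta>) * dirichlet G (Y_star \<rho>))"
    proof -
      have "ennreal \<delta> * ennreal (2 * (\<delta> + C) / \<delta>) = ennreal (2 * (\<delta> + C))"
        using \<delta>(1) C(1) by (subst ennreal_mult[symmetric]) auto
      also have "\<dots> = 2 * ennreal \<delta> + 2 * ennreal C"
        using \<delta>(1) C(1) by (simp add: distrib_left ennreal_mult')
      finally have "ennreal \<delta> * (ennreal (2 * (\<delta> + C) / \<delta>) * dirichlet G (Y_star \<rho>)) = (2 * ennreal \<delta> + 2 * ennreal C) * dirichlet G (Y_star \<rho>)"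
        by (simp only: mult.assoc[symmetric])
      then show ?thesis by (simp add: distrib_right mult.assoc)
    qed
    finally have "ennreal \<delta> * oscillation \<phi> ?H ?B \<le> ennreal \<delta> * (ennreal (2 * (\<delta> + C) / \<delta>) * dirichlet G (Y_star \<rho>))" .
    then show "oscillation \<phi> (half_cell i a \<inter> Y_star \<rho>) (?B \<inter> Y_star \<rho>) \<le> ennreal (2 * (\<delta> + C) / \<delta>) * dirichlet G (Y_star \<rho>)"
      unfolding BB using \<delta>(1) by (subst (asm) ennreal_mult_le_mult_iff) auto
  qed (use C \<delta> in auto)
qed

lemma convex_slab: "convex (slab i a \<delta> :: (real ^ 'n) set)"
proof -
  have "slab i a \<delta> = cell_Y \<inter> {y :: real ^ 'n. axis i 1 \<bullet> y < a + \<delta>} \<inter> {y. axis i 1 \<bullet> y > a - \<delta>}"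
    by (auto simp: slab_def inner_axis' abs_less_iff)
  then show ?thesis
    by (simp add: cell_Y_def convex_Int convex_box convex_halfspace_lt convex_halfspace_gt)
qed

lemma open_slab: "open (slab i a \<delta> :: (real ^ 'n) set)"
proof -
  have "slab i a \<delta> = cell_Y \<inter> {y :: real ^ 'n. axis i 1 \<bullet> y < a + \<delta>} \<inter> {y. axis i 1 \<bullet> y > a - \<delta>}"
    by (auto simp: slab_def inner_axis' abs_less_iff)
  then show ?thesis
    by (simp add: open_cell_Y open_Int open_halfspace_lt open_halfspace_gt)
qed

lemma emeasure_lborel_open_neq_0:
  fixes U :: "'a::euclidean_space set"
  assumes "open U" "x \<in> U"
  shows "emeasure lborel U \<noteq> 0"
proof -
  obtain a b where ab: "x \<in> box a b" "box a b \<subseteq> U" using assms by (rule open_contains_box[THEN iffD1, rule_format, elim_format]) auto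
  have lt: "a \<bullet> i < b \<bullet> i" if "i \<in> Basis" for i
    using ab(1) that by (meson less_trans mem_box(1))
  have "0 < emeasure lborel (box a b)"
    by (subst emeasure_lborel_box) (auto simp: inner_diff_left lt less_imp_le[OF lt] intro!: prod_pos)
  also have "\<dots> \<le> emeasure lborel U" using ab assms by (intro emeasure_mono) auto
  finally show ?thesis by simp
qed

text \<open>Slabs along faces with different normals intersect in a set of positive measure, and
  each slab is convex and avoids the hole.\<close>

lemma linked_slabs_neq:
  fixes i j :: "'n::finite"
  assumes ij: "i \<noteq> j" and ab: "a \<in> {0, 1}" "b \<in> {0, 1}" and \<delta>: "0 < \<delta>" "\<delta> \<le> 1/2" "R \<le> 1/2 - \<delta>"
  shows "linked R (slab i a \<delta>) (slab j b \<delta>)"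
proof -
  let ?B = "slab i a \<delta> \<inter> slab j b \<delta> :: (real ^ 'n) set"
  note sub = slab_subset_Y_star[OF ab(1) \<delta>(3), of i] slab_subset_Y_star[OF ab(2) \<delta>(3), of j]
  \<comment> \<open>\<open>\<bar>a - \<delta> / 2\<bar>\<close> is \<delta>/2 for the face at 0 and
    1 - \<delta>/2 for the face at 1, so \<open>z\<close> lies at depth \<delta>/2 below both
    faces.\<close>
  define z :: "real ^ 'n" where "z = (\<chi> k. if k = i then \<bar>a - \<delta> / 2\<bar> else if k = j then \<bar>b - \<delta> / 2\<bar> else 1/2)"
  have "z \<in> ?B" using ab \<delta> ij by (auto simp: slab_def mem_cell_Y z_def)
  then have B0: "emeasure lborel ?B \<noteq> 0" by (rule emeasure_lborel_open_neq_0[rotated]) (intro open_Int open_slab)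
  have 1: "linked R (slab i a \<delta>) ?B"
    by (rule linked_mono[OF linked_convex[OF slab_borel convex_slab sub(1)]]) auto
  have 2: "linked R ?B (slab j b \<delta>)"
    by (rule linked_mono[OF linked_convex[OF slab_borel convex_slab sub(2)]]) auto
  show ?thesis
    by (rule linked_trans[OF _ _ _ 1 2 _ B0]) (use sub in auto)
qed

text \<open>Both halves are linked to the slab on their own side. The slabs on opposite faces are
  disjoint and are joined through a slab along a face with another normal; this is where dimension
  at least 2 enters, since in one dimension the hole disconnects the cell.\<close>

lemma linked_cell_slab:
  fixes i :: "'n::finite"
  assumes card: "CARD('n) \<ge> 2" and \<delta>: "0 < \<delta>" "\<delta> \<le> 1/2" "R \<le> 1/2 - \<delta>"
  shows "linked R cell_Y (slab i 1 \<delta>)"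
proof -
  obtain j :: 'n where j: "j \<noteq> i"
  proof -
    have "\<not> (UNIV :: 'n set) \<subseteq> {i}" using card card_mono[of "{i}" "UNIV :: 'n set"] by auto
    then show ?thesis using that by auto
  qed
  have ne: "emeasure lborel (slab k a \<delta> :: (real ^ 'n) set) \<noteq> 0" if "a \<in> {0, 1}" for k a
  proof (rule emeasure_lborel_open_neq_0[OF open_slab])
    show "(\<chi> l. if l = k then \<bar>a - \<delta> / 2\<bar> else 1/2) \<in> slab k a \<delta>"
      using that \<delta> by (auto simp: slab_def mem_cell_Y)
  qed
  note sub = slab_subset_Y_star[OF _ \<delta>(3)]
  have self: "linked R (slab k a \<delta> :: (real ^ 'n) set) (slab k a \<delta>)" if "a \<in> {0, 1}" for k a
    by (rule linked_convex[OF slab_borel convex_slab sub[OF that]])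
  have h: "linked R (half_cell i a) (slab i a \<delta>)" if "a \<in> {0, 1}" for a
    by (rule linked_half_cell_slab[OF that \<delta> self[OF that]])
  have 0: "linked R (slab i 0 \<delta>) (slab i 1 \<delta>)"
    by (rule linked_trans[OF _ _ _ linked_slabs_neq[OF j[symmetric] _ _ \<delta>, of 0 1] linked_slabs_neq[OF j _ _ \<delta>, of 1 1] sub ne]) auto
  have "linked R (half_cell i 0) (slab i 1 \<delta>)"
    by (rule linked_trans[OF _ _ _ h 0 sub ne]) auto
  then have "linked R (half_cell i 0 \<union> half_cell i 1) (slab i 1 \<delta>)"
    using h[of 1] by (intro linked_Un) auto
  then show ?thesis
  proof (rule linked_mono)
    show "cell_Y \<subseteq> half_cell i 0 \<union> half_cell i 1"
    proof
      fix y :: "real ^ 'n" assume y: "y \<in> cell_Y"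
      then have "0 < y $ i" "y $ i < 1" by (auto simp: mem_cell_Y)
      then have "\<bar>y $ i - 0\<bar> \<le> 1/2 \<or> \<bar>y $ i - 1\<bar> \<le> 1/2" by arith
      then show "y \<in> half_cell i 0 \<union> half_cell i 1" using y unfolding half_cell_def by blast
    qed
  qed simp
qed

section \<open>Poincare inequality with a common reference set\<close>

definition avg :: "'a::euclidean_space set \<Rightarrow> ('a \<Rightarrow> real) \<Rightarrow> real" where
  "avg S u = (LINT x|lebesgue_on S. u x) / measure lebesgue S"

text \<open>The average is taken over a fixed slab instead of the perforated cell, so that neither
  the constant nor the normalisation depends on the radius. The estimate is the link from the whole
  cell to this slab with one integration replaced by an average.\<close>

lemma Poincare_smooth:
  assumes card: "CARD('n::finite) \<ge> 2" and R: "R < 1/2"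
  shows "\<exists>S C. open S \<and> S \<subseteq> Y_star R \<and> 0 < measure lebesgue S \<and> 0 \<le> C \<and>
    (\<forall>\<rho>\<le>R. \<forall>\<phi> :: real ^ 'n \<Rightarrow> real. \<forall>G. smooth \<phi> \<longrightarrow> (\<forall>x. GDERIV \<phi> x :> G x) \<longrightarrow>
       L2_norm (Y_star \<rho>) (\<lambda>x. \<phi> x - avg S \<phi>) \<le> C * L2_norm (Y_star \<rho>) G)"
proof -
  define \<delta> where "\<delta> = min (1/2) (1/2 - R)"
  have \<delta>: "0 < \<delta>" "\<delta> \<le> 1/2" "R \<le> 1/2 - \<delta>" using R unfolding \<delta>_def by linarith+
  fix i :: 'n
  define S :: "(real ^ 'n) set" where "S = slab i 1 \<delta>"
  have SR: "S \<subseteq> Y_star R" unfolding S_def by (rule slab_subset_Y_star) (use \<delta> in auto)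
  have oS: "open S" unfolding S_def by (rule open_slab)
  have Sb [measurable]: "S \<in> sets borel" unfolding S_def by simp
  have Sl: "S \<in> lmeasurable"
    using bounded_subset[OF bounded_Y_star SR] oS by (intro bounded_set_imp_lmeasurable) auto
  have eS: "emeasure lborel S = ennreal (measure lebesgue S)"
    using emeasure_eq_measure2[OF Sl] Sb by (simp add: emeasure_completion main_part_sets)
  have "(\<chi> l. if l = i then \<bar>1 - \<delta> / 2\<bar> else 1/2) \<in> S"
    using \<delta> by (auto simp: S_def slab_def mem_cell_Y)
  then have "emeasure lborel S \<noteq> 0" by (rule emeasure_lborel_open_neq_0[OF oS])
  then have m0: "0 < measure lebesgue S" unfolding eS by (simp add: ennreal_eq_0_iff not_le)
  obtain C where C: "0 \<le> C" "\<And>\<rho> (\<phi> :: real ^ 'n \<Rightarrow> real) G. \<rho> \<le> R \<Longrightarrow> (\<forall>x. GDERIV \<phi> x :> G x) \<Longrightarrow> continuous_on UNIV G \<Longrightarrow>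
      oscillation \<phi> (cell_Y \<inter> Y_star \<rho>) (S \<inter> Y_star \<rho>) \<le> ennreal C * dirichlet G (Y_star \<rho>)"
    using linked_cell_slab[OF card \<delta>, of i] unfolding linked_def S_def by metis
  show ?thesis
  proof (intro exI[of _ S] exI[of _ "sqrt (C / measure lebesgue S)"] conjI allI impI)
    fix \<rho> and \<phi> :: "real ^ 'n \<Rightarrow> real" and G :: "real ^ 'n \<Rightarrow> real ^ 'n"
    assume A: "\<rho> \<le> R" "smooth \<phi>" "\<forall>x. GDERIV \<phi> x :> G x"
    obtain G' where G': "\<And>x. GDERIV \<phi> x :> G' x" "continuous_on UNIV G'" using smooth_gradient[OF A(2)] by metis
    have "G = G'" using GDERIV_unique[OF _ G'(1)] A(3) by blast
    then have Gc: "continuous_on UNIV G" using G' by simp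
    have \<phi>c: "continuous_on UNIV \<phi>" using A(2) by (rule smooth_continuous)
    have [measurable]: "\<phi> \<in> borel_measurable borel" "G \<in> borel_measurable borel"
      using \<phi>c Gc by (auto intro: borel_measurable_continuous_onI)
    have S\<rho>: "S \<inter> Y_star \<rho> = S" "cell_Y \<inter> Y_star \<rho> = Y_star \<rho>"
      using SR Y_star_antimono[OF A(1)] by (auto simp: mem_Y_star)
    let ?m = "measure lebesgue S"
    \<comment> \<open>Cauchy-Schwarz over \<open>S\<close>: the squared deviation from the average
      is at most the average of the squared differences.\<close>
    have pw: "ennreal ?m * ennreal ((\<phi> x - avg S \<phi>)\<^sup>2) \<le> (\<integral>\<^sup>+y. indicator S y * ennreal ((\<phi> x - \<phi> y)\<^sup>2) \<partial>lborel)" for x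
    proof -
      define f where "f y = \<phi> x - \<phi> y" for y
      have fc: "continuous_on UNIV f" unfolding f_def by (intro continuous_intros \<phi>c)
      have bS: "bounded S" using SR bounded_Y_star bounded_subset by blast
      have fL: "f \<in> L2 S" using fc bS Sl by (intro continuous_imp_L2) auto
      have \<phi>L: "\<phi> \<in> L2 S" using \<phi>c bS Sl by (intro continuous_imp_L2) auto
      have "(LINT y|lebesgue_on S. f y) = ?m * \<phi> x - (LINT y|lebesgue_on S. \<phi> y)"
        unfolding f_def using L2_integrable[OF \<phi>L Sl] L2_integrable[OF L2_const[OF Sl], of "\<phi> x"] Sl
        by (simp add: measure_restrict_space)
      then have "?m * (\<phi> x - avg S \<phi>) = (LINT y|lebesgue_on S. f y)"
        using m0 by (simp add: avg_def right_diff_distrib)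
      then have "\<bar>?m * (\<phi> x - avg S \<phi>)\<bar> \<le> sqrt ?m * L2_norm S f"
        using L2_integral_le[OF fL Sl] by simp
      then have "(?m * (\<phi> x - avg S \<phi>))\<^sup>2 \<le> (sqrt ?m * L2_norm S f)\<^sup>2"
        by (metis abs_ge_zero power2_abs power_mono)
      then have "?m * (?m * (\<phi> x - avg S \<phi>)\<^sup>2) \<le> ?m * (L2_norm S f)\<^sup>2"
        using m0 by (simp add: power_mult_distrib power2_eq_square mult_ac)
      then have "?m * (\<phi> x - avg S \<phi>)\<^sup>2 \<le> (L2_norm S f)\<^sup>2" using m0 by simp
      then have "ennreal (?m * (\<phi> x - avg S \<phi>)\<^sup>2) \<le> ennreal ((L2_norm S f)\<^sup>2)" by (rule ennreal_leI)
      also have "\<dots> = (\<integral>\<^sup>+y. indicator S y * ennreal ((norm (f y))\<^sup>2) \<partial>lborel)"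
        by (rule nn_integral_lborel_L2[symmetric, OF borel_measurable_continuous_onI[OF fc] Sb fL])
      finally show ?thesis by (simp add: ennreal_mult f_def)
    qed
    define u where "u x = \<phi> x - avg S \<phi>" for x
    have uc: "continuous_on UNIV u" unfolding u_def by (intro continuous_intros \<phi>c)
    have [measurable]: "u \<in> borel_measurable borel" using uc by (rule borel_measurable_continuous_onI)
    have uL: "u \<in> L2 (Y_star \<rho>)" by (intro continuous_imp_L2 uc bounded_Y_star) auto
    have GL: "G \<in> L2 (Y_star \<rho>)" by (intro continuous_imp_L2 Gc bounded_Y_star) auto
    have "ennreal (?m * (L2_norm (Y_star \<rho>) u)\<^sup>2) = ennreal ?m * (\<integral>\<^sup>+x. indicator (Y_star \<rho>) x * ennreal ((norm (u x))\<^sup>2) \<partial>lborel)"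
      using nn_integral_lborel_L2[OF _ Y_star_borel uL] by (simp add: ennreal_mult)
    also have "\<dots> = (\<integral>\<^sup>+x. indicator (Y_star \<rho>) x * (ennreal ?m * ennreal ((\<phi> x - avg S \<phi>)\<^sup>2)) \<partial>lborel)"
      by (subst nn_integral_cmult[symmetric]) (auto intro!: nn_integral_cong simp: mult_ac u_def)
    also have "\<dots> \<le> (\<integral>\<^sup>+x. indicator (Y_star \<rho>) x * (\<integral>\<^sup>+y. indicator S y * ennreal ((\<phi> x - \<phi> y)\<^sup>2) \<partial>lborel) \<partial>lborel)"
      by (intro nn_integral_mono mult_left_mono pw) simp
    also have "\<dots> = oscillation \<phi> (Y_star \<rho>) S"
      unfolding oscillation_def by (simp add: nn_integral_cmult)
    also have "\<dots> \<le> ennreal C * dirichlet G (Y_star \<rho>)"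
      using C(2)[OF A(1,3) Gc] by (simp add: S\<rho>)
    also have "dirichlet G (Y_star \<rho>) = ennreal ((L2_norm (Y_star \<rho>) G)\<^sup>2)"
      unfolding dirichlet_def using nn_integral_lborel_L2[OF _ Y_star_borel GL] by simp
    also have "ennreal C * \<dots> = ennreal (C * (L2_norm (Y_star \<rho>) G)\<^sup>2)" using C(1) by (simp add: ennreal_mult)
    finally have "?m * (L2_norm (Y_star \<rho>) u)\<^sup>2 \<le> C * (L2_norm (Y_star \<rho>) G)\<^sup>2"
      using C(1) by (simp add: ennreal_le_iff)
    then have "(L2_norm (Y_star \<rho>) u)\<^sup>2 \<le> (C / ?m) * (L2_norm (Y_star \<rho>) G)\<^sup>2"
      using m0 by (simp add: field_simps)
    then have "L2_norm (Y_star \<rho>) u \<le> sqrt ((C / ?m) * (L2_norm (Y_star \<rho>) G)\<^sup>2)" by (rule real_le_rsqrt)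
    also have "\<dots> = sqrt (C / ?m) * L2_norm (Y_star \<rho>) G"
      by (simp only: real_sqrt_mult real_sqrt_abs abs_of_nonneg[OF L2_norm_nonneg])
    finally show "L2_norm (Y_star \<rho>) (\<lambda>x. \<phi> x - avg S \<phi>) \<le> sqrt (C / ?m) * L2_norm (Y_star \<rho>) G"
      unfolding u_def .
  qed (use oS SR m0 C(1) in auto)
qed

section \<open>Periodic Sobolev functions on the perforated cell\<close>

lemma L2_norm_sum_tendsto_0:
  fixes f g :: "nat \<Rightarrow> 'a::euclidean_space \<Rightarrow> 'b::euclidean_space"
  assumes "\<And>k. f k \<in> L2 A" "\<And>k. g k \<in> L2 A"
    and "(\<lambda>k. L2_norm A (f k)) \<longlonglongrightarrow> 0" "(\<lambda>k. L2_norm A (g k)) \<longlonglongrightarrow> 0"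
  shows "(\<lambda>k. L2_norm A (\<lambda>x. f k x + g k x)) \<longlonglongrightarrow> 0"
proof (rule Lim_null_comparison)
  show "\<forall>\<^sub>F k in sequentially. norm (L2_norm A (\<lambda>x. f k x + g k x)) \<le> L2_norm A (f k) + L2_norm A (g k)"
    using L2_norm_triangle[OF assms(1,2)] by simp
  show "(\<lambda>k. L2_norm A (f k) + L2_norm A (g k)) \<longlonglongrightarrow> 0"
    using tendsto_add[OF assms(3,4)] by simp
qed

lemma H1_norm_tendsto_0_iff:
  assumes "open U" "bounded U" "\<And>k. has_weak_gradient U (u k) (G k)"
  shows "(\<lambda>k. H1_norm U (u k)) \<longlonglongrightarrow> 0 \<longleftrightarrow>
    (\<lambda>k. L2_norm U (u k)) \<longlonglongrightarrow> 0 \<and> (\<lambda>k. L2_norm U (G k)) \<longlonglongrightarrow> 0"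
proof (intro iffI conjI)
  note b = H1_norm_bounds[OF assms]
  assume h: "(\<lambda>k. H1_norm U (u k)) \<longlonglongrightarrow> 0"
  show "(\<lambda>k. L2_norm U (u k)) \<longlonglongrightarrow> 0" "(\<lambda>k. L2_norm U (G k)) \<longlonglongrightarrow> 0"
    by (rule Lim_null_comparison[OF _ h]; simp add: b)+
next
  note b = H1_norm_bounds[OF assms]
  assume h: "(\<lambda>k. L2_norm U (u k)) \<longlonglongrightarrow> 0 \<and> (\<lambda>k. L2_norm U (G k)) \<longlonglongrightarrow> 0"
  then have "(\<lambda>k. L2_norm U (u k) + L2_norm U (G k)) \<longlonglongrightarrow> 0"
    using tendsto_add_zero by blast
  then show "(\<lambda>k. H1_norm U (u k)) \<longlonglongrightarrow> 0"
    by (rule Lim_null_comparison[rotated]) (use b(3) in simp)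
qed

text \<open>The sequence witnessing a face trace together with its classical gradients. Keeping the
  gradients explicit separates convergence in \<open>H1\<close> into two statements about
  \<open>L2\<close> norms and avoids the chosen representative \<open>weak_gradient\<close>.\<close>

definition trace_approx ::
  "real \<Rightarrow> (real ^ 'n \<Rightarrow> real) \<Rightarrow> (real ^ 'n \<Rightarrow> real ^ 'n) \<Rightarrow> 'n \<Rightarrow> real \<Rightarrow> (real ^ 'n \<Rightarrow> real) \<Rightarrow>
    (nat \<Rightarrow> real ^ 'n \<Rightarrow> real) \<Rightarrow> (nat \<Rightarrow> real ^ 'n \<Rightarrow> real ^ 'n) \<Rightarrow> bool" where
  "trace_approx \<rho> v G i a g \<phi> d\<phi> \<longleftrightarrow> (\<forall>k. smooth (\<phi> k)) \<and> (\<forall>k x. GDERIV (\<phi> k) x :> d\<phi> k x) \<and>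
     (\<lambda>k. L2_norm (Y_star \<rho>) (\<lambda>y. \<phi> k y - v y)) \<longlonglongrightarrow> 0 \<and>
     (\<lambda>k. L2_norm (Y_star \<rho>) (\<lambda>y. d\<phi> k y - G y)) \<longlonglongrightarrow> 0 \<and>
     (\<lambda>k. L2_norm cell_Y (\<lambda>y. \<phi> k (subst_coord i a y) - g y)) \<longlonglongrightarrow> 0"

lemma has_face_trace_iff:
  assumes w: "has_weak_gradient (Y_star \<rho>) v G"
  shows "has_face_trace \<rho> v i a g \<longleftrightarrow> g \<in> L2 cell_Y \<and> (\<exists>\<phi> d\<phi>. trace_approx \<rho> v G i a g \<phi> d\<phi>)"
proof -
  have eq: "(\<lambda>k. H1_norm (Y_star \<rho>) (\<lambda>y. \<phi> k y - v y)) \<longlonglongrightarrow> 0 \<longleftrightarrow>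
      (\<lambda>k. L2_norm (Y_star \<rho>) (\<lambda>y. \<phi> k y - v y)) \<longlonglongrightarrow> 0 \<and> (\<lambda>k. L2_norm (Y_star \<rho>) (\<lambda>y. d\<phi> k y - G y)) \<longlonglongrightarrow> 0"
    if "\<And>k. smooth (\<phi> k)" "\<And>k x. GDERIV (\<phi> k) x :> d\<phi> k x" for \<phi> d\<phi>
    by (rule H1_norm_tendsto_0_iff[OF open_Y_star bounded_Y_star])
      (intro has_weak_gradient_diff open_Y_star bounded_Y_star w has_weak_gradient_smooth that)
  have v: "v \<in> H1 (Y_star \<rho>)" using w by (auto simp: H1_def)
  show ?thesis
  proof
    assume h: "has_face_trace \<rho> v i a g"
    then obtain \<phi> :: "nat \<Rightarrow> real ^ 'a \<Rightarrow> real" where \<phi>: "\<And>k. smooth (\<phi> k)" "(\<lambda>k. H1_norm (Y_star \<rho>) (\<lambda>y. \<phi> k y - v y)) \<longlonglongrightarrow> 0"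
      "(\<lambda>k. L2_norm cell_Y (\<lambda>y. \<phi> k (subst_coord i a y) - g y)) \<longlonglongrightarrow> 0" "g \<in> L2 cell_Y"
      unfolding has_face_trace_def by blast
    have "\<exists>G. \<forall>x. GDERIV (\<phi> k) x :> G x" for k using smooth_gradient[OF \<phi>(1)] by metis
    then obtain d\<phi> where d: "\<And>k x. GDERIV (\<phi> k) x :> d\<phi> k x" by metis
    have "trace_approx \<rho> v G i a g \<phi> d\<phi>"
      using \<phi> d eq[OF \<phi>(1) d] by (simp add: trace_approx_def)
    with \<phi>(4) show "g \<in> L2 cell_Y \<and> (\<exists>\<phi> d\<phi>. trace_approx \<rho> v G i a g \<phi> d\<phi>)"
      by (intro conjI exI)
  next
    assume h: "g \<in> L2 cell_Y \<and> (\<exists>\<phi> d\<phi>. trace_approx \<rho> v G i a g \<phi> d\<phi>)"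
    then obtain \<phi> d\<phi> where t: "trace_approx \<rho> v G i a g \<phi> d\<phi>" by blast
    then have sm: "\<And>k. smooth (\<phi> k)" "\<And>k x. GDERIV (\<phi> k) x :> d\<phi> k x" by (auto simp: trace_approx_def)
    show "has_face_trace \<rho> v i a g"
      unfolding has_face_trace_def using h t v eq[OF sm] sm(1)
      by (intro conjI exI[of _ \<phi>]) (simp_all add: trace_approx_def)
  qed
qed

lemma trace_approx_in_L2:
  assumes t: "trace_approx \<rho> v G i a g \<phi> d\<phi>" and w: "has_weak_gradient (Y_star \<rho>) v G" and g: "g \<in> L2 cell_Y"
  shows "(\<lambda>y. \<phi> k y - v y) \<in> L2 (Y_star \<rho>)" "(\<lambda>y. d\<phi> k y - G y) \<in> L2 (Y_star \<rho>)"
    "(\<lambda>y. \<phi> k (subst_coord i a y) - g y) \<in> L2 cell_Y"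
proof -
  have sm: "smooth (\<phi> k)" "\<And>x. GDERIV (\<phi> k) x :> d\<phi> k x" using t by (auto simp: trace_approx_def)
  have wk: "has_weak_gradient (Y_star \<rho>) (\<phi> k) (d\<phi> k)"
    by (rule has_weak_gradient_smooth[OF open_Y_star bounded_Y_star sm])
  show "(\<lambda>y. \<phi> k y - v y) \<in> L2 (Y_star \<rho>)" "(\<lambda>y. d\<phi> k y - G y) \<in> L2 (Y_star \<rho>)"
    using has_weak_gradient_L2[OF w] has_weak_gradient_L2[OF wk] by auto
  have cs: "continuous_on UNIV (\<lambda>y. \<phi> k (subst_coord i a y))"
    unfolding subst_coord_eq by (intro continuous_on_compose2[OF smooth_continuous[OF sm(1), of UNIV]] continuous_intros) auto
  show "(\<lambda>y. \<phi> k (subst_coord i a y) - g y) \<in> L2 cell_Y"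
    by (intro L2_diff g continuous_imp_L2 cs bounded_cell_Y) auto
qed

lemma trace_approx_add:
  assumes t: "trace_approx \<rho> v G i a g \<phi> d\<phi>" and w: "has_weak_gradient (Y_star \<rho>) v G" and g: "g \<in> L2 cell_Y"
    and t': "trace_approx \<rho> v' G' i a g' \<phi>' d\<phi>'" and w': "has_weak_gradient (Y_star \<rho>) v' G'" and g': "g' \<in> L2 cell_Y"
  shows "trace_approx \<rho> (\<lambda>y. v y + v' y) (\<lambda>y. G y + G' y) i a (\<lambda>y. g y + g' y)
    (\<lambda>k y. \<phi> k y + \<phi>' k y) (\<lambda>k y. d\<phi> k y + d\<phi>' k y)"
proof -
  note L = trace_approx_in_L2[OF t w g] and L' = trace_approx_in_L2[OF t' w' g']
  have T: "\<And>k. smooth (\<phi> k)" "\<And>k x. GDERIV (\<phi> k) x :> d\<phi> k x"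
     "(\<lambda>k. L2_norm (Y_star \<rho>) (\<lambda>y. \<phi> k y - v y)) \<longlonglongrightarrow> 0"
     "(\<lambda>k. L2_norm (Y_star \<rho>) (\<lambda>y. d\<phi> k y - G y)) \<longlonglongrightarrow> 0"
     "(\<lambda>k. L2_norm cell_Y (\<lambda>y. \<phi> k (subst_coord i a y) - g y)) \<longlonglongrightarrow> 0"
    using t by (auto simp: trace_approx_def)
  have T': "\<And>k. smooth (\<phi>' k)" "\<And>k x. GDERIV (\<phi>' k) x :> d\<phi>' k x"
     "(\<lambda>k. L2_norm (Y_star \<rho>) (\<lambda>y. \<phi>' k y - v' y)) \<longlonglongrightarrow> 0"
     "(\<lambda>k. L2_norm (Y_star \<rho>) (\<lambda>y. d\<phi>' k y - G' y)) \<longlonglongrightarrow> 0"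
     "(\<lambda>k. L2_norm cell_Y (\<lambda>y. \<phi>' k (subst_coord i a y) - g' y)) \<longlonglongrightarrow> 0"
    using t' by (auto simp: trace_approx_def)
  show ?thesis
    unfolding trace_approx_def
    using L2_norm_sum_tendsto_0[OF L(1) L'(1) T(3) T'(3)] L2_norm_sum_tendsto_0[OF L(2) L'(2) T(4) T'(4)]
      L2_norm_sum_tendsto_0[OF L(3) L'(3) T(5) T'(5)] T(1,2) T'(1,2)
    by (auto simp: add_diff_add intro: smooth_add GDERIV_add)
qed

lemma trace_approx_cmult:
  assumes t: "trace_approx \<rho> v G i a g \<phi> d\<phi>"
  shows "trace_approx \<rho> (\<lambda>y. c * v y) (\<lambda>y. c *\<^sub>R G y) i a (\<lambda>y. c * g y) (\<lambda>k y. c * \<phi> k y) (\<lambda>k y. c *\<^sub>R d\<phi> k y)"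
proof -
  have s: "(\<lambda>k. L2_norm A (\<lambda>y. c *\<^sub>R f k y - c *\<^sub>R h y)) \<longlonglongrightarrow> 0"
    if "(\<lambda>k. L2_norm A (\<lambda>y. f k y - h y)) \<longlonglongrightarrow> 0" for A and f :: "nat \<Rightarrow> real ^ 'a \<Rightarrow> 'b::euclidean_space" and h
    using tendsto_mult_right_zero[OF that, of "\<bar>c\<bar>"] by (simp add: L2_norm_scaleR flip: scaleR_diff_right)
  have "GDERIV (\<lambda>y. c * \<phi> k y) x :> c *\<^sub>R d\<phi> k x" for k x
    using GDERIV_mult[OF GDERIV_const, of "\<phi> k" x "d\<phi> k x" c] t by (simp add: trace_approx_def)
  then show ?thesis
    using t s[of _ "\<lambda>k y. \<phi> k y" v] s[of _ "\<lambda>k y. d\<phi> k y" G] s[of _ "\<lambda>k y. \<phi> k (subst_coord i a y)" g]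
    by (auto simp: trace_approx_def intro: smooth_cmult)
qed

text \<open>Opposite faces may use different approximating sequences; only the trace
  \<open>g\<close> is shared.\<close>

definition has_periodic_trace ::
  "real \<Rightarrow> (real ^ 'n \<Rightarrow> real) \<Rightarrow> (real ^ 'n \<Rightarrow> real ^ 'n) \<Rightarrow> 'n \<Rightarrow> bool" where
  "has_periodic_trace \<rho> v G i \<longleftrightarrow> (\<exists>g\<in>L2 cell_Y.
     (\<exists>\<phi> d\<phi>. trace_approx \<rho> v G i 0 g \<phi> d\<phi>) \<and> (\<exists>\<phi> d\<phi>. trace_approx \<rho> v G i 1 g \<phi> d\<phi>))"

lemma has_periodic_traceI:
  "g \<in> L2 cell_Y \<Longrightarrow> trace_approx \<rho> v G i 0 g \<phi> d\<phi> \<Longrightarrow> trace_approx \<rho> v G i 1 g \<psi> d\<psi> \<Longrightarrow> has_periodic_trace \<rho> v G i"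
  unfolding has_periodic_trace_def by (intro bexI[of _ g] conjI exI)

lemma has_periodic_traceE:
  assumes "has_periodic_trace \<rho> v G i"
  obtains g \<phi> d\<phi> \<psi> d\<psi> where "g \<in> L2 cell_Y" "trace_approx \<rho> v G i 0 g \<phi> d\<phi>" "trace_approx \<rho> v G i 1 g \<psi> d\<psi>"
  using assms unfolding has_periodic_trace_def by (elim bexE conjE exE)

lemma H1_per_iff:
  assumes w: "has_weak_gradient (Y_star \<rho>) v G"
  shows "v \<in> H1_per \<rho> \<longleftrightarrow> (\<forall>i. has_periodic_trace \<rho> v G i)"
proof -
  have "v \<in> H1 (Y_star \<rho>)" using w by (auto simp: H1_def)
  then have "v \<in> H1_per \<rho> \<longleftrightarrow> (\<forall>i. \<exists>g. has_face_trace \<rho> v i 0 g \<and> has_face_trace \<rho> v i 1 g)"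
    by (simp add: H1_per_def)
  also have "\<dots> \<longleftrightarrow> (\<forall>i. has_periodic_trace \<rho> v G i)"
    by (simp add: has_face_trace_iff[OF w] has_periodic_trace_def Bex_def conj_ac)
  finally show ?thesis .
qed

lemma H1_per_weak_gradient: "v \<in> H1_per \<rho> \<Longrightarrow> has_weak_gradient (Y_star \<rho>) v (weak_gradient (Y_star \<rho>) v)"
  by (simp add: H1_per_def H1_iff)

lemma H1_per_add:
  assumes v: "v \<in> H1_per \<rho>" and v': "v' \<in> H1_per \<rho>"
  shows "(\<lambda>y. v y + v' y) \<in> H1_per \<rho>"
proof -
  note w = H1_per_weak_gradient[OF v] and w' = H1_per_weak_gradient[OF v']
  note w2 = has_weak_gradient_add[OF open_Y_star bounded_Y_star w w']
  show ?thesis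
    unfolding H1_per_iff[OF w2]
  proof
    fix i
    obtain g \<phi> d\<phi> \<psi> d\<psi> where 1: "g \<in> L2 cell_Y" "trace_approx \<rho> v (weak_gradient (Y_star \<rho>) v) i 0 g \<phi> d\<phi>"
      "trace_approx \<rho> v (weak_gradient (Y_star \<rho>) v) i 1 g \<psi> d\<psi>"
      using H1_per_iff[OF w] v by (meson has_periodic_traceE)
    obtain g' \<phi>' d\<phi>' \<psi>' d\<psi>' where 2: "g' \<in> L2 cell_Y" "trace_approx \<rho> v' (weak_gradient (Y_star \<rho>) v') i 0 g' \<phi>' d\<phi>'"
      "trace_approx \<rho> v' (weak_gradient (Y_star \<rho>) v') i 1 g' \<psi>' d\<psi>'"
      using H1_per_iff[OF w'] v' by (meson has_periodic_traceE)
    show "has_periodic_trace \<rho> (\<lambda>y. v y + v' y) (\<lambda>y. weak_gradient (Y_star \<rho>) v y + weak_gradient (Y_star \<rho>) v' y) i"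
      by (rule has_periodic_traceI[OF L2_add[OF 1(1) 2(1)] trace_approx_add[OF 1(2) w 1(1) 2(2) w' 2(1)]
            trace_approx_add[OF 1(3) w 1(1) 2(3) w' 2(1)]])
  qed
qed

lemma H1_per_cmult:
  assumes v: "v \<in> H1_per \<rho>"
  shows "(\<lambda>y. c * v y) \<in> H1_per \<rho>"
proof -
  note w = H1_per_weak_gradient[OF v]
  show ?thesis
    unfolding H1_per_iff[OF has_weak_gradient_cmult[OF w]]
  proof
    fix i
    obtain g \<phi> d\<phi> \<psi> d\<psi> where 1: "g \<in> L2 cell_Y" "trace_approx \<rho> v (weak_gradient (Y_star \<rho>) v) i 0 g \<phi> d\<phi>"
      "trace_approx \<rho> v (weak_gradient (Y_star \<rho>) v) i 1 g \<psi> d\<psi>"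
      using H1_per_iff[OF w] v by (meson has_periodic_traceE)
    show "has_periodic_trace \<rho> (\<lambda>y. c * v y) (\<lambda>y. c *\<^sub>R weak_gradient (Y_star \<rho>) v y) i"
      by (rule has_periodic_traceI[OF L2_cmult[OF 1(1)] trace_approx_cmult[OF 1(2)] trace_approx_cmult[OF 1(3)]])
  qed
qed

lemma H1_per_diff: "v \<in> H1_per \<rho> \<Longrightarrow> v' \<in> H1_per \<rho> \<Longrightarrow> (\<lambda>y. v y - v' y) \<in> H1_per \<rho>"
  using H1_per_add[OF _ H1_per_cmult[of v' \<rho> "-1"], of v] by simp

lemma has_weak_gradient_const: "has_weak_gradient (Y_star \<rho>) (\<lambda>y. c) (\<lambda>y. 0)"
  by (rule has_weak_gradient_smooth[OF open_Y_star bounded_Y_star smooth_const GDERIV_const])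

lemma H1_per_const: "(\<lambda>y. c) \<in> H1_per \<rho>"
proof -
  have "trace_approx \<rho> (\<lambda>y. c) (\<lambda>y. 0) i a (\<lambda>y. c) (\<lambda>k y. c) (\<lambda>k y. 0)" for i a
    by (simp add: trace_approx_def L2_norm_def GDERIV_const)
  then show ?thesis
    unfolding H1_per_iff[OF has_weak_gradient_const] using has_periodic_traceI[OF L2_const[OF cell_Y_lmeasurable]] by blast
qed

lemma H1_per_sum: "(\<And>j. j \<in> I \<Longrightarrow> v j \<in> H1_per \<rho>) \<Longrightarrow> (\<lambda>y. \<Sum>j\<in>I. v j y) \<in> H1_per \<rho>"
  by (induction I rule: infinite_finite_induct) (auto intro: H1_per_const H1_per_add)

text \<open>Traces are measured on the faces of the full cell and are unaffected by the hole, while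
  norms over the smaller perforated cell only decrease. This makes the spaces for different radii
  nested.\<close>

lemma H1_per_antimono:
  assumes v: "v \<in> H1_per \<rho>" and le: "\<rho> \<le> \<sigma>"
  shows "v \<in> H1_per \<sigma>"
proof -
  note w = H1_per_weak_gradient[OF v]
  note sub = Y_star_antimono[OF le]
  note w2 = has_weak_gradient_subset[OF w sub open_Y_star open_Y_star]
  have t: "trace_approx \<sigma> v (weak_gradient (Y_star \<rho>) v) i a g \<phi> d\<phi>"
    if "trace_approx \<rho> v (weak_gradient (Y_star \<rho>) v) i a g \<phi> d\<phi>" "g \<in> L2 cell_Y" for i a g \<phi> d\<phi>
  proof -
    note L = trace_approx_in_L2[OF that(1) w that(2)]
    have "(\<lambda>k. L2_norm (Y_star \<sigma>) (\<lambda>y. \<phi> k y - v y)) \<longlonglongrightarrow> 0"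
      by (rule Lim_null_comparison[where g = "\<lambda>k. L2_norm (Y_star \<rho>) (\<lambda>y. \<phi> k y - v y)"])
        (use that(1) L2_subset(2)[OF L(1) sub] in \<open>auto simp: trace_approx_def\<close>)
    moreover have "(\<lambda>k. L2_norm (Y_star \<sigma>) (\<lambda>y. d\<phi> k y - weak_gradient (Y_star \<rho>) v y)) \<longlonglongrightarrow> 0"
      by (rule Lim_null_comparison[where g = "\<lambda>k. L2_norm (Y_star \<rho>) (\<lambda>y. d\<phi> k y - weak_gradient (Y_star \<rho>) v y)"])
        (use that(1) L2_subset(2)[OF L(2) sub] in \<open>auto simp: trace_approx_def\<close>)
    ultimately show ?thesis using that(1) by (auto simp: trace_approx_def)
  qed
  show ?thesis
    unfolding H1_per_iff[OF w2]
  proof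
    fix i
    obtain g \<phi> d\<phi> \<psi> d\<psi> where 1: "g \<in> L2 cell_Y" "trace_approx \<rho> v (weak_gradient (Y_star \<rho>) v) i 0 g \<phi> d\<phi>"
      "trace_approx \<rho> v (weak_gradient (Y_star \<rho>) v) i 1 g \<psi> d\<psi>"
      using H1_per_iff[OF w] v by (meson has_periodic_traceE)
    show "has_periodic_trace \<sigma> v (weak_gradient (Y_star \<rho>) v) i"
      by (rule has_periodic_traceI[OF 1(1) t[OF 1(2) 1(1)] t[OF 1(3) 1(1)]])
  qed
qed

lemma has_weak_gradient_cong_AE2:
  assumes U: "U \<in> sets lebesgue" and G: "has_weak_gradient U u G"
    and eq: "AE x in lebesgue_on U. u x = v x"
  shows "has_weak_gradient U v G"
  unfolding has_weak_gradient_def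
proof (intro conjI allI impI)
  show "v \<in> L2 U" "G \<in> L2 U" using G L2_cong_AE[OF U _ eq] by (auto simp: has_weak_gradient_def)
  fix \<psi> d\<psi> assume t: "test_function U \<psi>" "\<forall>x. GDERIV \<psi> x :> d\<psi> x"
  have "(LINT x|lebesgue_on U. u x *\<^sub>R d\<psi> x) = (LINT x|lebesgue_on U. v x *\<^sub>R d\<psi> x)"
    using eq by (intro integral_lebesgue_on_cong_AE[OF U]) auto
  then show "(LINT x|lebesgue_on U. v x *\<^sub>R d\<psi> x) = - (LINT x|lebesgue_on U. \<psi> x *\<^sub>R G x)"
    using G t unfolding has_weak_gradient_def by metis
qed

lemma H1_per_cong_AE:
  assumes v: "v \<in> H1_per \<rho>" and eq: "AE y in lebesgue_on (Y_star \<rho>). v y = v' y"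
  shows "v' \<in> H1_per \<rho>"
proof -
  note w = H1_per_weak_gradient[OF v]
  note w2 = has_weak_gradient_cong_AE2[OF Y_star_sets w eq]
  have n: "L2_norm (Y_star \<rho>) (\<lambda>y. \<phi> y - v' y) = L2_norm (Y_star \<rho>) (\<lambda>y. \<phi> y - v y)" for \<phi>
    using eq by (intro L2_norm_cong_AE[OF Y_star_sets]) auto
  show ?thesis
    using v unfolding H1_per_iff[OF w2] H1_per_iff[OF w] has_periodic_trace_def trace_approx_def n .
qed

text \<open>Closedness of the periodic space. A diagonal choice of smooth functions approximates
  \<open>v\<close>; by the trace inequality their values on the face at 0 converge, hence so do the
  traces \<open>g n\<close>. As \<open>g n\<close> is common to both faces, the limit trace is
  too.\<close>

lemma H1_per_limit:
  fixes v :: "real ^ 'n \<Rightarrow> real"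
  assumes \<rho>: "\<rho> < 1/2" and u: "\<And>n. u n \<in> H1_per \<rho>" and w: "\<And>n. has_weak_gradient (Y_star \<rho>) (u n) (G n)"
    and v: "v \<in> L2 (Y_star \<rho>)" "(\<lambda>n. L2_norm (Y_star \<rho>) (\<lambda>y. u n y - v y)) \<longlonglongrightarrow> 0"
    and H: "H \<in> L2 (Y_star \<rho>)" "(\<lambda>n. L2_norm (Y_star \<rho>) (\<lambda>y. G n y - H y)) \<longlonglongrightarrow> 0"
  shows "has_weak_gradient (Y_star \<rho>) v H" "v \<in> H1_per \<rho>"
proof -
  show wv: "has_weak_gradient (Y_star \<rho>) v H"
    by (rule has_weak_gradient_limit[OF open_Y_star bounded_Y_star w v H])
  define e where "e n = inverse (real (Suc n))" for n
  have e: "0 < e n" "e \<longlonglongrightarrow> 0" for n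
    unfolding e_def using LIMSEQ_inverse_real_of_nat by simp_all
  show "v \<in> H1_per \<rho>"
    unfolding H1_per_iff[OF wv]
  proof
    fix i :: 'n
    have "\<exists>g\<in>L2 cell_Y. (\<exists>\<phi> d\<phi>. trace_approx \<rho> (u n) (G n) i 0 g \<phi> d\<phi>) \<and> (\<exists>\<phi> d\<phi>. trace_approx \<rho> (u n) (G n) i 1 g \<phi> d\<phi>)" for n
      using u[of n] unfolding H1_per_iff[OF w] has_periodic_trace_def by blast
    then obtain g where g: "\<And>n. g n \<in> L2 cell_Y" and ga: "\<And>n. \<exists>\<phi> d\<phi>. trace_approx \<rho> (u n) (G n) i 0 (g n) \<phi> d\<phi>"
      "\<And>n. \<exists>\<phi> d\<phi>. trace_approx \<rho> (u n) (G n) i 1 (g n) \<phi> d\<phi>" by metis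
    \<comment> \<open>One smooth function within \<open>e n\<close> of \<open>u n\<close> in value,
      gradient and trace simultaneously.\<close>
    have pick: "\<exists>\<psi> d\<psi>. smooth \<psi> \<and> (\<forall>x. GDERIV \<psi> x :> d\<psi> x) \<and> L2_norm (Y_star \<rho>) (\<lambda>y. \<psi> y - u n y) < e n \<and>
        L2_norm (Y_star \<rho>) (\<lambda>y. d\<psi> y - G n y) < e n \<and> L2_norm cell_Y (\<lambda>y. \<psi> (subst_coord i a y) - g n y) < e n"
      if ex: "\<exists>\<phi> d\<phi>. trace_approx \<rho> (u n) (G n) i a (g n) \<phi> d\<phi>" for n a
    proof -
      obtain \<phi> d\<phi> where t: "trace_approx \<rho> (u n) (G n) i a (g n) \<phi> d\<phi>" using ex by blast
      have "eventually (\<lambda>k. L2_norm (Y_star \<rho>) (\<lambda>y. \<phi> k y - u n y) < e n) sequentially"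
        "eventually (\<lambda>k. L2_norm (Y_star \<rho>) (\<lambda>y. d\<phi> k y - G n y) < e n) sequentially"
        "eventually (\<lambda>k. L2_norm cell_Y (\<lambda>y. \<phi> k (subst_coord i a y) - g n y) < e n) sequentially"
        using t e(1)[of n] by (auto simp: trace_approx_def intro: order_tendstoD)
      then have "eventually (\<lambda>k. L2_norm (Y_star \<rho>) (\<lambda>y. \<phi> k y - u n y) < e n \<and>
        L2_norm (Y_star \<rho>) (\<lambda>y. d\<phi> k y - G n y) < e n \<and> L2_norm cell_Y (\<lambda>y. \<phi> k (subst_coord i a y) - g n y) < e n) sequentially"
        by eventually_elim blast
      then obtain k where "L2_norm (Y_star \<rho>) (\<lambda>y. \<phi> k y - u n y) < e n \<and>
        L2_norm (Y_star \<rho>) (\<lambda>y. d\<phi> k y - G n y) < e n \<and> L2_norm cell_Y (\<lambda>y. \<phi> k (subst_coord i a y) - g n y) < e n"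
        using eventually_happens'[OF sequentially_bot] by blast
      then show ?thesis using t unfolding trace_approx_def by blast
    qed
    have approx: "\<exists>\<psi> d\<psi>. (\<forall>n. smooth (\<psi> n)) \<and> (\<forall>n x. GDERIV (\<psi> n) x :> d\<psi> n x) \<and>
        (\<lambda>n. L2_norm (Y_star \<rho>) (\<lambda>y. \<psi> n y - v y)) \<longlonglongrightarrow> 0 \<and> (\<lambda>n. L2_norm (Y_star \<rho>) (\<lambda>y. d\<psi> n y - H y)) \<longlonglongrightarrow> 0 \<and>
        (\<lambda>n. L2_norm cell_Y (\<lambda>y. \<psi> n (subst_coord i a y) - g n y)) \<longlonglongrightarrow> 0"
      if ex: "\<And>n. \<exists>\<phi> d\<phi>. trace_approx \<rho> (u n) (G n) i a (g n) \<phi> d\<phi>" for a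
    proof -
      define P where "P n \<psi> d\<psi> \<longleftrightarrow> smooth \<psi> \<and> (\<forall>x. GDERIV \<psi> x :> d\<psi> x) \<and> L2_norm (Y_star \<rho>) (\<lambda>y. \<psi> y - u n y) < e n \<and>
        L2_norm (Y_star \<rho>) (\<lambda>y. d\<psi> y - G n y) < e n \<and> L2_norm cell_Y (\<lambda>y. \<psi> (subst_coord i a y) - g n y) < e n"
        for n \<psi> d\<psi>
      have "\<exists>\<psi> d\<psi>. P n \<psi> d\<psi>" for n
        using pick[OF ex] unfolding P_def .
      then obtain \<psi> d\<psi> where P: "\<And>n. P n (\<psi> n) (d\<psi> n)" by metis
      have s: "\<And>n. smooth (\<psi> n)" "\<And>n x. GDERIV (\<psi> n) x :> d\<psi> n x"
        "\<And>n. L2_norm (Y_star \<rho>) (\<lambda>y. \<psi> n y - u n y) < e n" "\<And>n. L2_norm (Y_star \<rho>) (\<lambda>y. d\<psi> n y - G n y) < e n"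
        "\<And>n. L2_norm cell_Y (\<lambda>y. \<psi> n (subst_coord i a y) - g n y) < e n"
        using P unfolding P_def by simp_all
      have ws: "has_weak_gradient (Y_star \<rho>) (\<psi> n) (d\<psi> n)" for n
        by (rule has_weak_gradient_smooth[OF open_Y_star bounded_Y_star s(1,2)])
      have z: "(\<lambda>n. f n) \<longlonglongrightarrow> 0" if "\<And>n. f n < e n" "\<And>n. 0 \<le> f n" for f
        by (rule Lim_null_comparison[OF _ e(2)]) (use that in \<open>simp add: less_imp_le\<close>)
      have "(\<lambda>n. L2_norm (Y_star \<rho>) (\<lambda>y. (\<psi> n y - u n y) + (u n y - v y))) \<longlonglongrightarrow> 0"
        by (rule L2_norm_sum_tendsto_0[OF L2_diff[OF has_weak_gradient_L2(1)[OF ws] has_weak_gradient_L2(1)[OF w]]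
              L2_diff[OF has_weak_gradient_L2(1)[OF w] v(1)] z v(2)]) (use s in auto)
      moreover have "(\<lambda>n. L2_norm (Y_star \<rho>) (\<lambda>y. (d\<psi> n y - G n y) + (G n y - H y))) \<longlonglongrightarrow> 0"
        by (rule L2_norm_sum_tendsto_0[OF L2_diff[OF has_weak_gradient_L2(2)[OF ws] has_weak_gradient_L2(2)[OF w]]
              L2_diff[OF has_weak_gradient_L2(2)[OF w] H(1)] z H(2)]) (use s in auto)
      moreover have "(\<lambda>n. L2_norm cell_Y (\<lambda>y. \<psi> n (subst_coord i a y) - g n y)) \<longlonglongrightarrow> 0"
        by (rule z) (use s in auto)
      ultimately show ?thesis using s(1,2) by (auto intro!: exI[of _ \<psi>] exI[of _ d\<psi>])
    qed
    obtain \<psi> d\<psi> where p0: "\<And>n. smooth (\<psi> n)" "\<And>n x. GDERIV (\<psi> n) x :> d\<psi> n x"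
      "(\<lambda>n. L2_norm (Y_star \<rho>) (\<lambda>y. \<psi> n y - v y)) \<longlonglongrightarrow> 0" "(\<lambda>n. L2_norm (Y_star \<rho>) (\<lambda>y. d\<psi> n y - H y)) \<longlonglongrightarrow> 0"
      "(\<lambda>n. L2_norm cell_Y (\<lambda>y. \<psi> n (subst_coord i 0 y) - g n y)) \<longlonglongrightarrow> 0"
      using approx[OF ga(1)] by blast
    obtain \<zeta> d\<zeta> where p1: "\<And>n. smooth (\<zeta> n)" "\<And>n x. GDERIV (\<zeta> n) x :> d\<zeta> n x"
      "(\<lambda>n. L2_norm (Y_star \<rho>) (\<lambda>y. \<zeta> n y - v y)) \<longlonglongrightarrow> 0" "(\<lambda>n. L2_norm (Y_star \<rho>) (\<lambda>y. d\<zeta> n y - H y)) \<longlonglongrightarrow> 0"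
      "(\<lambda>n. L2_norm cell_Y (\<lambda>y. \<zeta> n (subst_coord i 1 y) - g n y)) \<longlonglongrightarrow> 0"
      using approx[OF ga(2)] by blast
    obtain C where C: "\<And>\<phi> :: real ^ 'n \<Rightarrow> real. smooth \<phi> \<Longrightarrow> (\<lambda>y. \<phi> (subst_coord i 0 y)) \<in> L2 cell_Y"
      "\<And>\<phi> :: real ^ 'n \<Rightarrow> real. smooth \<phi> \<Longrightarrow> L2_norm cell_Y (\<lambda>y. \<phi> (subst_coord i 0 y)) \<le> C * H1_norm (Y_star \<rho>) \<phi>"
      using trace_inequality[OF \<rho>, of 0 i] by auto
    have C': "(\<lambda>y. \<phi> (subst_coord i 1 y)) \<in> L2 cell_Y" if "smooth \<phi>" for \<phi> :: "real ^ 'n \<Rightarrow> real"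
      using trace_inequality[OF \<rho>, of 1 i] that by auto
    have wp: "has_weak_gradient (Y_star \<rho>) (\<psi> n) (d\<psi> n)" for n
      by (rule has_weak_gradient_smooth[OF open_Y_star bounded_Y_star p0(1,2)])
    \<comment> \<open>Distance of the diagonal sequence from its limit, an upper bound for the
      \<open>H1\<close> norm; the trace inequality turns it into a Cauchy estimate on the
      face.\<close>
    define \<eta> where "\<eta> n = L2_norm (Y_star \<rho>) (\<lambda>y. \<psi> n y - v y) + L2_norm (Y_star \<rho>) (\<lambda>y. d\<psi> n y - H y)" for n
    have \<eta>0: "\<eta> \<longlonglongrightarrow> 0" unfolding \<eta>_def using tendsto_add[OF p0(3,4)] by simp
    have \<eta>n: "0 \<le> \<eta> n" for n by (simp add: \<eta>_def)
    have cau: "L2_norm cell_Y (\<lambda>y. \<psi> m (subst_coord i 0 y) - \<psi> n (subst_coord i 0 y)) \<le> \<bar>C\<bar> * (\<eta> m + \<eta> n)" for m n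
    proof -
      have sm: "smooth (\<lambda>y. \<psi> m y - \<psi> n y)"
        using smooth_add[OF p0(1)[of m] smooth_cmult[OF p0(1)[of n], of "-1"]] by simp
      note wd = has_weak_gradient_diff[OF open_Y_star bounded_Y_star wp[of m] wp[of n]]
      have L: "\<psi> k \<in> L2 (Y_star \<rho>)" "d\<psi> k \<in> L2 (Y_star \<rho>)" for k using has_weak_gradient_L2[OF wp] by auto
      have "H1_norm (Y_star \<rho>) (\<lambda>y. \<psi> m y - \<psi> n y) \<le> L2_norm (Y_star \<rho>) (\<lambda>y. \<psi> m y - \<psi> n y) + L2_norm (Y_star \<rho>) (\<lambda>y. d\<psi> m y - d\<psi> n y)"
        by (rule H1_norm_bounds(3)[OF open_Y_star bounded_Y_star wd])
      also have "L2_norm (Y_star \<rho>) (\<lambda>y. \<psi> m y - \<psi> n y) \<le> L2_norm (Y_star \<rho>) (\<lambda>y. \<psi> m y - v y) + L2_norm (Y_star \<rho>) (\<lambda>y. v y - \<psi> n y)"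
        by (rule L2_norm_triangle_diff[OF L(1) v(1) L(1)])
      also have "L2_norm (Y_star \<rho>) (\<lambda>y. v y - \<psi> n y) = L2_norm (Y_star \<rho>) (\<lambda>y. \<psi> n y - v y)" by (rule L2_norm_minus_commute)
      also have "L2_norm (Y_star \<rho>) (\<lambda>y. d\<psi> m y - d\<psi> n y) \<le> L2_norm (Y_star \<rho>) (\<lambda>y. d\<psi> m y - H y) + L2_norm (Y_star \<rho>) (\<lambda>y. H y - d\<psi> n y)"
        by (rule L2_norm_triangle_diff[OF L(2) H(1) L(2)])
      also have "L2_norm (Y_star \<rho>) (\<lambda>y. H y - d\<psi> n y) = L2_norm (Y_star \<rho>) (\<lambda>y. d\<psi> n y - H y)" by (rule L2_norm_minus_commute)
      finally have h: "H1_norm (Y_star \<rho>) (\<lambda>y. \<psi> m y - \<psi> n y) \<le> \<eta> m + \<eta> n" by (simp add: \<eta>_def)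
      have "L2_norm cell_Y (\<lambda>y. \<psi> m (subst_coord i 0 y) - \<psi> n (subst_coord i 0 y)) \<le> C * H1_norm (Y_star \<rho>) (\<lambda>y. \<psi> m y - \<psi> n y)"
        using C(2)[OF sm] .
      also have "\<dots> \<le> \<bar>C\<bar> * H1_norm (Y_star \<rho>) (\<lambda>y. \<psi> m y - \<psi> n y)" by (intro mult_right_mono) auto
      also have "\<dots> \<le> \<bar>C\<bar> * (\<eta> m + \<eta> n)" using h by (intro mult_left_mono) auto
      finally show ?thesis .
    qed
    have "\<exists>h\<in>L2 cell_Y. (\<lambda>n. L2_norm cell_Y (\<lambda>y. \<psi> n (subst_coord i 0 y) - h y)) \<longlonglongrightarrow> 0"
    proof (rule L2_complete)
      show "(\<lambda>y. \<psi> n (subst_coord i 0 y)) \<in> L2 cell_Y" for n using C(1)[OF p0(1)] .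
      fix \<epsilon> :: real assume \<epsilon>: "0 < \<epsilon>"
      define d where "d = \<epsilon> / (\<bar>C\<bar> + 1) / 2"
      have d: "0 < d" using \<epsilon> by (simp add: d_def)
      obtain N where N: "\<And>n. n \<ge> N \<Longrightarrow> \<eta> n < d"
        using order_tendstoD(2)[OF \<eta>0 d] by (auto simp: eventually_sequentially)
      have "L2_norm cell_Y (\<lambda>y. \<psi> m (subst_coord i 0 y) - \<psi> n (subst_coord i 0 y)) < \<epsilon>" if "m \<ge> N" "n \<ge> N" for m n
      proof -
        have "L2_norm cell_Y (\<lambda>y. \<psi> m (subst_coord i 0 y) - \<psi> n (subst_coord i 0 y)) \<le> \<bar>C\<bar> * (\<eta> m + \<eta> n)" by (rule cau)
        also have "\<dots> \<le> (\<bar>C\<bar> + 1) * (\<eta> m + \<eta> n)" using \<eta>n[of m] \<eta>n[of n] by (intro mult_right_mono) auto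
        also have "\<dots> < (\<bar>C\<bar> + 1) * (d + d)" using N[OF that(1)] N[OF that(2)] by (intro mult_strict_left_mono) auto
        also have "\<dots> = \<epsilon>"
        proof -
          have "d + d = \<epsilon> / (\<bar>C\<bar> + 1)" unfolding d_def by (rule field_sum_of_halves)
          moreover have "\<bar>C\<bar> + 1 \<noteq> 0" by linarith
          ultimately show ?thesis by simp
        qed
        finally show ?thesis .
      qed
      then show "\<exists>N. \<forall>m\<ge>N. \<forall>n\<ge>N. L2_norm cell_Y (\<lambda>y. \<psi> m (subst_coord i 0 y) - \<psi> n (subst_coord i 0 y)) < \<epsilon>" by blast
    qed
    then obtain h where h: "h \<in> L2 cell_Y" "(\<lambda>n. L2_norm cell_Y (\<lambda>y. \<psi> n (subst_coord i 0 y) - h y)) \<longlonglongrightarrow> 0" by blast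
    \<comment> \<open>The traces \<open>g n\<close> are squeezed to \<open>h\<close> on the face at
      0, which then fixes the limit on the face at 1.\<close>
    have gh: "(\<lambda>n. L2_norm cell_Y (\<lambda>y. (g n y - \<psi> n (subst_coord i 0 y)) + (\<psi> n (subst_coord i 0 y) - h y))) \<longlonglongrightarrow> 0"
      by (rule L2_norm_sum_tendsto_0[OF L2_diff[OF g C(1)[OF p0(1)]] L2_diff[OF C(1)[OF p0(1)] h(1)] _ h(2)])
        (use p0(5) in \<open>subst L2_norm_minus_commute, assumption\<close>)
    have gh': "(\<lambda>n. L2_norm cell_Y (\<lambda>y. g n y - h y)) \<longlonglongrightarrow> 0" using gh by simp
    have "(\<lambda>n. L2_norm cell_Y (\<lambda>y. (\<zeta> n (subst_coord i 1 y) - g n y) + (g n y - h y))) \<longlonglongrightarrow> 0"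
      by (rule L2_norm_sum_tendsto_0[OF L2_diff[OF C'[OF p1(1)] g] L2_diff[OF g h(1)] p1(5) gh'])
    then have h1: "(\<lambda>n. L2_norm cell_Y (\<lambda>y. \<zeta> n (subst_coord i 1 y) - h y)) \<longlonglongrightarrow> 0" by simp
    have "trace_approx \<rho> v H i 0 h \<psi> d\<psi>" "trace_approx \<rho> v H i 1 h \<zeta> d\<zeta>"
      using p0 p1 h(2) h1 by (auto simp: trace_approx_def)
    then show "has_periodic_trace \<rho> v H i"
      by (rule has_periodic_traceI[OF h(1)])
  qed
qed

section \<open>Averages and the Poincare inequality for periodic functions\<close>

lemma avg_diff:
  assumes "u \<in> L2 S" "v \<in> L2 S" "S \<in> lmeasurable"
  shows "avg S (\<lambda>x. u x - v x) = avg S u - avg S v"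
  using L2_integrable[OF assms(1,3)] L2_integrable[OF assms(2,3)] by (simp add: avg_def diff_divide_distrib)

lemma avg_const: "S \<in> lmeasurable \<Longrightarrow> 0 < measure lebesgue S \<Longrightarrow> avg S (\<lambda>x. c) = c"
  by (simp add: avg_def measure_restrict_space)

lemma avg_le:
  assumes "u \<in> L2 S" "S \<in> lmeasurable" "0 < measure lebesgue S"
  shows "\<bar>avg S u\<bar> \<le> L2_norm S u / sqrt (measure lebesgue S)"
proof -
  have "\<bar>avg S u\<bar> \<le> sqrt (measure lebesgue S) * L2_norm S u / measure lebesgue S"
    unfolding avg_def using L2_integral_le[OF assms(1,2)] assms(3) by (simp add: divide_right_mono)
  also have "\<dots> = L2_norm S u / sqrt (measure lebesgue S)"
    using assms(3) by (simp add: field_simps flip: power2_eq_square)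
  finally show ?thesis .
qed

lemma L2_norm_const: "A \<in> lmeasurable \<Longrightarrow> L2_norm A (\<lambda>x. c :: real) = \<bar>c\<bar> * sqrt (measure lebesgue A)"
  by (simp add: L2_norm_def measure_restrict_space real_sqrt_mult)

text \<open>The smooth inequality passes to the limit because both the average over \<open>S\<close>
  and the norms are continuous in \<open>L2\<close>.\<close>

lemma Poincare_periodic:
  assumes card: "CARD('n::finite) \<ge> 2" and R: "R < 1/2"
  shows "\<exists>S C. open S \<and> S \<subseteq> Y_star R \<and> 0 < measure lebesgue S \<and> 0 \<le> C \<and>
    (\<forall>\<rho>\<le>R. \<forall>v :: real ^ 'n \<Rightarrow> real. \<forall>G. v \<in> H1_per \<rho> \<longrightarrow> has_weak_gradient (Y_star \<rho>) v G \<longrightarrow>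
       L2_norm (Y_star \<rho>) (\<lambda>x. v x - avg S v) \<le> C * L2_norm (Y_star \<rho>) G)"
proof -
  obtain S :: "(real ^ 'n) set" and C where S: "open S" "S \<subseteq> Y_star R" "0 < measure lebesgue S" "0 \<le> C" and
    P: "\<And>\<rho> (\<phi> :: real ^ 'n \<Rightarrow> real) G. \<rho> \<le> R \<Longrightarrow> smooth \<phi> \<Longrightarrow> (\<forall>x. GDERIV \<phi> x :> G x) \<Longrightarrow>
       L2_norm (Y_star \<rho>) (\<lambda>x. \<phi> x - avg S \<phi>) \<le> C * L2_norm (Y_star \<rho>) G"
    using Poincare_smooth[OF card R] by metis
  have Sl: "S \<in> lmeasurable"
    using bounded_subset[OF bounded_Y_star S(2)] S(1) by (intro bounded_set_imp_lmeasurable) auto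
  show ?thesis
  proof (intro exI[of _ S] exI[of _ C] conjI allI impI S)
    fix \<rho> and v :: "real ^ 'n \<Rightarrow> real" and G
    assume \<rho>: "\<rho> \<le> R" and v: "v \<in> H1_per \<rho>" and w: "has_weak_gradient (Y_star \<rho>) v G"
    let ?Y = "Y_star \<rho> :: (real ^ 'n) set"
    fix i :: 'n
    \<comment> \<open>The definition of a trace carries smooth functions converging to
      \<open>v\<close> in \<open>H1\<close>, so density of smooth functions comes with
      periodicity.\<close>
    obtain g \<phi> d\<phi> where t: "trace_approx \<rho> v G i 0 g \<phi> d\<phi>"
      using v H1_per_iff[OF w] by (meson has_periodic_traceE)
    have S\<rho>: "S \<subseteq> ?Y" using S(2) Y_star_antimono[OF \<rho>] by blast
    note s = Y_star_sets[of \<rho>]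
    have Ss: "S \<in> sets lebesgue" using Sl by (rule fmeasurableD)
    have sm: "smooth (\<phi> k)" "\<And>x. GDERIV (\<phi> k) x :> d\<phi> k x" for k using t by (auto simp: trace_approx_def)
    have wk: "has_weak_gradient ?Y (\<phi> k) (d\<phi> k)" for k
      by (rule has_weak_gradient_smooth[OF open_Y_star bounded_Y_star sm])
    note L = has_weak_gradient_L2[OF w] and Lk = has_weak_gradient_L2[OF wk]
    have c: "(\<lambda>x. c) \<in> L2 ?Y" for c :: real by (rule L2_const) simp
    let ?K = "sqrt (measure lebesgue ?Y) / sqrt (measure lebesgue S)"
    \<comment> \<open>Three errors: replacing \<open>v\<close> by the smooth function, the smooth
      Poincare inequality, and replacing the average of the smooth function by that of
      \<open>v\<close>.\<close>
    have est: "L2_norm ?Y (\<lambda>x. v x - avg S v) \<le> L2_norm ?Y (\<lambda>x. \<phi> k x - v x)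
        + C * (L2_norm ?Y G + L2_norm ?Y (\<lambda>x. d\<phi> k x - G x)) + L2_norm ?Y (\<lambda>x. \<phi> k x - v x) * ?K" for k
    proof -
      have "L2_norm ?Y (\<lambda>x. v x - avg S v) \<le> L2_norm ?Y (\<lambda>x. v x - \<phi> k x) + L2_norm ?Y (\<lambda>x. \<phi> k x - avg S v)"
        by (rule L2_norm_triangle_diff[OF L(1) Lk(1) c])
      also have "L2_norm ?Y (\<lambda>x. \<phi> k x - avg S v) \<le> L2_norm ?Y (\<lambda>x. \<phi> k x - avg S (\<phi> k)) + L2_norm ?Y (\<lambda>x. avg S (\<phi> k) - avg S v)"
        by (rule L2_norm_triangle_diff[OF Lk(1) c c])
      also have "L2_norm ?Y (\<lambda>x. \<phi> k x - avg S (\<phi> k)) \<le> C * L2_norm ?Y (d\<phi> k)"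
        using P[OF \<rho> sm(1)] sm(2) by blast
      also have "L2_norm ?Y (d\<phi> k) \<le> L2_norm ?Y G + L2_norm ?Y (\<lambda>x. d\<phi> k x - G x)"
        by (rule L2_norm_triangle_le[OF Lk(2) L(2)])
      also have "L2_norm ?Y (\<lambda>x. avg S (\<phi> k) - avg S v) = \<bar>avg S (\<lambda>x. \<phi> k x - v x)\<bar> * sqrt (measure lebesgue ?Y)"
        using avg_diff[OF L2_subset(1)[OF Lk(1) S\<rho> Ss s] L2_subset(1)[OF L(1) S\<rho> Ss s] Sl]
        by (simp add: L2_norm_const)
      also have "\<bar>avg S (\<lambda>x. \<phi> k x - v x)\<bar> \<le> L2_norm S (\<lambda>x. \<phi> k x - v x) / sqrt (measure lebesgue S)"
        by (rule avg_le[OF L2_subset(1)[OF L2_diff[OF Lk(1) L(1)] S\<rho> Ss s] Sl S(3)])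
      also have "L2_norm S (\<lambda>x. \<phi> k x - v x) \<le> L2_norm ?Y (\<lambda>x. \<phi> k x - v x)"
        by (rule L2_subset(2)[OF L2_diff[OF Lk(1) L(1)] S\<rho> Ss s])
      finally show ?thesis
        using S(3,4) by (simp add: L2_norm_minus_commute[of _ v] mult_left_mono mult_right_mono divide_right_mono)
    qed
    have "(\<lambda>k. L2_norm ?Y (\<lambda>x. \<phi> k x - v x) + C * (L2_norm ?Y G + L2_norm ?Y (\<lambda>x. d\<phi> k x - G x)) + L2_norm ?Y (\<lambda>x. \<phi> k x - v x) * ?K)
        \<longlonglongrightarrow> 0 + C * (L2_norm ?Y G + 0) + 0 * ?K"
      using t by (intro tendsto_intros) (auto simp: trace_approx_def)
    then have "L2_norm ?Y (\<lambda>x. v x - avg S v) \<le> 0 + C * (L2_norm ?Y G + 0) + 0 * ?K"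
      by (rule LIMSEQ_le_const) (use est in blast)
    then show "L2_norm ?Y (\<lambda>x. v x - avg S v) \<le> C * L2_norm ?Y G" by simp
  qed
qed

section \<open>The cell problem\<close>

lemma L2_norm_parallelogram:
  assumes "f \<in> L2 A" "g \<in> L2 A"
  shows "(L2_norm A (\<lambda>x. f x - g x))\<^sup>2
    = 2 * (L2_norm A f)\<^sup>2 + 2 * (L2_norm A g)\<^sup>2 - 4 * (L2_norm A (\<lambda>x. (1/2) *\<^sub>R (f x + g x)))\<^sup>2"
proof -
  have "(L2_norm A (\<lambda>x. f x + (-1) *\<^sub>R g x))\<^sup>2 + (L2_norm A (\<lambda>x. f x + 1 *\<^sub>R g x))\<^sup>2
      = 2 * (L2_norm A f)\<^sup>2 + 2 * (L2_norm A g)\<^sup>2"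
    unfolding L2_norm_add_sq[OF assms] by simp
  moreover have "4 * (L2_norm A (\<lambda>x. (1/2) *\<^sub>R (f x + g x)))\<^sup>2 = (L2_norm A (\<lambda>x. f x + 1 *\<^sub>R g x))\<^sup>2"
    unfolding L2_norm_scaleR by (simp add: power_mult_distrib power2_eq_square)
  ultimately show ?thesis by simp
qed

text \<open>First variation: a nonzero inner product would let a small step along \<open>H\<close>
  decrease the norm.\<close>

lemma L2_inner_eq_0_if_minimal:
  assumes L: "F \<in> L2 A" "H \<in> L2 A" and min: "\<And>t. (L2_norm A F)\<^sup>2 \<le> (L2_norm A (\<lambda>x. F x + t *\<^sub>R H x))\<^sup>2"
  shows "L2_inner A F H = 0"
proof (rule ccontr)
  assume b: "L2_inner A F H \<noteq> 0"
  let ?b = "L2_inner A F H" and ?h = "(L2_norm A H)\<^sup>2"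
  \<comment> \<open>The minimising step of the quadratic with 1 added to the denominator, so that it
    is defined when \<open>H\<close> vanishes; the decrease remains strict.\<close>
  define t where "t = - ?b / (?h + 1)"
  have h: "0 < ?h + 1" using zero_le_power2[of "L2_norm A H"] by linarith
  have "0 \<le> 2 * t * ?b + t\<^sup>2 * ?h" using min[of t] L2_norm_add_sq[OF L, of t] by simp
  also have "t\<^sup>2 * ?h \<le> t\<^sup>2 * (?h + 1)" by (intro mult_left_mono) auto
  also have "t\<^sup>2 * (?h + 1) = - t * ?b"
  proof -
    have "t * (?h + 1) = - ?b" using h unfolding t_def by simp
    then have "t * (t * (?h + 1)) = t * - ?b" by (rule arg_cong)
    then show ?thesis by (simp add: power2_eq_square mult.assoc)
  qed
  finally have "0 \<le> t * ?b" by simp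
  moreover have "t * ?b < 0"
  proof -
    have "t * ?b = - (?b\<^sup>2 / (?h + 1))" by (simp add: t_def power2_eq_square)
    moreover have "0 < ?b\<^sup>2 / (?h + 1)" using h b by (intro divide_pos_pos) simp_all
    ultimately show ?thesis by simp
  qed
  ultimately show False by simp
qed

lemma Cauchy_if_le_sum:
  fixes f :: "nat \<Rightarrow> 'a::euclidean_space \<Rightarrow> 'b::euclidean_space"
  assumes le: "\<And>m n. L2_norm A (\<lambda>x. f m x - f n x) \<le> C * sqrt (d m + d n)" and d: "d \<longlonglongrightarrow> 0" and C: "0 \<le> C"
  shows "0 < e \<Longrightarrow> \<exists>N. \<forall>m\<ge>N. \<forall>n\<ge>N. L2_norm A (\<lambda>x. f m x - f n x) < e"
proof -
  assume e: "0 < e"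
  \<comment> \<open>Two terms below \<eta> add up to the required square, and \<open>C + 1\<close>
    makes the final estimate strict and covers \<open>C = 0\<close>.\<close>
  define \<eta> where "\<eta> = (e / (C + 1))\<^sup>2 / 2"
  have \<eta>: "0 < \<eta>" using e C by (simp add: \<eta>_def)
  obtain N where N: "\<And>n. n \<ge> N \<Longrightarrow> d n < \<eta>"
    using order_tendstoD(2)[OF d \<eta>] by (auto simp: eventually_sequentially)
  have "L2_norm A (\<lambda>x. f m x - f n x) < e" if "m \<ge> N" "n \<ge> N" for m n
  proof -
    have "d m + d n \<le> (e / (C + 1))\<^sup>2" using N[OF that(1)] N[OF that(2)] by (simp add: \<eta>_def)
    then have "sqrt (d m + d n) \<le> e / (C + 1)" using e C by (simp add: real_le_lsqrt)
    then have "C * sqrt (d m + d n) \<le> C * (e / (C + 1))" using C by (rule mult_left_mono)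
    also have "\<dots> < e" using e C by (simp add: divide_less_eq)
    finally show ?thesis using le[of m n] by simp
  qed
  then show "\<exists>N. \<forall>m\<ge>N. \<forall>n\<ge>N. L2_norm A (\<lambda>x. f m x - f n x) < e" by blast
qed

text \<open>Fixes one reference set and one constant for all radii up to \<open>R\<close>, so that
  correctors for different radii can be normalised and compared by the same average.\<close>

locale periodic_Poincare =
  fixes R C :: real and S :: "(real ^ 'n) set"
  assumes R: "R < 1/2" and open_S: "open S" and S_subset: "S \<subseteq> Y_star R" and S_pos: "0 < measure lebesgue S"
    and C: "0 \<le> C"
    and Poincare: "\<And>\<rho> v G. \<rho> \<le> R \<Longrightarrow> v \<in> H1_per \<rho> \<Longrightarrow> has_weak_gradient (Y_star \<rho>) v G \<Longrightarrow>
      L2_norm (Y_star \<rho>) (\<lambda>x. v x - avg S v) \<le> C * L2_norm (Y_star \<rho>) G"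
begin

lemma S_subset': "\<rho> \<le> R \<Longrightarrow> S \<subseteq> Y_star \<rho>"
  using S_subset Y_star_antimono by blast

lemma S_lmeasurable: "S \<in> lmeasurable"
  using bounded_subset[OF bounded_Y_star S_subset] open_S by (intro bounded_set_imp_lmeasurable) auto

lemma S_sets: "S \<in> sets lebesgue"
  using S_lmeasurable by (rule fmeasurableD)

lemma L2_S: "\<rho> \<le> R \<Longrightarrow> f \<in> L2 (Y_star \<rho>) \<Longrightarrow> f \<in> L2 S"
  using L2_subset(1)[OF _ S_subset' S_sets Y_star_sets] .

lemma avg_tendsto:
  assumes \<rho>: "\<rho> \<le> R" and u: "\<And>n. u n \<in> L2 (Y_star \<rho>)" and v: "v \<in> L2 (Y_star \<rho>)"
    and lim: "(\<lambda>n. L2_norm (Y_star \<rho>) (\<lambda>y. u n y - v y)) \<longlonglongrightarrow> 0"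
  shows "(\<lambda>n. avg S (u n)) \<longlonglongrightarrow> avg S v"
proof (rule tendsto_if_norm_diff_le[OF _ lim])
  fix n
  have "\<bar>avg S (u n) - avg S v\<bar> = \<bar>avg S (\<lambda>y. u n y - v y)\<bar>"
    by (simp add: avg_diff[OF L2_S[OF \<rho> u] L2_S[OF \<rho> v] S_lmeasurable])
  also have "\<dots> \<le> L2_norm S (\<lambda>y. u n y - v y) / sqrt (measure lebesgue S)"
    by (intro avg_le S_lmeasurable S_pos L2_S[OF \<rho>] L2_diff u v)
  also have "\<dots> \<le> L2_norm (Y_star \<rho>) (\<lambda>y. u n y - v y) / sqrt (measure lebesgue S)"
    by (intro divide_right_mono L2_subset(2)[OF _ S_subset'[OF \<rho>] S_sets Y_star_sets] L2_diff u v) auto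
  finally show "norm (avg S (u n) - avg S v) \<le> L2_norm (Y_star \<rho>) (\<lambda>y. u n y - v y) * (1 / sqrt (measure lebesgue S))"
    by simp
qed

text \<open>Dirichlet principle: the energy of \<open>G + e\<close> is minimised over pairs of a
  periodic function and its gradient, and the cell equation is the first variation. Zero average
  over \<open>S\<close> removes the freedom of adding constants.\<close>

lemma cell_problem_solution:
  assumes \<rho>: "\<rho> \<le> R"
  shows "\<exists>w G. w \<in> H1_per \<rho> \<and> has_weak_gradient (Y_star \<rho>) w G \<and> avg S w = 0 \<and>
    (\<forall>v H. v \<in> H1_per \<rho> \<longrightarrow> has_weak_gradient (Y_star \<rho>) v H \<longrightarrow> L2_inner (Y_star \<rho>) (\<lambda>y. G y + e) H = 0)"
proof -
  let ?Y = "Y_star \<rho> :: (real ^ 'n) set"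
  \<comment> \<open>Pairs keep the gradient as data, so that sums and multiples need no reference to
    the chosen weak gradient.\<close>
  define V where "V = {(v, G). v \<in> H1_per \<rho> \<and> has_weak_gradient ?Y v G}"
  define J where "J p = (L2_norm ?Y (\<lambda>y. snd p y + e))\<^sup>2" for p :: "(real ^ 'n \<Rightarrow> real) \<times> (real ^ 'n \<Rightarrow> real ^ 'n)"
  define m where "m = Inf (J ` V)"
  have e: "(\<lambda>y. e) \<in> L2 ?Y" by (rule L2_const) simp
  have V0: "(\<lambda>y. 0, \<lambda>y. 0) \<in> V" by (simp add: V_def H1_per_const has_weak_gradient_zero)
  have J0: "0 \<le> J p" for p by (simp add: J_def)
  have bdd: "bdd_below (J ` V)" by (rule bdd_belowI[of _ 0]) (use J0 in blast)
  have mJ: "m \<le> J p" if "p \<in> V" for p unfolding m_def using that bdd by (intro cInf_lower) auto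
  define d where "d n = inverse (real (Suc n))" for n
  have d: "0 < d n" "d \<longlonglongrightarrow> 0" for n unfolding d_def using LIMSEQ_inverse_real_of_nat by simp_all
  have "\<exists>p\<in>V. J p < m + d n" for n
  proof -
    have "Inf (J ` V) < m + d n" using d(1)[of n] by (simp add: m_def)
    then show ?thesis using V0 bdd by (subst (asm) cInf_less_iff) auto
  qed
  then obtain p where p: "\<And>n. p n \<in> V" "\<And>n. J (p n) < m + d n" by metis
  define G where "G n = snd (p n)" for n
  \<comment> \<open>Subtracting the average leaves the gradient unchanged and lets the Poincare
    inequality control the functions as well.\<close>
  define u where "u n y = fst (p n) y - avg S (fst (p n))" for n y
  have u: "u n \<in> H1_per \<rho>" "has_weak_gradient ?Y (u n) (G n)" for n
  proof -
    have *: "fst (p n) \<in> H1_per \<rho>" "has_weak_gradient ?Y (fst (p n)) (snd (p n))" using p(1)[of n] by (auto simp: V_def)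
    show "u n \<in> H1_per \<rho>" unfolding u_def by (intro H1_per_diff * H1_per_const)
    show "has_weak_gradient ?Y (u n) (G n)"
      using has_weak_gradient_diff[OF open_Y_star bounded_Y_star *(2) has_weak_gradient_const]
      unfolding u_def G_def by simp
  qed
  note uL = has_weak_gradient_L2[OF u(2)]
  have au: "avg S (u n) = 0" for n
  proof -
    have "fst (p n) \<in> L2 ?Y" using p(1)[of n] by (auto simp: V_def dest: has_weak_gradient_L2)
    then show ?thesis
      unfolding u_def using avg_diff[OF L2_S[OF \<rho>] L2_const[OF S_lmeasurable] S_lmeasurable]
      by (simp add: avg_const[OF S_lmeasurable S_pos])
  qed
  \<comment> \<open>Midpoints are admissible, so their energy is at least \<open>m\<close>; the
    parallelogram identity converts near minimality into a Cauchy estimate for the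
    gradients.\<close>
  have Gc: "L2_norm ?Y (\<lambda>y. G k y - G n y) \<le> 1 * sqrt (2 * d k + 2 * d n)" for k n
  proof -
    have L: "(\<lambda>y. G k y + e) \<in> L2 ?Y" for k by (intro L2_add uL e)
    have "(\<lambda>y. (1/2) * (u k y + u n y), \<lambda>y. (1/2) *\<^sub>R (G k y + G n y)) \<in> V"
      using H1_per_cmult[OF H1_per_add[OF u(1)[of k] u(1)[of n]], of "1/2"]
        has_weak_gradient_cmult[OF has_weak_gradient_add[OF open_Y_star bounded_Y_star u(2)[of k] u(2)[of n]], of "1/2"]
      by (simp only: V_def mem_Collect_eq case_prod_conv simp_thms)
    then have "m \<le> (L2_norm ?Y (\<lambda>y. (1/2) *\<^sub>R (G k y + G n y) + e))\<^sup>2"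
      using mJ[of "(\<lambda>y. (1/2) * (u k y + u n y), \<lambda>y. (1/2) *\<^sub>R (G k y + G n y))"] by (simp add: J_def)
    also have "(\<lambda>y. (1/2) *\<^sub>R (G k y + G n y) + e) = (\<lambda>y. (1/2) *\<^sub>R ((G k y + e) + (G n y + e)))"
    proof (rule ext)
      fix y
      have "(G k y + e) + (G n y + e) = (G k y + G n y) + (e + e)" by simp
      then show "(1/2) *\<^sub>R (G k y + G n y) + e = (1/2) *\<^sub>R ((G k y + e) + (G n y + e))"
        by (simp only: scaleR_add_right[of _ "G k y + G n y"] scaleR_half_double)
    qed
    finally have mid: "m \<le> (L2_norm ?Y (\<lambda>y. (1/2) *\<^sub>R ((G k y + e) + (G n y + e))))\<^sup>2" .
    have "(L2_norm ?Y (\<lambda>y. G k y - G n y))\<^sup>2 = (L2_norm ?Y (\<lambda>y. (G k y + e) - (G n y + e)))\<^sup>2" by simp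
    also have "\<dots> = 2 * (L2_norm ?Y (\<lambda>y. G k y + e))\<^sup>2 + 2 * (L2_norm ?Y (\<lambda>y. G n y + e))\<^sup>2
        - 4 * (L2_norm ?Y (\<lambda>y. (1/2) *\<^sub>R ((G k y + e) + (G n y + e))))\<^sup>2"
      by (rule L2_norm_parallelogram[OF L L])
    also have "\<dots> \<le> 2 * d k + 2 * d n"
      using p(2)[of k] p(2)[of n] mid by (simp add: J_def G_def)
    finally show ?thesis by (simp add: real_le_rsqrt)
  qed
  have d2: "(\<lambda>n. 2 * d n) \<longlonglongrightarrow> 0" using tendsto_mult_right_zero[OF d(2)] .
  have uc: "L2_norm ?Y (\<lambda>y. u k y - u n y) \<le> C * sqrt (2 * d k + 2 * d n)" for k n
  proof -
    have a0: "avg S (\<lambda>y. u k y - u n y) = 0"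
      using avg_diff[OF L2_S[OF \<rho> uL(1)] L2_S[OF \<rho> uL(1)] S_lmeasurable] by (simp add: au)
    have "L2_norm ?Y (\<lambda>y. (u k y - u n y) - avg S (\<lambda>y. u k y - u n y)) \<le> C * L2_norm ?Y (\<lambda>y. G k y - G n y)"
      by (rule Poincare[OF \<rho> H1_per_diff[OF u(1) u(1)] has_weak_gradient_diff[OF open_Y_star bounded_Y_star u(2) u(2)]])
    also have "\<dots> \<le> C * sqrt (2 * d k + 2 * d n)" using Gc[of k n] C by (intro mult_left_mono) auto
    finally show ?thesis by (simp add: a0)
  qed
  have "\<exists>w\<in>L2 ?Y. (\<lambda>n. L2_norm ?Y (\<lambda>y. u n y - w y)) \<longlonglongrightarrow> 0"
    by (rule L2_complete[OF uL(1) Cauchy_if_le_sum[OF uc d2 C]])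
  then obtain w where w: "w \<in> L2 ?Y" "(\<lambda>n. L2_norm ?Y (\<lambda>y. u n y - w y)) \<longlonglongrightarrow> 0" by blast
  have "\<exists>H\<in>L2 ?Y. (\<lambda>n. L2_norm ?Y (\<lambda>y. G n y - H y)) \<longlonglongrightarrow> 0"
    by (rule L2_complete[OF uL(2) Cauchy_if_le_sum[OF Gc d2]]) auto
  then obtain H where H: "H \<in> L2 ?Y" "(\<lambda>n. L2_norm ?Y (\<lambda>y. G n y - H y)) \<longlonglongrightarrow> 0" by blast
  have \<rho>': "\<rho> < 1/2" using \<rho> R by simp
  note wH = H1_per_limit[OF \<rho>' u w H]
  have "(\<lambda>n. avg S (u n)) \<longlonglongrightarrow> avg S w" by (rule avg_tendsto[OF \<rho> uL(1) w])
  then have aw: "avg S w = 0" by (simp add: au LIMSEQ_const_iff)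
  have HeL: "(\<lambda>y. H y + e) \<in> L2 ?Y" by (intro L2_add H e)
  have m0: "0 \<le> m" unfolding m_def using V0 J0 by (intro cInf_greatest) auto
  have "L2_norm ?Y (\<lambda>y. H y + e) \<le> sqrt m"
  proof -
    have "L2_norm ?Y (\<lambda>y. H y + e) \<le> sqrt (m + d n) + L2_norm ?Y (\<lambda>y. G n y - H y)" for n
    proof -
      have "L2_norm ?Y (\<lambda>y. H y + e) \<le> L2_norm ?Y (\<lambda>y. G n y + e) + L2_norm ?Y (\<lambda>y. (H y + e) - (G n y + e))"
        by (rule L2_norm_triangle_le[OF HeL L2_add[OF uL(2) e]])
      moreover have "L2_norm ?Y (\<lambda>y. G n y + e) \<le> sqrt (m + d n)"
        using p(2)[of n] by (intro real_le_rsqrt) (simp add: J_def G_def)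
      moreover have "L2_norm ?Y (\<lambda>y. (H y + e) - (G n y + e)) = L2_norm ?Y (\<lambda>y. G n y - H y)"
        by (simp add: L2_norm_minus_commute)
      ultimately show ?thesis by simp
    qed
    moreover have "(\<lambda>n. sqrt (m + d n) + L2_norm ?Y (\<lambda>y. G n y - H y)) \<longlonglongrightarrow> sqrt (m + 0) + 0"
      by (intro tendsto_intros d H)
    ultimately have "L2_norm ?Y (\<lambda>y. H y + e) \<le> sqrt (m + 0) + 0" by (intro LIMSEQ_le_const) auto
    then show ?thesis by simp
  qed
  then have "(L2_norm ?Y (\<lambda>y. H y + e))\<^sup>2 \<le> (sqrt m)\<^sup>2" by (intro power_mono) auto
  then have Hm: "(L2_norm ?Y (\<lambda>y. H y + e))\<^sup>2 \<le> m" using m0 by simp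
  have "L2_inner ?Y (\<lambda>y. H y + e) K = 0" if v: "v \<in> H1_per \<rho>" "has_weak_gradient ?Y v K" for v K
  proof (rule L2_inner_eq_0_if_minimal[OF HeL has_weak_gradient_L2(2)[OF v(2)]])
    fix t
    have "(\<lambda>y. w y + t * v y, \<lambda>y. H y + t *\<^sub>R K y) \<in> V"
      unfolding V_def
      by (auto intro!: H1_per_cmult H1_per_add wH v has_weak_gradient_cmult has_weak_gradient_add open_Y_star bounded_Y_star)
    from mJ[OF this] have "m \<le> (L2_norm ?Y (\<lambda>y. H y + e + t *\<^sub>R K y))\<^sup>2" by (simp add: J_def add_ac)
    with Hm show "(L2_norm ?Y (\<lambda>y. H y + e))\<^sup>2 \<le> (L2_norm ?Y (\<lambda>y. H y + e + t *\<^sub>R K y))\<^sup>2"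
      by (rule order_trans)
  qed
  then show ?thesis using wH aw by blast
qed

lemma eq_mod_const_if_gradient_eq:
  fixes v v' :: "real ^ 'n \<Rightarrow> real"
  assumes \<rho>: "\<rho> \<le> R" and v: "v \<in> H1_per \<rho>" "has_weak_gradient (Y_star \<rho>) v G"
    and v': "v' \<in> H1_per \<rho>" "has_weak_gradient (Y_star \<rho>) v' G'" and eq: "L2_norm (Y_star \<rho>) (\<lambda>y. G y - G' y) = 0"
  shows "eq_mod_const \<rho> v v'"
proof -
  let ?c = "avg S (\<lambda>y. v y - v' y)"
  have w: "has_weak_gradient (Y_star \<rho>) (\<lambda>y. v y - v' y) (\<lambda>y. G y - G' y)"
    by (rule has_weak_gradient_diff[OF open_Y_star bounded_Y_star v(2) v'(2)])
  have "L2_norm (Y_star \<rho>) (\<lambda>y. (v y - v' y) - ?c) \<le> C * L2_norm (Y_star \<rho>) (\<lambda>y. G y - G' y)"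
    by (rule Poincare[OF \<rho> H1_per_diff[OF v(1) v'(1)] w])
  then have "L2_norm (Y_star \<rho>) (\<lambda>y. (v y - v' y) - ?c) = 0"
    using L2_norm_nonneg[of "Y_star \<rho>" "\<lambda>y. (v y - v' y) - ?c"] by (simp add: eq)
  moreover have "(\<lambda>y. (v y - v' y) - ?c) \<in> L2 (Y_star \<rho>)"
    by (intro L2_diff has_weak_gradient_L2(1)[OF v(2)] has_weak_gradient_L2(1)[OF v'(2)] L2_const) simp
  ultimately have "AE y in lebesgue_on (Y_star \<rho>). (v y - v' y) - ?c = 0"
    by (intro L2_norm_0_imp_AE)
  then have "AE y in lebesgue_on (Y_star \<rho>). v y = v' y + ?c" by eventually_elim simp
  then show ?thesis unfolding eq_mod_const_def by (rule exI)
qed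

end

lemma ex_periodic_Poincare:
  assumes "CARD('n::finite) \<ge> 2" "R < 1/2"
  shows "\<exists>C (S :: (real ^ 'n) set). periodic_Poincare R C S"
  using Poincare_periodic[OF assms] assms(2) unfolding periodic_Poincare_def by blast

text \<open>The definition uses the chosen representative \<open>weak_gradient\<close>; gradients
  being unique almost everywhere, any representative may be used for the solution and the test
  function.\<close>

lemma solves_cell_iff:
  fixes w :: "real ^ 'n \<Rightarrow> real"
  assumes w: "has_weak_gradient (Y_star \<rho>) w G"
  shows "solves_cell \<rho> j w \<longleftrightarrow> w \<in> H1_per \<rho> \<and>
    (\<forall>v H. v \<in> H1_per \<rho> \<longrightarrow> has_weak_gradient (Y_star \<rho>) v H \<longrightarrow> L2_inner (Y_star \<rho>) (\<lambda>y. G y + axis j 1) H = 0)"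
proof -
  note wg = weak_gradient_AE[OF open_Y_star bounded_Y_star]
  have eq: "(LINT y|lebesgue_on (Y_star \<rho>). (weak_gradient (Y_star \<rho>) w y + axis j 1) \<bullet> weak_gradient (Y_star \<rho>) v y)
      = L2_inner (Y_star \<rho>) (\<lambda>y. G y + axis j 1) H" if "has_weak_gradient (Y_star \<rho>) v H" for v H
    unfolding L2_inner_def
  proof (rule integral_lebesgue_on_cong_AE[OF Y_star_sets])
    show "AE y in lebesgue_on (Y_star \<rho>). (weak_gradient (Y_star \<rho>) w y + axis j 1) \<bullet> weak_gradient (Y_star \<rho>) v y
        = (G y + axis j 1) \<bullet> H y"
      using wg[OF w] wg[OF that] by eventually_elim simp
  qed
  show ?thesis
  proof
    assume s: "solves_cell \<rho> j w"
    have "L2_inner (Y_star \<rho>) (\<lambda>y. G y + axis j 1) H = 0" if "v \<in> H1_per \<rho>" "has_weak_gradient (Y_star \<rho>) v H" for v H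
      using s that(1) eq[OF that(2)] unfolding solves_cell_def by auto
    then show "w \<in> H1_per \<rho> \<and> (\<forall>v H. v \<in> H1_per \<rho> \<longrightarrow> has_weak_gradient (Y_star \<rho>) v H \<longrightarrow> L2_inner (Y_star \<rho>) (\<lambda>y. G y + axis j 1) H = 0)"
      using s unfolding solves_cell_def by auto
  next
    assume s: "w \<in> H1_per \<rho> \<and> (\<forall>v H. v \<in> H1_per \<rho> \<longrightarrow> has_weak_gradient (Y_star \<rho>) v H \<longrightarrow> L2_inner (Y_star \<rho>) (\<lambda>y. G y + axis j 1) H = 0)"
    have "L2_inner (Y_star \<rho>) (\<lambda>y. G y + axis j 1) (weak_gradient (Y_star \<rho>) v) = 0" if "v \<in> H1_per \<rho>" for v
      using s that H1_per_weak_gradient[OF that] by blast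
    then show "solves_cell \<rho> j w"
      using s eq[OF H1_per_weak_gradient] by (simp add: solves_cell_def)
  qed
qed

text \<open>A monotone function has countably many discontinuities. They are put into
  \<open>Q\<close> themselves, and at all other points rationals from the left suffice.
  Approximation from the left is required because the object at \<open>q\<close> must live on the
  larger cell.\<close>

lemma antimono_left_dense:
  fixes E :: "real \<Rightarrow> real"
  assumes "antimono E"
  obtains Q where "countable Q" "\<And>\<rho> \<epsilon>. 0 < \<epsilon> \<Longrightarrow> \<exists>q\<in>Q. q \<le> \<rho> \<and> E q - E \<rho> < \<epsilon>"
proof -
  define D where "D = {a. \<not> isCont (\<lambda>x. - E x) a}"
  have "mono (\<lambda>x. - E x)" using assms by (auto simp: monotone_def)
  then have D: "countable D" unfolding D_def by (rule mono_ctble_discont)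
  show ?thesis
  proof (rule that[of "\<rat> \<union> D"])
    show "countable (\<rat> \<union> D)" using D countable_rat by blast
    fix \<rho> \<epsilon> :: real assume \<epsilon>: "0 < \<epsilon>"
    show "\<exists>q\<in>\<rat> \<union> D. q \<le> \<rho> \<and> E q - E \<rho> < \<epsilon>"
    proof (cases "\<rho> \<in> D")
      case True
      then show ?thesis using \<epsilon> by (intro bexI[of _ \<rho>]) auto
    next
      case False
      then have "isCont (\<lambda>x. - E x) \<rho>" by (simp add: D_def)
      then obtain d where d: "0 < d" "\<And>x. \<bar>x - \<rho>\<bar> < d \<Longrightarrow> \<bar>E \<rho> - E x\<bar> < \<epsilon>"
        using \<epsilon> unfolding continuous_at_eps_delta by (auto simp: dist_real_def)
      obtain q where q: "q \<in> \<rat>" "\<rho> - d < q" "q < \<rho>" using Rats_dense_in_real[of "\<rho> - d" \<rho>] d(1) by auto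
      then have "\<bar>E \<rho> - E q\<bar> < \<epsilon>" by (intro d(2)) auto
      then show ?thesis using q by (intro bexI[of _ q]) auto
    qed
  qed
qed

text \<open>Distances in the family are controlled by differences of a monotone function, so
  countably many members approximate every one of them at a prescribed rate. Selecting among them by
  a measurable index gives jointly measurable approximations that converge, for each single radius,
  at almost every \<open>y\<close>.\<close>

lemma measurable_family_version:
  fixes F :: "real \<Rightarrow> real ^ 'n \<Rightarrow> 'b::euclidean_space" and E :: "real \<Rightarrow> real"
  assumes E: "antimono E" and F: "\<And>\<rho>. \<rho> \<le> R \<Longrightarrow> F \<rho> \<in> L2 (Y_star \<rho>)"
    and le: "\<And>q \<rho>. q \<le> \<rho> \<Longrightarrow> \<rho> \<le> R \<Longrightarrow> (L2_norm (Y_star \<rho>) (\<lambda>y. F q y - F \<rho> y))\<^sup>2 \<le> K * (E q - E \<rho>)"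
    and K: "0 \<le> K"
  shows "\<exists>W\<in>borel_measurable (borel \<Otimes>\<^sub>M borel). \<forall>\<rho>\<le>R. AE y in lebesgue_on (Y_star \<rho>). W (\<rho>, y) = F \<rho> y"
proof -
  obtain Q where Q: "countable Q" "\<And>\<rho> \<epsilon>. 0 < \<epsilon> \<Longrightarrow> \<exists>q\<in>Q. q \<le> \<rho> \<and> E q - E \<rho> < \<epsilon>"
    using antimono_left_dense[OF E] by metis
  have "Q \<noteq> {}" using Q(2)[of 1 0] by auto
  define q where "q = from_nat_into Q"
  have q: "\<And>p. p \<in> Q \<Longrightarrow> \<exists>k. p = q k"
    unfolding q_def using from_nat_into_surj[OF Q(1)] by metis
  have [measurable]: "E \<in> borel_measurable borel"
  proof -
    have "mono (\<lambda>x. - E x)" using E by (auto simp: monotone_def)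
    then have "(\<lambda>x. - E x) \<in> borel_measurable borel" by (rule borel_measurable_mono)
    then have "(\<lambda>x. - (- E x)) \<in> borel_measurable borel" by (rule borel_measurable_uminus)
    then show ?thesis by simp
  qed
  have "\<exists>g\<in>borel_measurable borel. p \<le> R \<longrightarrow> (AE y in lebesgue_on (Y_star p). F p y = g y)" for p
  proof (cases "p \<le> R")
    case True
    then show ?thesis using ex_borel_version_lebesgue_on[OF Y_star_sets L2_measurable[OF F]] by auto
  next
    case False
    have "(\<lambda>y :: real ^ 'n. 0 :: 'b) \<in> borel_measurable borel" by simp
    with False show ?thesis by (intro bexI[of _ "\<lambda>y. 0"]) simp_all
  qed
  then obtain B where B [measurable]: "\<And>p. B p \<in> borel_measurable borel"
    and BF: "\<And>p. p \<le> R \<Longrightarrow> AE y in lebesgue_on (Y_star p). F p y = B p y" by metis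
  \<comment> \<open>The least admissible index is a measurable choice, as the conditions are Borel
    in the radius. The rate \<open>(1/8) ^ n\<close> is the one that yields almost everywhere
    convergence without passing to a subsequence.\<close>
  define idx where "idx n \<rho> = (LEAST k. q k \<le> \<rho> \<and> E (q k) - E \<rho> < (1/8) ^ n)" for n \<rho>
  have idx: "q (idx n \<rho>) \<le> \<rho> \<and> E (q (idx n \<rho>)) - E \<rho> < (1/8) ^ n" for n \<rho>
  proof -
    obtain p where p: "p \<in> Q" "p \<le> \<rho> \<and> E p - E \<rho> < (1/8) ^ n" using Q(2)[of "(1/8) ^ n" \<rho>] by auto
    obtain k where "p = q k" using q[OF p(1)] by blast
    then have "q k \<le> \<rho> \<and> E (q k) - E \<rho> < (1/8) ^ n" using p(2) by simp
    then show ?thesis unfolding idx_def by (rule LeastI)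
  qed
  have idxm: "(\<lambda>p. idx n (fst p)) \<in> measurable (borel \<Otimes>\<^sub>M borel) (count_space UNIV)" for n
    unfolding idx_def by measurable
  define Wn where "Wn n p = B (q (idx n (fst p))) (snd p)" for n p
  have Wn [measurable]: "Wn n \<in> borel_measurable (borel \<Otimes>\<^sub>M borel)" for n
  proof -
    have "(\<lambda>p. (\<lambda>k p. B (q k) (snd p)) (idx n (fst p)) p) \<in> borel_measurable (borel \<Otimes>\<^sub>M borel)"
      by (rule measurable_compose_countable[OF _ idxm]) measurable
    then show ?thesis unfolding Wn_def .
  qed
  \<comment> \<open>For fixed radius this converges to \<open>F \<rho>\<close> outside a null set of
    \<open>y\<close>; \<open>lim\<close> is measurable whatever its value elsewhere.\<close>
  define W where "W p = lim (\<lambda>n. Wn n p)" for p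
  have "W \<in> borel_measurable (borel \<Otimes>\<^sub>M borel)" unfolding W_def by measurable
  moreover have "AE y in lebesgue_on (Y_star \<rho>). W (\<rho>, y) = F \<rho> y" if \<rho>: "\<rho> \<le> R" for \<rho>
  proof -
    let ?q = "\<lambda>n. q (idx n \<rho>)"
    have qle: "?q n \<le> \<rho>" "?q n \<le> R" for n using idx[of n \<rho>] \<rho> by auto
    have FL: "F (?q n) \<in> L2 (Y_star \<rho>)" for n
      by (rule L2_subset(1)[OF F[OF qle(2)] Y_star_antimono[OF qle(1)] Y_star_sets Y_star_sets])
    have ae: "AE y in lebesgue_on (Y_star \<rho>). F (?q n) y = Wn n (\<rho>, y)" for n
    proof -
      have "AE y in lebesgue. y \<in> Y_star (?q n) \<longrightarrow> F (?q n) y = B (?q n) y"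
        using BF[OF qle(2)] by (simp add: AE_restrict_space_iff)
      then have "AE y in lebesgue. y \<in> Y_star \<rho> \<longrightarrow> F (?q n) y = B (?q n) y"
        by eventually_elim (use Y_star_antimono[OF qle(1)] in blast)
      then show ?thesis by (simp add: AE_restrict_space_iff Wn_def)
    qed
    have dL: "(\<lambda>y. F (?q n) y - F \<rho> y) \<in> L2 (Y_star \<rho>)" for n by (rule L2_diff[OF FL F[OF \<rho>]])
    have "(L2_norm (Y_star \<rho>) (\<lambda>y. F (?q n) y - F \<rho> y))\<^sup>2 \<le> K * (1/8) ^ n" for n
    proof -
      have "K * (E (?q n) - E \<rho>) \<le> K * (1/8) ^ n" using idx[of n \<rho>] K by (intro mult_left_mono) auto
      then show ?thesis using le[OF qle(1) \<rho>, of n] by linarith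
    qed
    from L2_AE_tendsto[OF dL this]
    have s: "AE y in lebesgue_on (Y_star \<rho>). summable (\<lambda>n. 4 ^ n * (norm (F (?q n) y - F \<rho> y))\<^sup>2)" .
    have "AE y in lebesgue_on (Y_star \<rho>). \<forall>n. F (?q n) y = Wn n (\<rho>, y)"
      using ae by (simp add: AE_all_countable)
    with s show ?thesis
    proof eventually_elim
      case (elim y)
      have "summable (\<lambda>n. norm (F (?q n) y - F \<rho> y))"
        using elim(1) by (rule summable_weighted_sq_imp) simp
      then have "(\<lambda>n. norm (F (?q n) y - F \<rho> y)) \<longlonglongrightarrow> 0" by (rule summable_LIMSEQ_zero)
      then have "(\<lambda>n. F (?q n) y - F \<rho> y) \<longlonglongrightarrow> 0" by (rule tendsto_norm_zero_cancel)
      then have "(\<lambda>n. F (?q n) y) \<longlonglongrightarrow> F \<rho> y" by (rule LIM_zero_cancel)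
      then have "(\<lambda>n. Wn n (\<rho>, y)) \<longlonglongrightarrow> F \<rho> y" using elim(2) by simp
      then show ?case unfolding W_def by (rule limI)
    qed
  qed
  ultimately show ?thesis by (intro bexI[of _ W]) auto
qed

section \<open>Correctors and their dependence on the radius\<close>

definition corrector :: "real \<Rightarrow> real ^ 'n \<Rightarrow> (real ^ 'n \<Rightarrow> real) \<Rightarrow> (real ^ 'n \<Rightarrow> real ^ 'n) \<Rightarrow> bool" where
  "corrector \<rho> e w G \<longleftrightarrow> w \<in> H1_per \<rho> \<and> has_weak_gradient (Y_star \<rho>) w G \<and>
    (\<forall>v H. v \<in> H1_per \<rho> \<longrightarrow> has_weak_gradient (Y_star \<rho>) v H \<longrightarrow> L2_inner (Y_star \<rho>) (\<lambda>y. G y + e) H = 0)"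

lemma L2_inner_cong_AE:
  assumes "A \<in> sets lebesgue" "AE x in lebesgue_on A. f x = f' x" "AE x in lebesgue_on A. g x = g' x"
  shows "L2_inner A f g = L2_inner A f' g'"
proof -
  have "AE x in lebesgue_on A. f x \<bullet> g x = f' x \<bullet> g' x" using assms(2,3) by eventually_elim simp
  then show ?thesis unfolding L2_inner_def by (rule integral_lebesgue_on_cong_AE[OF assms(1)])
qed

lemma corrector_cong_AE:
  assumes c: "corrector \<rho> e w G" and w: "AE y in lebesgue_on (Y_star \<rho>). w y = w' y"
    and G: "AE y in lebesgue_on (Y_star \<rho>). G y = G' y"
  shows "corrector \<rho> e w' G'"
proof -
  have "AE y in lebesgue_on (Y_star \<rho>). G y + e = G' y + e" using G by eventually_elim simp
  then have "L2_inner (Y_star \<rho>) (\<lambda>y. G y + e) H = L2_inner (Y_star \<rho>) (\<lambda>y. G' y + e) H" for H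
    by (intro L2_inner_cong_AE[OF Y_star_sets]) auto
  then show ?thesis
    using c H1_per_cong_AE[OF _ w] has_weak_gradient_cong_AE2[OF Y_star_sets has_weak_gradient_cong_AE[OF Y_star_sets _ G] w]
    unfolding corrector_def by metis
qed

lemma L2_norm_const_le: "L2_norm (Y_star \<rho> :: (real ^ 'n) set) (\<lambda>y. e) \<le> norm (e :: 'b::euclidean_space)"
proof -
  have "measure lebesgue (Y_star \<rho> :: (real ^ 'n) set) \<le> measure lebesgue (cell_Y :: (real ^ 'n) set)"
    by (intro measure_mono_fmeasurable) (auto simp: Y_star_def)
  also have "\<dots> = 1" by (simp add: measure_completion measure_def emeasure_cell_Y)
  finally have "measure lebesgue (Y_star \<rho> :: (real ^ 'n) set) \<le> 1" .
  then have "norm e * sqrt (measure lebesgue (Y_star \<rho> :: (real ^ 'n) set)) \<le> norm e * 1"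
    by (intro mult_left_mono) auto
  then show ?thesis by (simp add: L2_norm_def measure_restrict_space real_sqrt_mult mult.commute)
qed

text \<open>Test the cell equation with the corrector itself and use that the perforated cell has
  volume at most 1. The bound is uniform in the radius.\<close>

lemma corrector_gradient_bound:
  assumes "corrector \<rho> e w G"
  shows "L2_norm (Y_star \<rho>) G \<le> norm e"
proof -
  let ?Y = "Y_star \<rho> :: (real ^ 'a) set"
  have G: "G \<in> L2 ?Y" using assms by (auto simp: corrector_def dest: has_weak_gradient_L2)
  have e: "(\<lambda>y. e) \<in> L2 ?Y" by (rule L2_const) simp
  have "0 = L2_inner ?Y (\<lambda>y. G y + e) G" using assms unfolding corrector_def by metis
  also have "\<dots> = (L2_norm ?Y G)\<^sup>2 + L2_inner ?Y (\<lambda>y. e) G"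
    using L2_integrable_inner[OF G G] L2_integrable_inner[OF e G]
    by (simp add: L2_inner_def inner_add_left L2_norm_power2 power2_norm_eq_inner)
  finally have "(L2_norm ?Y G)\<^sup>2 \<le> L2_norm ?Y (\<lambda>y. e) * L2_norm ?Y G"
    using L2_Cauchy_Schwarz[OF e G] by linarith
  then have "L2_norm ?Y G * L2_norm ?Y G \<le> norm e * L2_norm ?Y G"
    using mult_right_mono[OF L2_norm_const_le[of \<rho> e] L2_norm_nonneg[of ?Y G]]
    unfolding power2_eq_square by (rule order_trans)
  then show ?thesis
  proof (cases "L2_norm ?Y G = 0")
    case False
    then have "0 < L2_norm ?Y G" using L2_norm_nonneg[of ?Y G] by linarith
    then show ?thesis using \<open>L2_norm ?Y G * L2_norm ?Y G \<le> norm e * L2_norm ?Y G\<close> by (rule mult_right_le_imp_le[rotated])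
  qed simp
qed

context periodic_Poincare
begin

lemma corrector_bound:
  fixes w :: "real ^ 'n \<Rightarrow> real"
  assumes "\<rho> \<le> R" "corrector \<rho> e w G" "avg S w = 0"
  shows "L2_norm (Y_star \<rho>) w \<le> C * norm e"
proof -
  have "L2_norm (Y_star \<rho>) (\<lambda>y. w y - avg S w) \<le> C * L2_norm (Y_star \<rho>) G"
    using assms(2) by (intro Poincare[OF assms(1)]) (auto simp: corrector_def)
  also have "\<dots> \<le> C * norm e"
    using corrector_gradient_bound[OF assms(2)] C by (rule mult_left_mono)
  finally show ?thesis by (simp add: assms(3))
qed

text \<open>Correctors for different radii are nested orthogonal projections, so their squared distance is
  a difference of values of the monotone energy; this makes the radius dependence measurable.\<close>

lemma corrector_Pythagoras:
  fixes w :: "real ^ 'n \<Rightarrow> real"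
  assumes q: "q \<le> \<rho>" "\<rho> \<le> R" and cq: "corrector q e w G" and c: "corrector \<rho> e w' G'"
  shows "(L2_norm (Y_star \<rho>) (\<lambda>y. G y - G' y))\<^sup>2 \<le> (L2_norm (Y_star q) (\<lambda>y. G y + e))\<^sup>2 - (L2_norm (Y_star \<rho>) (\<lambda>y. G' y + e))\<^sup>2"
proof -
  note sub = Y_star_antimono[OF q(1)]
  have w: "w \<in> H1_per \<rho>" "has_weak_gradient (Y_star \<rho>) w G"
    using cq H1_per_antimono[OF _ q(1)] has_weak_gradient_subset[OF _ sub open_Y_star open_Y_star]
    by (auto simp: corrector_def)
  have w': "w' \<in> H1_per \<rho>" "has_weak_gradient (Y_star \<rho>) w' G'" using c by (auto simp: corrector_def)
  have e: "(\<lambda>y. e) \<in> L2 (Y_star p)" for p :: real by (rule L2_const) simp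
  have G'e: "(\<lambda>y. G' y + e) \<in> L2 (Y_star \<rho>)" by (rule L2_add[OF has_weak_gradient_L2(2)[OF w'(2)] e])
  have Ge: "(\<lambda>y. G y + e) \<in> L2 (Y_star q)"
    using cq by (auto simp: corrector_def dest: has_weak_gradient_L2 intro: L2_add e)
  have d: "(\<lambda>y. G y - G' y) \<in> L2 (Y_star \<rho>)"
    by (rule L2_diff[OF has_weak_gradient_L2(2)[OF w(2)] has_weak_gradient_L2(2)[OF w'(2)]])
  have o: "L2_inner (Y_star \<rho>) (\<lambda>y. G' y + e) (\<lambda>y. G y - G' y) = 0"
    using c H1_per_diff[OF w(1) w'(1)] has_weak_gradient_diff[OF open_Y_star bounded_Y_star w(2) w'(2)]
    unfolding corrector_def by blast
  have "(L2_norm (Y_star \<rho>) (\<lambda>y. (G' y + e) + 1 *\<^sub>R (G y - G' y)))\<^sup>2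
      = (L2_norm (Y_star \<rho>) (\<lambda>y. G' y + e))\<^sup>2 + (L2_norm (Y_star \<rho>) (\<lambda>y. G y - G' y))\<^sup>2"
    unfolding L2_norm_add_sq[OF G'e d] by (simp add: o)
  moreover have "(\<lambda>y. (G' y + e) + 1 *\<^sub>R (G y - G' y)) = (\<lambda>y. G y + e)" by (rule ext) simp
  ultimately have "(L2_norm (Y_star \<rho>) (\<lambda>y. G y + e))\<^sup>2
      = (L2_norm (Y_star \<rho>) (\<lambda>y. G' y + e))\<^sup>2 + (L2_norm (Y_star \<rho>) (\<lambda>y. G y - G' y))\<^sup>2" by (simp only:)
  moreover have "(L2_norm (Y_star \<rho>) (\<lambda>y. G y + e))\<^sup>2 \<le> (L2_norm (Y_star q) (\<lambda>y. G y + e))\<^sup>2"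
    by (intro power_mono L2_subset(2)[OF Ge sub]) auto
  ultimately show ?thesis by linarith
qed

text \<open>For each radius the corrector with zero average over \<open>S\<close> is chosen. The
  choice itself is arbitrary, but the energy estimate forces the chosen gradients and functions to
  vary so tamely that jointly Borel versions exist.\<close>

lemma ex_measurable_corrector:
  fixes e :: "real ^ 'n"
  shows "\<exists>W\<in>borel_measurable (borel \<Otimes>\<^sub>M borel). \<exists>H\<in>borel_measurable (borel \<Otimes>\<^sub>M borel). \<forall>\<rho>\<le>R.
    corrector \<rho> e (\<lambda>y. W (\<rho>, y)) (\<lambda>y. H (\<rho>, y)) \<and> L2_norm (Y_star \<rho>) (\<lambda>y. W (\<rho>, y)) \<le> C * norm e"
proof -
  have "\<exists>w G. \<rho> \<le> R \<longrightarrow> corrector \<rho> e w G \<and> avg S w = 0" for \<rho>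
    using cell_problem_solution[of \<rho> e] unfolding corrector_def by blast
  then obtain w G where wG: "\<And>\<rho>. \<rho> \<le> R \<Longrightarrow> corrector \<rho> e (w \<rho>) (G \<rho>)" "\<And>\<rho>. \<rho> \<le> R \<Longrightarrow> avg S (w \<rho>) = 0"
    by metis
  have L: "w \<rho> \<in> L2 (Y_star \<rho>)" "G \<rho> \<in> L2 (Y_star \<rho>)" if "\<rho> \<le> R" for \<rho>
    using wG(1)[OF that] by (auto simp: corrector_def dest: has_weak_gradient_L2)
  \<comment> \<open>The value 0 beyond \<open>R\<close> keeps the energy monotone on the whole line,
    because energies are nonnegative.\<close>
  define E where "E \<rho> = (if \<rho> \<le> R then (L2_norm (Y_star \<rho>) (\<lambda>y. G \<rho> y + e))\<^sup>2 else 0)" for \<rho>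
  have EG: "(L2_norm (Y_star \<rho>) (\<lambda>y. G q y - G \<rho> y))\<^sup>2 \<le> 1 * (E q - E \<rho>)" if "q \<le> \<rho>" "\<rho> \<le> R" for q \<rho>
    using corrector_Pythagoras[OF that wG(1) wG(1)] that by (simp add: E_def)
  have E: "antimono E"
  proof (rule antimonoI)
    fix q \<rho> :: real assume q: "q \<le> \<rho>"
    show "E \<rho> \<le> E q"
    proof (cases "\<rho> \<le> R")
      case True
      have "0 \<le> 1 * (E q - E \<rho>)" by (rule order_trans[OF zero_le_power2 EG[OF q True]])
      then show ?thesis by simp
    qed (simp add: E_def)
  qed
  \<comment> \<open>Both correctors have zero average over the same set \<open>S\<close>, so the
    Poincare inequality carries the gradient estimate over to the functions.\<close>
  have Ew: "(L2_norm (Y_star \<rho>) (\<lambda>y. w q y - w \<rho> y))\<^sup>2 \<le> C\<^sup>2 * (E q - E \<rho>)" if q: "q \<le> \<rho>" "\<rho> \<le> R" for q \<rho>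
  proof -
    note sub = Y_star_antimono[OF q(1)]
    have qR: "q \<le> R" using q by simp
    have w: "w q \<in> H1_per \<rho>" "has_weak_gradient (Y_star \<rho>) (w q) (G q)"
      using wG(1)[OF qR] H1_per_antimono[OF _ q(1)] has_weak_gradient_subset[OF _ sub open_Y_star open_Y_star]
      by (auto simp: corrector_def)
    have w': "w \<rho> \<in> H1_per \<rho>" "has_weak_gradient (Y_star \<rho>) (w \<rho>) (G \<rho>)" using wG(1)[OF q(2)] by (auto simp: corrector_def)
    have "avg S (\<lambda>y. w q y - w \<rho> y) = 0"
      using avg_diff[OF L2_S[OF qR L(1)[OF qR]] L2_S[OF q(2) L(1)[OF q(2)]] S_lmeasurable] wG(2)[OF qR] wG(2)[OF q(2)] by simp
    then have "L2_norm (Y_star \<rho>) (\<lambda>y. w q y - w \<rho> y) \<le> C * L2_norm (Y_star \<rho>) (\<lambda>y. G q y - G \<rho> y)"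
      using Poincare[OF q(2) H1_per_diff[OF w(1) w'(1)] has_weak_gradient_diff[OF open_Y_star bounded_Y_star w(2) w'(2)]] by simp
    then have "(L2_norm (Y_star \<rho>) (\<lambda>y. w q y - w \<rho> y))\<^sup>2 \<le> (C * L2_norm (Y_star \<rho>) (\<lambda>y. G q y - G \<rho> y))\<^sup>2"
      by (intro power_mono) auto
    also have "\<dots> \<le> C\<^sup>2 * (E q - E \<rho>)"
      using EG[OF q] by (simp add: power_mult_distrib mult_left_mono)
    finally show ?thesis .
  qed
  obtain W where W: "W \<in> borel_measurable (borel \<Otimes>\<^sub>M borel)" "\<And>\<rho>. \<rho> \<le> R \<Longrightarrow> AE y in lebesgue_on (Y_star \<rho>). W (\<rho>, y) = w \<rho> y"
    using measurable_family_version[OF E L(1) Ew] by auto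
  obtain H where H: "H \<in> borel_measurable (borel \<Otimes>\<^sub>M borel)" "\<And>\<rho>. \<rho> \<le> R \<Longrightarrow> AE y in lebesgue_on (Y_star \<rho>). H (\<rho>, y) = G \<rho> y"
    using measurable_family_version[OF E L(2) EG] by auto
  have "corrector \<rho> e (\<lambda>y. W (\<rho>, y)) (\<lambda>y. H (\<rho>, y)) \<and> L2_norm (Y_star \<rho>) (\<lambda>y. W (\<rho>, y)) \<le> C * norm e" if \<rho>: "\<rho> \<le> R" for \<rho>
  proof
    have ae: "AE y in lebesgue_on (Y_star \<rho>). w \<rho> y = W (\<rho>, y)" "AE y in lebesgue_on (Y_star \<rho>). G \<rho> y = H (\<rho>, y)"
      using W(2)[OF \<rho>] H(2)[OF \<rho>] by (auto simp: eq_commute)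
    show "corrector \<rho> e (\<lambda>y. W (\<rho>, y)) (\<lambda>y. H (\<rho>, y))"
      using wG(1)[OF \<rho>] ae by (rule corrector_cong_AE)
    have "L2_norm (Y_star \<rho>) (\<lambda>y. W (\<rho>, y)) = L2_norm (Y_star \<rho>) (w \<rho>)"
      by (rule L2_norm_cong_AE[OF Y_star_sets W(2)[OF \<rho>]])
    then show "L2_norm (Y_star \<rho>) (\<lambda>y. W (\<rho>, y)) \<le> C * norm e"
      using corrector_bound[OF \<rho> wG(1)[OF \<rho>] wG(2)[OF \<rho>]] by simp
  qed
  then show ?thesis using W(1) H(1) by blast
qed

end

section \<open>The homogenized matrix\<close>

text \<open>The difference of the two correctors is an admissible test function; subtracting the two
  equations leaves the squared norm of the gradient difference.\<close>

lemma corrector_gradient_unique: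
  assumes c: "corrector \<rho> e w G" and c': "corrector \<rho> e w' G'"
  shows "L2_norm (Y_star \<rho>) (\<lambda>y. G y - G' y) = 0"
proof -
  let ?Y = "Y_star \<rho> :: (real ^ 'a) set"
  have w: "w \<in> H1_per \<rho>" "has_weak_gradient ?Y w G" and w': "w' \<in> H1_per \<rho>" "has_weak_gradient ?Y w' G'"
    using c c' by (auto simp: corrector_def)
  let ?d = "\<lambda>y. G y - G' y"
  have d: "?d \<in> L2 ?Y" by (rule L2_diff[OF has_weak_gradient_L2(2)[OF w(2)] has_weak_gradient_L2(2)[OF w'(2)]])
  have e: "(\<lambda>y. e) \<in> L2 ?Y" by (rule L2_const) simp
  note Le = L2_add[OF has_weak_gradient_L2(2)[OF w(2)] e] and Le' = L2_add[OF has_weak_gradient_L2(2)[OF w'(2)] e]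
  note wd = H1_per_diff[OF w(1) w'(1)] has_weak_gradient_diff[OF open_Y_star bounded_Y_star w(2) w'(2)]
  have "L2_inner ?Y (\<lambda>y. G y + e) ?d = 0" "L2_inner ?Y (\<lambda>y. G' y + e) ?d = 0"
    using c c' wd unfolding corrector_def by blast+
  moreover have "L2_inner ?Y ?d ?d = L2_inner ?Y (\<lambda>y. G y + e) ?d - L2_inner ?Y (\<lambda>y. G' y + e) ?d"
    unfolding L2_inner_def
    by (subst Bochner_Integration.integral_diff[symmetric])
      (simp_all add: L2_integrable_inner[OF Le d] L2_integrable_inner[OF Le' d] inner_diff_left[symmetric])
  ultimately show ?thesis by (simp add: L2_inner_self)
qed

lemma solves_cell_imp_corrector:
  "solves_cell \<rho> j w \<Longrightarrow> corrector \<rho> (axis j 1) w (weak_gradient (Y_star \<rho>) w)"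
  using solves_cell_iff[of \<rho> w _ j] H1_per_weak_gradient unfolding corrector_def by (metis solves_cell_def)

lemma corrector_imp_solves_cell: "corrector \<rho> (axis j 1) w G \<Longrightarrow> solves_cell \<rho> j w"
  using solves_cell_iff[of \<rho> w G j] unfolding corrector_def by blast

text \<open>\<open>A_hom\<close> is defined through an arbitrary choice of cell solution. Uniqueness
  of corrector gradients makes its entries computable from any corrector, in particular from the
  measurable family.\<close>

lemma A_hom_eq:
  assumes c: "corrector \<rho> (axis j 1) w G"
  shows "A_hom \<rho> $ i $ j = (LINT y|lebesgue_on (Y_star \<rho>). (G y + axis j 1) $ i)"
proof -
  have "solves_cell \<rho> j (cell_solution \<rho> j)"
    unfolding cell_solution_def by (rule someI[where P = "solves_cell \<rho> j", OF corrector_imp_solves_cell[OF c]])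
  then have c': "corrector \<rho> (axis j 1) (cell_solution \<rho> j) (weak_gradient (Y_star \<rho>) (cell_solution \<rho> j))"
    by (rule solves_cell_imp_corrector)
  have L: "(\<lambda>y. weak_gradient (Y_star \<rho>) (cell_solution \<rho> j) y - G y) \<in> L2 (Y_star \<rho>)"
    using c c' by (auto simp: corrector_def intro!: L2_diff dest: has_weak_gradient_L2)
  have "AE y in lebesgue_on (Y_star \<rho>). weak_gradient (Y_star \<rho>) (cell_solution \<rho> j) y - G y = 0"
    by (rule L2_norm_0_imp_AE[OF L corrector_gradient_unique[OF c' c]])
  then have "AE y in lebesgue_on (Y_star \<rho>).
      (if i = j then 1 else 0) + weak_gradient (Y_star \<rho>) (cell_solution \<rho> j) y $ i = (G y + axis j 1) $ i"
    by eventually_elim (auto simp: axis_def)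
  then have "(LINT y|lebesgue_on (Y_star \<rho>). (if i = j then 1 else 0) + weak_gradient (Y_star \<rho>) (cell_solution \<rho> j) y $ i)
      = (LINT y|lebesgue_on (Y_star \<rho>). (G y + axis j 1) $ i)"
    by (rule integral_lebesgue_on_cong_AE[OF Y_star_sets])
  then show ?thesis by (simp add: A_hom_def)
qed

lemma vec_eq_sum_axis: "(\<xi> :: real ^ 'n) = (\<Sum>j\<in>UNIV. (\<xi> $ j) *\<^sub>R axis j 1)"
  using basis_expansion[of \<xi>] by (simp add: scalar_mult_eq_scaleR)

locale correctors = periodic_Poincare R C S for R C :: real and S :: "(real ^ 'n) set" +
  fixes W :: "'n \<Rightarrow> real \<times> (real ^ 'n) \<Rightarrow> real" and H :: "'n \<Rightarrow> real \<times> (real ^ 'n) \<Rightarrow> real ^ 'n"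
  assumes W [measurable]: "\<And>j. W j \<in> borel_measurable (borel \<Otimes>\<^sub>M borel)"
    and H [measurable]: "\<And>j. H j \<in> borel_measurable (borel \<Otimes>\<^sub>M borel)"
    and corrector: "\<And>j \<rho>. \<rho> \<le> R \<Longrightarrow> corrector \<rho> (axis j 1) (\<lambda>y. W j (\<rho>, y)) (\<lambda>y. H j (\<rho>, y))"
    and W_bound: "\<And>j \<rho>. \<rho> \<le> R \<Longrightarrow> L2_norm (Y_star \<rho>) (\<lambda>y. W j (\<rho>, y)) \<le> C"

lemma (in periodic_Poincare) ex_correctors: "\<exists>W H. correctors R C S W H"
proof -
  have "\<exists>W H. W \<in> borel_measurable (borel \<Otimes>\<^sub>M borel) \<and> H \<in> borel_measurable (borel \<Otimes>\<^sub>M borel) \<and> (\<forall>\<rho>\<le>R.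
    corrector \<rho> (axis j 1) (\<lambda>y. W (\<rho>, y)) (\<lambda>y. H (\<rho>, y)) \<and> L2_norm (Y_star \<rho>) (\<lambda>y. W (\<rho>, y)) \<le> C * norm (axis j 1 :: real ^ 'n))" for j :: 'n
    using ex_measurable_corrector[of "axis j 1"] by blast
  then obtain W H where "\<And>j. W j \<in> borel_measurable (borel \<Otimes>\<^sub>M borel) \<and> H j \<in> borel_measurable (borel \<Otimes>\<^sub>M borel) \<and> (\<forall>\<rho>\<le>R.
    corrector \<rho> (axis j 1) (\<lambda>y. W j (\<rho>, y)) (\<lambda>y. H j (\<rho>, y)) \<and> L2_norm (Y_star \<rho>) (\<lambda>y. W j (\<rho>, y)) \<le> C * norm (axis j 1 :: real ^ 'n))"
    by metis
  then have "correctors R C S W H"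
    by (intro correctors.intro periodic_Poincare_axioms correctors_axioms.intro) (auto simp: norm_axis_1)
  then show ?thesis by blast
qed

context correctors
begin

lemma H_L2: "\<rho> \<le> R \<Longrightarrow> (\<lambda>y. H j (\<rho>, y)) \<in> L2 (Y_star \<rho>)"
  and W_L2: "\<rho> \<le> R \<Longrightarrow> (\<lambda>y. W j (\<rho>, y)) \<in> L2 (Y_star \<rho>)"
  using corrector[of \<rho> j] by (auto simp: corrector_def dest: has_weak_gradient_L2)

lemma H_bound: "\<rho> \<le> R \<Longrightarrow> L2_norm (Y_star \<rho>) (\<lambda>y. H j (\<rho>, y)) \<le> 1"
  using corrector_gradient_bound[OF corrector[of \<rho> j]] by (simp add: norm_axis_1)

text \<open>By linearity of the cell problem this is the corrector for the constant field
  \<xi>.\<close>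

definition corr :: "real \<Rightarrow> real ^ 'n \<Rightarrow> real ^ 'n \<Rightarrow> real" where
  "corr \<rho> \<xi> y = (\<Sum>j\<in>UNIV. \<xi> $ j *\<^sub>R W j (\<rho>, y))"

definition corr_grad :: "real \<Rightarrow> real ^ 'n \<Rightarrow> real ^ 'n \<Rightarrow> real ^ 'n" where
  "corr_grad \<rho> \<xi> y = (\<Sum>j\<in>UNIV. \<xi> $ j *\<^sub>R H j (\<rho>, y))"

lemma corr_per:
  assumes "\<rho> \<le> R"
  shows "corr \<rho> \<xi> \<in> H1_per \<rho>" "has_weak_gradient (Y_star \<rho>) (corr \<rho> \<xi>) (corr_grad \<rho> \<xi>)"
proof -
  have c: "(\<lambda>y. W j (\<rho>, y)) \<in> H1_per \<rho>" "has_weak_gradient (Y_star \<rho>) (\<lambda>y. W j (\<rho>, y)) (\<lambda>y. H j (\<rho>, y))" for j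
    using corrector[OF assms, of j] by (auto simp: corrector_def)
  have "(\<lambda>y. \<Sum>j\<in>UNIV. \<xi> $ j * W j (\<rho>, y)) \<in> H1_per \<rho>"
    by (intro H1_per_sum H1_per_cmult c)
  then show "corr \<rho> \<xi> \<in> H1_per \<rho>" by (simp add: corr_def[abs_def])
  have "has_weak_gradient (Y_star \<rho>) (\<lambda>y. \<Sum>j\<in>UNIV. \<xi> $ j * W j (\<rho>, y)) (\<lambda>y. \<Sum>j\<in>UNIV. \<xi> $ j *\<^sub>R H j (\<rho>, y))"
    by (intro has_weak_gradient_sum open_Y_star bounded_Y_star has_weak_gradient_cmult c)
  then show "has_weak_gradient (Y_star \<rho>) (corr \<rho> \<xi>) (corr_grad \<rho> \<xi>)"
    by (simp add: corr_def[abs_def] corr_grad_def[abs_def])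
qed

lemma flux_eq: "\<xi> + corr_grad \<rho> \<xi> y = (\<Sum>j\<in>UNIV. \<xi> $ j *\<^sub>R (H j (\<rho>, y) + axis j 1))"
  using vec_eq_sum_axis[of \<xi>] by (simp add: corr_grad_def scaleR_add_right sum.distrib add.commute)

lemma flux_L2:
  assumes "\<rho> \<le> R"
  shows "(\<lambda>y. \<xi> + corr_grad \<rho> \<xi> y) \<in> L2 (Y_star \<rho>)"
  using has_weak_gradient_L2(2)[OF corr_per(2)[OF assms]] by (intro L2_add L2_const) auto

lemma flux_orthogonal:
  assumes \<rho>: "\<rho> \<le> R" and v: "v \<in> H1_per \<rho>" "has_weak_gradient (Y_star \<rho>) v K"
  shows "L2_inner (Y_star \<rho>) (\<lambda>y. \<xi> + corr_grad \<rho> \<xi> y) K = 0"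
proof -
  have L: "(\<lambda>y. H j (\<rho>, y) + axis j 1) \<in> L2 (Y_star \<rho>)" for j
    by (intro L2_add H_L2[OF \<rho>] L2_const) simp
  have "L2_inner (Y_star \<rho>) (\<lambda>y. \<xi> + corr_grad \<rho> \<xi> y) K
      = (LINT y|lebesgue_on (Y_star \<rho>). (\<Sum>j\<in>UNIV. \<xi> $ j * ((H j (\<rho>, y) + axis j 1) \<bullet> K y)))"
    by (simp add: L2_inner_def flux_eq inner_sum_left del: scaleR_add_right)
  also have "\<dots> = (\<Sum>j\<in>UNIV. \<xi> $ j * L2_inner (Y_star \<rho>) (\<lambda>y. H j (\<rho>, y) + axis j 1) K)"
    unfolding L2_inner_def
    by (subst Bochner_Integration.integral_sum)
      (auto intro!: integrable_mult_right L2_integrable_inner[OF L has_weak_gradient_L2(2)[OF v(2)]])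
  also have "\<dots> = 0"
    using corrector[OF \<rho>] v unfolding corrector_def by (intro sum.neutral) auto
  finally show ?thesis .
qed

lemma flux_average:
  assumes \<rho>: "\<rho> \<le> R"
  shows "L2_inner (Y_star \<rho>) (\<lambda>y. \<xi> + corr_grad \<rho> \<xi> y) (\<lambda>y. \<eta>) = (A_hom \<rho> *v \<xi>) \<bullet> \<eta>"
proof -
  have L: "(\<lambda>y. H j (\<rho>, y) + axis j 1) \<in> L2 (Y_star \<rho>)" for j
    by (intro L2_add H_L2[OF \<rho>] L2_const) simp
  have i: "integrable (lebesgue_on (Y_star \<rho>)) (\<lambda>y. (H j (\<rho>, y) + axis j 1) $ i)" for i j
    using integrable_inner_left[of "axis i 1" "lebesgue_on (Y_star \<rho>)" "\<lambda>y. H j (\<rho>, y) + axis j 1"] L2_integrable[OF L Y_star_lmeasurable]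
    by (simp add: inner_axis)
  have "L2_inner (Y_star \<rho>) (\<lambda>y. \<xi> + corr_grad \<rho> \<xi> y) (\<lambda>y. \<eta>)
      = (LINT y|lebesgue_on (Y_star \<rho>). (\<Sum>j\<in>UNIV. \<Sum>i\<in>UNIV. (\<xi> $ j * \<eta> $ i) * (H j (\<rho>, y) + axis j 1) $ i))"
    unfolding L2_inner_def flux_eq inner_sum_left inner_scaleR_left
    by (intro Bochner_Integration.integral_cong refl sum.cong)
      (auto simp: inner_vec_def sum_distrib_left mult_ac)
  also have "\<dots> = (\<Sum>j\<in>UNIV. \<Sum>i\<in>UNIV. (\<xi> $ j * \<eta> $ i) * (LINT y|lebesgue_on (Y_star \<rho>). (H j (\<rho>, y) + axis j 1) $ i))"
    by (subst Bochner_Integration.integral_sum, intro Bochner_Integration.integrable_sum integrable_mult_right i,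
        intro sum.cong refl, subst Bochner_Integration.integral_sum, intro integrable_mult_right i,
        intro sum.cong refl integral_mult_right_zero)
  also have "\<dots> = (\<Sum>j\<in>UNIV. \<Sum>i\<in>UNIV. (\<xi> $ j * \<eta> $ i) * A_hom \<rho> $ i $ j)"
    by (simp add: A_hom_eq[OF corrector[OF \<rho>]])
  also have "\<dots> = (\<Sum>i\<in>UNIV. \<Sum>j\<in>UNIV. (\<xi> $ j * \<eta> $ i) * A_hom \<rho> $ i $ j)"
    by (rule sum.swap)
  also have "\<dots> = (A_hom \<rho> *v \<xi>) \<bullet> \<eta>"
    by (simp add: inner_vec_def matrix_vector_mult_def sum_distrib_left sum_distrib_right mult_ac)
  finally show ?thesis .
qed

text \<open>The algebraic core of the elimination: the flux is orthogonal to periodic gradients, so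
  \<open>K\<close> drops out, and against the constant \<eta> it only contributes its integral over
  the cell, which is the homogenized flux.\<close>

lemma cell_energy:
  assumes \<rho>: "\<rho> \<le> R" and v: "v \<in> H1_per \<rho>" "has_weak_gradient (Y_star \<rho>) v K"
  shows "(LINT y|lebesgue_on (Y_star \<rho>). D * ((\<xi> + corr_grad \<rho> \<xi> y) \<bullet> (\<eta> + K y))) = (D *\<^sub>R (A_hom \<rho> *v \<xi>)) \<bullet> \<eta>"
proof -
  have c: "(\<lambda>y. \<eta>) \<in> L2 (Y_star \<rho>)" by (rule L2_const) simp
  have "(LINT y|lebesgue_on (Y_star \<rho>). (\<xi> + corr_grad \<rho> \<xi> y) \<bullet> (\<eta> + K y))
      = L2_inner (Y_star \<rho>) (\<lambda>y. \<xi> + corr_grad \<rho> \<xi> y) (\<lambda>y. \<eta>) + L2_inner (Y_star \<rho>) (\<lambda>y. \<xi> + corr_grad \<rho> \<xi> y) K"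
    unfolding L2_inner_def inner_add_right[of "\<xi> + corr_grad \<rho> \<xi> _"]
    by (intro Bochner_Integration.integral_add L2_integrable_inner flux_L2[OF \<rho>] c has_weak_gradient_L2(2)[OF v(2)])
  also have "\<dots> = (A_hom \<rho> *v \<xi>) \<bullet> \<eta>"
    by (simp add: flux_average[OF \<rho>] flux_orthogonal[OF \<rho> v])
  finally show ?thesis by simp
qed

text \<open>The 2 is 1 for the corrector gradient plus 1 for the unit vector, the volume of the cell
  being at most 1.\<close>

lemma A_hom_bound:
  fixes i j :: 'n
  assumes \<rho>: "\<rho> \<le> R"
  shows "\<bar>A_hom \<rho> $ i $ j\<bar> \<le> 2"
proof -
  let ?F = "\<lambda>y. H j (\<rho>, y) + axis j 1"
  have c: "(\<lambda>y. axis k 1 :: real ^ 'n) \<in> L2 (Y_star \<rho>)" for k by (rule L2_const) simp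
  have L: "?F \<in> L2 (Y_star \<rho>)" by (rule L2_add[OF H_L2[OF \<rho>] c])
  have n: "L2_norm (Y_star \<rho> :: (real ^ 'n) set) (\<lambda>y. axis k 1 :: real ^ 'n) \<le> 1" for k
    by (rule order_trans[OF L2_norm_const_le]) simp
  have "A_hom \<rho> $ i $ j = L2_inner (Y_star \<rho>) ?F (\<lambda>y. axis i 1)"
    by (simp add: A_hom_eq[OF corrector[OF \<rho>]] L2_inner_def inner_axis)
  then have "\<bar>A_hom \<rho> $ i $ j\<bar> \<le> L2_norm (Y_star \<rho>) ?F * L2_norm (Y_star \<rho> :: (real ^ 'n) set) (\<lambda>y. axis i 1 :: real ^ 'n)"
    using L2_Cauchy_Schwarz[OF L c] by simp
  also have "\<dots> \<le> 2 * 1"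
  proof (intro mult_mono)
    have "L2_norm (Y_star \<rho>) ?F \<le> L2_norm (Y_star \<rho>) (\<lambda>y. H j (\<rho>, y)) + L2_norm (Y_star \<rho> :: (real ^ 'n) set) (\<lambda>y. axis j 1 :: real ^ 'n)"
      by (rule L2_norm_triangle[OF H_L2[OF \<rho>] c])
    also have "\<dots> \<le> 1 + 1"
      by (intro add_mono H_bound \<rho> n)
    finally show "L2_norm (Y_star \<rho>) ?F \<le> 2" by simp
  qed (auto intro: n)
  finally show ?thesis by simp
qed

text \<open>The entries are integrals over \<open>y\<close> of a function jointly Borel in radius
  and position, with the moving cell encoded by an indicator. Equality is claimed up to
  \<open>R\<close>, where the correctors are available.\<close>

lemma A_hom_measurable:
  fixes i j :: 'n
  shows "\<exists>a\<in>borel_measurable borel. \<forall>\<rho>\<le>R. A_hom \<rho> $ i $ j = a \<rho>"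
proof -
  define f where "f \<rho> y = indicator (Y_star \<rho>) y * (H j (\<rho>, y) + axis j 1) $ i" for \<rho> and y :: "real ^ 'n"
  have Y: "{p :: real \<times> (real ^ 'n). snd p \<in> Y_star (fst p)} \<in> sets (borel \<Otimes>\<^sub>M borel)"
  proof -
    have "{p :: real \<times> (real ^ 'n). snd p \<in> Y_star (fst p)} = {p \<in> space (borel \<Otimes>\<^sub>M borel). snd p \<in> cell_Y \<and> fst p < norm (snd p - x_M)}"
      by (auto simp: mem_Y_star space_pair_measure)
    also have "\<dots> \<in> sets (borel \<Otimes>\<^sub>M borel)" by measurable
    finally show ?thesis .
  qed
  have "(\<lambda>p. indicator {p :: real \<times> (real ^ 'n). snd p \<in> Y_star (fst p)} p * (H j p + axis j 1) $ i) \<in> borel_measurable (borel \<Otimes>\<^sub>M borel)"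
    unfolding cart_eq_inner_axis using Y by measurable
  also have "(\<lambda>p. indicator {p :: real \<times> (real ^ 'n). snd p \<in> Y_star (fst p)} p * (H j p + axis j 1) $ i) = case_prod f"
    by (auto simp: f_def indicator_def fun_eq_iff)
  finally have f: "case_prod f \<in> borel_measurable (borel \<Otimes>\<^sub>M lborel)" by (simp cong: measurable_cong_sets)
  have "(\<lambda>\<rho>. LINT y|lborel. f \<rho> y) \<in> borel_measurable borel"
    using f by (rule lborel.borel_measurable_lebesgue_integral)
  moreover have "A_hom \<rho> $ i $ j = (LINT y|lborel. f \<rho> y)" if "\<rho> \<le> R" for \<rho>
  proof -
    have fm: "f \<rho> \<in> borel_measurable lborel" using measurable_Pair2[OF f, of \<rho>] by simp
    have "A_hom \<rho> $ i $ j = (LINT y|lebesgue. f \<rho> y)"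
      unfolding A_hom_eq[OF corrector[OF that]] f_def by (rule integral_lebesgue_on_indicator[OF Y_star_sets])
    then show ?thesis by (simp add: integral_completion[OF fm])
  qed
  ultimately show ?thesis by (intro bexI[of _ "\<lambda>\<rho>. LINT y|lborel. f \<rho> y"]) auto
qed

end

section \<open>Eliminating the corrector\<close>

text \<open>The product of a null set with a whole space is null. The work lies in the bracketing:
  the exceptional set lives on the first two factors, while the triple is paired as first factor
  against the other two.\<close>

lemma AE_lborel_triple:
  fixes P :: "'a::euclidean_space \<times> 'b::euclidean_space \<Rightarrow> bool"
  assumes "AE p in lborel. P p"
  shows "AE z in (lborel :: ('a \<times> 'b \<times> 'c::euclidean_space) measure). P (fst z, fst (snd z))"
proof -
  obtain N where N: "{x \<in> space lborel. \<not> P x} \<subseteq> N" "emeasure lborel N = 0" "N \<in> sets lborel"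
    using assms by (rule AE_E)
  have Nm [measurable]: "N \<in> sets (borel \<Otimes>\<^sub>M borel)" using N(3) unfolding borel_prod by simp
  have "AE p in lborel \<Otimes>\<^sub>M lborel. p \<notin> N"
    using N(2,3) by (simp only: lborel_prod) (intro AE_not_in, simp add: null_sets_def)
  then have "AE x in lborel. AE y in lborel. (x, y) \<notin> N" by (rule lborel_pair.AE_pair)
  then have "AE x in lborel. AE q in (lborel :: ('b \<times> 'c) measure). (x, fst q) \<notin> N"
  proof eventually_elim
    case (elim x)
    have "AE q in (lborel :: 'b measure) \<Otimes>\<^sub>M (lborel :: 'c measure). (x, fst q) \<notin> N"
    proof (rule lborel_pair.AE_pair_measure)
      show "{q \<in> space ((lborel :: 'b measure) \<Otimes>\<^sub>M (lborel :: 'c measure)). (x, fst q) \<notin> N} \<in> sets (lborel \<Otimes>\<^sub>M lborel)"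
        by measurable
      show "AE y in lborel. AE c in (lborel :: 'c measure). (x, fst (y, c)) \<notin> N"
        using elim by eventually_elim simp
    qed
    then show ?case by (simp only: lborel_prod)
  qed
  then have "AE z in (lborel :: 'a measure) \<Otimes>\<^sub>M (lborel :: ('b \<times> 'c) measure). (fst z, fst (snd z)) \<notin> N"
  proof (intro lborel_pair.AE_pair_measure)
    have "{z \<in> space (borel \<Otimes>\<^sub>M (borel \<Otimes>\<^sub>M borel)). (fst z, fst (snd z)) \<notin> N} \<in> sets ((borel :: 'a measure) \<Otimes>\<^sub>M ((borel :: 'b measure) \<Otimes>\<^sub>M (borel :: 'c measure)))"
      by measurable
    then show "{z \<in> space ((lborel :: 'a measure) \<Otimes>\<^sub>M (lborel :: ('b \<times> 'c) measure)). (fst z, fst (snd z)) \<notin> N} \<in> sets (lborel \<Otimes>\<^sub>M lborel)"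
      by (simp only: borel_prod lborel_prod space_lborel space_borel sets_lborel)
  qed simp
  then have "AE z in (lborel :: ('a \<times> 'b \<times> 'c) measure). (fst z, fst (snd z)) \<notin> N"
    by (simp only: lborel_prod)
  then show ?thesis
    by eventually_elim (use N(1) in auto)
qed

lemma L2_norm_sum_le:
  assumes "finite I" "\<And>i. i \<in> I \<Longrightarrow> f i \<in> L2 A"
  shows "L2_norm A (\<lambda>x. \<Sum>i\<in>I. f i x) \<le> (\<Sum>i\<in>I. L2_norm A (f i))"
  using assms
proof (induction I rule: finite_induct)
  case (insert i I)
  have "L2_norm A (\<lambda>x. f i x + (\<Sum>i\<in>I. f i x)) \<le> L2_norm A (f i) + L2_norm A (\<lambda>x. \<Sum>i\<in>I. f i x)"
    using insert by (intro L2_norm_triangle L2_sum) auto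
  with insert show ?case by fastforce
qed (simp add: L2_norm_def)

locale perforated_cylinder = correctors R C S W H
  for R C :: real and S :: "(real ^ 'n) set" and W :: "'n \<Rightarrow> real \<times> (real ^ 'n) \<Rightarrow> real"
    and H :: "'n \<Rightarrow> real \<times> (real ^ 'n) \<Rightarrow> real ^ 'n" +
  fixes T :: real and \<Omega> :: "(real ^ 'n) set" and r :: "real \<Rightarrow> real ^ 'n \<Rightarrow> real"
  assumes open_\<Omega>: "open \<Omega>"
    and r_measurable: "(\<lambda>(t, x). r t x) \<in> borel_measurable (lebesgue_on ({0<..<T} \<times> \<Omega>))"
    and r_le: "AE p in lebesgue_on ({0<..<T} \<times> \<Omega>). case p of (t, x) \<Rightarrow> r t x \<le> R"
begin

abbreviation cyl :: "(real \<times> (real ^ 'n)) set" where "cyl \<equiv> {0<..<T} \<times> \<Omega>"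

definition perf :: "(real \<times> (real ^ 'n) \<times> (real ^ 'n)) set" where
  "perf = {(t, x, y). t \<in> {0<..<T} \<and> x \<in> \<Omega> \<and> y \<in> Y_star (r t x)}"

lemma cyl_borel [measurable, simp]: "cyl \<in> sets borel"
  by (intro borel_open open_Times open_\<Omega>) auto

lemma cyl_sets [simp]: "cyl \<in> sets lebesgue"
  by (intro sets_completionI_sets) simp

lemma \<Omega>_sets [simp]: "\<Omega> \<in> sets lebesgue"
  using open_\<Omega> by (intro sets_completionI_sets) simp

lemma cyl_eq: "cyl = {(t, x). t \<in> {0<..<T} \<and> x \<in> \<Omega>}"
  by auto

lemma AE_cyl_slices:
  assumes "AE p in lebesgue_on cyl. P p"
  shows "AE t in lebesgue_on {0<..<T}. AE x in lebesgue_on \<Omega>. P (t, x)"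
proof -
  have A: "{(t, x). t \<in> {0<..<T} \<and> x \<in> \<Omega>} \<in> sets lebesgue" using cyl_sets unfolding cyl_eq .
  have "AE t in lebesgue_on {0<..<T}. \<Omega> \<in> sets lebesgue \<and> (AE x in lebesgue_on \<Omega>. P (t, x))"
    by (rule AE_lebesgue_on_slices[OF _ A assms[unfolded cyl_eq]]) simp
  then show ?thesis by eventually_elim simp
qed

lemma Fubini_cyl:
  assumes "integrable (lebesgue_on cyl) f"
  shows "(LINT t|lebesgue_on {0<..<T}. LINT x|lebesgue_on \<Omega>. f (t, x)) = (LINT p|lebesgue_on cyl. f p :: real)"
proof -
  have A: "{(t, x). t \<in> {0<..<T} \<and> x \<in> \<Omega>} \<in> sets lebesgue" using cyl_sets unfolding cyl_eq .
  have "(LINT t|lebesgue_on {0<..<T}. LINT x|lebesgue_on \<Omega>. f (t, x))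
      = (LINT p|lebesgue_on {(t, x). t \<in> {0<..<T} \<and> x \<in> \<Omega>}. f p)"
    by (rule Fubini_lebesgue_on(3)[OF _ A assms[unfolded cyl_eq]]) simp
  then show ?thesis unfolding cyl_eq .
qed

lemma ex_borel_radius:
  "\<exists>r'\<in>borel_measurable borel. AE p in lebesgue_on cyl. (case p of (t, x) \<Rightarrow> r t x) = r' p"
  using ex_borel_version_lebesgue_on[OF cyl_sets r_measurable] by simp

lemma AE_cyl_triple:
  assumes "AE p in lebesgue_on cyl. P p"
  shows "AE z in (lborel :: (real \<times> (real ^ 'n) \<times> (real ^ 'n)) measure). (fst z, fst (snd z)) \<in> cyl \<longrightarrow> P (fst z, fst (snd z))"
proof -
  have "AE p in lborel. p \<in> cyl \<longrightarrow> P p"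
    using assms by (simp add: AE_restrict_space_iff AE_completion_iff)
  then show ?thesis by (rule AE_lborel_triple)
qed

text \<open>A Borel substitute for \<open>perf\<close> built from a Borel version of the radius. The
  condition that the radius be at most \<open>R\<close> is added so that the uniform corrector
  bounds hold at every point, not just almost everywhere.\<close>

definition perf' :: "(real \<times> (real ^ 'n) \<Rightarrow> real) \<Rightarrow> (real \<times> (real ^ 'n) \<times> (real ^ 'n)) set" where
  "perf' r' = {z. (fst z, fst (snd z)) \<in> cyl \<and> r' (fst z, fst (snd z)) \<le> R \<and> snd (snd z) \<in> Y_star (r' (fst z, fst (snd z)))}"

lemma perf'_borel:
  assumes r': "r' \<in> borel_measurable borel"
  shows "perf' r' \<in> sets borel"
proof -
  have [measurable]: "r' \<in> borel_measurable (borel \<Otimes>\<^sub>M borel)" using r' by (simp add: borel_prod)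
  have [measurable]: "cyl \<in> sets (borel \<Otimes>\<^sub>M borel)" using cyl_borel unfolding borel_prod .
  have "perf' r' = {z \<in> space (borel \<Otimes>\<^sub>M (borel \<Otimes>\<^sub>M borel)). (fst z, fst (snd z)) \<in> cyl \<and> r' (fst z, fst (snd z)) \<le> R \<and>
      snd (snd z) \<in> cell_Y \<and> r' (fst z, fst (snd z)) < norm (snd (snd z) - x_M)}"
    by (auto simp: perf'_def mem_Y_star space_pair_measure)
  also have "\<dots> \<in> sets (borel \<Otimes>\<^sub>M (borel \<Otimes>\<^sub>M borel))" by measurable
  finally show ?thesis unfolding borel_prod .
qed

lemma perf_iff: "z \<in> perf \<longleftrightarrow> (fst z, fst (snd z)) \<in> cyl \<and> snd (snd z) \<in> Y_star (r (fst z) (fst (snd z)))"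
  by (cases z) (auto simp: perf_def)

lemma AE_perf_iff:
  assumes eq: "AE p in lebesgue_on cyl. (case p of (t, x) \<Rightarrow> r t x) = r' p"
  shows "AE z in lborel. z \<in> perf' r' \<longleftrightarrow> z \<in> perf"
  using AE_cyl_triple[OF eq] AE_cyl_triple[OF r_le]
  by eventually_elim (auto simp: perf'_def perf_iff)

lemma perf_sets [simp]: "perf \<in> sets lebesgue"
proof -
  obtain r' where r': "r' \<in> borel_measurable borel" "AE p in lebesgue_on cyl. (case p of (t, x) \<Rightarrow> r t x) = r' p"
    using ex_borel_radius by blast
  show ?thesis
  proof (rule completion.in_sets_AE)
    show "AE z in lebesgue. z \<in> perf' r' \<longleftrightarrow> z \<in> perf" using AE_perf_iff[OF r'(2)] by (simp add: AE_completion_iff)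
    show "perf' r' \<in> sets lebesgue" using perf'_borel[OF r'(1)] by (intro sets_completionI_sets) simp
  qed simp
qed

text \<open>Fubini with variable slices is used twice, first splitting off time and then space.
  Measurability of almost every time slice is supplied by the first application.\<close>

lemma Fubini_perf:
  assumes f: "integrable (lebesgue_on perf) f"
  shows "(LINT t|lebesgue_on {0<..<T}. LINT x|lebesgue_on \<Omega>. LINT y|lebesgue_on (Y_star (r t x)). f (t, x, y))
    = (LINT z|lebesgue_on perf. f z :: real)"
proof -
  define B :: "real \<Rightarrow> ((real ^ 'n) \<times> (real ^ 'n)) set" where "B t = {(x, y). x \<in> \<Omega> \<and> y \<in> Y_star (r t x)}" for t
  have eq: "perf = {(t, q). t \<in> {0<..<T} \<and> q \<in> B t}" by (auto simp: perf_def B_def)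
  have A: "{(t, q). t \<in> {0<..<T} \<and> q \<in> B t} \<in> sets lebesgue" using perf_sets unfolding eq .
  have St: "{0<..<T} \<in> sets lebesgue" by simp
  note F = Fubini_lebesgue_on[OF St A f[unfolded eq]]
  have "AE t in lebesgue_on {0<..<T}. (LINT x|lebesgue_on \<Omega>. LINT y|lebesgue_on (Y_star (r t x)). f (t, x, y))
      = (LINT q|lebesgue_on (B t). f (t, q))"
    using F(1)
  proof eventually_elim
    case (elim t)
    then show ?case
      unfolding B_def by (intro Fubini_lebesgue_on(3)[of \<Omega> "\<lambda>x. Y_star (r t x)" "\<lambda>q. f (t, q)", simplified]) auto
  qed
  then have "(LINT t|lebesgue_on {0<..<T}. LINT x|lebesgue_on \<Omega>. LINT y|lebesgue_on (Y_star (r t x)). f (t, x, y))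
      = (LINT t|lebesgue_on {0<..<T}. LINT q|lebesgue_on (B t). f (t, q))"
    by (rule integral_lebesgue_on_cong_AE[OF St])
  also have "\<dots> = (LINT z|lebesgue_on perf. f z)" using F(3) unfolding eq .
  finally show ?thesis .
qed

lemma AE_perf_slices:
  assumes P: "AE z in lebesgue_on perf. P z"
  shows "AE t in lebesgue_on {0<..<T}. AE x in lebesgue_on \<Omega>. AE y in lebesgue_on (Y_star (r t x)). P (t, x, y)"
proof -
  define B :: "real \<Rightarrow> ((real ^ 'n) \<times> (real ^ 'n)) set" where "B t = {(x, y). x \<in> \<Omega> \<and> y \<in> Y_star (r t x)}" for t
  have eq: "perf = {(t, q). t \<in> {0<..<T} \<and> q \<in> B t}" by (auto simp: perf_def B_def)
  have A: "{(t, q). t \<in> {0<..<T} \<and> q \<in> B t} \<in> sets lebesgue" using perf_sets unfolding eq .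
  have "AE t in lebesgue_on {0<..<T}. B t \<in> sets lebesgue \<and> (AE q in lebesgue_on (B t). P (t, q))"
    by (rule AE_lebesgue_on_slices[OF _ A P[unfolded eq]]) simp
  then show ?thesis
  proof eventually_elim
    case (elim t)
    note b = elim[unfolded B_def, THEN conjunct1] elim[unfolded B_def, THEN conjunct2]
    show ?case
      using AE_lebesgue_on_slices[OF \<Omega>_sets b] by eventually_elim simp
  qed
qed

text \<open>Integrating first over the cell bounds the squared norm by a constant times that of
  \<open>g (t, x)\<close>, thanks to the bound \<open>K\<close> that is uniform in the radius; the
  remaining integral is the norm of \<open>g\<close> on the cylinder.\<close>

lemma parametric_L2:
  fixes F :: "'n \<Rightarrow> real \<times> (real ^ 'n) \<Rightarrow> 'b::euclidean_space"
  assumes F: "\<And>j. F j \<in> borel_measurable (borel \<Otimes>\<^sub>M borel)"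
    and L: "\<And>j \<rho>. \<rho> \<le> R \<Longrightarrow> (\<lambda>y. F j (\<rho>, y)) \<in> L2 (Y_star \<rho>)"
    and K: "\<And>j \<rho>. \<rho> \<le> R \<Longrightarrow> L2_norm (Y_star \<rho>) (\<lambda>y. F j (\<rho>, y)) \<le> K"
    and g: "g \<in> borel_measurable borel" "g \<in> L2 cyl"
    and r': "r' \<in> borel_measurable borel" and eq: "AE p in lebesgue_on cyl. (case p of (t, x) \<Rightarrow> r t x) = r' p"
  shows "(\<lambda>(t, x, y). \<Sum>j\<in>UNIV. g (t, x) $ j *\<^sub>R F j (r' (t, x), y)) \<in> L2 perf"
proof -
  let ?V = "\<lambda>z. \<Sum>j\<in>UNIV. g (fst z, fst (snd z)) $ j *\<^sub>R F j (r' (fst z, fst (snd z)), snd (snd z))"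
  have Vm: "?V \<in> borel_measurable borel"
  proof -
    have [measurable]: "r' \<in> borel_measurable (borel \<Otimes>\<^sub>M borel)" "g \<in> borel_measurable (borel \<Otimes>\<^sub>M borel)"
      using r' g(1) by (simp_all add: borel_prod)
    have [measurable]: "(\<lambda>p. g p $ j) \<in> borel_measurable (borel \<Otimes>\<^sub>M borel)" for j
      unfolding cart_eq_inner_axis by measurable
    note F [measurable]
    have "?V \<in> borel_measurable (borel \<Otimes>\<^sub>M (borel \<Otimes>\<^sub>M borel))" by measurable
    then show ?thesis by (simp add: borel_prod)
  qed
  define B where "B = perf' r'"
  have Bb [measurable]: "B \<in> sets borel" unfolding B_def by (rule perf'_borel[OF r'])
  define h where "h z = indicator B z * ennreal ((norm (?V z))\<^sup>2)" for z
  have hm: "h \<in> borel_measurable borel" unfolding h_def using Vm by measurable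
  let ?M = "(real CARD('n) * K)\<^sup>2"
  have K0: "0 \<le> K" using K[of R] L2_norm_nonneg order_trans by blast
  \<comment> \<open>Minkowski over the coordinates: each of the \<open>CARD('n)\<close> terms has
    norm at most \<open>K\<close> times that of \<open>g (t, x)\<close>. Where the radius exceeds
    \<open>R\<close> the integrand is zero by construction.\<close>
  have inner: "(\<integral>\<^sup>+y. h (t, x, y) \<partial>lborel) \<le> ennreal ?M * (indicator cyl (t, x) * ennreal ((norm (g (t, x)))\<^sup>2))" for t x
  proof (cases "(t, x) \<in> cyl \<and> r' (t, x) \<le> R")
    case True
    let ?\<rho> = "r' (t, x)" and ?\<xi> = "g (t, x)"
    let ?v = "\<lambda>y. \<Sum>j\<in>UNIV. ?\<xi> $ j *\<^sub>R F j (?\<rho>, y)"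
    have \<rho>: "?\<rho> \<le> R" using True by simp
    have vL: "?v \<in> L2 (Y_star ?\<rho>)" by (intro L2_sum L2_scaleR L \<rho>)
    have vb: "?v \<in> borel_measurable borel"
      using F by (intro borel_measurable_sum borel_measurable_scaleR borel_measurable_const measurable_compose[OF measurable_Pair1' F]) auto
    have "L2_norm (Y_star ?\<rho>) ?v \<le> (\<Sum>j\<in>UNIV. L2_norm (Y_star ?\<rho>) (\<lambda>y. ?\<xi> $ j *\<^sub>R F j (?\<rho>, y)))"
      by (intro L2_norm_sum_le finite L2_scaleR L \<rho>)
    also have "\<dots> \<le> (\<Sum>j\<in>(UNIV :: 'n set). norm ?\<xi> * K)"
      unfolding L2_norm_scaleR by (intro sum_mono mult_mono K \<rho> component_le_norm_cart) auto
    finally have "L2_norm (Y_star ?\<rho>) ?v \<le> real CARD('n) * K * norm ?\<xi>" by (simp add: mult_ac)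
    then have "(L2_norm (Y_star ?\<rho>) ?v)\<^sup>2 \<le> (real CARD('n) * K * norm ?\<xi>)\<^sup>2" by (intro power_mono) auto
    then have le: "ennreal ((L2_norm (Y_star ?\<rho>) ?v)\<^sup>2) \<le> ennreal (?M * (norm ?\<xi>)\<^sup>2)"
      by (intro ennreal_leI) (simp add: power_mult_distrib)
    have "(\<integral>\<^sup>+y. h (t, x, y) \<partial>lborel) = (\<integral>\<^sup>+y. indicator (Y_star ?\<rho>) y * ennreal ((norm (?v y))\<^sup>2) \<partial>lborel)"
      using True by (intro nn_integral_cong) (auto simp: h_def B_def perf'_def indicator_def)
    also have "\<dots> = ennreal ((L2_norm (Y_star ?\<rho>) ?v)\<^sup>2)"
      by (rule nn_integral_lborel_L2[OF vb Y_star_borel vL])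
    finally show ?thesis using le True by (simp add: ennreal_mult)
  next
    case False
    then have "h (t, x, y) = 0" for y by (auto simp: h_def B_def perf'_def)
    then show ?thesis by simp
  qed
  have hx: "(\<integral>\<^sup>+q. h (t, q) \<partial>lborel) = (\<integral>\<^sup>+x. \<integral>\<^sup>+y. h (t, x, y) \<partial>lborel \<partial>lborel)" for t
  proof -
    have "(\<lambda>q. h (t, q)) \<in> borel_measurable (lborel \<Otimes>\<^sub>M lborel)"
      using measurable_compose[OF measurable_Pair1' hm[folded borel_prod], of t] by (simp add: borel_prod lborel_prod)
    then show ?thesis
      using lborel.nn_integral_fst[of "\<lambda>q. h (t, q)" lborel] by (simp add: lborel_prod)
  qed
  have "(\<integral>\<^sup>+z. h z \<partial>lborel) = (\<integral>\<^sup>+t. \<integral>\<^sup>+q. h (t, q) \<partial>lborel \<partial>lborel)"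
    using lborel.nn_integral_fst[of h lborel] hm by (simp add: lborel_prod)
  also have "\<dots> \<le> (\<integral>\<^sup>+t. \<integral>\<^sup>+x. ennreal ?M * (indicator cyl (t, x) * ennreal ((norm (g (t, x)))\<^sup>2)) \<partial>lborel \<partial>lborel)"
    unfolding hx by (intro nn_integral_mono inner)
  also have "\<dots> = (\<integral>\<^sup>+p. ennreal ?M * (indicator cyl p * ennreal ((norm (g p))\<^sup>2)) \<partial>lborel)"
  proof -
    have "(\<lambda>p. ennreal ?M * (indicator cyl p * ennreal ((norm (g p))\<^sup>2))) \<in> borel_measurable (lborel \<Otimes>\<^sub>M lborel)"
      using g(1) by (simp add: lborel_prod)
    then show ?thesis
      using lborel.nn_integral_fst[of "\<lambda>p. ennreal ?M * (indicator cyl p * ennreal ((norm (g p))\<^sup>2))" lborel] by (simp add: lborel_prod)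
  qed
  also have "\<dots> = ennreal ?M * ennreal ((L2_norm cyl g)\<^sup>2)"
    using g by (subst nn_integral_cmult) (auto simp: nn_integral_lborel_L2[OF g(1) cyl_borel g(2)])
  also have "\<dots> < \<infinity>" by (simp flip: ennreal_mult)
  finally have fin: "(\<integral>\<^sup>+z. h z \<partial>lborel) < \<infinity>" .
  have "(\<integral>\<^sup>+z. ennreal ((norm (?V z))\<^sup>2) \<partial>lebesgue_on perf) = (\<integral>\<^sup>+z. ennreal ((norm (?V z))\<^sup>2) * indicator perf z \<partial>lebesgue)"
    by (rule nn_integral_restrict_space) simp
  also have "\<dots> = (\<integral>\<^sup>+z. ennreal ((norm (?V z))\<^sup>2) * indicator perf z \<partial>lborel)"
    by (rule nn_integral_completion)
  also have "\<dots> = (\<integral>\<^sup>+z. h z \<partial>lborel)"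
  proof (rule nn_integral_cong_AE)
    show "AE z in lborel. ennreal ((norm (?V z))\<^sup>2) * indicator perf z = h z"
      using AE_perf_iff[OF eq] by eventually_elim (auto simp: h_def B_def indicator_def)
  qed
  finally have "(\<integral>\<^sup>+z. ennreal ((norm (?V z))\<^sup>2) \<partial>lebesgue_on perf) < \<infinity>" using fin by simp
  moreover have "?V \<in> borel_measurable (lebesgue_on perf)"
  proof -
    have "?V \<in> borel_measurable lebesgue" using Vm by (intro measurable_completion) simp
    then show ?thesis by (rule measurable_restrict_space1)
  qed
  ultimately have "?V \<in> L2 perf" by (simp add: L2_iff_nn_integral)
  then show ?thesis by (simp add: case_prod_beta')
qed

text \<open>The corrector is assembled from Borel versions of the radius and of the macroscopic
  gradient, which makes it Borel on the product; the formula with the original functions then holds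
  almost everywhere.\<close>

lemma corr_in_L2_H1_per:
  assumes Gu: "(\<lambda>(t, x). Gu t x) \<in> L2 cyl"
  shows "\<exists>v Gv. in_L2_H1_per {0<..<T} \<Omega> r v Gv \<and>
    (AE p in lebesgue_on cyl. case p of (t, x) \<Rightarrow> Gv t x = corr_grad (r t x) (Gu t x))"
proof -
  obtain r' where r': "r' \<in> borel_measurable borel" "AE p in lebesgue_on cyl. (case p of (t, x) \<Rightarrow> r t x) = r' p"
    using ex_borel_radius by blast
  obtain g where g: "g \<in> borel_measurable borel" "AE p in lebesgue_on cyl. (case p of (t, x) \<Rightarrow> Gu t x) = g p"
    using ex_borel_version_lebesgue_on[OF cyl_sets L2_measurable[OF Gu]] by blast
  have gL: "g \<in> L2 cyl" by (rule L2_cong_AE[OF cyl_sets Gu g(2)])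
  define v where "v t x = corr (r' (t, x)) (g (t, x))" for t x
  define Gv where "Gv t x = corr_grad (r' (t, x)) (g (t, x))" for t x
  have "(\<lambda>(t, x, y). v t x y) \<in> L2 perf"
    using parametric_L2[OF W W_L2 W_bound g(1) gL r'] by (simp add: v_def corr_def)
  moreover have "(\<lambda>(t, x, y). Gv t x y) \<in> L2 perf"
    using parametric_L2[OF H H_L2 H_bound g(1) gL r'] by (simp add: Gv_def corr_grad_def)
  moreover have "AE p in lebesgue_on cyl. case p of (t, x) \<Rightarrow>
      v t x \<in> H1_per (r t x) \<and> has_weak_gradient (Y_star (r t x)) (v t x) (Gv t x)"
    using r'(2) r_le by eventually_elim (auto simp: v_def Gv_def corr_per)
  ultimately have "in_L2_H1_per {0<..<T} \<Omega> r v Gv"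
    unfolding in_L2_H1_per_def perf_def[symmetric] by simp
  moreover have "AE p in lebesgue_on cyl. case p of (t, x) \<Rightarrow> Gv t x = corr_grad (r t x) (Gu t x)"
    using r'(2) g(2) by eventually_elim (auto simp: Gv_def)
  ultimately show ?thesis by blast
qed

section \<open>From two-scale energy to homogenized flux and back\<close>

lemma homogenized_flux_L2:
  fixes Gu :: "real \<Rightarrow> real ^ 'n \<Rightarrow> real ^ 'n"
  assumes Gu: "(\<lambda>(t, x). Gu t x) \<in> L2 cyl"
  shows "(\<lambda>(t, x). D *\<^sub>R (A_hom (r t x) *v Gu t x)) \<in> L2 cyl"
proof -
  define Q where "Q i j b \<longleftrightarrow> b \<in> borel_measurable borel \<and> (\<forall>\<rho>\<le>R. A_hom \<rho> $ i $ j = b \<rho>)" for i j :: 'n and b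
  have "\<exists>b. Q i j b" for i j using A_hom_measurable[of i j] unfolding Q_def by blast
  then obtain a where "\<And>i j. Q i j (a i j)" by metis
  then have a: "\<And>i j. a i j \<in> borel_measurable borel" "\<And>i j \<rho>. \<rho> \<le> R \<Longrightarrow> A_hom \<rho> $ i $ j = a i j \<rho>"
    by (auto simp: Q_def)
  have gj: "(\<lambda>p. (case p of (t, x) \<Rightarrow> Gu t x) $ j) \<in> L2 cyl" for j
  proof (rule L2_bound)
    show "(\<lambda>p. (case p of (t, x) \<Rightarrow> Gu t x) $ j) \<in> borel_measurable (lebesgue_on cyl)"
      unfolding cart_eq_inner_axis using L2_measurable[OF Gu] by measurable
    show "integrable (lebesgue_on cyl) (\<lambda>p. (norm (case p of (t, x) \<Rightarrow> Gu t x))\<^sup>2)" by (rule L2_integrable_sq[OF Gu])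
    show "(norm ((case p of (t, x) \<Rightarrow> Gu t x) $ j))\<^sup>2 \<le> (norm (case p of (t, x) \<Rightarrow> Gu t x))\<^sup>2" for p
      by (intro power_mono Finite_Cartesian_Product.norm_nth_le) simp
  qed
  have am: "(\<lambda>p. a i j (case p of (t, x) \<Rightarrow> r t x)) \<in> borel_measurable (lebesgue_on cyl)" for i j
    using measurable_compose[OF r_measurable a(1)] .
  have ab: "AE p in lebesgue_on cyl. \<bar>a i j (case p of (t, x) \<Rightarrow> r t x)\<bar> \<le> 2" for i j
    using r_le
  proof eventually_elim
    case (elim p)
    obtain t x where p: "p = (t, x)" by (cases p)
    then show ?case using elim A_hom_bound[of "r t x" i j] by (simp add: a(2))
  qed
  \<comment> \<open>The flux is written as a sum of bounded measurable coefficients times square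
    integrable vector fields; the factor \<open>D\<close> is placed in the axis vector.\<close>
  have "(\<lambda>p. \<Sum>i\<in>UNIV. \<Sum>j\<in>UNIV. a i j (case p of (t, x) \<Rightarrow> r t x) *\<^sub>R ((case p of (t, x) \<Rightarrow> Gu t x) $ j *\<^sub>R (axis i D :: real ^ 'n))) \<in> L2 cyl"
  proof (intro L2_sum L2_mult_bounded[OF am ab])
    fix i j
    show "(\<lambda>p. (case p of (t, x) \<Rightarrow> Gu t x) $ j *\<^sub>R (axis i D :: real ^ 'n)) \<in> L2 cyl"
    proof (rule L2_bound)
      show "(\<lambda>p. (case p of (t, x) \<Rightarrow> Gu t x) $ j *\<^sub>R (axis i D :: real ^ 'n)) \<in> borel_measurable (lebesgue_on cyl)"
        using L2_measurable[OF gj[of j]] by measurable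
      show "integrable (lebesgue_on cyl) (\<lambda>p. (norm (axis i D :: real ^ 'n))\<^sup>2 * (norm ((case p of (t, x) \<Rightarrow> Gu t x) $ j))\<^sup>2)"
        by (intro integrable_mult_right L2_integrable_sq gj)
    qed (simp add: power_mult_distrib)
  qed
  moreover have "AE p in lebesgue_on cyl. (\<Sum>i\<in>UNIV. \<Sum>j\<in>UNIV. a i j (case p of (t, x) \<Rightarrow> r t x) *\<^sub>R ((case p of (t, x) \<Rightarrow> Gu t x) $ j *\<^sub>R (axis i D :: real ^ 'n)))
      = (case p of (t, x) \<Rightarrow> D *\<^sub>R (A_hom (r t x) *v Gu t x))"
    using r_le
  proof eventually_elim
    case (elim p)
    obtain t x where p: "p = (t, x)" by (cases p)
    have "(\<Sum>i\<in>UNIV. \<Sum>j\<in>UNIV. a i j (r t x) *\<^sub>R (Gu t x $ j *\<^sub>R (axis i D :: real ^ 'n))) = D *\<^sub>R (A_hom (r t x) *v Gu t x)"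
    proof -
      have "r t x \<le> R" using elim p by simp
      then have "(\<Sum>j\<in>UNIV. a i j (r t x) *\<^sub>R (Gu t x $ j *\<^sub>R (axis i D :: real ^ 'n)))
          = axis i (D * (\<Sum>j\<in>UNIV. A_hom (r t x) $ i $ j * Gu t x $ j))" for i
        by (auto simp: vec_eq_iff axis_def sum_distrib_left mult_ac a(2))
      moreover have "(\<Sum>i\<in>UNIV. axis i (c i)) = (\<chi> i. c i)" for c :: "'n \<Rightarrow> real"
        by (simp add: vec_eq_iff axis_def)
      ultimately show ?thesis by (simp add: vec_eq_iff matrix_vector_mult_def)
    qed
    then show ?case by (simp add: p)
  qed
  ultimately show ?thesis by (rule L2_cong_AE[OF cyl_sets])
qed

text \<open>Used in both directions: it applies to any function whose cell gradient is the corrector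
  gradient almost everywhere. The inner integral is evaluated slice by slice, and the product form
  follows from Fubini once the flux is square integrable.\<close>

lemma energy_eq:
  assumes Gu: "(\<lambda>(t, x). Gu t x) \<in> L2 cyl"
    and Gu1: "AE t in lebesgue_on {0<..<T}. AE x in lebesgue_on \<Omega>. AE y in lebesgue_on (Y_star (r t x)).
      Gu1 t x y = corr_grad (r t x) (Gu t x) y"
    and \<phi>: "in_L2_H1 {0<..<T} \<Omega> \<phi> G\<phi>" and \<phi>1: "in_L2_H1_per {0<..<T} \<Omega> r \<phi>1 G\<phi>1"
  shows "(LINT t|lebesgue_on {0<..<T}. LINT x|lebesgue_on \<Omega>. LINT y|lebesgue_on (Y_star (r t x)).
             D * ((Gu t x + Gu1 t x y) \<bullet> (G\<phi> t x + G\<phi>1 t x y)))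
    = L2_inner cyl (\<lambda>(t, x). D *\<^sub>R (A_hom (r t x) *v Gu t x)) (\<lambda>(t, x). G\<phi> t x)"
proof -
  have "AE p in lebesgue_on cyl. case p of (t, x) \<Rightarrow>
        \<phi>1 t x \<in> H1_per (r t x) \<and> has_weak_gradient (Y_star (r t x)) (\<phi>1 t x) (G\<phi>1 t x)"
    using \<phi>1 by (simp add: in_L2_H1_per_def)
  then have "AE p in lebesgue_on cyl. case p of (t, x) \<Rightarrow> r t x \<le> R \<and>
        \<phi>1 t x \<in> H1_per (r t x) \<and> has_weak_gradient (Y_star (r t x)) (\<phi>1 t x) (G\<phi>1 t x)"
    using r_le by eventually_elim auto
  from AE_cyl_slices[OF this] Gu1
  have "AE t in lebesgue_on {0<..<T}. (LINT x|lebesgue_on \<Omega>. LINT y|lebesgue_on (Y_star (r t x)).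
             D * ((Gu t x + Gu1 t x y) \<bullet> (G\<phi> t x + G\<phi>1 t x y)))
      = (LINT x|lebesgue_on \<Omega>. (D *\<^sub>R (A_hom (r t x) *v Gu t x)) \<bullet> G\<phi> t x)"
  proof eventually_elim
    case (elim t)
    have "AE x in lebesgue_on \<Omega>. (LINT y|lebesgue_on (Y_star (r t x)). D * ((Gu t x + Gu1 t x y) \<bullet> (G\<phi> t x + G\<phi>1 t x y)))
        = (D *\<^sub>R (A_hom (r t x) *v Gu t x)) \<bullet> G\<phi> t x"
      using elim
    proof eventually_elim
      case (elim x)
      have "(LINT y|lebesgue_on (Y_star (r t x)). D * ((Gu t x + Gu1 t x y) \<bullet> (G\<phi> t x + G\<phi>1 t x y)))
          = (LINT y|lebesgue_on (Y_star (r t x)). D * ((Gu t x + corr_grad (r t x) (Gu t x) y) \<bullet> (G\<phi> t x + G\<phi>1 t x y)))"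
        by (rule integral_lebesgue_on_cong_AE[OF Y_star_sets]) (use elim(2) in \<open>eventually_elim, simp\<close>)
      also have "\<dots> = (D *\<^sub>R (A_hom (r t x) *v Gu t x)) \<bullet> G\<phi> t x"
        using elim(1) by (intro cell_energy[of _ "\<phi>1 t x"]) auto
      finally show ?case .
    qed
    then show ?case by (rule integral_lebesgue_on_cong_AE[OF \<Omega>_sets])
  qed
  then have "(LINT t|lebesgue_on {0<..<T}. LINT x|lebesgue_on \<Omega>. LINT y|lebesgue_on (Y_star (r t x)).
             D * ((Gu t x + Gu1 t x y) \<bullet> (G\<phi> t x + G\<phi>1 t x y)))
      = (LINT t|lebesgue_on {0<..<T}. LINT x|lebesgue_on \<Omega>. (D *\<^sub>R (A_hom (r t x) *v Gu t x)) \<bullet> G\<phi> t x)"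
    by (rule integral_lebesgue_on_cong_AE[rotated]) simp
  also have "\<dots> = L2_inner cyl (\<lambda>(t, x). D *\<^sub>R (A_hom (r t x) *v Gu t x)) (\<lambda>(t, x). G\<phi> t x)"
    using Fubini_cyl[OF L2_integrable_inner[OF homogenized_flux_L2[OF Gu, of D], of "\<lambda>(t, x). G\<phi> t x"]] \<phi>
    by (simp add: in_L2_H1_def L2_inner_def)
  finally show ?thesis .
qed

text \<open>The difference between \<open>u1\<close> and the explicit corrector is itself an
  admissible test function. Orthogonality of the flux removes the corrector part, leaving
  \<open>D\<close> times the squared norm of the gradient difference.\<close>

lemma corrector_identification:
  assumes D: "0 < D" and Gu: "(\<lambda>(t, x). Gu t x) \<in> L2 cyl" and u1: "in_L2_H1_per {0<..<T} \<Omega> r u1 Gu1"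
    and eqn: "\<And>\<phi>1 G\<phi>1. in_L2_H1_per {0<..<T} \<Omega> r \<phi>1 G\<phi>1 \<Longrightarrow>
      (LINT t|lebesgue_on {0<..<T}. LINT x|lebesgue_on \<Omega>. LINT y|lebesgue_on (Y_star (r t x)).
             D * ((Gu t x + Gu1 t x y) \<bullet> G\<phi>1 t x y)) = 0"
  shows "AE t in lebesgue_on {0<..<T}. AE x in lebesgue_on \<Omega>. AE y in lebesgue_on (Y_star (r t x)).
      Gu1 t x y = corr_grad (r t x) (Gu t x) y"
proof -
  obtain v Gv where v: "in_L2_H1_per {0<..<T} \<Omega> r v Gv"
    and Gv: "AE p in lebesgue_on cyl. case p of (t, x) \<Rightarrow> Gv t x = corr_grad (r t x) (Gu t x)"
    using corr_in_L2_H1_per[OF Gu] by blast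
  \<comment> \<open>Admissible precisely because the explicit corrector is jointly measurable and
    square integrable over the perforated domain.\<close>
  define z where "z t x y = u1 t x y - v t x y" for t x y
  define Gz where "Gz t x y = Gu1 t x y - Gv t x y" for t x y
  have ae: "AE p in lebesgue_on cyl. case p of (t, x) \<Rightarrow>
        r t x \<le> R \<and> z t x \<in> H1_per (r t x) \<and> has_weak_gradient (Y_star (r t x)) (z t x) (Gz t x) \<and> Gv t x = corr_grad (r t x) (Gu t x)"
  proof -
    have "AE p in lebesgue_on cyl. case p of (t, x) \<Rightarrow>
        u1 t x \<in> H1_per (r t x) \<and> has_weak_gradient (Y_star (r t x)) (u1 t x) (Gu1 t x)"
      "AE p in lebesgue_on cyl. case p of (t, x) \<Rightarrow>
        v t x \<in> H1_per (r t x) \<and> has_weak_gradient (Y_star (r t x)) (v t x) (Gv t x)"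
      using u1 v by (simp_all add: in_L2_H1_per_def)
    then show ?thesis
      using Gv r_le
      by eventually_elim (auto simp: z_def[abs_def] Gz_def[abs_def]
          intro: H1_per_diff has_weak_gradient_diff[OF open_Y_star bounded_Y_star])
  qed
  have zL: "(\<lambda>(t, x, y). z t x y) \<in> L2 perf" "(\<lambda>(t, x, y). Gz t x y) \<in> L2 perf"
  proof -
    have L: "(\<lambda>(t, x, y). u1 t x y) \<in> L2 perf" "(\<lambda>(t, x, y). v t x y) \<in> L2 perf"
      "(\<lambda>(t, x, y). Gu1 t x y) \<in> L2 perf" "(\<lambda>(t, x, y). Gv t x y) \<in> L2 perf"
      using u1 v unfolding in_L2_H1_per_def perf_def[symmetric] by blast+
    from L2_diff[OF L(1,2)] L2_diff[OF L(3,4)] show "(\<lambda>(t, x, y). z t x y) \<in> L2 perf" "(\<lambda>(t, x, y). Gz t x y) \<in> L2 perf"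
      by (simp_all add: z_def Gz_def case_prod_beta')
  qed
  have zp: "in_L2_H1_per {0<..<T} \<Omega> r z Gz"
    unfolding in_L2_H1_per_def perf_def[symmetric] using zL ae by (auto elim: eventually_mono)
  have "AE t in lebesgue_on {0<..<T}. (LINT x|lebesgue_on \<Omega>. LINT y|lebesgue_on (Y_star (r t x)). D * ((Gu t x + Gu1 t x y) \<bullet> Gz t x y))
      = (LINT x|lebesgue_on \<Omega>. LINT y|lebesgue_on (Y_star (r t x)). D * (norm (Gz t x y))\<^sup>2)"
    using AE_cyl_slices[OF ae]
  proof eventually_elim
    case (elim t)
    then have "AE x in lebesgue_on \<Omega>. (LINT y|lebesgue_on (Y_star (r t x)). D * ((Gu t x + Gu1 t x y) \<bullet> Gz t x y))
        = (LINT y|lebesgue_on (Y_star (r t x)). D * (norm (Gz t x y))\<^sup>2)"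
    proof eventually_elim
      case (elim x)
      then have e: "r t x \<le> R" "z t x \<in> H1_per (r t x)" "has_weak_gradient (Y_star (r t x)) (z t x) (Gz t x)"
        "Gv t x = corr_grad (r t x) (Gu t x)" by auto
      let ?Y = "Y_star (r t x) :: (real ^ 'n) set" and ?F = "\<lambda>y. Gu t x + corr_grad (r t x) (Gu t x) y"
      have i: "integrable (lebesgue_on ?Y) (\<lambda>y. ?F y \<bullet> Gz t x y)" "integrable (lebesgue_on ?Y) (\<lambda>y. Gz t x y \<bullet> Gz t x y)"
        by (intro L2_integrable_inner flux_L2[OF e(1)] has_weak_gradient_L2(2)[OF e(3)])+
      have "(Gu t x + Gu1 t x y) \<bullet> Gz t x y = ?F y \<bullet> Gz t x y + Gz t x y \<bullet> Gz t x y" for y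
      proof -
        have "Gu t x + Gu1 t x y = ?F y + Gz t x y" by (simp add: Gz_def e(4))
        then show ?thesis by (simp only: inner_add_left[of "?F y"])
      qed
      then have "(LINT y|lebesgue_on ?Y. (Gu t x + Gu1 t x y) \<bullet> Gz t x y)
          = (LINT y|lebesgue_on ?Y. ?F y \<bullet> Gz t x y) + (LINT y|lebesgue_on ?Y. Gz t x y \<bullet> Gz t x y)"
        by (simp only: Bochner_Integration.integral_add[OF i])
      also have "(LINT y|lebesgue_on ?Y. ?F y \<bullet> Gz t x y) = 0"
        using flux_orthogonal[OF e(1-3)] by (simp add: L2_inner_def)
      finally show ?case by (simp add: power2_norm_eq_inner)
    qed
    then show ?case by (rule integral_lebesgue_on_cong_AE[OF \<Omega>_sets])
  qed
  then have "(LINT t|lebesgue_on {0<..<T}. LINT x|lebesgue_on \<Omega>. LINT y|lebesgue_on (Y_star (r t x)). D * (norm (Gz t x y))\<^sup>2)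
      = (LINT t|lebesgue_on {0<..<T}. LINT x|lebesgue_on \<Omega>. LINT y|lebesgue_on (Y_star (r t x)). D * ((Gu t x + Gu1 t x y) \<bullet> Gz t x y))"
    by (intro integral_lebesgue_on_cong_AE[symmetric]) simp_all
  also have "\<dots> = 0" by (rule eqn[OF zp])
  finally have "0 = (LINT t|lebesgue_on {0<..<T}. LINT x|lebesgue_on \<Omega>. LINT y|lebesgue_on (Y_star (r t x)). D * (norm (Gz t x y))\<^sup>2)" by simp
  \<comment> \<open>Only as an integral over the product domain does the vanishing of this
    expression give a vanishing integrand almost everywhere.\<close>
  also have "\<dots> = (LINT p|lebesgue_on perf. D * (norm (case p of (t, x, y) \<Rightarrow> Gz t x y))\<^sup>2)"
    using Fubini_perf[OF integrable_mult_right[OF L2_integrable_sq[OF zL(2)], of D]] by simp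
  also have "\<dots> = D * (L2_norm perf (\<lambda>(t, x, y). Gz t x y))\<^sup>2" by (simp add: L2_norm_power2)
  finally have "L2_norm perf (\<lambda>(t, x, y). Gz t x y) = 0" using D by simp
  then have "AE p in lebesgue_on perf. (case p of (t, x, y) \<Rightarrow> Gz t x y) = 0"
    by (rule L2_norm_0_imp_AE[OF zL(2)])
  from AE_perf_slices[OF this] AE_cyl_slices[OF ae] show ?thesis
  proof eventually_elim
    case (elim t)
    then show ?case
    proof eventually_elim
      case (elim x)
      then have "Gv t x = corr_grad (r t x) (Gu t x)" by auto
      from elim(1) show ?case by eventually_elim (use \<open>Gv t x = _\<close> in \<open>simp add: Gz_def\<close>)
    qed
  qed
qed

end

section \<open>Data of the macroscopic problem\<close>

lemma ball_volume_mono: "mono (ball_volume TYPE('n::finite))"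
  unfolding ball_volume_def by (intro monoI measure_mono_fmeasurable) auto

lemma ball_volume_nonneg: "0 \<le> ball_volume TYPE('n::finite) \<rho>"
  by (simp add: ball_volume_def)

lemma finite_cell_indices:
  fixes \<Omega> :: "(real ^ 'n) set"
  assumes e: "0 < e" and b: "bounded \<Omega>"
  shows "finite (cell_indices e \<Omega>)"
proof -
  obtain B where B: "\<And>x. x \<in> \<Omega> \<Longrightarrow> norm x \<le> B" using b by (auto simp: bounded_iff)
  \<comment> \<open>The offset inside a cell lies between 0 and 1, so an index can exceed the scaled
    bound by less than 1.\<close>
  define N where "N = \<lceil>B / e\<rceil> + 1"
  have "k $ i \<in> {- N..N}" if k: "k \<in> cell_indices e \<Omega>" for k i
  proof -
    obtain y where y: "y \<in> cell_Y" "e *\<^sub>R (\<chi> i. real_of_int (k $ i)) + e *\<^sub>R y \<in> \<Omega>"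
      using k by (auto simp: cell_indices_def scaled_cell_def)
    have "\<bar>e * (real_of_int (k $ i) + y $ i)\<bar> \<le> B"
      using component_le_norm_cart[of "e *\<^sub>R (\<chi> i. real_of_int (k $ i)) + e *\<^sub>R y" i] B[OF y(2)]
      by (simp add: distrib_left)
    then have "\<bar>real_of_int (k $ i) + y $ i\<bar> \<le> B / e"
      using e by (simp add: abs_mult pos_le_divide_eq mult.commute)
    moreover have "0 < y $ i" "y $ i < 1" using y(1) by (auto simp: mem_cell_Y)
    moreover have "B / e \<le> real_of_int \<lceil>B / e\<rceil>" by (rule le_of_int_ceiling)
    moreover have "real_of_int N = real_of_int \<lceil>B / e\<rceil> + 1" by (simp add: N_def)
    ultimately have "real_of_int (k $ i) \<le> real_of_int N" "- real_of_int N \<le> real_of_int (k $ i)"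
      by linarith+
    then have "real_of_int (k $ i) \<le> real_of_int N" "real_of_int (- N) \<le> real_of_int (k $ i)"
      by simp_all
    then show ?thesis by (simp only: of_int_le_iff atLeastAtMost_iff)
  qed
  then have "(\<lambda>k. \<lambda>i. k $ i) ` cell_indices e \<Omega> \<subseteq> (UNIV \<rightarrow>\<^sub>E {- N..N})" by (auto simp: PiE_def)
  then have "finite ((\<lambda>k. \<lambda>i. k $ i) ` cell_indices e \<Omega>)"
    by (rule finite_subset) (intro finite_PiE finite finite_atLeastAtMost_int)
  moreover have "inj_on (\<lambda>k. \<lambda>i. k $ i) (cell_indices e \<Omega>)"
    by (auto simp: inj_on_def vec_eq_iff fun_eq_iff)
  ultimately show ?thesis by (rule finite_imageD)
qed

lemma scaled_cell_image: "scaled_cell e k A = (+) (e *\<^sub>R (\<chi> i. real_of_int (k $ i))) ` (\<lambda>y. e *\<^sub>R y) ` A"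
  by (auto simp: scaled_cell_def image_image)

lemma open_scaled_cell: "0 < e \<Longrightarrow> open (scaled_cell e k (cell_Y :: (real ^ 'n) set))"
  unfolding scaled_cell_image by (intro open_translation open_scaling open_cell_Y) simp

text \<open>The closed cells cover the domain; the finitely many cell boundaries are
  negligible.\<close>

lemma AE_in_scaled_cells:
  fixes \<Omega> :: "(real ^ 'n) set"
  assumes e: "0 < e" and b: "bounded \<Omega>"
    and \<Omega>: "\<Omega> \<subseteq> (\<Union>k\<in>cell_indices e \<Omega>. scaled_cell e k (closure cell_Y))"
  shows "AE x in lebesgue. x \<in> \<Omega> \<longrightarrow> (\<exists>k\<in>cell_indices e \<Omega>. x \<in> scaled_cell e k cell_Y)"
proof -
  have null: "AE x in lebesgue. x \<notin> scaled_cell e k (closure cell_Y - cell_Y :: (real ^ 'n) set)" for k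
  proof -
    have cl: "closure (cell_Y :: (real ^ 'n) set) = cbox 0 1"
      unfolding cell_Y_def by (rule closure_box) (auto simp: box_eq_empty Basis_vec_def inner_axis)
    have "negligible (closure cell_Y - cell_Y :: (real ^ 'n) set)"
      unfolding cl unfolding cell_Y_def by (rule negligible_frontier_interval)
    then have "negligible (scaled_cell e k (closure cell_Y - cell_Y :: (real ^ 'n) set))"
      unfolding scaled_cell_def
      by (intro negligible_differentiable_image_negligible order_refl linear_imp_differentiable_on
          differentiable_on_add differentiable_on_const linear_scaleR)
    then show ?thesis by (intro AE_not_in) (simp add: negligible_iff_null_sets)
  qed
  have "AE x in lebesgue. \<forall>k\<in>cell_indices e \<Omega>. x \<notin> scaled_cell e k (closure cell_Y - cell_Y)"
    using null by (subst AE_ball_countable[OF countable_finite[OF finite_cell_indices[OF e b]]]) blast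
  then show ?thesis
  proof eventually_elim
    case (elim x)
    show ?case
    proof
      assume "x \<in> \<Omega>"
      then obtain k y where k: "k \<in> cell_indices e \<Omega>" and y: "y \<in> closure cell_Y" "x = e *\<^sub>R (\<chi> i. real_of_int (k $ i)) + e *\<^sub>R y"
        using \<Omega> unfolding scaled_cell_def by blast
      have "y \<in> cell_Y"
      proof (rule ccontr)
        assume "y \<notin> cell_Y"
        then have "x \<in> scaled_cell e k (closure cell_Y - cell_Y)" unfolding scaled_cell_def using y by blast
        then show False using elim k by blast
      qed
      then show "\<exists>k\<in>cell_indices e \<Omega>. x \<in> scaled_cell e k cell_Y"
        unfolding scaled_cell_def using y(2) k by blast
    qed
  qed
qed

lemma lipschitz_bounded:
  fixes g :: "'a::metric_space \<Rightarrow> real"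
  assumes "L-lipschitz_on X g" "bounded X"
  shows "\<exists>B. \<forall>x\<in>X. \<bar>g x\<bar> \<le> B"
proof -
  obtain d where d: "\<And>x y. x \<in> X \<Longrightarrow> y \<in> X \<Longrightarrow> dist x y \<le> d"
    using assms(2) by (auto simp: bounded_two_points)
  show ?thesis
  proof (cases "X = {}")
    case False
    then obtain a where a: "a \<in> X" by blast
    have "\<bar>g x\<bar> \<le> \<bar>g a\<bar> + L * d" if x: "x \<in> X" for x
    proof -
      have "dist (g x) (g a) \<le> L * dist x a" using assms(1) x a by (rule lipschitz_onD)
      also have "\<dots> \<le> L * d" using d[OF x a] lipschitz_on_nonneg[OF assms(1)] by (rule mult_left_mono)
      finally show ?thesis by (simp add: dist_real_def)
    qed
    then show ?thesis by blast
  qed simp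
qed

lemma AE_lebesgue_triple_snd:
  fixes P :: "'b::euclidean_space \<Rightarrow> bool"
  assumes "AE x in lebesgue. P x"
  shows "AE p in (lebesgue :: ('a::euclidean_space \<times> 'b) measure). P (snd p)"
proof -
  obtain N where N: "{x \<in> space lborel. \<not> P x} \<subseteq> N" "emeasure lborel N = 0" "N \<in> sets lborel"
    using assms[unfolded AE_completion_iff] by (rule AE_E)
  have Nm [measurable]: "N \<in> sets borel" using N(3) by simp
  have "AE p in (lborel :: 'a measure) \<Otimes>\<^sub>M (lborel :: 'b measure). snd p \<notin> N"
  proof (rule lborel_pair.AE_pair_measure)
    show "{p \<in> space ((lborel :: 'a measure) \<Otimes>\<^sub>M (lborel :: 'b measure)). snd p \<notin> N} \<in> sets (lborel \<Otimes>\<^sub>M lborel)"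
      by measurable
    have "AE y in lborel. y \<notin> N" using N by (intro AE_not_in) (simp add: null_sets_def)
    then show "AE x in (lborel :: 'a measure). AE y in lborel. snd (x, y) \<notin> N" by simp
  qed
  then have "AE p in (lborel :: ('a \<times> 'b) measure). snd p \<notin> N" by (simp only: lborel_prod)
  then have "AE p in (lborel :: ('a \<times> 'b) measure). P (snd p)"
    by eventually_elim (use N(1) in auto)
  then show ?thesis by (rule AE_completion)
qed

text \<open>The source is Lipschitz cell by cell and may jump across faces. Finitely many bounded
  cells give a global bound, and outside the null set of faces it is continuous on an open
  set.\<close>

lemma fp_L2:
  fixes \<Omega> :: "(real ^ 'n) set" and fp :: "real \<Rightarrow> real ^ 'n \<Rightarrow> real"
  assumes e: "0 < e" and o: "open \<Omega>" and b: "bounded \<Omega>"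
    and \<Omega>: "\<Omega> \<subseteq> (\<Union>k\<in>cell_indices e \<Omega>. scaled_cell e k (closure cell_Y))"
    and lip: "\<And>k. k \<in> cell_indices e \<Omega> \<Longrightarrow> \<exists>L. L-lipschitz_on ({0<..<T} \<times> scaled_cell e k cell_Y) (\<lambda>(t, x). fp t x)"
  shows "\<exists>B. AE p in lebesgue_on ({0<..<T} \<times> \<Omega>). \<bar>case p of (t, x) \<Rightarrow> fp t x\<bar> \<le> B"
    and "(\<lambda>(t, x). fp t x) \<in> borel_measurable (lebesgue_on ({0<..<T} \<times> \<Omega>))"
proof -
  let ?I = "cell_indices e \<Omega>" and ?Q = "{0<..<T} \<times> \<Omega>"
  let ?X = "\<lambda>k. {0<..<T} \<times> scaled_cell e k (cell_Y :: (real ^ 'n) set)"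
  have fin: "finite ?I" by (rule finite_cell_indices[OF e b])
  have Q: "?Q \<in> sets lebesgue"
    by (intro sets_completionI_sets) (use o in \<open>simp add: borel_open open_Times\<close>)
  have X: "open (?X k)" for k by (intro open_Times open_scaled_cell[OF e]) simp
  have Xs: "?X k \<in> sets borel" for k using X by (rule borel_open)
  have cov: "AE p in lebesgue. p \<in> ?Q \<longrightarrow> (\<exists>k\<in>?I. p \<in> ?X k)"
    using AE_lebesgue_triple_snd[OF AE_in_scaled_cells[OF e b \<Omega>], where 'a = real]
    by eventually_elim auto
  have "\<forall>k\<in>?I. \<exists>B. \<forall>p\<in>?X k. \<bar>case p of (t, x) \<Rightarrow> fp t x\<bar> \<le> B"
  proof
    fix k assume "k \<in> ?I"
    then obtain L where L: "L-lipschitz_on (?X k) (\<lambda>(t, x). fp t x)" using lip by blast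
    have "bounded (scaled_cell e k (cell_Y :: (real ^ 'n) set))"
      unfolding scaled_cell_image by (intro bounded_translation bounded_scaling bounded_cell_Y)
    then have "bounded (?X k)" by (intro bounded_Times) auto
    with L show "\<exists>B. \<forall>p\<in>?X k. \<bar>case p of (t, x) \<Rightarrow> fp t x\<bar> \<le> B" by (rule lipschitz_bounded)
  qed
  then obtain B where B: "\<And>k p. k \<in> ?I \<Longrightarrow> p \<in> ?X k \<Longrightarrow> \<bar>case p of (t, x) \<Rightarrow> fp t x\<bar> \<le> B k" by metis
  \<comment> \<open>The sum of absolute values dominates the bound on each of the finitely many
    cells.\<close>
  define M where "M = (\<Sum>k\<in>?I. \<bar>B k\<bar>)"
  have "AE p in lebesgue. p \<in> ?Q \<longrightarrow> \<bar>case p of (t, x) \<Rightarrow> fp t x\<bar> \<le> M"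
    using cov
  proof eventually_elim
    case (elim p)
    show ?case
    proof
      assume "p \<in> ?Q"
      then obtain k where k: "k \<in> ?I" "p \<in> ?X k" using elim by blast
      have "\<bar>case p of (t, x) \<Rightarrow> fp t x\<bar> \<le> \<bar>B k\<bar>" using B[OF k] by linarith
      also have "\<dots> \<le> M" unfolding M_def by (rule member_le_sum[OF k(1)]) (use fin in auto)
      finally show "\<bar>case p of (t, x) \<Rightarrow> fp t x\<bar> \<le> M" .
    qed
  qed
  then show "\<exists>B. AE p in lebesgue_on ?Q. \<bar>case p of (t, x) \<Rightarrow> fp t x\<bar> \<le> B"
    using Q by (auto simp: AE_restrict_space_iff)
  define Z where "Z = (\<Union>k\<in>?I. ?X k)"
  have Zs: "Z \<in> sets borel" unfolding Z_def using Xs fin by (intro sets.finite_UN) auto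
  \<comment> \<open>Continuity on each of several open sets glues to their union, so the individual
    Lipschitz constants need not match.\<close>
  have "continuous_on Z (\<lambda>(t, x). fp t x)"
    unfolding Z_def
  proof (rule continuous_on_open_UN)
    show "open (?X k)" for k by (rule X)
    show "continuous_on (?X k) (\<lambda>(t, x). fp t x)" if "k \<in> ?I" for k
      using lip[OF that] lipschitz_on_continuous_on by blast
  qed
  then have "(\<lambda>p. indicator Z p *\<^sub>R (case p of (t, x) \<Rightarrow> fp t x)) \<in> borel_measurable borel"
    using Zs by (intro borel_measurable_continuous_on_indicator) auto
  then have "(\<lambda>p. indicator Z p *\<^sub>R (case p of (t, x) \<Rightarrow> fp t x)) \<in> borel_measurable lebesgue"
    by (intro measurable_completion) simp
  then have m: "(\<lambda>p. indicator Z p *\<^sub>R (case p of (t, x) \<Rightarrow> fp t x)) \<in> borel_measurable (lebesgue_on ?Q)"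
    by (rule measurable_restrict_space1)
  have "AE p in lebesgue. p \<in> ?Q \<longrightarrow> indicator Z p *\<^sub>R (case p of (t, x) \<Rightarrow> fp t x) = (case p of (t, x) \<Rightarrow> fp t x)"
    using cov by eventually_elim (auto simp: Z_def indicator_def)
  then have "AE p in lebesgue_on ?Q. indicator Z p *\<^sub>R (case p of (t, x) \<Rightarrow> fp t x) = (case p of (t, x) \<Rightarrow> fp t x)"
    using Q by (simp add: AE_restrict_space_iff)
  with Q m show "(\<lambda>(t, x). fp t x) \<in> borel_measurable (lebesgue_on ?Q)"
    by (rule borel_measurable_lebesgue_on_cong_AE)
qed

text \<open>Square integrability of the right-hand side is what allows its iterated integral against
  a test function to be read as an \<open>L2\<close> product on the cylinder.\<close>

lemma source_L2:
  fixes \<Omega> :: "(real ^ 'n) set" and fp r dV :: "real \<Rightarrow> real ^ 'n \<Rightarrow> real"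
  assumes \<Omega>: "open \<Omega>" "bounded \<Omega>"
    and fp: "\<exists>B. AE p in lebesgue_on ({0<..<T} \<times> \<Omega>). \<bar>case p of (t, x) \<Rightarrow> fp t x\<bar> \<le> B"
      "(\<lambda>(t, x). fp t x) \<in> borel_measurable (lebesgue_on ({0<..<T} \<times> \<Omega>))"
    and r: "(\<lambda>(t, x). r t x) \<in> borel_measurable (lebesgue_on ({0<..<T} \<times> \<Omega>))"
      "AE p in lebesgue_on ({0<..<T} \<times> \<Omega>). case p of (t, x) \<Rightarrow> r t x \<le> R"
    and dV: "(\<lambda>(t, x). dV t x) \<in> L2 ({0<..<T} \<times> \<Omega>)"
  shows "(\<lambda>(t, x). (1 - ball_volume TYPE('n) (r t x)) * fp t x - dV t x * cs) \<in> L2 ({0<..<T} \<times> \<Omega>)"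
proof -
  let ?Q = "{0<..<T} \<times> \<Omega>"
  have Q: "?Q \<in> sets lebesgue"
    by (intro sets_completionI_sets) (use \<Omega> in \<open>simp add: borel_open open_Times\<close>)
  have Ql: "?Q \<in> lmeasurable"
    using \<Omega> by (intro bounded_set_imp_lmeasurable bounded_Times Q) auto
  obtain B where B: "AE p in lebesgue_on ?Q. \<bar>case p of (t, x) \<Rightarrow> fp t x\<bar> \<le> B" using fp(1) by blast
  have fL: "(\<lambda>(t, x). fp t x) \<in> L2 ?Q" by (rule L2_bounded[OF Ql fp(2)]) (use B in simp)
  have "ball_volume TYPE('n) \<in> borel_measurable borel" by (rule borel_measurable_mono[OF ball_volume_mono])
  from measurable_compose[OF r(1) this]
  have m: "(\<lambda>p. 1 - ball_volume TYPE('n) (case p of (t, x) \<Rightarrow> r t x)) \<in> borel_measurable (lebesgue_on ?Q)"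
    by (intro borel_measurable_diff) auto
  have bd: "AE p in lebesgue_on ?Q. \<bar>1 - ball_volume TYPE('n) (case p of (t, x) \<Rightarrow> r t x)\<bar> \<le> 1 + ball_volume TYPE('n) R"
    using r(2)
  proof eventually_elim
    case (elim p)
    then have "ball_volume TYPE('n) (case p of (t, x) \<Rightarrow> r t x) \<le> ball_volume TYPE('n) R"
      by (intro monoD[OF ball_volume_mono]) auto
    moreover have "0 \<le> ball_volume TYPE('n) (case p of (t, x) \<Rightarrow> r t x)" by (rule ball_volume_nonneg)
    ultimately show ?case by linarith
  qed
  have "(\<lambda>p. (1 - ball_volume TYPE('n) (case p of (t, x) \<Rightarrow> r t x)) *\<^sub>R (case p of (t, x) \<Rightarrow> fp t x) - cs * (case p of (t, x) \<Rightarrow> dV t x)) \<in> L2 ?Q"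
    by (intro L2_diff L2_mult_bounded[OF m bd fL] L2_cmult dV)
  then show ?thesis by (simp add: case_prod_beta' mult.commute)
qed

theorem theorem5p2:
  fixes \<Omega> :: "(real ^ 'n) set"
    and eps :: "nat \<Rightarrow> real"
    and T rmin rmax cs D Cf :: real
    and f :: "real \<Rightarrow> real \<Rightarrow> real"
    and fp :: "real \<Rightarrow> real ^ 'n \<Rightarrow> real"
    and uini rini :: "real ^ 'n \<Rightarrow> real"
    and u0 r :: "real \<Rightarrow> real ^ 'n \<Rightarrow> real"
    and u1 :: "real \<Rightarrow> real ^ 'n \<Rightarrow> real ^ 'n \<Rightarrow> real"
  assumes "CARD('n) \<ge> 2"
    and "0 < T"
    and "\<And>m. 0 < eps m \<and> eps m \<le> 1" and "eps \<longlonglongrightarrow> 0"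
    and "open \<Omega>" and "bounded \<Omega>"
    and "\<And>m. \<Omega> = interior (\<Union>k\<in>cell_indices (eps m) \<Omega>. scaled_cell (eps m) k (closure cell_Y))"
    and "0 < rmin" and "rmin < rmax" and "rmax < 1/2"
    and "0 < cs" and "0 < D"
    and "\<And>u \<rho>. \<rho> \<le> rmin \<Longrightarrow> 0 \<le> f u \<rho>"
    and "\<And>u \<rho>. rmax \<le> \<rho> \<Longrightarrow> f u \<rho> \<le> 0"
    and "\<exists>C. \<forall>v w \<rho> \<sigma>. \<bar>f w \<sigma> - f v \<rho>\<bar> \<le> C * (\<bar>w - v\<bar> + \<bar>\<sigma> - \<rho>\<bar>)"
    and "\<And>u \<rho>. \<bar>f u \<rho>\<bar> \<le> Cf"
    and "\<And>m k. k \<in> cell_indices (eps m) \<Omega> \<Longrightarrow>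
           \<exists>L. L-lipschitz_on ({0<..<T} \<times> scaled_cell (eps m) k cell_Y) (\<lambda>(t, x). fp t x)"
    and "uini \<in> L2 \<Omega>" and "rini \<in> L2 \<Omega>"
    and "AE x in lebesgue_on \<Omega>. rini x \<in> {rmin..rmax}"
    and "unique_solution_two_scale T \<Omega> rmin rmax cs D f fp uini rini u0 u1 r"
  shows "(\<forall>\<rho>\<in>{rmin..rmax}. \<forall>j::'n.
            (\<exists>w. solves_cell \<rho> j w) \<and>
            (\<forall>v w. solves_cell \<rho> j v \<longrightarrow> solves_cell \<rho> j w \<longrightarrow> eq_mod_const \<rho> v w)) \<and>
         unique_solution_homogenized T \<Omega> rmin rmax cs D f fp uini rini u0 r"
proof (intro conjI)
  \<comment> \<open>All admissible radii are at most \<open>rmax\<close>, so this single reference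
    set and constant serve for every cell.\<close>
  obtain C and S :: "(real ^ 'n) set" where "periodic_Poincare rmax C S"
    using ex_periodic_Poincare[OF assms(1,10)] by blast
  then interpret periodic_Poincare rmax C S .
  obtain W H where "correctors rmax C S W H"
    using ex_correctors by blast
  then interpret correctors rmax C S W H .
  have "solves_cell \<rho> j v \<longrightarrow> solves_cell \<rho> j w \<longrightarrow> eq_mod_const \<rho> v w" if "\<rho> \<in> {rmin..rmax}" for \<rho> v w and j :: 'n
  proof (intro impI)
    assume "solves_cell \<rho> j v" "solves_cell \<rho> j w"
    note c = this[THEN solves_cell_imp_corrector]
    from that have "\<rho> \<le> rmax" by simp
    then show "eq_mod_const \<rho> v w"
      by (rule eq_mod_const_if_gradient_eq[OF _ _ _ _ _ corrector_gradient_unique[OF c]])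
        (use c in \<open>auto simp: corrector_def\<close>)
  qed
  moreover have "\<exists>w. solves_cell \<rho> j w" if "\<rho> \<in> {rmin..rmax}" for \<rho> and j :: 'n
    using corrector_imp_solves_cell[OF corrector] that by (meson atLeastAtMost_iff)
  ultimately show "\<forall>\<rho>\<in>{rmin..rmax}. \<forall>j::'n. (\<exists>w. solves_cell \<rho> j w) \<and>
      (\<forall>v w. solves_cell \<rho> j v \<longrightarrow> solves_cell \<rho> j w \<longrightarrow> eq_mod_const \<rho> v w)"
    by blast
  let ?V = "ball_volume TYPE('n)"
  have \<Omega>: "\<Omega> \<subseteq> (\<Union>k\<in>cell_indices (eps 0) \<Omega>. scaled_cell (eps 0) k (closure cell_Y))"
    using assms(7)[of 0] interior_subset by blast
  have e0: "0 < eps 0" using assms(3) by simp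
  note fp = fp_L2[OF e0 assms(5,6) \<Omega> assms(17)]
  \<comment> \<open>Stated for arbitrary solutions rather than the given one: uniqueness concerns
    competitors with their own radius function and hence their own perforated domain.\<close>
  have cylinder: "perforated_cylinder rmax C S W H T \<Omega> s"
    if "limit_class T \<Omega> rmin rmax uini rini v0 s Gu dr dV l" for v0 s Gu dr dV l
  proof
    show "(\<lambda>(t, x). s t x) \<in> borel_measurable (lebesgue_on ({0<..<T} \<times> \<Omega>))"
      using that unfolding limit_class_def in_W1inf_L2_def has_weak_dt_def by (blast intro: L2_measurable)
    have "AE p in lebesgue_on ({0<..<T} \<times> \<Omega>). case p of (t, x) \<Rightarrow> s t x \<in> {rmin..rmax}"
      using that by (simp add: limit_class_def)
    then show "AE p in lebesgue_on ({0<..<T} \<times> \<Omega>). case p of (t, x) \<Rightarrow> s t x \<le> rmax"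
      by eventually_elim auto
  qed (rule assms(5))
  \<comment> \<open>The two problems write the source term differently, once as an iterated integral
    and once as a scalar product on the cylinder.\<close>
  have rhs: "(LINT t|lebesgue_on {0<..<T}. LINT x|lebesgue_on \<Omega>. ((1 - ?V (s t x)) * fp t x - dV t x * cs) * \<phi> t x)
      = L2_inner ({0<..<T} \<times> \<Omega>) (\<lambda>(t, x). (1 - ?V (s t x)) * fp t x - dV t x * cs) (\<lambda>(t, x). \<phi> t x)"
    if lc: "limit_class T \<Omega> rmin rmax uini rini v0 s Gu dr dV l" and \<phi>: "in_L2_H1 {0<..<T} \<Omega> \<phi> G\<phi>"
    for v0 s Gu dr dV l \<phi> G\<phi>
  proof -
    interpret perforated_cylinder rmax C S W H T \<Omega> s by (rule cylinder[OF lc])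
    have dV: "(\<lambda>(t, x). dV t x) \<in> L2 cyl" and \<phi>L: "(\<lambda>(t, x). \<phi> t x) \<in> L2 cyl"
      using lc \<phi> by (auto simp: limit_class_def has_weak_dt_def in_L2_H1_def)
    note F = source_L2[OF assms(5,6) fp r_measurable r_le dV, of cs]
    show ?thesis
      using Fubini_cyl[OF L2_integrable_mult[OF F \<phi>L]] by (simp add: L2_inner_def case_prod_beta')
  qed
  have Gu_L2: "(\<lambda>(t, x). Gu t x) \<in> L2 ({0<..<T} \<times> \<Omega>)"
    if "limit_class T \<Omega> rmin rmax uini rini v0 s Gu dr dV l" for v0 s Gu dr dV l
    using that by (simp add: limit_class_def in_L2_H1_def)
  \<comment> \<open>The corrector is reconstructed from the homogenized solution; the time
    derivatives, initial values and radius equation carry over unchanged.\<close>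
  have to_two_scale: "\<exists>v1. solves_two_scale T \<Omega> rmin rmax cs D f fp uini rini v0 v1 s"
    if h: "solves_homogenized T \<Omega> rmin rmax cs D f fp uini rini v0 s" for v0 s
  proof -
    obtain Gu dr dV l where lc: "limit_class T \<Omega> rmin rmax uini rini v0 s Gu dr dV l"
      and eq: "\<And>\<phi> G\<phi>. in_L2_H1 {0<..<T} \<Omega> \<phi> G\<phi> \<Longrightarrow> (LINT t|lebesgue_on {0<..<T}. l t (\<phi> t))
        + L2_inner ({0<..<T} \<times> \<Omega>) (\<lambda>(t, x). D *\<^sub>R (A_hom (s t x) *v Gu t x)) (\<lambda>(t, x). G\<phi> t x)
        = L2_inner ({0<..<T} \<times> \<Omega>) (\<lambda>(t, x). (1 - ?V (s t x)) * fp t x - dV t x * cs) (\<lambda>(t, x). \<phi> t x)"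
      and ode: "\<forall>\<theta>. (\<lambda>(t, x). \<theta> t x) \<in> L2 ({0<..<T} \<times> \<Omega>) \<longrightarrow>
        (LINT t|lebesgue_on {0<..<T}. LINT x|lebesgue_on \<Omega>. dr t x * \<theta> t x)
        = (LINT t|lebesgue_on {0<..<T}. LINT x|lebesgue_on \<Omega>. 1 / cs * f (v0 t x) (s t x) * \<theta> t x)"
      using h unfolding solves_homogenized_def by blast
    interpret perforated_cylinder rmax C S W H T \<Omega> s by (rule cylinder[OF lc])
    obtain v1 Gv1 where v1: "in_L2_H1_per {0<..<T} \<Omega> s v1 Gv1"
      and Gv1: "AE p in lebesgue_on cyl. case p of (t, x) \<Rightarrow> Gv1 t x = corr_grad (s t x) (Gu t x)"
      using corr_in_L2_H1_per[OF Gu_L2[OF lc]] by blast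
    have id: "AE t in lebesgue_on {0<..<T}. AE x in lebesgue_on \<Omega>. AE y in lebesgue_on (Y_star (s t x)).
        Gv1 t x y = corr_grad (s t x) (Gu t x) y"
      using AE_cyl_slices[OF Gv1]
    proof eventually_elim
      case (elim t)
      then show ?case by eventually_elim simp
    qed
    have "(LINT t|lebesgue_on {0<..<T}. l t (\<phi> t))
        + (LINT t|lebesgue_on {0<..<T}. LINT x|lebesgue_on \<Omega>. LINT y|lebesgue_on (Y_star (s t x)).
             D * ((Gu t x + Gv1 t x y) \<bullet> (G\<phi> t x + G\<phi>1 t x y)))
        = (LINT t|lebesgue_on {0<..<T}. LINT x|lebesgue_on \<Omega>. ((1 - ?V (s t x)) * fp t x - dV t x * cs) * \<phi> t x)"
      if "in_L2_H1 {0<..<T} \<Omega> \<phi> G\<phi>" "in_L2_H1_per {0<..<T} \<Omega> s \<phi>1 G\<phi>1" for \<phi> G\<phi> \<phi>1 G\<phi>1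
      unfolding energy_eq[OF Gu_L2[OF lc] id that] rhs[OF lc that(1)] by (rule eq[OF that(1)])
    then show ?thesis
      unfolding solves_two_scale_def using lc v1 ode by blast
  qed
  note sol = assms(21)[unfolded unique_solution_two_scale_def]
  have "solves_homogenized T \<Omega> rmin rmax cs D f fp uini rini u0 r"
  proof -
    have "solves_two_scale T \<Omega> rmin rmax cs D f fp uini rini u0 u1 r" using sol by blast
    then obtain Gu Gu1 dr dV l where lc: "limit_class T \<Omega> rmin rmax uini rini u0 r Gu dr dV l"
      and u1: "in_L2_H1_per {0<..<T} \<Omega> r u1 Gu1"
      and eq: "\<And>\<phi> G\<phi> \<phi>1 G\<phi>1. in_L2_H1 {0<..<T} \<Omega> \<phi> G\<phi> \<Longrightarrow> in_L2_H1_per {0<..<T} \<Omega> r \<phi>1 G\<phi>1 \<Longrightarrow>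
        (LINT t|lebesgue_on {0<..<T}. l t (\<phi> t))
        + (LINT t|lebesgue_on {0<..<T}. LINT x|lebesgue_on \<Omega>. LINT y|lebesgue_on (Y_star (r t x)).
             D * ((Gu t x + Gu1 t x y) \<bullet> (G\<phi> t x + G\<phi>1 t x y)))
        = (LINT t|lebesgue_on {0<..<T}. LINT x|lebesgue_on \<Omega>. ((1 - ?V (r t x)) * fp t x - dV t x * cs) * \<phi> t x)"
      and ode: "\<forall>\<theta>. (\<lambda>(t, x). \<theta> t x) \<in> L2 ({0<..<T} \<times> \<Omega>) \<longrightarrow>
        (LINT t|lebesgue_on {0<..<T}. LINT x|lebesgue_on \<Omega>. dr t x * \<theta> t x)
        = (LINT t|lebesgue_on {0<..<T}. LINT x|lebesgue_on \<Omega>. 1 / cs * f (u0 t x) (r t x) * \<theta> t x)"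
      unfolding solves_two_scale_def by blast
    interpret perforated_cylinder rmax C S W H T \<Omega> r by (rule cylinder[OF lc])
    \<comment> \<open>The zero macroscopic test function isolates the cell equation, the zero
      corrector isolates the macroscopic one.\<close>
    have zero: "in_L2_H1 {0<..<T} \<Omega> (\<lambda>t x. 0) (\<lambda>t x. 0)"
      by (simp add: in_L2_H1_def case_prod_beta' has_weak_gradient_zero)
    have zero_per: "in_L2_H1_per {0<..<T} \<Omega> r (\<lambda>t x y. 0) (\<lambda>t x y. 0)"
      by (simp add: in_L2_H1_per_def case_prod_beta' has_weak_gradient_zero H1_per_const)
    \<comment> \<open>Homogeneity of \<open>l t\<close>, and hence its vanishing at zero, is known
      only for almost every \<open>t\<close>.\<close>
    have l0: "(LINT t|lebesgue_on {0<..<T}. l t (\<lambda>x. 0)) = 0"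
    proof -
      have "AE t in lebesgue_on {0<..<T}. l t \<in> H1_dual \<Omega>"
        using lc by (simp add: limit_class_def has_weak_dt_dual_def L2_H1_dual_def)
      then have "AE t in lebesgue_on {0<..<T}. l t (\<lambda>x. 0) = 0"
      proof eventually_elim
        case (elim t)
        have "(\<lambda>x. 0) \<in> H1 \<Omega>" using has_weak_gradient_zero[of \<Omega>] by (auto simp: H1_def)
        moreover have "\<forall>u\<in>H1 \<Omega>. \<forall>c. l t (\<lambda>x. c * u x) = c * l t u"
          using elim by (simp add: H1_dual_def)
        ultimately have "\<forall>c. l t (\<lambda>x. c * 0) = c * l t (\<lambda>x. 0)" by (rule bspec[rotated])
        from spec[OF this, of 0] show ?case by simp
      qed
      then have "(LINT t|lebesgue_on {0<..<T}. l t (\<lambda>x. 0)) = (LINT t|lebesgue_on {0<..<T}. 0)"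
        by (intro integral_lebesgue_on_cong_AE) simp
      then show ?thesis by simp
    qed
    \<comment> \<open>This identification rests on \<open>0 < D\<close>: the cell equation
      determines the gradient of \<open>u1\<close> from that of \<open>u0\<close> and the
      radius.\<close>
    have id: "AE t in lebesgue_on {0<..<T}. AE x in lebesgue_on \<Omega>. AE y in lebesgue_on (Y_star (r t x)).
        Gu1 t x y = corr_grad (r t x) (Gu t x) y"
    proof (rule corrector_identification[OF assms(12) Gu_L2[OF lc] u1])
      fix \<phi>1 G\<phi>1 assume "in_L2_H1_per {0<..<T} \<Omega> r \<phi>1 G\<phi>1"
      from eq[OF zero this] show "(LINT t|lebesgue_on {0<..<T}. LINT x|lebesgue_on \<Omega>. LINT y|lebesgue_on (Y_star (r t x)).
             D * ((Gu t x + Gu1 t x y) \<bullet> G\<phi>1 t x y)) = 0"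
        by (simp add: l0)
    qed
    have "(LINT t|lebesgue_on {0<..<T}. l t (\<phi> t))
        + L2_inner ({0<..<T} \<times> \<Omega>) (\<lambda>(t, x). D *\<^sub>R (A_hom (r t x) *v Gu t x)) (\<lambda>(t, x). G\<phi> t x)
        = L2_inner ({0<..<T} \<times> \<Omega>) (\<lambda>(t, x). (1 - ?V (r t x)) * fp t x - dV t x * cs) (\<lambda>(t, x). \<phi> t x)"
      if "in_L2_H1 {0<..<T} \<Omega> \<phi> G\<phi>" for \<phi> G\<phi>
      using eq[OF that zero_per] unfolding energy_eq[OF Gu_L2[OF lc] id that zero_per] rhs[OF lc that] .
    then show ?thesis
      unfolding solves_homogenized_def using lc ode by blast
  qed
  \<comment> \<open>A competitor lifts to a two-scale solution, whose macroscopic part and radius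
    coincide with \<open>u0\<close> and \<open>r\<close> by the assumed uniqueness.\<close>
  then show "unique_solution_homogenized T \<Omega> rmin rmax cs D f fp uini rini u0 r"
    unfolding unique_solution_homogenized_def using to_two_scale sol by metis
qed

end
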